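(* Let $X$ be an $n$-dimensional complex analytic manifold and $D\subset X$ a free divisor given by a global reduced equation $f:X\to\mathbb{C}$. Assume that $D$ satisfies property $(\mathrm{GK})$. Then the following properties are equivalent: (a) The complex $\mathcal{D}_X\otimes_{\mathcal{V}_0}\mathrm{Sp}\,\mathcal{O}_X$ is exact in degree $-1$. (b) The module $\mathcal{D}_X[s]/\mathcal{D}_X[s]\cdot\Theta_{f,s}$ has no $s$-torsion. (c) The divisor $D$ is pre-Spencer.
   Context: $\mathcal{O}_X$ is the sheaf of holomorphic functions, $\mathcal{D}_X$ the sheaf of holomorphic linear differential operators with its order filtration $F$, $\mathcal{D}_X[s]$ the polynomial ring in a central variable $s$, with the total order filtration $F_T^k\mathcal{D}_X[s]=\sum_{i=0}^k(F^i\mathcal{D}_X)s^{k-i}$. In local coordinates, $\mathrm{Gr}_{F_T}\mathcal{D}_X[s]=\mathcal{O}_X[s,\xi_1,\dots,\xi_n]$ with $\xi_i$ the symbol of $\partial/\partial x_i$. A holomorphic vector field is logarithmic along the hypersurface $D$ if it preserves the ideal of $D$; $\mathrm{Der}(\log D)$ is the sheaf of logarithmic vector fields. $D$ is a free divisor if $\mathrm{Der}(\log D)$ is a locally free $\mathcal{O}_X$-module (of rank $n$). Property $(\mathrm{GK})$: at every $p\in D$, for some (and hence any) reduced local equation $h$ of $D$ at $p$ and some (or any) local basis $\{\delta_1,\dots,\delta_n\}$ of $\mathrm{Der}(\log D)_p$, the symbols with respect to $F_T$ of $\delta_1-\frac{\delta_1(h)}{h}s,\dots,\delta_n-\frac{\delta_n(h)}{h}s$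 form a regular sequence in $\mathrm{Gr}_{F_T}\mathcal{D}_{X,p}[s]$. $\Theta_{f,s}\subset\mathcal{D}_X[s]$ is the $\mathcal{O}_X$-submodule of operators $\delta-\alpha s$ with $\delta$ a holomorphic vector field, $\alpha\in\mathcal{O}_X$ and $\delta(f)=\alpha f$. $\mathcal{V}_0=\mathcal{D}_X(\log D)$ is the sheaf of rings of logarithmic differential operators, i.e. those $P\in\mathcal{D}_X$ with $P(\mathcal{I}_D^m)\subset\mathcal{I}_D^m$ for all $m$, where $\mathcal{I}_D$ is the ideal of $D$. The Spencer complex $\mathrm{Sp}\,\mathcal{O}_X$ is the complex of left $\mathcal{V}_0$-modules with $\mathcal{V}_0\otimes_{\mathcal{O}_X}\bigwedge^r\mathrm{Der}(\log D)$ in degree $-r$ ($r\ge0$) and differential $$P\otimes(\lambda_1\wedge\cdots\wedge\lambda_r)\mapsto\sum_i(-1)^{i-1}P\lambda_i\otimes(\lambda_1\wedge\cdots\widehat{\lambda_i}\cdots\wedge\lambda_r)+\sum_{i<j}(-1)^{i+j}P\otimes([\lambda_i,\lambda_j]\wedge\lambda_1\wedge\cdots\widehat{\lambda_i}\cdots\widehat{\lambda_j}\cdots\wedge\lambda_r).$$ Thus $\mathcal{D}_X\otimes_{\mathcal{V}_0}\mathrm{Sp}\,\mathcal{O}_X$ has terms $\mathcal{D}_X\otimes_{\mathcal{O}_X}\bigwedge^r\mathrm{Der}(\log D)$ in degree $-r$ with the same formula for the differential. A complex is exact in degree $-1$ if $h^{-1}=0$. The free divisor $D$ is pre-Spencer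 if $\mathcal{D}_X\otimes_{\mathcal{V}_0}\mathrm{Sp}\,\mathcal{O}_X$ has vanishing cohomology in all degrees $\ne0$. A module has no $s$-torsion if multiplication by $s$ on it is injective. *)

theory Defs
  imports
    "HOL-Analysis.Analysis"
    "HOL-Algebra.UnivPoly"
    "HOL-Algebra.Generated_Groups"
    "HOL-Algebra.Free_Abelian_Groups"
begin

section \<open>Complex manifolds and their holomorphic functions\<close>

definition holomorphic_Cn :: "(complex ^ 'n \<Rightarrow> complex) \<Rightarrow> (complex ^ 'n) set \<Rightarrow> bool" where
  "holomorphic_Cn F V \<longleftrightarrow>
     (\<forall>z\<in>V. \<exists>F'. (F has_derivative F') (at z) \<and> (\<forall>c v. F' (c *s v) = c * F' v))"

type_synonym ('a, 'n) chart = "'a set \<times> ('a \<Rightarrow> complex ^ 'n)"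

text \<open>
  A manifold is a topological space \<open>X\<close> with an atlas \<open>A\<close> of charts \<open>(U, \<phi>)\<close>; its dimension is
  the cardinality of the index type \<open>'n\<close>. Second countability is not required: everything
  below is local on \<open>X\<close>.
\<close>

definition complex_chart :: "'a topology \<Rightarrow> ('a, 'n::finite) chart \<Rightarrow> bool" where
  "complex_chart X c \<longleftrightarrow>
     (case c of (U, \<phi>) \<Rightarrow> openin X U \<and> open (\<phi> ` U) \<and>
        homeomorphic_map (subtopology X U) (top_of_set (\<phi> ` U)) \<phi>)"

definition complex_manifold :: "'a topology \<Rightarrow> ('a, 'n::finite) chart set \<Rightarrow> bool" where
  "complex_manifold X A \<longleftrightarrow>
     Hausdorff_space X \<and>
     (\<forall>c\<in>A. complex_chart X c) \<and>
     (\<Union>c\<in>A. fst c) = topspace X \<and>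
     (\<forall>(U, \<phi>)\<in>A. \<forall>(V, \<psi>)\<in>A. \<forall>i.
        holomorphic_Cn (\<lambda>z. \<psi> (inv_into U \<phi> z) $ i) (\<phi> ` (U \<inter> V)))"

definition holomorphic_fun ::
  "'a topology \<Rightarrow> ('a, 'n::finite) chart set \<Rightarrow> ('a \<Rightarrow> complex) \<Rightarrow> 'a set \<Rightarrow> bool" where
  "holomorphic_fun X A g W \<longleftrightarrow>
     openin X W \<and> (\<forall>(U, \<phi>)\<in>A. holomorphic_Cn (\<lambda>z. g (inv_into U \<phi> z)) (\<phi> ` (U \<inter> W)))"

section \<open>The stalk of the structure sheaf at a point\<close>

text \<open>
  Functions are total on the type \<open>'a\<close>; a germ is a class of functions modulo equality near \<open>p\<close>.
\<close>

type_synonym 'a germ = "('a \<Rightarrow> complex) set"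

definition germ_at :: "'a topology \<Rightarrow> 'a \<Rightarrow> ('a \<Rightarrow> complex) \<Rightarrow> 'a germ" where
  "germ_at X p g = {h. eventually (\<lambda>x. h x = g x) (nhdsin X p)}"

definition rep :: "'b set \<Rightarrow> 'b" where
  "rep C = (SOME x. x \<in> C)"

definition O_stalk :: "'a topology \<Rightarrow> ('a, 'n::finite) chart set \<Rightarrow> 'a \<Rightarrow> 'a germ ring" where
  "O_stalk X A p =
     \<lparr>carrier = {germ_at X p g | g. \<exists>W. p \<in> W \<and> holomorphic_fun X A g W},
      monoid.mult = (\<lambda>a b. germ_at X p (\<lambda>x. rep a x * rep b x)),
      monoid.one = germ_at X p (\<lambda>x. 1),
      ring.zero = germ_at X p (\<lambda>x. 0),
      ring.add = (\<lambda>a b. germ_at X p (\<lambda>x. rep a x + rep b x))\<rparr>"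

section \<open>Vector fields and differential operators\<close>

text \<open>
  A differential operator at \<open>p\<close> is represented by its action on the stalk of the structure sheaf
  (this action is faithful), hence as an element of the ring of additive endomorphisms.
\<close>

definition End_ring :: "('g, 'm) ring_scheme \<Rightarrow> ('g \<Rightarrow> 'g) ring" where
  "End_ring R =
     \<lparr>carrier = {P \<in> extensional (carrier R). P \<in> hom (add_monoid R) (add_monoid R)},
      monoid.mult = (\<lambda>P Q. compose (carrier R) P Q),
      monoid.one = (\<lambda>g\<in>carrier R. g),
      ring.zero = (\<lambda>g\<in>carrier R. \<zero>\<^bsub>R\<^esub>),
      ring.add = (\<lambda>P Q. \<lambda>g\<in>carrier R. P g \<oplus>\<^bsub>R\<^esub> Q g)\<rparr>"

definition mult_op :: "('g, 'm) ring_scheme \<Rightarrow> 'g \<Rightarrow> 'g \<Rightarrow> 'g" where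
  "mult_op R a = (\<lambda>g\<in>carrier R. a \<otimes>\<^bsub>R\<^esub> g)"

definition partial_deriv ::
  "('a, 'n::finite) chart \<Rightarrow> 'n \<Rightarrow> ('a \<Rightarrow> complex) \<Rightarrow> 'a \<Rightarrow> complex" where
  "partial_deriv c i g x =
     (case c of (U, \<phi>) \<Rightarrow>
        deriv (\<lambda>t. g (inv_into U \<phi> (\<chi> j. if j = i then t else \<phi> x $ j))) (\<phi> x $ i))"

definition partial_op ::
  "'a topology \<Rightarrow> ('a, 'n::finite) chart set \<Rightarrow> 'a \<Rightarrow> ('a, 'n) chart \<Rightarrow> 'n \<Rightarrow> 'a germ \<Rightarrow> 'a germ" where
  "partial_op X A p c i =
     (\<lambda>a\<in>carrier (O_stalk X A p). germ_at X p (partial_deriv c i (rep a)))"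

definition vector_field_germ ::
  "'a topology \<Rightarrow> ('a, 'n::finite) chart set \<Rightarrow> 'a \<Rightarrow> ('a, 'n) chart \<Rightarrow> ('n \<Rightarrow> 'a germ) \<Rightarrow>
     'a germ \<Rightarrow> 'a germ" where
  "vector_field_germ X A p c a =
     (let R = O_stalk X A p; E = End_ring R in
        (\<Oplus>\<^bsub>E\<^esub>i\<in>UNIV. mult_op R (a i) \<otimes>\<^bsub>E\<^esub> partial_op X A p c i))"

definition Der_stalk ::
  "'a topology \<Rightarrow> ('a, 'n::finite) chart set \<Rightarrow> 'a \<Rightarrow> ('a germ \<Rightarrow> 'a germ) set" where
  "Der_stalk X A p =
     {vector_field_germ X A p c a | c a.
        c \<in> A \<and> p \<in> fst c \<and> (\<forall>i. a i \<in> carrier (O_stalk X A p))}"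

text \<open>
  Operators of order at most \<open>k\<close>: holomorphic combinations of the iterated partial derivatives
  \<open>\<partial>\<^sub>i\<^sub>1 \<dots> \<partial>\<^sub>i\<^sub>m\<close>, \<open>m \<le> k\<close>. Iterated derivatives are indexed by words rather than multi-indices;
  the partial derivatives commute, so this gives the same operators.
\<close>

definition iterated_partial ::
  "'a topology \<Rightarrow> ('a, 'n::finite) chart set \<Rightarrow> 'a \<Rightarrow> ('a, 'n) chart \<Rightarrow> 'n list \<Rightarrow>
     'a germ \<Rightarrow> 'a germ" where
  "iterated_partial X A p c w =
     (let E = End_ring (O_stalk X A p) in
        foldr (\<lambda>i P. partial_op X A p c i \<otimes>\<^bsub>E\<^esub> P) w \<one>\<^bsub>E\<^esub>)"

definition D_order ::
  "'a topology \<Rightarrow> ('a, 'n::finite) chart set \<Rightarrow> 'a \<Rightarrow> nat \<Rightarrow> ('a germ \<Rightarrow> 'a germ) set" where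
  "D_order X A p k =
     (let R = O_stalk X A p; E = End_ring R in
        {(\<Oplus>\<^bsub>E\<^esub>w\<in>{w. length w \<le> k}. mult_op R (a w) \<otimes>\<^bsub>E\<^esub> iterated_partial X A p c w) | c a.
           c \<in> A \<and> p \<in> fst c \<and> (\<forall>w. a w \<in> carrier R)})"

definition D_stalk ::
  "'a topology \<Rightarrow> ('a, 'n::finite) chart set \<Rightarrow> 'a \<Rightarrow> ('a germ \<Rightarrow> 'a germ) ring" where
  "D_stalk X A p = (End_ring (O_stalk X A p))\<lparr>carrier := (\<Union>k. D_order X A p k)\<rparr>"

section \<open>Free divisors\<close>

definition ideal_stalk ::
  "'a topology \<Rightarrow> ('a, 'n::finite) chart set \<Rightarrow> 'a set \<Rightarrow> 'a \<Rightarrow> 'a germ set" where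
  "ideal_stalk X A D p =
     {a \<in> carrier (O_stalk X A p).
        \<exists>g\<in>a. eventually (\<lambda>x. x \<in> D \<longrightarrow> g x = 0) (nhdsin X p)}"

text \<open>
  The second condition says that \<open>f\<close> vanishes identically near no point, so that \<open>D\<close> is a
  hypersurface; the last one that the equation is reduced.
\<close>

definition global_reduced_equation ::
  "'a topology \<Rightarrow> ('a, 'n::finite) chart set \<Rightarrow> ('a \<Rightarrow> complex) \<Rightarrow> 'a set \<Rightarrow> bool" where
  "global_reduced_equation X A f D \<longleftrightarrow>
     holomorphic_fun X A f (topspace X) \<and>
     (\<forall>p\<in>topspace X. germ_at X p f \<noteq> \<zero>\<^bsub>O_stalk X A p\<^esub>) \<and>
     D = {x \<in> topspace X. f x = 0} \<and>
     (\<forall>p\<in>topspace X. ideal_stalk X A D p = PIdl\<^bsub>O_stalk X A p\<^esub> (germ_at X p f))"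

definition Der_log_stalk ::
  "'a topology \<Rightarrow> ('a, 'n::finite) chart set \<Rightarrow> 'a set \<Rightarrow> 'a \<Rightarrow> ('a germ \<Rightarrow> 'a germ) set" where
  "Der_log_stalk X A D p =
     {\<delta> \<in> Der_stalk X A p. \<forall>g\<in>ideal_stalk X A D p. \<delta> g \<in> ideal_stalk X A D p}"

definition O_basis ::
  "('g, 'm) ring_scheme \<Rightarrow> ('g \<Rightarrow> 'g) set \<Rightarrow> ('g \<Rightarrow> 'g) list \<Rightarrow> bool" where
  "O_basis R L ds \<longleftrightarrow>
     set ds \<subseteq> L \<and>
     (\<forall>\<delta>\<in>L. \<exists>!a. a \<in> {..<length ds} \<rightarrow>\<^sub>E carrier R \<and>
        \<delta> = (\<Oplus>\<^bsub>End_ring R\<^esub>i\<in>{..<length ds}. mult_op R (a i) \<otimes>\<^bsub>End_ring R\<^esub> ds ! i))"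

text \<open>
  Local freeness of rank \<open>n\<close>: near every point \<open>p\<close> there are vector fields
  \<open>\<Sum>\<^sub>j a\<^sub>i\<^sub>j \<partial>/\<partial>x\<^sub>j\<close>, \<open>i < n\<close>, whose germs form a basis of the stalk at every nearby point.
\<close>

definition free_divisor ::
  "'a topology \<Rightarrow> ('a, 'n::finite) chart set \<Rightarrow> 'a set \<Rightarrow> bool" where
  "free_divisor X A D \<longleftrightarrow>
     (\<forall>p\<in>topspace X. \<exists>W. \<exists>c\<in>A. \<exists>a :: nat \<Rightarrow> 'n \<Rightarrow> 'a \<Rightarrow> complex.
        p \<in> W \<and> W \<subseteq> fst c \<and>
        (\<forall>i<CARD('n). \<forall>j. holomorphic_fun X A (a i j) W) \<and>
        (\<forall>q\<in>W. O_basis (O_stalk X A q) (Der_log_stalk X A D q)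
           (map (\<lambda>i. vector_field_germ X A q c (\<lambda>j. germ_at X q (a i j))) [0..<CARD('n)])))"

section \<open>Associated graded rings and regular sequences\<close>

text \<open>
  For an increasing ring filtration \<open>F\<close> (with \<open>F\<^sup>-\<^sup>1 = 0\<close>), homogeneous parts are additive cosets
  of \<open>F\<^sup>k\<^sup>-\<^sup>1\<close> in \<open>F\<^sup>k\<close>, and an element of the graded ring is a finitely supported family of these.
\<close>

definition gr_coset :: "('d, 'm) ring_scheme \<Rightarrow> (nat \<Rightarrow> 'd set) \<Rightarrow> nat \<Rightarrow> 'd \<Rightarrow> 'd set" where
  "gr_coset R F k x = (case k of 0 \<Rightarrow> {\<zero>\<^bsub>R\<^esub>} | Suc m \<Rightarrow> F m) +>\<^bsub>R\<^esub> x"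

definition Gr :: "('d, 'm) ring_scheme \<Rightarrow> (nat \<Rightarrow> 'd set) \<Rightarrow> (nat \<Rightarrow> 'd set) ring" where
  "Gr R F =
     \<lparr>carrier = {u. (\<forall>k. \<exists>x\<in>F k. u k = gr_coset R F k x) \<and>
                    finite {k. u k \<noteq> gr_coset R F k \<zero>\<^bsub>R\<^esub>}},
      monoid.mult = (\<lambda>u v k. gr_coset R F k (\<Oplus>\<^bsub>R\<^esub>i\<in>{..k}. rep (u i) \<otimes>\<^bsub>R\<^esub> rep (v (k - i)))),
      monoid.one = (\<lambda>k. gr_coset R F k (if k = 0 then \<one>\<^bsub>R\<^esub> else \<zero>\<^bsub>R\<^esub>)),
      ring.zero = (\<lambda>k. gr_coset R F k \<zero>\<^bsub>R\<^esub>),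
      ring.add = (\<lambda>u v k. gr_coset R F k (rep (u k) \<oplus>\<^bsub>R\<^esub> rep (v k)))\<rparr>"

definition gr_symbol :: "('d, 'm) ring_scheme \<Rightarrow> (nat \<Rightarrow> 'd set) \<Rightarrow> 'd \<Rightarrow> nat \<Rightarrow> 'd set" where
  "gr_symbol R F x =
     (\<lambda>k. gr_coset R F k (if k = (LEAST d. x \<in> F d) then x else \<zero>\<^bsub>R\<^esub>))"

definition regular_sequence :: "('r, 'm) ring_scheme \<Rightarrow> 'r list \<Rightarrow> bool" where
  "regular_sequence R xs \<longleftrightarrow>
     set xs \<subseteq> carrier R \<and>
     Idl\<^bsub>R\<^esub> (set xs) \<noteq> carrier R \<and>
     (\<forall>i<length xs. \<forall>y\<in>carrier R.
        xs ! i \<otimes>\<^bsub>R\<^esub> y \<in> Idl\<^bsub>R\<^esub> (set (take i xs)) \<longrightarrow> y \<in> Idl\<^bsub>R\<^esub> (set (take i xs)))"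

section \<open>The ring \<open>D[s]\<close> and property (GK)\<close>

text \<open>\<^term>\<open>UP\<close> makes sense over a noncommutative ring; its indeterminate \<open>s\<close> is central.\<close>

definition Ds_stalk ::
  "'a topology \<Rightarrow> ('a, 'n::finite) chart set \<Rightarrow> 'a \<Rightarrow>
     ('a germ \<Rightarrow> 'a germ, nat \<Rightarrow> 'a germ \<Rightarrow> 'a germ) up_ring" where
  "Ds_stalk X A p = UP (D_stalk X A p)"

definition s_var ::
  "'a topology \<Rightarrow> ('a, 'n::finite) chart set \<Rightarrow> 'a \<Rightarrow> nat \<Rightarrow> 'a germ \<Rightarrow> 'a germ" where
  "s_var X A p = monom (Ds_stalk X A p) \<one>\<^bsub>D_stalk X A p\<^esub> 1"

definition total_order ::
  "'a topology \<Rightarrow> ('a, 'n::finite) chart set \<Rightarrow> 'a \<Rightarrow> nat \<Rightarrow> (nat \<Rightarrow> 'a germ \<Rightarrow> 'a germ) set" where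
  "total_order X A p k =
     {(\<Oplus>\<^bsub>Ds_stalk X A p\<^esub>i\<in>{..k}. monom (Ds_stalk X A p) (P i) (k - i)) | P.
        \<forall>i\<le>k. P i \<in> D_order X A p i}"

definition theta ::
  "'a topology \<Rightarrow> ('a, 'n::finite) chart set \<Rightarrow> 'a \<Rightarrow> ('a germ \<Rightarrow> 'a germ) \<Rightarrow> 'a germ \<Rightarrow>
     nat \<Rightarrow> 'a germ \<Rightarrow> 'a germ" where
  "theta X A p \<delta> \<alpha> =
     monom (Ds_stalk X A p) \<delta> 0
       \<ominus>\<^bsub>Ds_stalk X A p\<^esub>
     (monom (Ds_stalk X A p) (mult_op (O_stalk X A p) \<alpha>) 0 \<otimes>\<^bsub>Ds_stalk X A p\<^esub> s_var X A p)"

text \<open>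
  The quotient \<open>\<delta>(h)/h\<close>; it exists and is unique when \<open>\<delta>\<close> is logarithmic and \<open>h\<close> is a reduced
  local equation.
\<close>

definition log_quotient :: "('g, 'm) ring_scheme \<Rightarrow> ('g \<Rightarrow> 'g) \<Rightarrow> 'g \<Rightarrow> 'g" where
  "log_quotient R \<delta> h = (THE \<alpha>. \<alpha> \<in> carrier R \<and> \<delta> h = \<alpha> \<otimes>\<^bsub>R\<^esub> h)"

definition property_GK ::
  "'a topology \<Rightarrow> ('a, 'n::finite) chart set \<Rightarrow> 'a set \<Rightarrow> bool" where
  "property_GK X A D \<longleftrightarrow>
     (\<forall>p\<in>D. \<exists>h\<in>carrier (O_stalk X A p). \<exists>ds.
        ideal_stalk X A D p = PIdl\<^bsub>O_stalk X A p\<^esub> h \<and>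
        length ds = CARD('n) \<and>
        O_basis (O_stalk X A p) (Der_log_stalk X A D p) ds \<and>
        regular_sequence (Gr (Ds_stalk X A p) (total_order X A p))
          (map (\<lambda>\<delta>. gr_symbol (Ds_stalk X A p) (total_order X A p)
                  (theta X A p \<delta> (log_quotient (O_stalk X A p) \<delta> h))) ds))"

section \<open>The module \<open>D[s] / D[s] \<Theta>\<close>\<close>

definition left_ideal_gen :: "('d, 'm) ring_scheme \<Rightarrow> 'd set \<Rightarrow> 'd set" where
  "left_ideal_gen R S =
     \<Inter>{I. additive_subgroup I R \<and> S \<subseteq> I \<and> (\<forall>r\<in>carrier R. \<forall>x\<in>I. r \<otimes>\<^bsub>R\<^esub> x \<in> I)}"

definition Theta_stalk ::
  "'a topology \<Rightarrow> ('a, 'n::finite) chart set \<Rightarrow> ('a \<Rightarrow> complex) \<Rightarrow> 'a \<Rightarrow>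
     (nat \<Rightarrow> 'a germ \<Rightarrow> 'a germ) set" where
  "Theta_stalk X A f p =
     {theta X A p \<delta> \<alpha> | \<delta> \<alpha>.
        \<delta> \<in> Der_stalk X A p \<and> \<alpha> \<in> carrier (O_stalk X A p) \<and>
        \<delta> (germ_at X p f) = \<alpha> \<otimes>\<^bsub>O_stalk X A p\<^esub> germ_at X p f}"

text \<open>Injectivity of multiplication by a central element \<open>s\<close> on the left module \<open>R/J\<close>.\<close>

definition quotient_torsion_free :: "('d, 'm) ring_scheme \<Rightarrow> 'd set \<Rightarrow> 'd \<Rightarrow> bool" where
  "quotient_torsion_free R J s \<longleftrightarrow>
     (\<forall>P\<in>carrier R. \<forall>Q\<in>carrier R.
        J +>\<^bsub>R\<^esub> (s \<otimes>\<^bsub>R\<^esub> P) = J +>\<^bsub>R\<^esub> (s \<otimes>\<^bsub>R\<^esub> Q) \<longrightarrow> J +>\<^bsub>R\<^esub> P = J +>\<^bsub>R\<^esub> Q)"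

definition no_s_torsion ::
  "'a topology \<Rightarrow> ('a, 'n::finite) chart set \<Rightarrow> ('a \<Rightarrow> complex) \<Rightarrow> bool" where
  "no_s_torsion X A f \<longleftrightarrow>
     (\<forall>p\<in>topspace X.
        quotient_torsion_free (Ds_stalk X A p)
          (left_ideal_gen (Ds_stalk X A p) (Theta_stalk X A f p)) (s_var X A p))"

section \<open>The logarithmic Spencer complex\<close>

text \<open>
  Let \<open>B \<subseteq> R\<close> be a commutative subring and \<open>L \<subseteq> R\<close> a left \<open>B\<close>-submodule closed under commutators.
  The abelian group \<open>R \<otimes>\<^sub>B \<Lambda>\<^sup>r\<^sub>B L\<close> is presented by generators \<open>(P, [\<lambda>\<^sub>1, \<dots>, \<lambda>\<^sub>r])\<close>, standing for
  \<open>P \<otimes> (\<lambda>\<^sub>1 \<and> \<dots> \<and> \<lambda>\<^sub>r)\<close>, subject to additivity in each argument, \<open>B\<close>-balancedness between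
  the first argument and each of the others, and alternation.
\<close>

definition wedge_gens :: "('d, 'm) ring_scheme \<Rightarrow> 'd set \<Rightarrow> nat \<Rightarrow> ('d \<times> 'd list) set" where
  "wedge_gens R L r = {(P, ls). P \<in> carrier R \<and> length ls = r \<and> set ls \<subseteq> L}"

definition wedge_rels ::
  "('d, 'm) ring_scheme \<Rightarrow> 'd set \<Rightarrow> 'd set \<Rightarrow> nat \<Rightarrow> ('d \<times> 'd list \<Rightarrow>\<^sub>0 int) set" where
  "wedge_rels R B L r =
     {frag_of (P \<oplus>\<^bsub>R\<^esub> Q, ls) - frag_of (P, ls) - frag_of (Q, ls) | P Q ls.
        (P, ls) \<in> wedge_gens R L r \<and> Q \<in> carrier R} \<union>
     {frag_of (P, ls[i := l \<oplus>\<^bsub>R\<^esub> m]) - frag_of (P, ls[i := l]) - frag_of (P, ls[i := m]) | P ls i l m.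
        (P, ls) \<in> wedge_gens R L r \<and> i < r \<and> l \<in> L \<and> m \<in> L} \<union>
     {frag_of (P \<otimes>\<^bsub>R\<^esub> b, ls) - frag_of (P, ls[i := b \<otimes>\<^bsub>R\<^esub> ls ! i]) | P b ls i.
        (P, ls) \<in> wedge_gens R L r \<and> i < r \<and> b \<in> B} \<union>
     {frag_of (P, ls) | P ls.
        (P, ls) \<in> wedge_gens R L r \<and> (\<exists>i j. i < j \<and> j < r \<and> ls ! i = ls ! j)}"

definition wedge_null ::
  "('d, 'm) ring_scheme \<Rightarrow> 'd set \<Rightarrow> 'd set \<Rightarrow> nat \<Rightarrow> ('d \<times> 'd list \<Rightarrow>\<^sub>0 int) set" where
  "wedge_null R B L r = generate (free_Abelian_group (wedge_gens R L r)) (wedge_rels R B L r)"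

definition spencer_term ::
  "('d, 'm) ring_scheme \<Rightarrow> 'd set \<Rightarrow> 'd set \<Rightarrow> nat \<Rightarrow> ('d \<times> 'd list \<Rightarrow>\<^sub>0 int) set monoid" where
  "spencer_term R B L r = free_Abelian_group (wedge_gens R L r) Mod wedge_null R B L r"

text \<open>
  The differential on generators. Positions in the list are counted from \<open>0\<close>, so the sign
  \<open>(-1)\<^sup>i\<^sup>-\<^sup>1\<close> becomes \<open>(-1)\<^sup>i\<close> and \<open>(-1)\<^sup>i\<^sup>+\<^sup>j\<close> is unchanged.
\<close>

definition spencer_bdry ::
  "('d, 'm) ring_scheme \<Rightarrow> 'd \<times> 'd list \<Rightarrow> ('d \<times> 'd list \<Rightarrow>\<^sub>0 int)" where
  "spencer_bdry R = (\<lambda>(P, ls).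
     (\<Sum>i<length ls. frag_cmul ((-1) ^ i) (frag_of (P \<otimes>\<^bsub>R\<^esub> ls ! i, nths ls (- {i})))) +
     (\<Sum>j<length ls. \<Sum>i<j. frag_cmul ((-1) ^ (i + j))
        (frag_of (P, ((ls ! i \<otimes>\<^bsub>R\<^esub> ls ! j) \<ominus>\<^bsub>R\<^esub> (ls ! j \<otimes>\<^bsub>R\<^esub> ls ! i)) # nths ls (- {i, j})))))"

text \<open>
  The induced map \<open>R \<otimes> \<Lambda>\<^sup>r L \<rightarrow> R \<otimes> \<Lambda>\<^sup>r\<^sup>-\<^sup>1 L\<close> for \<open>r \<ge> 1\<close>. The boundary maps relations to relations,
  so all members of the union are the same coset.
\<close>

definition spencer_diff ::
  "('d, 'm) ring_scheme \<Rightarrow> 'd set \<Rightarrow> 'd set \<Rightarrow> nat \<Rightarrow>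
     ('d \<times> 'd list \<Rightarrow>\<^sub>0 int) set \<Rightarrow> ('d \<times> 'd list \<Rightarrow>\<^sub>0 int) set" where
  "spencer_diff R B L r = (\<lambda>C.
     \<Union>x\<in>C. wedge_null R B L (r - 1)
       #>\<^bsub>free_Abelian_group (wedge_gens R L (r - 1))\<^esub> frag_extend (spencer_bdry R) x)"

text \<open>Exactness in degree \<open>-r\<close>, for \<open>r \<ge> 1\<close>.\<close>

definition spencer_exact ::
  "('d, 'm) ring_scheme \<Rightarrow> 'd set \<Rightarrow> 'd set \<Rightarrow> nat \<Rightarrow> bool" where
  "spencer_exact R B L r \<longleftrightarrow>
     kernel (spencer_term R B L r) (spencer_term R B L (r - 1)) (spencer_diff R B L r) =
       spencer_diff R B L (r + 1) ` carrier (spencer_term R B L (r + 1))"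

text \<open>
  Exactness in degree \<open>-r\<close>, tested on stalks, of the complex of sheaves \<open>\<D> \<otimes> Sp \<O>\<close> (tensor product
  over the logarithmic operators \<open>\<V>\<^sub>0\<close>). Its terms \<open>\<D> \<otimes> (\<V>\<^sub>0 \<otimes> \<Lambda>\<^sup>r Der(log D))\<close> are
  \<open>\<D> \<otimes> \<Lambda>\<^sup>r Der(log D)\<close> over \<open>\<O>\<close>, with the same formula for the differential. The subring \<open>B\<close> is
  \<open>\<O>\<close>, embedded by multiplication operators.
\<close>

definition log_spencer_exact ::
  "'a topology \<Rightarrow> ('a, 'n::finite) chart set \<Rightarrow> 'a set \<Rightarrow> nat \<Rightarrow> bool" where
  "log_spencer_exact X A D r \<longleftrightarrow>
     (\<forall>p\<in>topspace X.
        spencer_exact (D_stalk X A p)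
          (mult_op (O_stalk X A p) ` carrier (O_stalk X A p)) (Der_log_stalk X A D p) r)"

text \<open>The complex vanishes in positive degrees, so only degrees \<open>-r\<close> with \<open>r \<ge> 1\<close> matter.\<close>

definition pre_spencer ::
  "'a topology \<Rightarrow> ('a, 'n::finite) chart set \<Rightarrow> 'a set \<Rightarrow> bool" where
  "pre_spencer X A D \<longleftrightarrow> (\<forall>r\<ge>1. log_spencer_exact X A D r)"

end

theory Submission
  imports Defs "HOL-Complex_Analysis.Cauchy_Integral_Formula"
begin

text \<open>
  All assertions are tested at a point \<open>p\<close>. Write \<open>O\<close> for the germs of holomorphic functions at
  \<open>p\<close>, \<open>D\<close> for the germs of differential operators, \<open>L\<close> for the logarithmic vector fields, with
  \<open>O\<close>-basis \<open>\<delta>\<^sub>1, \<dots>, \<delta>\<^sub>n\<close>, and let \<open>h\<close> be a local equation, \<open>\<delta>\<^sub>i(h) = \<alpha>\<^sub>i h\<close>. The complex in question is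
  \<open>K = D \<otimes> \<Lambda>L\<close>. The elements \<open>\<theta>\<^sub>i = \<delta>\<^sub>i - \<alpha>\<^sub>i s\<close> of \<open>D[s]\<close> satisfy the same commutation relations as
  the \<open>\<delta>\<^sub>i\<close>, so there is a second complex \<open>K\<^sub>s = D[s] \<otimes> \<Lambda>\<Theta>\<close>, and \<open>s = 0\<close> gives a short exact sequence
  \<open>0 \<rightarrow> K\<^sub>s \<rightarrow> K\<^sub>s \<rightarrow> K \<rightarrow> 0\<close> whose first map is multiplication by \<open>s\<close>. In homological degree \<open>0\<close> the
  homology of \<open>K\<^sub>s\<close> is \<open>D[s] / D[s]\<Theta>\<close>.

  By (GK) the symbols of the \<open>\<theta>\<^sub>i\<close> are a regular sequence. Up to terms of lower order, the differential
  of \<open>K\<^sub>s\<close> is that of the Koszul complex of these symbols, hence \<open>K\<^sub>s\<close> is exact in all degrees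
  \<open>r \<ge> 1\<close> (lemmas \<open>koszul_exact\<close> and \<open>exact\<close>). The long exact sequence then shows that \<open>K\<close> is
  exact in all degrees \<open>r \<ge> 2\<close>, and that it is exact in degree \<open>1\<close> iff multiplication by \<open>s\<close> is
  injective on \<open>D[s] / D[s]\<Theta>\<close> (\<open>exact_higher\<close>, \<open>torsion_free_imp_exact\<close>, \<open>exact_imp_torsion_free\<close>).
  This is the equivalence of the three properties at a point of the divisor.

  Two points need care. Property (GK) speaks of some equation \<open>h = u f\<close> at \<open>p\<close>, whereas \<open>\<Theta>\<close> is formed
  with \<open>f\<close>; the automorphism \<open>P \<mapsto> u\<^sup>-\<^sup>s P u\<^sup>s\<close> of \<open>D[s]\<close> maps the operators \<open>\<theta>\<close> of \<open>h\<close> to those of \<open>f\<close>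
  (\<open>torsion_free_change_of_equation\<close>). And off the divisor, where (GK) says nothing, every vector field
  is logarithmic, and the symbols of the coordinate fields are regular in the graded ring of \<open>D\<close> itself
  (\<open>regular_lie_basis_fields\<close>).

  Both complexes are treated as instances of the locale \<open>lie_basis\<close>, in which chains are families of
  ring elements indexed by finite sets of natural numbers; \<open>spencer_exact_iff\<close> identifies this model
  with the quotient of a free abelian group that defines the exactness of the Spencer complex.
\<close>

section \<open>Rings with carriers inside type-class rings\<close>

lemmas (in ring) closed_rules = zero_closed one_closed a_closed m_closed a_inv_closed minus_closed
lemmas (in ring) laws = a_assoc a_comm l_zero minus_eq l_neg m_assoc l_one r_one l_distr r_distr

text \<open>
  Rings with carriers are studied inside rings of class \<open>ring_1\<close>, where ring identities can be proved by
  rewriting. The product of all rings on a type, indexed by the rings themselves, contains each of them.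
  Indices that are not rings contribute the fixed value \<open>undefined\<close>, which keeps the representation
  unique, and a factor \<open>int\<close> ensures \<open>0 \<noteq> 1\<close>.
\<close>
typedef 'd ring_product =
  "{F :: ('d ring \<Rightarrow> 'd) \<times> int. \<forall>R. (Ring.ring R \<longrightarrow> fst F R \<in> carrier R) \<and> (\<not> Ring.ring R \<longrightarrow> fst F R = undefined)}"
  by (intro exI[of _ "(\<lambda>R. if Ring.ring R then \<zero>\<^bsub>R\<^esub> else undefined, 0)"])
    (auto intro: ring.closed_rules)

setup_lifting type_definition_ring_product

instantiation ring_product :: (type) ring_1
begin

lift_definition zero_ring_product :: "'a ring_product" is
  "(\<lambda>R. if Ring.ring R then \<zero>\<^bsub>R\<^esub> else undefined, 0)"
  by (auto intro: ring.closed_rules)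
lift_definition one_ring_product :: "'a ring_product" is
  "(\<lambda>R. if Ring.ring R then \<one>\<^bsub>R\<^esub> else undefined, 1)"
  by (auto intro: ring.closed_rules)
lift_definition plus_ring_product :: "'a ring_product \<Rightarrow> 'a ring_product \<Rightarrow> 'a ring_product" is
  "\<lambda>F G. (\<lambda>R. if Ring.ring R then fst F R \<oplus>\<^bsub>R\<^esub> fst G R else undefined, snd F + snd G)"
  by (auto intro: ring.closed_rules split: if_splits)
lift_definition minus_ring_product :: "'a ring_product \<Rightarrow> 'a ring_product \<Rightarrow> 'a ring_product" is
  "\<lambda>F G. (\<lambda>R. if Ring.ring R then fst F R \<ominus>\<^bsub>R\<^esub> fst G R else undefined, snd F - snd G)"
  by (auto intro: ring.closed_rules split: if_splits)
lift_definition uminus_ring_product :: "'a ring_product \<Rightarrow> 'a ring_product" is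
  "\<lambda>F. (\<lambda>R. if Ring.ring R then \<ominus>\<^bsub>R\<^esub> fst F R else undefined, - snd F)"
  by (auto intro: ring.closed_rules split: if_splits)
lift_definition times_ring_product :: "'a ring_product \<Rightarrow> 'a ring_product \<Rightarrow> 'a ring_product" is
  "\<lambda>F G. (\<lambda>R. if Ring.ring R then fst F R \<otimes>\<^bsub>R\<^esub> fst G R else undefined, snd F * snd G)"
  by (auto intro: ring.closed_rules split: if_splits)

instance
proof
  fix a b c :: "'a ring_product"
  show "a + b + c = a + (b + c)" "a + b = b + a" "0 + a = a" "a - b = a + - b" "- a + a = 0"
    "a * b * c = a * (b * c)" "1 * a = a" "a * 1 = a" "(a + b) * c = a * c + b * c"
    "a * (b + c) = a * b + a * c" "(0::'a ring_product) \<noteq> 1"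
    by (transfer; auto intro!: ext ring.laws simp: prod_eq_iff algebra_simps split: if_splits)+
qed

end

definition ring_inclusion :: "'d ring \<Rightarrow> 'd \<Rightarrow> 'd ring_product" where
  "ring_inclusion R x =
     Abs_ring_product (\<lambda>R'. if R' = R then x else if Ring.ring R' then \<zero>\<^bsub>R'\<^esub> else undefined, 0)"

text \<open>
  The unit need not be preserved: the image of \<open>\<one>\<close> is an idempotent that acts as a unit on the image.
\<close>
locale ring_embedding = R: Ring.ring R for R (structure) +
  fixes j :: "'d \<Rightarrow> 'r::ring_1"
  assumes inj: "inj_on j (carrier R)"
    and add: "\<lbrakk>x \<in> carrier R; y \<in> carrier R\<rbrakk> \<Longrightarrow> j (x \<oplus> y) = j x + j y"
    and mult: "\<lbrakk>x \<in> carrier R; y \<in> carrier R\<rbrakk> \<Longrightarrow> j (x \<otimes> y) = j x * j y"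
begin

lemma zero [simp]: "j \<zero> = 0"
  using add[of \<zero> \<zero>] by simp

lemma a_inv: "x \<in> carrier R \<Longrightarrow> j (\<ominus> x) = - j x"
  using add[of x "\<ominus> x"] by (simp add: R.r_neg minus_unique)

lemma minus: "\<lbrakk>x \<in> carrier R; y \<in> carrier R\<rbrakk> \<Longrightarrow> j (x \<ominus> y) = j x - j y"
  by (simp add: a_minus_def add a_inv)

lemma finsum: "f \<in> A \<rightarrow> carrier R \<Longrightarrow> j (finsum R f A) = (\<Sum>x\<in>A. j (f x))"
  by (induction A rule: infinite_finite_induct) (auto simp: add Pi_def R.finsum_closed)

lemma eq_iff: "\<lbrakk>x \<in> carrier R; y \<in> carrier R\<rbrakk> \<Longrightarrow> j x = j y \<longleftrightarrow> x = y"
  using inj by (auto dest: inj_onD)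

lemma one_mult: "x \<in> carrier R \<Longrightarrow> j \<one> * j x = j x" "x \<in> carrier R \<Longrightarrow> j x * j \<one> = j x"
  by (simp_all flip: mult)

end

lemma ring_embedding_inclusion:
  fixes R :: "'d ring"
  assumes "Ring.ring R"
  shows "ring_embedding R (ring_inclusion R)"
proof -
  interpret Ring.ring R by fact
  have Rep: "Rep_ring_product (ring_inclusion R x) =
      (\<lambda>R'. if R' = R then x else if Ring.ring R' then \<zero>\<^bsub>R'\<^esub> else undefined, 0)" if "x \<in> carrier R" for x
    unfolding ring_inclusion_def
    by (rule Abs_ring_product_inverse) (use that assms in \<open>auto intro: ring.closed_rules\<close>)
  show ?thesis
  proof unfold_locales
    show "inj_on (ring_inclusion R) (carrier R)"
    proof (rule inj_onI)
      fix x y assume "x \<in> carrier R" "y \<in> carrier R" "ring_inclusion R x = ring_inclusion R y"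
      then have "fst (Rep_ring_product (ring_inclusion R x)) R = fst (Rep_ring_product (ring_inclusion R y)) R" by simp
      then show "x = y" by (simp add: Rep \<open>x \<in> carrier R\<close> \<open>y \<in> carrier R\<close>)
    qed
    fix x y assume xy: "x \<in> carrier R" "y \<in> carrier R"
    have zz: "\<zero>\<^bsub>R'\<^esub> \<oplus>\<^bsub>R'\<^esub> \<zero>\<^bsub>R'\<^esub> = \<zero>\<^bsub>R'\<^esub>" "\<zero>\<^bsub>R'\<^esub> \<otimes>\<^bsub>R'\<^esub> \<zero>\<^bsub>R'\<^esub> = \<zero>\<^bsub>R'\<^esub>" if "Ring.ring R'" for R' :: "'d ring"
    proof -
      interpret R': Ring.ring R' by fact
      show "\<zero>\<^bsub>R'\<^esub> \<oplus>\<^bsub>R'\<^esub> \<zero>\<^bsub>R'\<^esub> = \<zero>\<^bsub>R'\<^esub>" "\<zero>\<^bsub>R'\<^esub> \<otimes>\<^bsub>R'\<^esub> \<zero>\<^bsub>R'\<^esub> = \<zero>\<^bsub>R'\<^esub>" by simp_all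
    qed
    show "ring_inclusion R (x \<oplus>\<^bsub>R\<^esub> y) = ring_inclusion R x + ring_inclusion R y"
      by (rule Rep_ring_product_inject[THEN iffD1])
         (use xy assms zz in \<open>auto simp: plus_ring_product.rep_eq Rep intro!: ext\<close>)
    show "ring_inclusion R (x \<otimes>\<^bsub>R\<^esub> y) = ring_inclusion R x * ring_inclusion R y"
      by (rule Rep_ring_product_inject[THEN iffD1])
         (use xy assms zz in \<open>auto simp: times_ring_product.rep_eq Rep intro!: ext\<close>)
  qed
qed

section \<open>Alternating chains\<close>

text \<open>
  A chain stands for \<open>\<Sum> c\<^sub>I \<otimes> e\<^sub>i\<^sub>1 \<and> \<dots> \<and> e\<^sub>i\<^sub>r\<close>, the sum being over the sets \<open>I = {i\<^sub>1 < \<dots> < i\<^sub>r}\<close>. Signs are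
  written with a Boolean in \<open>pm\<close>. Then \<open>ext i\<close> is exterior multiplication by \<open>e\<^sub>i\<close> on the left, \<open>con i\<close> is
  contraction with the dual vector, and \<open>rmult x\<close> multiplies the coefficients by \<open>x\<close> on the right, as
  the ring element \<open>x\<close> does in the differential.
\<close>
typedef 'r chain = "UNIV :: (nat set \<Rightarrow> 'r) set"
  morphisms coef Chain ..

setup_lifting type_definition_chain

lemma coef_Chain [simp]: "coef (Chain h) = h"
  by (simp add: Chain_inverse)

lemma chain_eq_iff: "c = c' \<longleftrightarrow> (\<forall>I. coef c I = coef c' I)"
  by transfer auto

instantiation chain :: (ab_group_add) ab_group_add
begin

lift_definition zero_chain :: "'a chain" is "\<lambda>_. 0" .
lift_definition plus_chain :: "'a chain \<Rightarrow> 'a chain \<Rightarrow> 'a chain" is "\<lambda>c c' I. c I + c' I" .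
lift_definition minus_chain :: "'a chain \<Rightarrow> 'a chain \<Rightarrow> 'a chain" is "\<lambda>c c' I. c I - c' I" .
lift_definition uminus_chain :: "'a chain \<Rightarrow> 'a chain" is "\<lambda>c I. - c I" .

instance
  by standard (transfer; simp add: fun_eq_iff algebra_simps)+

end

lemmas coef_simps [simp] = zero_chain.rep_eq plus_chain.rep_eq minus_chain.rep_eq uminus_chain.rep_eq

lemma coef_sum: "coef (\<Sum>a\<in>A. t a) I = (\<Sum>a\<in>A. coef (t a) I)"
  by (induction A rule: infinite_finite_induct) auto

definition pm :: "bool \<Rightarrow> 'r::ab_group_add \<Rightarrow> 'r" where
  "pm b x = (if b then x else - x)"

definition even_below :: "nat \<Rightarrow> nat set \<Rightarrow> bool" where
  "even_below i I = even (card {j\<in>I. j < i})"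

definition ext :: "nat \<Rightarrow> 'r chain \<Rightarrow> 'r::ab_group_add chain" where
  "ext i c = Chain (\<lambda>I. if i \<in> I then pm (even_below i I) (coef c (I - {i})) else 0)"

definition con :: "nat \<Rightarrow> 'r chain \<Rightarrow> 'r::ab_group_add chain" where
  "con i c = Chain (\<lambda>I. if i \<in> I then 0 else pm (even_below i I) (coef c (insert i I)))"

definition rmult :: "'r \<Rightarrow> 'r chain \<Rightarrow> 'r::ring_1 chain" where
  "rmult x c = Chain (\<lambda>I. coef c I * x)"

lemma even_below_insert:
  "even_below i (insert j I) = (if j < i \<and> j \<notin> I then \<not> even_below i I else even_below i I)"
proof (cases "j < i \<and> j \<notin> I")
  case True
  then have "{k \<in> insert j I. k < i} = insert j {k \<in> I. k < i}" by auto
  with True show ?thesis by (simp add: even_below_def)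
next
  case False
  then have "{k \<in> insert j I. k < i} = {k \<in> I. k < i}" by auto
  with False show ?thesis by (auto simp: even_below_def)
qed

lemma even_below_remove:
  "even_below i (I - {j}) = (if j < i \<and> j \<in> I then \<not> even_below i I else even_below i I)"
proof (cases "j \<in> I")
  case True
  then show ?thesis using even_below_insert[of i j "I - {j}"] by (auto simp: insert_absorb)
qed simp

lemma pm_simps [simp]: "pm b 0 = 0" "pm b (- x) = - pm b x" "pm b (pm b x) = x" "pm (\<not> b) x = - pm b x"
  "pm True x = x" "pm False x = - x"
  by (auto simp: pm_def)

lemma pm_add: "pm b (x + y) = pm b x + pm b y" and pm_diff: "pm b (x - y) = pm b x - pm b y"
  by (auto simp: pm_def)

lemma pm_commute: "pm b (pm b' x) = pm b' (pm b x)" by (auto simp: pm_def)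

lemma pm_times: "pm b x * y = pm b (x * (y::'r::ring_1))" by (auto simp: pm_def)

lemma ext_additive: "ext i (c + c') = ext i c + ext i c'" "ext i (c - c') = ext i c - ext i c'"
  "ext i (- c) = - ext i c" "ext i 0 = 0"
  by (auto simp: ext_def pm_add pm_diff chain_eq_iff)

lemma con_additive: "con i (c + c') = con i c + con i c'" "con i (c - c') = con i c - con i c'"
  "con i (- c) = - con i c" "con i 0 = 0"
  by (auto simp: con_def pm_add pm_diff chain_eq_iff)

lemma rmult_additive: "rmult x (c + c') = rmult x c + rmult x c'" "rmult x (c - c') = rmult x c - rmult x c'"
  "rmult x (- c) = - rmult x c" "rmult x 0 = 0"
  "rmult (x + y) c = rmult x c + rmult y c" "rmult (x - y) c = rmult x c - rmult y c"
  "rmult (- x) c = - rmult x c" "rmult 0 c = 0"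
  by (auto simp: rmult_def algebra_simps chain_eq_iff)

lemma sum_additive:
  assumes "\<And>x y. h (x + y) = h x + h y" "h 0 = (0 :: 'b::comm_monoid_add)"
  shows "h (\<Sum>i\<in>A. t i) = (\<Sum>i\<in>A. h (t i))"
  using assms by (induction A rule: infinite_finite_induct) auto

lemma ext_sum: "ext i (\<Sum>x\<in>A. t x) = (\<Sum>x\<in>A. ext i (t x))"
  by (rule sum_additive[of "ext i"]) (simp_all add: ext_additive)
lemma con_sum: "con i (\<Sum>x\<in>A. t x) = (\<Sum>x\<in>A. con i (t x))"
  by (rule sum_additive[of "con i"]) (simp_all add: con_additive)
lemma rmult_sum: "rmult y (\<Sum>x\<in>A. t x) = (\<Sum>x\<in>A. rmult y (t x))"
  by (rule sum_additive[of "rmult y"]) (simp_all add: rmult_additive)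
lemma rmult_sum_left: "rmult (\<Sum>x\<in>A. t x) c = (\<Sum>x\<in>A. rmult (t x) c)"
  by (rule sum_additive[of "\<lambda>y. rmult y c"]) (simp_all add: rmult_additive)

lemma rmult_rmult: "rmult x (rmult y c) = rmult (y * x) c"
  by (simp add: rmult_def mult.assoc)

lemma ext_rmult: "ext i (rmult x c) = rmult x (ext i c)"
  by (auto simp: ext_def rmult_def pm_times chain_eq_iff)
lemma con_rmult: "con i (rmult x c) = rmult x (con i c)"
  by (auto simp: con_def rmult_def pm_times chain_eq_iff)

lemma ext_ext: "ext i (ext j c) = - ext j (ext i c)"
proof (unfold chain_eq_iff, rule allI)
  fix I
  have "I - {i} - {j} = I - {j} - {i}" by auto
  then show "coef (ext i (ext j c)) I = coef (- ext j (ext i c)) I"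
    by (cases "i = j") (auto simp: ext_def even_below_remove pm_commute)
qed

lemma ext_ext_same [simp]: "ext i (ext i c) = 0"
  by (auto simp: ext_def chain_eq_iff)

lemma con_con: "con i (con j c) = - con j (con i c)"
proof (unfold chain_eq_iff, rule allI)
  fix I
  have "insert i (insert j I) = insert j (insert i I)" by auto
  then show "coef (con i (con j c)) I = coef (- con j (con i c)) I"
    by (cases "i = j") (auto simp: con_def even_below_insert pm_commute)
qed

lemma con_con_same [simp]: "con i (con i c) = 0"
  by (auto simp: con_def chain_eq_iff)

lemma con_ext_same: "con i (ext i c) = c - ext i (con i c)"
  by (auto simp: con_def ext_def chain_eq_iff even_below_insert even_below_remove insert_absorb)

lemma con_ext: "i \<noteq> j \<Longrightarrow> con i (ext j c) = - ext j (con i c)"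
proof (unfold chain_eq_iff, rule allI)
  fix I assume "i \<noteq> j"
  then have "insert i I - {j} = insert i (I - {j})" by auto
  with \<open>i \<noteq> j\<close> show "coef (con i (ext j c)) I = coef (- ext j (con i c)) I"
    by (auto simp: con_def ext_def even_below_insert even_below_remove pm_commute)
qed

definition pt :: "'r \<Rightarrow> 'r::zero chain" where
  "pt P = Chain (\<lambda>I. if I = {} then P else 0)"

lemma con_pt [simp]: "con i (pt P) = 0"
  by (auto simp: con_def pt_def chain_eq_iff)

lemma rmult_pt: "rmult x (pt P) = pt (P * x)"
  by (auto simp: rmult_def pt_def chain_eq_iff)

lemma pt_additive: "pt (P + Q) = pt P + pt (Q :: 'r::ring_1)" "pt (- P) = - pt P" "pt 0 = (0 :: 'r chain)"
  "pt (P - Q) = pt P - pt Q"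
  by (auto simp: pt_def chain_eq_iff)

lemma sum_antisym_zero:
  fixes t :: "nat \<Rightarrow> nat \<Rightarrow> 'a::ab_group_add"
  assumes anti: "\<And>i j. i < n \<Longrightarrow> j < n \<Longrightarrow> t i j = - t j i" and diag: "\<And>i. i < n \<Longrightarrow> t i i = 0"
  shows "(\<Sum>i<n. \<Sum>j<n. t i j) = 0"
proof -
  have "(\<Sum>i<m. \<Sum>j<m. t i j) = 0" if "m \<le> n" for m
    using that
  proof (induction m)
    case (Suc m)
    have "(\<Sum>i<m. t i m) + (\<Sum>j<m. t m j) = (\<Sum>i<m. t i m + t m i)" by (simp only: sum.distrib)
    also have "\<dots> = (\<Sum>i<m. 0)"
    proof (rule sum.cong)
      fix i assume "i \<in> {..<m}"
      then have "t i m = - t m i" by (intro anti) (use Suc.prems in auto)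
      then show "t i m + t m i = 0" by simp
    qed simp
    finally have "(\<Sum>i<m. t i m) + (\<Sum>j<m. t m j) = 0" by simp
    moreover have "t m m = 0" using Suc.prems by (intro diag) simp
    ultimately show ?case using Suc.IH Suc.prems by (simp add: sum.distrib add.commute)
  qed simp
  then show ?thesis by simp
qed

lemma sum_triangle:
  fixes t :: "nat \<Rightarrow> nat \<Rightarrow> 'a::ab_group_add"
  assumes "\<And>i. i < n \<Longrightarrow> t i i = 0"
  shows "(\<Sum>j<n. \<Sum>i<j. t i j + t j i) = (\<Sum>j<n. \<Sum>i<n. t i j)"
  using assms by (induction n) (auto simp: sum.distrib algebra_simps)

section \<open>The Spencer complex of a free Lie algebra of operators\<close>

text \<open>
  A commutative ring \<open>B\<close> inside a ring \<open>C\<close> with unit \<open>e\<close>, and a free left \<open>B\<close>-module \<open>L\<close> with basis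
  \<open>g\<^sub>0, \<dots>, g\<^sub>n\<^sub>-\<^sub>1\<close> that is closed under commutators and acts on \<open>B\<close> by derivations; \<open>co\<close> gives the
  coordinates. The unit is \<open>e\<close> rather than \<open>1\<close> because embedded rings need not contain \<open>1\<close>.
\<close>
locale lie_basis =
  fixes e :: "'r::ring_1" and C B L :: "'r set" and n :: nat and g :: "nat \<Rightarrow> 'r"
    and co :: "'r \<Rightarrow> nat \<Rightarrow> 'r"
  assumes C_plus: "\<lbrakk>x \<in> C; y \<in> C\<rbrakk> \<Longrightarrow> x + y \<in> C" and C_minus: "\<lbrakk>x \<in> C; y \<in> C\<rbrakk> \<Longrightarrow> x - y \<in> C"
    and C_times: "\<lbrakk>x \<in> C; y \<in> C\<rbrakk> \<Longrightarrow> x * y \<in> C"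
    and e_left: "x \<in> C \<Longrightarrow> e * x = x" and e_right: "x \<in> C \<Longrightarrow> x * e = x"
    and B_C: "B \<subseteq> C" and B_e: "e \<in> B" and B_plus: "\<lbrakk>x \<in> B; y \<in> B\<rbrakk> \<Longrightarrow> x + y \<in> B"
    and B_minus: "\<lbrakk>x \<in> B; y \<in> B\<rbrakk> \<Longrightarrow> x - y \<in> B" and B_times: "\<lbrakk>x \<in> B; y \<in> B\<rbrakk> \<Longrightarrow> x * y \<in> B"
    and B_commute: "\<lbrakk>x \<in> B; y \<in> B\<rbrakk> \<Longrightarrow> x * y = y * x"
    and L_C: "L \<subseteq> C" and L_zero: "0 \<in> L" and L_plus: "\<lbrakk>x \<in> L; y \<in> L\<rbrakk> \<Longrightarrow> x + y \<in> L"
    and L_scale: "\<lbrakk>b \<in> B; x \<in> L\<rbrakk> \<Longrightarrow> b * x \<in> L"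
    and L_bracket: "\<lbrakk>x \<in> L; y \<in> L\<rbrakk> \<Longrightarrow> x * y - y * x \<in> L"
    and L_anchor: "\<lbrakk>x \<in> L; b \<in> B\<rbrakk> \<Longrightarrow> x * b - b * x \<in> B"
    and g_L: "i < n \<Longrightarrow> g i \<in> L"
    and co_B: "\<lbrakk>x \<in> L; i < n\<rbrakk> \<Longrightarrow> co x i \<in> B"
    and co_expand: "x \<in> L \<Longrightarrow> (\<Sum>i<n. co x i * g i) = x"
    and co_unique: "\<lbrakk>\<And>i. i < n \<Longrightarrow> u i \<in> B; k < n\<rbrakk> \<Longrightarrow> co (\<Sum>i<n. u i * g i) k = u k"
begin

lemma C_zero: "0 \<in> C" and C_uminus: "x \<in> C \<Longrightarrow> - x \<in> C" and B_zero: "0 \<in> B" and B_uminus: "x \<in> B \<Longrightarrow> - x \<in> B"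
proof -
  show Z: "0 \<in> C" "0 \<in> B" using C_minus[of e e] B_minus[of e e] B_e B_C by auto
  show "x \<in> C \<Longrightarrow> - x \<in> C" "x \<in> B \<Longrightarrow> - x \<in> B" using Z C_minus[of 0 x] B_minus[of 0 x] by auto
qed

lemma C_sum: "(\<And>i. i \<in> A \<Longrightarrow> t i \<in> C) \<Longrightarrow> (\<Sum>i\<in>A. t i) \<in> C"
  by (induction A rule: infinite_finite_induct) (auto intro: C_zero C_plus)

lemma L_uminus: "x \<in> L \<Longrightarrow> - x \<in> L"
  using L_scale[of "- e" x] B_e B_uminus e_left[of x] L_C by auto

lemma L_sum: "(\<And>i. i \<in> A \<Longrightarrow> t i \<in> L) \<Longrightarrow> (\<Sum>i\<in>A. t i) \<in> L"
  by (induction A rule: infinite_finite_induct) (auto intro: L_zero L_plus)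

lemma co_plus:
  assumes "x \<in> L" "y \<in> L" "i < n" shows "co (x + y) i = co x i + co y i"
proof -
  have "x + y = (\<Sum>i<n. (co x i + co y i) * g i)"
    using assms co_expand by (simp add: distrib_right sum.distrib)
  then show ?thesis using co_unique[of "\<lambda>i. co x i + co y i" i] assms by (simp add: co_B B_plus)
qed

lemma co_scale:
  assumes "x \<in> L" "b \<in> B" "i < n" shows "co (b * x) i = b * co x i"
proof -
  have "b * x = (\<Sum>i<n. (b * co x i) * g i)"
    using assms co_expand[of x] by (simp add: sum_distrib_left[symmetric] mult.assoc)
  then show ?thesis using co_unique[of "\<lambda>i. b * co x i" i] assms by (simp add: co_B B_times)
qed

lemma co_zero: "i < n \<Longrightarrow> co 0 i = 0"
  using co_unique[of "\<lambda>_. 0" i] B_zero by simp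

lemma co_uminus:
  assumes "x \<in> L" "i < n" shows "co (- x) i = - co x i"
  using co_plus[OF assms(1) L_uminus[OF assms(1)] assms(2)] co_zero[OF assms(2)]
  by (simp add: eq_neg_iff_add_eq_0 add.commute)

lemma co_basis:
  assumes "i < n" "j < n" shows "co (g i) j = (if j = i then e else 0)"
proof -
  have "(\<Sum>j<n. (if j = i then e else 0) * g j) = (\<Sum>j<n. if j = i then e * g i else 0)"
    by (rule sum.cong) auto
  also have "\<dots> = g i" using assms e_left[of "g i"] g_L[of i] L_C by auto
  finally show ?thesis using co_unique[of "\<lambda>j. if j = i then e else 0" j] assms B_e B_zero by simp
qed

text \<open>
  Exterior multiplication by an element of \<open>L\<close> on the left; since the tensor product is over \<open>B\<close>, the
  coordinates of \<open>x\<close> pass to the right of the coefficients.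
\<close>
definition W :: "'r \<Rightarrow> 'r chain \<Rightarrow> 'r chain" where
  "W x c = (\<Sum>i<n. ext i (rmult (co x i) c))"

lemma W_additive: "W x (c + c') = W x c + W x c'" "W x (c - c') = W x c - W x c'" "W x (- c) = - W x c"
  "W x 0 = 0"
  by (simp_all add: W_def rmult_additive ext_additive sum.distrib sum_subtractf sum_negf)

lemma W_sum: "W x (\<Sum>a\<in>A. t a) = (\<Sum>a\<in>A. W x (t a))"
  by (rule sum_additive[of "W x"]) (simp_all add: W_additive)

lemma W_plus_left: "\<lbrakk>x \<in> L; y \<in> L\<rbrakk> \<Longrightarrow> W (x + y) c = W x c + W y c"
  by (simp add: W_def co_plus rmult_additive ext_additive sum.distrib)

lemma W_uminus_left: "x \<in> L \<Longrightarrow> W (- x) c = - W x c"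
  by (simp add: W_def co_uminus rmult_additive ext_additive sum_negf)

lemma W_minus_left: "\<lbrakk>x \<in> L; y \<in> L\<rbrakk> \<Longrightarrow> W (x - y) c = W x c - W y c"
  using W_plus_left[of x "- y" c] W_uminus_left[of y c] L_uminus[of y] by simp

lemma W_zero_left: "W 0 c = 0"
  using W_minus_left[of 0 0 c] L_zero by simp

lemma W_sum_left: "(\<And>a. a \<in> A \<Longrightarrow> t a \<in> L) \<Longrightarrow> W (\<Sum>a\<in>A. t a) c = (\<Sum>a\<in>A. W (t a) c)"
  by (induction A rule: infinite_finite_induct) (auto simp: W_zero_left W_plus_left L_sum)

lemma W_scale:
  assumes "x \<in> L" "b \<in> B" shows "W x (rmult b c) = W (b * x) c"
  using assms by (simp add: W_def co_scale rmult_rmult)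

lemma rmult_W:
  assumes "x \<in> L" "b \<in> B" shows "rmult b (W x c) = W (b * x) c"
proof -
  have "rmult b (W x c) = (\<Sum>i<n. ext i (rmult (co x i * b) c))"
    by (simp add: W_def rmult_sum ext_rmult[symmetric] rmult_rmult)
  also have "\<dots> = W (b * x) c"
    unfolding W_def by (rule sum.cong) (use assms B_commute co_B in \<open>auto simp: co_scale\<close>)
  finally show ?thesis .
qed

lemma W_W_expand: "W x (W y c) = (\<Sum>i<n. \<Sum>j<n. ext i (ext j (rmult (co y j * co x i) c)))"
  by (simp add: W_def rmult_sum ext_sum ext_rmult rmult_rmult)

lemma W_W_same:
  assumes "x \<in> L" shows "W x (W x c) = 0"
  unfolding W_W_expand
proof (rule sum_antisym_zero)
  fix i j assume "i < n" "j < n"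
  then have "co x j * co x i = co x i * co x j" using assms by (intro B_commute co_B)
  then show "ext i (ext j (rmult (co x j * co x i) c)) = - ext j (ext i (rmult (co x i * co x j) c))"
    using ext_ext[of i j] by simp
qed simp

lemma W_W:
  assumes "x \<in> L" "y \<in> L" shows "W x (W y c) = - W y (W x c)"
proof -
  have "0 = W (x + y) (W (x + y) c)" using W_W_same[of "x + y"] assms L_plus by simp
  also have "\<dots> = W x (W y c) + W y (W x c)"
    using assms W_W_same by (simp add: W_plus_left W_additive)
  finally show ?thesis by (simp add: eq_neg_iff_add_eq_0)
qed

lemma con_W:
  assumes "j < n" shows "con j (W x c) = rmult (co x j) c - W x (con j c)"
proof -
  have "con j (ext i (rmult (co x i) c)) =
      (if i = j then rmult (co x j) c else 0) - ext i (rmult (co x i) (con j c))" for i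
    by (cases "i = j") (auto simp: con_ext_same con_ext con_rmult)
  then show ?thesis using assms by (simp add: W_def con_sum sum_subtractf)
qed

definition dv :: "'r \<Rightarrow> 'r \<Rightarrow> 'r" where
  "dv x y = (\<Sum>i<n. (x * co y i - co y i * x) * g i)"

lemma dv_L: "\<lbrakk>x \<in> L; y \<in> L\<rbrakk> \<Longrightarrow> dv x y \<in> L"
  unfolding dv_def by (intro L_sum L_scale L_anchor co_B g_L) auto

lemma W_rmult_swap:
  assumes "x \<in> L" "y \<in> L" shows "W y (rmult x c) - rmult x (W y c) = W (dv x y) c"
proof -
  have co: "co (dv x y) i = x * co y i - co y i * x" if "i < n" for i
    unfolding dv_def by (rule co_unique[OF _ that]) (use assms in \<open>auto intro: L_anchor co_B\<close>)
  show ?thesis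
    by (simp add: W_def rmult_sum ext_rmult[symmetric] rmult_rmult co rmult_additive ext_additive sum_subtractf)
qed

definition d1 :: "'r chain \<Rightarrow> 'r chain" where
  "d1 c = (\<Sum>i<n. con i (rmult (g i) c))"

definition d2 :: "'r chain \<Rightarrow> 'r chain" where
  "d2 c = (\<Sum>j<n. \<Sum>i<j. W (g i * g j - g j * g i) (con j (con i c)))"

text \<open>
  The Spencer differential on basis chains: \<open>d1\<close> collects the terms \<open>P\<lambda>\<^sub>i\<close> and \<open>d2\<close> the bracket terms.
\<close>
definition d :: "'r chain \<Rightarrow> 'r chain" where
  "d c = d1 c - d2 c"

text \<open>
  The right action of \<open>L\<close> on \<open>C \<otimes> \<Lambda>L\<close>: \<open>P \<otimes> \<lambda> \<mapsto> Px \<otimes> \<lambda> - P \<otimes> [x, \<lambda>]\<close>. It is the homotopy term in the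
  Cartan formula \<open>d_W\<close>, and it commutes with \<open>d\<close>, which is how \<open>d d = 0\<close> is obtained.
\<close>
definition rho :: "'r \<Rightarrow> 'r chain \<Rightarrow> 'r chain" where
  "rho x c = rmult x c - (\<Sum>j<n. W (x * g j - g j * x) (con j c))"

lemma d1_additive: "d1 (c + c') = d1 c + d1 c'" "d1 (c - c') = d1 c - d1 c'" "d1 0 = 0"
  by (simp_all add: d1_def rmult_additive con_additive sum.distrib sum_subtractf)
lemma d2_additive: "d2 (c + c') = d2 c + d2 c'" "d2 (c - c') = d2 c - d2 c'" "d2 0 = 0"
  by (simp_all add: d2_def W_additive con_additive sum.distrib sum_subtractf)
lemma d_additive: "d (c + c') = d c + d c'" "d (c - c') = d c - d c'" "d 0 = 0" "d (- c) = - d c"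
proof -
  show D: "d (c + c') = d c + d c'" "d (c - c') = d c - d c'" "d 0 = 0" for c c'
    by (simp_all add: d_def d1_additive d2_additive)
  show "d (- c) = - d c" using D(2)[of 0 c] D(3) by simp
qed
lemma rho_additive: "rho x (c + c') = rho x c + rho x c'" "rho x (c - c') = rho x c - rho x c'" "rho x 0 = 0"
  by (simp_all add: rho_def rmult_additive W_additive con_additive sum.distrib sum_subtractf algebra_simps)

lemma d_sum: "d (\<Sum>a\<in>A. t a) = (\<Sum>a\<in>A. d (t a))"
  by (rule sum_additive[of d]) (simp_all add: d_additive)

lemma d1_W:
  assumes "x \<in> L"
  shows "d1 (W x c) + W x (d1 c) = rmult x c + (\<Sum>i<n. W (dv (g i) x) (con i c))"
proof -
  have "con i (rmult (g i) (W x c)) + W x (con i (rmult (g i) c)) =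
      rmult (co x i * g i) c + W (dv (g i) x) (con i c)" if "i < n" for i
    using W_rmult_swap[OF g_L[OF that] assms, of "con i c"] that
    by (simp add: con_rmult con_W rmult_additive rmult_rmult algebra_simps)
  then have "d1 (W x c) + W x (d1 c) = (\<Sum>i<n. rmult (co x i * g i) c + W (dv (g i) x) (con i c))"
    by (simp add: d1_def W_sum sum.distrib[symmetric])
  also have "\<dots> = rmult x c + (\<Sum>i<n. W (dv (g i) x) (con i c))"
    using co_expand[OF assms] by (simp add: sum.distrib rmult_sum_left[symmetric])
  finally show ?thesis .
qed

lemma d2_W:
  assumes "x \<in> L"
  shows "d2 (W x c) + W x (d2 c) = (\<Sum>j<n. W (\<Sum>i<n. co x i * (g i * g j - g j * g i)) (con j c))"
proof -
  define t where "t i j = W (co x i * (g i * g j - g j * g i)) (con j c)" for i j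
  have t: "W (g i * g j - g j * g i) (con j (con i (W x c))) + W x (W (g i * g j - g j * g i) (con j (con i c)))
      = t i j + t j i" if "i < n" "j < n" for i j
  proof -
    let ?m = "g i * g j - g j * g i"
    have mL: "?m \<in> L" using that by (intro L_bracket g_L)
    have B: "co x i \<in> B" "co x j \<in> B" using that assms by (auto intro: co_B)
    have "con j (con i (W x c)) = rmult (co x i) (con j c) - rmult (co x j) (con i c) + W x (con j (con i c))"
      using that by (simp add: con_W con_additive con_rmult)
    then have "W ?m (con j (con i (W x c))) =
        W (co x i * ?m) (con j c) - W (co x j * ?m) (con i c) + W ?m (W x (con j (con i c)))"
      using mL B by (simp add: W_additive W_scale)
    moreover have "W ?m (W x (con j (con i c))) = - W x (W ?m (con j (con i c)))" by (rule W_W[OF mL assms])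
    moreover have "W (co x j * ?m) (con i c) = - t j i"
    proof -
      have "co x j * ?m = - (co x j * (g j * g i - g i * g j))" by (simp add: algebra_simps)
      moreover have "co x j * (g j * g i - g i * g j) \<in> L" using B that by (intro L_scale L_bracket g_L)
      ultimately show ?thesis by (simp only: W_uminus_left t_def)
    qed
    ultimately show ?thesis by (simp add: t_def)
  qed
  have "d2 (W x c) + W x (d2 c) = (\<Sum>j<n. \<Sum>i<j. t i j + t j i)"
    unfolding d2_def W_sum sum.distrib[symmetric] by (intro sum.cong refl t) auto
  also have "\<dots> = (\<Sum>j<n. \<Sum>i<n. t i j)" by (rule sum_triangle) (simp add: t_def W_zero_left)
  also have "\<dots> = (\<Sum>j<n. W (\<Sum>i<n. co x i * (g i * g j - g j * g i)) (con j c))"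
    unfolding t_def by (intro sum.cong refl W_sum_left[symmetric] L_scale co_B assms L_bracket g_L) auto
  finally show ?thesis .
qed

lemma bracket_left_expand:
  assumes "x \<in> L" "j < n"
  shows "(\<Sum>i<n. co x i * (g i * g j - g j * g i)) - dv (g j) x = x * g j - g j * x"
proof -
  have "(\<Sum>i<n. co x i * (g i * g j - g j * g i)) - dv (g j) x =
      (\<Sum>i<n. co x i * g i * g j - g j * (co x i * g i))"
    unfolding dv_def sum_subtractf[symmetric] by (rule sum.cong) (auto simp: algebra_simps)
  also have "\<dots> = x * g j - g j * x"
    using co_expand[OF assms(1)] by (simp add: sum_subtractf sum_distrib_left[symmetric] sum_distrib_right[symmetric])
  finally show ?thesis .
qed

lemma bracket_right_expand:
  assumes "y \<in> L"
  shows "dv x y + (\<Sum>j<n. co y j * (x * g j - g j * x)) = x * y - y * x"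
proof -
  have "dv x y + (\<Sum>j<n. co y j * (x * g j - g j * x)) =
      (\<Sum>j<n. x * (co y j * g j) - co y j * g j * x)"
    unfolding dv_def sum.distrib[symmetric] by (rule sum.cong) (auto simp: algebra_simps)
  also have "\<dots> = x * y - y * x"
    using co_expand[OF assms(1)] by (simp add: sum_subtractf sum_distrib_left[symmetric] sum_distrib_right[symmetric])
  finally show ?thesis .
qed

text \<open>
  Cartan's formula. With it, identities for \<open>d\<close> follow by induction over the factors of a wedge product.
  Derivatives of the coordinates of \<open>x\<close>, from \<open>d1\<close>, and brackets, from \<open>d2\<close>, combine to the brackets in
  \<open>rho x\<close> by \<open>bracket_left_expand\<close>.
\<close>
lemma d_W:
  assumes "x \<in> L" shows "d (W x c) = rho x c - W x (d c)"
proof -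
  have L: "(\<Sum>i<n. co x i * (g i * g j - g j * g i)) \<in> L" if "j < n" for j
    using assms that by (intro L_sum L_scale co_B L_bracket g_L) auto
  have "d (W x c) + W x (d c) = (d1 (W x c) + W x (d1 c)) - (d2 (W x c) + W x (d2 c))"
    by (simp add: d_def W_additive)
  also have "\<dots> = rmult x c - (\<Sum>j<n. W (\<Sum>i<n. co x i * (g i * g j - g j * g i)) (con j c) - W (dv (g j) x) (con j c))"
    using assms by (simp add: d1_W d2_W sum_subtractf)
  also have "\<dots> = rho x c"
    unfolding rho_def by (intro arg_cong2[where f = "(-)"] sum.cong refl)
      (use L dv_L g_L assms in \<open>simp add: W_minus_left[symmetric] bracket_left_expand\<close>)
  finally show ?thesis by (simp add: algebra_simps)
qed

lemma rho_W:
  assumes "x \<in> L" "y \<in> L" shows "rho x (W y c) = W y (rho x c) - W (x * y - y * x) c"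
proof -
  define m where "m j = x * g j - g j * x" for j
  have mL: "m j \<in> L" if "j < n" for j using assms that by (auto simp: m_def intro!: L_bracket g_L)
  have L: "(\<Sum>j<n. co y j * m j) \<in> L" using assms mL by (intro L_sum L_scale co_B) auto
  have *: "W (m j) (con j (W y c)) - W y (W (m j) (con j c)) = W (co y j * m j) c" if "j < n" for j
    using that assms W_W[OF mL[OF that] assms(2), of "con j c"]
    by (simp add: con_W W_additive W_scale mL co_B)
  have "rho x (W y c) - W y (rho x c) =
      - (W y (rmult x c) - rmult x (W y c)) - (\<Sum>j<n. W (m j) (con j (W y c)) - W y (W (m j) (con j c)))"
    by (simp add: rho_def W_additive W_sum m_def sum_subtractf algebra_simps)
  also have "\<dots> = - (W (dv x y) c) - (\<Sum>j<n. W (co y j * m j) c)"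
    using * assms by (simp add: W_rmult_swap)
  also have "(\<Sum>j<n. W (co y j * m j) c) = W (\<Sum>j<n. co y j * m j) c"
    by (rule W_sum_left[symmetric]) (use assms mL in \<open>auto intro: L_scale co_B\<close>)
  also have "- (W (dv x y) c) - W (\<Sum>j<n. co y j * m j) c = - W (x * y - y * x) c"
    using bracket_right_expand[OF assms(2), of x] dv_L[OF assms] L W_plus_left[of "dv x y" "\<Sum>j<n. co y j * m j" c]
    by (simp add: m_def)
  finally show ?thesis by (simp add: algebra_simps)
qed

text \<open>
  The chain of \<open>P \<otimes> (\<lambda>\<^sub>1 \<and> \<dots> \<and> \<lambda>\<^sub>r)\<close> for arbitrary elements \<open>\<lambda>\<^sub>i\<close> of \<open>L\<close>.
\<close>
definition Phi :: "'r \<Rightarrow> 'r list \<Rightarrow> 'r chain" where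
  "Phi P ls = foldr W ls (pt P)"

lemma Phi_simps [simp]: "Phi P [] = pt P" "Phi P (x # ls) = W x (Phi P ls)"
  by (simp_all add: Phi_def)

lemma d_pt [simp]: "d (pt P) = 0"
  by (simp add: d_def d1_def d2_def rmult_pt con_additive W_additive)

lemma rho_pt [simp]: "rho x (pt P) = pt (P * x)"
  by (simp add: rho_def rmult_pt W_additive)

lemma rho_rho:
  assumes "x \<in> L" "y \<in> L" "set ls \<subseteq> L"
  shows "rho y (rho x (Phi P ls)) - rho x (rho y (Phi P ls)) = rho (x * y - y * x) (Phi P ls)"
  using assms(3)
proof (induction ls)
  case Nil
  show ?case by (simp add: pt_additive algebra_simps)
next
  case (Cons z ls)
  let ?w = "Phi P ls"
  have z: "z \<in> L" using Cons.prems by simp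
  note L = assms(1,2) z L_bracket
  define jac where "jac = W (y * (x * z - z * x) - (x * z - z * x) * y) ?w - W (x * (y * z - z * y) - (y * z - z * y) * x) ?w"
  have "rho y (rho x (W z ?w)) - rho x (rho y (W z ?w)) =
      W z (rho y (rho x ?w) - rho x (rho y ?w)) + jac"
    using L by (simp add: rho_W rho_additive W_additive jac_def algebra_simps)
  also have "\<dots> = W z (rho (x * y - y * x) ?w) + jac" using Cons by simp
  also have "jac = - W ((x * y - y * x) * z - z * (x * y - y * x)) ?w"
  proof -
    have "jac = W ((y * (x * z - z * x) - (x * z - z * x) * y) - (x * (y * z - z * y) - (y * z - z * y) * x)) ?w"
      unfolding jac_def using L by (intro W_minus_left[symmetric]) auto
    also have "(y * (x * z - z * x) - (x * z - z * x) * y) - (x * (y * z - z * y) - (y * z - z * y) * x) =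
        - ((x * y - y * x) * z - z * (x * y - y * x))" by (simp add: algebra_simps)
    finally show ?thesis using L by (simp only: W_uminus_left)
  qed
  finally show ?case using L by (simp add: rho_W)
qed

lemma d_rho:
  assumes "x \<in> L" "set ls \<subseteq> L"
  shows "d (rho x (Phi P ls)) = rho x (d (Phi P ls))"
  using assms(2)
proof (induction ls)
  case (Cons z ls)
  let ?w = "Phi P ls"
  have z: "z \<in> L" using Cons.prems by simp
  note L = assms(1) z L_bracket
  have "d (rho x (W z ?w)) = rho z (rho x ?w) - W z (d (rho x ?w)) - rho (x * z - z * x) ?w + W (x * z - z * x) (d ?w)"
    using L by (simp add: rho_W d_additive d_W)
  also have "\<dots> = rho x (rho z ?w) - W z (rho x (d ?w)) + W (x * z - z * x) (d ?w)"
    using Cons rho_rho[of x z ls P] L by (simp add: algebra_simps)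
  also have "\<dots> = rho x (d (W z ?w))"
    using L by (simp add: d_W rho_additive rho_W)
  finally show ?case by simp
qed (simp add: rho_additive)

lemma d_d_Phi: "set ls \<subseteq> L \<Longrightarrow> d (d (Phi P ls)) = 0"
  by (induction ls) (simp_all add: d_additive d_W d_rho W_additive)

lemma nths_Compl_Cons:
  "nths (x # ls) (- {0}) = ls" "nths (x # ls) (- {Suc i}) = x # nths ls (- {i})"
  "nths (x # ls) (- {0, Suc i}) = nths ls (- {i})" "nths (x # ls) (- {Suc i, Suc k}) = x # nths ls (- {i, k})"
proof -
  have "{j. Suc j \<in> - {0}} = UNIV" "{j. Suc j \<in> - {Suc i}} = - {i}"
    "{j. Suc j \<in> - {0, Suc i}} = - {i}" "{j. Suc j \<in> - {Suc i, Suc k}} = - {i, k}" by auto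
  then show "nths (x # ls) (- {0}) = ls" "nths (x # ls) (- {Suc i}) = x # nths ls (- {i})"
    "nths (x # ls) (- {0, Suc i}) = nths ls (- {i})" "nths (x # ls) (- {Suc i, Suc k}) = x # nths ls (- {i, k})"
    by (simp_all add: nths_Cons nths_all)
qed

lemma W_pm: "W x (pm b c) = pm b (W x c)"
  by (simp add: pm_def W_additive)

lemma rho_Phi:
  assumes "x \<in> L" "set ls \<subseteq> L"
  shows "rho x (Phi P ls) =
    Phi (P * x) ls - (\<Sum>j<length ls. pm (even j) (Phi P ((x * ls ! j - ls ! j * x) # nths ls (- {j}))))"
  using assms(2)
proof (induction ls)
  case (Cons z ls)
  have z: "z \<in> L" using Cons.prems by simp
  have swap: "W z (W (x * ls ! j - ls ! j * x) c) = - W (x * ls ! j - ls ! j * x) (W z c)" if "j < length ls" for j c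
    using that Cons.prems assms(1) by (intro W_W L_bracket z) auto
  have "rho x (Phi P (z # ls)) = W z (rho x (Phi P ls)) - W (x * z - z * x) (Phi P ls)"
    using assms(1) z by (simp add: rho_W)
  also have "\<dots> = W z (Phi (P * x) ls) -
      (W (x * z - z * x) (Phi P ls) + (\<Sum>j<length ls. - pm (even j) (W (x * ls ! j - ls ! j * x) (W z (Phi P (nths ls (- {j})))))))"
    using Cons by (simp add: W_additive W_sum W_pm swap)
  also have "\<dots> = Phi (P * x) (z # ls) - (\<Sum>j<length (z # ls). pm (even j) (Phi P ((x * (z # ls) ! j - (z # ls) ! j * x) # nths (z # ls) (- {j}))))"
    by (simp only: length_Cons sum.lessThan_Suc_shift nths_Compl_Cons) simp
  finally show ?case .
qed simp

text \<open>
  This is the defining formula of the Spencer differential; the definition through the basis was chosen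
  because it makes sense without representing a chain as a combination of wedge products.
\<close>
lemma d_Phi:
  assumes "set ls \<subseteq> L"
  shows "d (Phi P ls) =
    (\<Sum>i<length ls. pm (even i) (Phi (P * ls ! i) (nths ls (- {i})))) +
    (\<Sum>j<length ls. \<Sum>i<j. pm (even (i + j)) (Phi P ((ls ! i * ls ! j - ls ! j * ls ! i) # nths ls (- {i, j}))))"
  using assms
proof (induction ls)
  case (Cons z ls)
  have z: "z \<in> L" and ls: "set ls \<subseteq> L" using Cons.prems by auto
  have swap: "W z (W (ls ! i * ls ! j - ls ! j * ls ! i) c) = - W (ls ! i * ls ! j - ls ! j * ls ! i) (W z c)"
    if "i < length ls" "j < length ls" for i j c
    using that ls by (intro W_W L_bracket z) auto
  let ?S1 = "\<Sum>i<length ls. pm (even i) (Phi (P * ls ! i) (z # nths ls (- {i})))"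
  let ?S2 = "\<Sum>j<length ls. \<Sum>i<j. pm (even (i + j)) (Phi P ((ls ! i * ls ! j - ls ! j * ls ! i) # z # nths ls (- {i, j})))"
  let ?S3 = "\<Sum>j<length ls. pm (even j) (Phi P ((z * ls ! j - ls ! j * z) # nths ls (- {j})))"
  have "d (Phi P (z # ls)) = rho z (Phi P ls) - W z (d (Phi P ls))" using z by (simp add: d_W)
  also have "W z (d (Phi P ls)) = ?S1 +
     (\<Sum>j<length ls. \<Sum>i<j. pm (even (i + j)) (W z (W (ls ! i * ls ! j - ls ! j * ls ! i) (Phi P (nths ls (- {i, j}))))))"
    using Cons.IH[OF ls] by (simp add: W_additive W_sum W_pm)
  also have "(\<Sum>j<length ls. \<Sum>i<j. pm (even (i + j)) (W z (W (ls ! i * ls ! j - ls ! j * ls ! i) (Phi P (nths ls (- {i, j})))))) = - ?S2"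
    unfolding sum_negf[symmetric] by (intro sum.cong refl) (auto simp: swap)
  also have "rho z (Phi P ls) = Phi (P * z) ls - ?S3" by (rule rho_Phi[OF z ls])
  also have "Phi (P * z) ls - ?S3 - (?S1 + - ?S2) =
    (\<Sum>i<length (z # ls). pm (even i) (Phi (P * (z # ls) ! i) (nths (z # ls) (- {i})))) +
    (\<Sum>j<length (z # ls). \<Sum>i<j. pm (even (i + j)) (Phi P (((z # ls) ! i * (z # ls) ! j - (z # ls) ! j * (z # ls) ! i) # nths (z # ls) (- {i, j}))))"
  proof -
    have "(\<Sum>i<length (z # ls). pm (even i) (Phi (P * (z # ls) ! i) (nths (z # ls) (- {i})))) = Phi (P * z) ls - ?S1"
      by (simp only: length_Cons sum.lessThan_Suc_shift nths_Compl_Cons) (simp add: sum_negf)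
    moreover have "(\<Sum>j<length (z # ls). \<Sum>i<j. pm (even (i + j)) (Phi P (((z # ls) ! i * (z # ls) ! j - (z # ls) ! j * (z # ls) ! i) # nths (z # ls) (- {i, j})))) = ?S2 - ?S3"
      by (simp only: length_Cons sum.lessThan_Suc_shift nths_Compl_Cons)
         (simp add: sum.distrib sum_negf sum_subtractf)
    ultimately show ?thesis by simp
  qed
  finally show ?case .
qed simp

end

section \<open>Graded chains and exactness\<close>

definition graded_chains :: "'r::zero set \<Rightarrow> nat \<Rightarrow> nat \<Rightarrow> 'r chain set" where
  "graded_chains S m r = {c. \<forall>I. coef c I \<in> S \<and> (coef c I \<noteq> 0 \<longrightarrow> I \<subseteq> {..<m} \<and> card I = r)}"

definition additive_group :: "'r::ab_group_add set \<Rightarrow> bool" where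
  "additive_group S \<longleftrightarrow> 0 \<in> S \<and> (\<forall>x\<in>S. \<forall>y\<in>S. x - y \<in> S)"

lemma additive_groupD:
  assumes "additive_group S"
  shows "0 \<in> S" "\<lbrakk>x \<in> S; y \<in> S\<rbrakk> \<Longrightarrow> x - y \<in> S" "x \<in> S \<Longrightarrow> - x \<in> S" "\<lbrakk>x \<in> S; y \<in> S\<rbrakk> \<Longrightarrow> x + y \<in> S"
    "x \<in> S \<Longrightarrow> pm b x \<in> S"
proof -
  show Z: "0 \<in> S" using assms by (simp add: additive_group_def)
  show M: "x - y \<in> S" if "x \<in> S" "y \<in> S" for x y
    using assms that by (simp add: additive_group_def)
  show U: "- x \<in> S" if "x \<in> S" for x using M[OF Z that] by simp
  show "x + y \<in> S" if "x \<in> S" "y \<in> S" for x y using M[OF that(1) U[OF that(2)]] by simp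
  show "pm b x \<in> S" if "x \<in> S" using that U by (simp add: pm_def)
qed

lemma additive_group_sum: "additive_group S \<Longrightarrow> (\<And>a. a \<in> A \<Longrightarrow> t a \<in> S) \<Longrightarrow> (\<Sum>a\<in>A. t a) \<in> S"
  by (induction A rule: infinite_finite_induct) (auto intro: additive_groupD)

lemma chainsI:
  "(\<And>I. coef c I \<in> S) \<Longrightarrow> (\<And>I. coef c I \<noteq> 0 \<Longrightarrow> I \<subseteq> {..<m} \<and> card I = r) \<Longrightarrow> c \<in> graded_chains S m r"
  by (simp add: graded_chains_def)

lemma chainsD:
  assumes "c \<in> graded_chains S m r" shows "coef c I \<in> S" "coef c I \<noteq> 0 \<Longrightarrow> I \<subseteq> {..<m} \<and> card I = r \<and> finite I"
  using assms finite_subset[of I "{..<m}"] by (auto simp: graded_chains_def)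

lemma chains_group: "additive_group S \<Longrightarrow> additive_group (graded_chains S m r)"
proof -
  assume S: "additive_group S"
  have "c - c' \<in> graded_chains S m r" if "c \<in> graded_chains S m r" "c' \<in> graded_chains S m r" for c c'
    unfolding graded_chains_def
  proof (intro CollectI allI conjI impI)
    fix I
    show "coef (c - c') I \<in> S" using that S by (simp add: graded_chains_def additive_groupD)
    assume "coef (c - c') I \<noteq> 0"
    then have "coef c I \<noteq> 0 \<or> coef c' I \<noteq> 0" by auto
    then show "I \<subseteq> {..<m}" "card I = r" using that by (auto simp: graded_chains_def)
  qed
  moreover have "0 \<in> graded_chains S m r" using S by (simp add: graded_chains_def additive_groupD)
  ultimately show ?thesis by (auto simp: additive_group_def)
qed

lemma chains_mono: "m \<le> m' \<Longrightarrow> graded_chains S m r \<subseteq> graded_chains S m' r"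
proof
  fix c assume "m \<le> m'" and c: "c \<in> graded_chains S m r"
  then have "{..<m} \<subseteq> {..<m'}" by auto
  then show "c \<in> graded_chains S m' r"
    using chainsD(1)[OF c] chainsD(2)[OF c] by (intro chainsI) (meson order_trans)+
qed

lemma chains_values: "c \<in> graded_chains S m r \<Longrightarrow> coef c I \<in> S"
  by (auto simp: graded_chains_def)

lemma chains_change_values: "c \<in> graded_chains S m r \<Longrightarrow> (\<And>I. coef c I \<in> S') \<Longrightarrow> c \<in> graded_chains S' m r"
  by (auto simp: graded_chains_def)

lemma chains_values_mono: "S \<subseteq> S' \<Longrightarrow> c \<in> graded_chains S m r \<Longrightarrow> c \<in> graded_chains S' m r"
  by (auto simp: graded_chains_def)

lemma chains_con: "additive_group S \<Longrightarrow> c \<in> graded_chains S m (Suc r) \<Longrightarrow> con i c \<in> graded_chains S m r"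
proof -
  assume S: "additive_group S" and c: "c \<in> graded_chains S m (Suc r)"
  have "I \<subseteq> {..<m} \<and> card I = r" if "coef (con i c) I \<noteq> 0" for I
  proof -
    have "i \<notin> I" "coef c (insert i I) \<noteq> 0" using that by (auto simp: con_def split: if_splits)
    then have "insert i I \<subseteq> {..<m}" "card (insert i I) = Suc r" "finite I"
      using chainsD(2)[OF c, of "insert i I"] by auto
    then show ?thesis using \<open>i \<notin> I\<close> by auto
  qed
  moreover have "coef (con i c) I \<in> S" for I
    using S c by (auto simp: con_def graded_chains_def intro: additive_groupD)
  ultimately show ?thesis by (simp add: graded_chains_def)
qed

lemma chains_con_0: "c \<in> graded_chains S m 0 \<Longrightarrow> con i c = 0"
proof -
  assume c: "c \<in> graded_chains S m 0"
  have "coef c (insert i I) = 0" for I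
  proof (rule ccontr)
    assume "coef c (insert i I) \<noteq> 0"
    then have "insert i I \<subseteq> {..<m}" "card (insert i I) = 0" using c by (auto simp: graded_chains_def)
    then show False using finite_subset[of "insert i I" "{..<m}"] by auto
  qed
  then show ?thesis by (auto simp: chain_eq_iff con_def)
qed

lemma chains_ext:
  "additive_group S \<Longrightarrow> c \<in> graded_chains S m r \<Longrightarrow> i < m \<Longrightarrow> ext i c \<in> graded_chains S m (Suc r)"
proof -
  assume S: "additive_group S" and c: "c \<in> graded_chains S m r" and i: "i < m"
  have "I \<subseteq> {..<m} \<and> card I = Suc r" if "coef (ext i c) I \<noteq> 0" for I
  proof -
    have "i \<in> I" "coef c (I - {i}) \<noteq> 0" using that by (auto simp: ext_def split: if_splits)
    then have I: "I - {i} \<subseteq> {..<m}" "card (I - {i}) = r" using c by (auto simp: graded_chains_def)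
    then have "finite I" using finite_subset[of "I - {i}" "{..<m}"] by simp
    then show ?thesis using I i \<open>i \<in> I\<close> by (metis card_Suc_Diff1 insert_Diff insert_subset lessThan_iff)
  qed
  moreover have "coef (ext i c) I \<in> S" for I
    using S c by (auto simp: ext_def graded_chains_def intro: additive_groupD)
  ultimately show ?thesis by (simp add: graded_chains_def)
qed

lemma chains_rmult:
  "c \<in> graded_chains S m r \<Longrightarrow> (\<And>y. y \<in> S \<Longrightarrow> y * x \<in> S') \<Longrightarrow> rmult x c \<in> graded_chains S' m r"
proof (rule chainsI)
  fix I assume c: "c \<in> graded_chains S m r" and x: "\<And>y. y \<in> S \<Longrightarrow> y * x \<in> S'"
  show "coef (rmult x c) I \<in> S'" using x chainsD(1)[OF c] by (simp add: rmult_def)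
  assume "coef (rmult x c) I \<noteq> 0"
  then have "coef c I \<noteq> 0" by (auto simp: rmult_def)
  then show "I \<subseteq> {..<m} \<and> card I = r" using chainsD(2)[OF c] by auto
qed

lemma chains_0_eq_pt: "c \<in> graded_chains S m 0 \<Longrightarrow> c = pt (coef c {})"
proof -
  assume c: "c \<in> graded_chains S m 0"
  have "coef c I = 0" if "I \<noteq> {}" for I
    using c that finite_subset[of I "{..<m}"] by (auto simp: graded_chains_def)
  then show ?thesis by (auto simp: chain_eq_iff pt_def)
qed

lemma chains_pt: "0 \<in> S \<Longrightarrow> P \<in> S \<Longrightarrow> pt P \<in> graded_chains S m 0"
  by (auto simp: graded_chains_def pt_def)

lemma chains_restrict:
  assumes "c \<in> graded_chains S (Suc m) r" "con m c = 0" shows "c \<in> graded_chains S m r"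
proof -
  have "I \<subseteq> {..<m}" if "coef c I \<noteq> 0" for I
  proof -
    have "m \<notin> I"
    proof
      assume "m \<in> I"
      have "coef (con m c) (I - {m}) = 0" using assms(2) by simp
      then show False using that \<open>m \<in> I\<close> by (simp add: con_def pm_def insert_absorb split: if_splits)
    qed
    moreover have "I \<subseteq> {..<Suc m}" using assms(1) that by (auto simp: graded_chains_def)
    ultimately show ?thesis by (auto simp: less_Suc_eq)
  qed
  then show ?thesis using assms(1) by (auto simp: graded_chains_def)
qed

lemma con_chains_zero: "c \<in> graded_chains S m r \<Longrightarrow> m \<le> i \<Longrightarrow> con i c = 0"
proof -
  assume c: "c \<in> graded_chains S m r" and i: "m \<le> i"
  have "coef c (insert i I) = 0" for I using c i by (auto simp: graded_chains_def)
  then show ?thesis by (auto simp: chain_eq_iff con_def)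
qed

definition single :: "nat set \<Rightarrow> 'r \<Rightarrow> 'r::zero chain" where
  "single I P = Chain (\<lambda>J. if J = I then P else 0)"

lemma coef_single [simp]: "coef (single I P) J = (if J = I then P else 0)"
  by (simp add: single_def)

lemma chains_expand:
  fixes c :: "'r::ab_group_add chain"
  assumes "c \<in> graded_chains S m r" shows "c = (\<Sum>I\<in>Pow {..<m}. single I (coef c I))"
  using assms by (auto simp: chain_eq_iff coef_sum graded_chains_def)

context lie_basis
begin

lemma C_group: "additive_group C"
  by (simp add: additive_group_def C_zero C_minus)

lemma W_basis: "i < n \<Longrightarrow> W (g i) c = ext i (rmult e c)"
proof -
  assume i: "i < n"
  have "W (g i) c = (\<Sum>j<n. if j = i then ext i (rmult e c) else 0)"
    unfolding W_def by (rule sum.cong) (use i in \<open>auto simp: co_basis rmult_additive ext_additive\<close>)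
  then show ?thesis using i by simp
qed

text \<open>
  The index set is sorted increasingly, so that each exterior multiplication comes with the sign \<open>+\<close>.
\<close>
lemma Phi_basis:
  assumes "P \<in> C" "I \<subseteq> {..<n}"
  shows "Phi P (map g (sorted_list_of_set I)) = single I P"
proof -
  have "Phi P (map g xs) = single (set xs) P" if "sorted_wrt (<) xs" "set xs \<subseteq> {..<n}" for xs
    using that
  proof (induction xs)
    case (Cons i xs)
    have "{j \<in> insert i (set xs). j < i} = {}" using Cons.prems by (auto dest: order.asym)
    then have "even_below i (insert i (set xs))" unfolding even_below_def by (simp only: card.empty even_zero)
    moreover have "i \<notin> set xs" using Cons.prems by auto
    ultimately have "ext i (single (set xs) P) = single (set (i # xs)) P"
      by (auto simp: chain_eq_iff ext_def)
    moreover have "rmult e (single (set xs) P) = single (set xs) P"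
      using assms(1) by (auto simp: chain_eq_iff rmult_def e_right)
    ultimately show ?case using Cons by (simp add: W_basis)
  qed (auto simp: chain_eq_iff pt_def)
  moreover have "finite I" using assms(2) finite_subset by blast
  ultimately show ?thesis using assms(2) by simp
qed

lemma chains_eq_sum_Phi:
  assumes "c \<in> graded_chains C n r"
  shows "c = (\<Sum>I\<in>Pow {..<n}. Phi (coef c I) (map g (sorted_list_of_set I)))"
proof -
  have "(\<Sum>I\<in>Pow {..<n}. Phi (coef c I) (map g (sorted_list_of_set I))) = (\<Sum>I\<in>Pow {..<n}. single I (coef c I))"
    by (rule sum.cong) (use assms in \<open>auto simp: Phi_basis chains_values\<close>)
  then show ?thesis using chains_expand[OF assms] by simp
qed

lemma d_d: "c \<in> graded_chains C n r \<Longrightarrow> d (d c) = 0"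
proof -
  assume c: "c \<in> graded_chains C n r"
  have "set (map g (sorted_list_of_set I)) \<subseteq> L" if "I \<in> Pow {..<n}" for I
    using that g_L finite_subset[of I "{..<n}"] by auto
  then have "(\<Sum>I\<in>Pow {..<n}. d (d (Phi (coef c I) (map g (sorted_list_of_set I))))) = 0"
    by (intro sum.neutral) (auto simp: d_d_Phi)
  then show ?thesis by (subst chains_eq_sum_Phi[OF c]) (simp add: d_sum)
qed

lemma chains_W:
  assumes "additive_group S" "\<And>y b. y \<in> S \<Longrightarrow> b \<in> B \<Longrightarrow> y * b \<in> S" "c \<in> graded_chains S n r" "x \<in> L"
  shows "W x c \<in> graded_chains S n (Suc r)"
  unfolding W_def
  by (intro additive_group_sum chains_group chains_ext chains_rmult[of _ S]) (use assms co_B in auto)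

lemma chains_d2:
  assumes "additive_group S" "\<And>y b. y \<in> S \<Longrightarrow> b \<in> B \<Longrightarrow> y * b \<in> S" "c \<in> graded_chains S n (Suc r)"
  shows "d2 c \<in> graded_chains S n r"
proof (cases r)
  case 0
  then have "con j (con i c) = 0" for i j
    using chains_con_0[OF chains_con] assms by metis
  then show ?thesis
    using additive_groupD(1)[OF chains_group[OF assms(1)]] by (simp add: d2_def W_additive)
next
  case (Suc r')
  have "W (g i * g j - g j * g i) (con j (con i c)) \<in> graded_chains S n (Suc r')" if "i < n" "j < n" for i j
    by (rule chains_W) (use assms that Suc in \<open>auto intro!: chains_con L_bracket g_L\<close>)
  then show ?thesis unfolding d2_def Suc
    by (intro additive_group_sum chains_group assms(1)) auto
qed

text \<open>
  The Koszul part of the differential on the first \<open>m\<close> basis vectors; the induction for exactness is on \<open>m\<close>.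
\<close>
definition dK :: "nat \<Rightarrow> 'r chain \<Rightarrow> 'r chain" where
  "dK m c = (\<Sum>i<m. con i (rmult (g i) c))"

lemma d1_eq_dK: "d1 c = dK n c"
  by (simp add: d1_def dK_def)

lemma dK_Suc: "dK (Suc m) c = dK m c + rmult (g m) (con m c)"
  by (simp add: dK_def con_rmult)

lemma dK_additive: "dK m (c + c') = dK m c + dK m c'" "dK m (c - c') = dK m c - dK m c'" "dK m 0 = 0"
  by (simp_all add: dK_def rmult_additive con_additive sum.distrib sum_subtractf)

lemma chains_dK:
  assumes "additive_group S'" "\<And>y i. y \<in> S \<Longrightarrow> i < m' \<Longrightarrow> y * g i \<in> S'" "c \<in> graded_chains S m (Suc r)"
  shows "dK m' c \<in> graded_chains S' m r"
  unfolding dK_def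
  by (intro additive_group_sum chains_group chains_con chains_rmult[of _ S]) (use assms in auto)

lemma chains_d: "c \<in> graded_chains C n (Suc r) \<Longrightarrow> d c \<in> graded_chains C n r"
  unfolding d_def d1_eq_dK
  by (intro additive_groupD(2) chains_group chains_dK[of _ C] chains_d2)
     (use C_group in \<open>auto intro: C_times subsetD[OF B_C] subsetD[OF L_C] g_L\<close>)

lemma dK_pt_sum: "dK n (\<Sum>j<n. ext j (pt (q j))) = pt (\<Sum>j<n. q j * g j)"
  and con_con_pt_sum: "con i (con k (\<Sum>j<n. ext j (pt (q j)))) = 0"
proof -
  have *: "con i (ext j (pt p)) = (if i = j then pt p else 0)" for i j and p :: 'r
    by (cases "i = j") (auto simp: con_ext con_ext_same ext_additive)
  show "con i (con k (\<Sum>j<n. ext j (pt (q j)))) = 0"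
    by (simp add: con_sum * if_distrib[of "con i"] con_additive cong: if_cong)
  have "dK n (\<Sum>j<n. ext j (pt (q j))) = (\<Sum>i<n. \<Sum>j<n. if i = j then pt (q j * g j) else 0)"
    unfolding dK_def
    by (intro sum.cong refl) (auto simp: con_sum rmult_sum ext_rmult[symmetric] rmult_pt * intro!: sum.cong)
  also have "\<dots> = (\<Sum>j<n. pt (q j * g j))" by simp
  also have "\<dots> = pt (\<Sum>j<n. q j * g j)"
    by (rule sum_additive[of pt, symmetric]) (simp_all add: pt_additive)
  finally show "dK n (\<Sum>j<n. ext j (pt (q j))) = pt (\<Sum>j<n. q j * g j)" .
qed

lemma chains_pt_sum:
  assumes "additive_group S" "\<And>j. j < m \<Longrightarrow> q j \<in> S"
  shows "(\<Sum>j<m. ext j (pt (q j))) \<in> graded_chains S m (Suc 0)"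
  by (intro additive_group_sum chains_group chains_ext chains_pt) (use assms in \<open>auto intro: additive_groupD\<close>)

lemma d_pt_sum: "d (\<Sum>j<n. ext j (pt (q j))) = pt (\<Sum>j<n. q j * g j)"
  unfolding d_def d1_eq_dK dK_pt_sum by (simp add: d2_def con_con_pt_sum W_additive)

lemma d_degree_1: "c \<in> graded_chains C n (Suc 0) \<Longrightarrow> d c = pt (\<Sum>i<n. coef c {i} * g i)"
proof -
  assume c: "c \<in> graded_chains C n (Suc 0)"
  have "coef (\<Sum>j<n. ext j (pt (coef c {j}))) I = coef c I" for I
  proof -
    have "coef (ext j (pt (coef c {j}))) I = (if I = {j} then coef c I else 0)" for j
    proof (cases "I = {j}")
      case True
      have "even_below j {j}" using even_below_insert[of j j "{}"] by (simp add: even_below_def)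
      then show ?thesis unfolding True by (simp add: ext_def pt_def)
    next
      case False
      then have "j \<in> I \<Longrightarrow> I - {j} \<noteq> {}" by blast
      then show ?thesis using False by (simp add: ext_def pt_def)
    qed
    then have eq: "coef (\<Sum>j<n. ext j (pt (coef c {j}))) I = (\<Sum>j<n. if I = {j} then coef c I else 0)"
      by (simp add: coef_sum)
    show ?thesis
    proof (cases "coef c I = 0")
      case False
      then obtain i where "I = {i}" "i < n" using c by (auto simp: graded_chains_def card_1_singleton_iff)
      then show ?thesis using eq by auto
    next
      case True
      show ?thesis unfolding eq True by simp
    qed
  qed
  then have "c = (\<Sum>j<n. ext j (pt (coef c {j})))" by (simp add: chain_eq_iff)
  then show ?thesis using d_pt_sum[of "\<lambda>j. coef c {j}"] by simp
qed

definition exact_at :: "nat \<Rightarrow> bool" where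
  "exact_at r \<longleftrightarrow> (\<forall>z\<in>graded_chains C n r. d z = 0 \<longrightarrow> (\<exists>w\<in>graded_chains C n (Suc r). z = d w))"

end

section \<open>Exactness from a regular sequence of symbols\<close>

text \<open>
  A filtration \<open>G\<close>, shifted so that \<open>G (Suc k)\<close> holds the elements of order \<open>\<le> k\<close> and \<open>G 0 = 0\<close>. The last
  assumption says that multiplication by the symbol of \<open>g\<^sub>m\<close> is injective modulo the symbols of the
  earlier \<open>g\<^sub>j\<close>, written with representatives.
\<close>
locale regular_lie_basis = lie_basis +
  fixes G :: "nat \<Rightarrow> 'a::ring_1 set"
  assumes G_0: "G 0 = {0}" and G_group: "additive_group (G k)" and G_mono: "G k \<subseteq> G (Suc k)"
    and G_C: "G k \<subseteq> C" and C_G: "x \<in> C \<Longrightarrow> \<exists>k. x \<in> G k"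
    and G_B: "\<lbrakk>x \<in> G k; b \<in> B\<rbrakk> \<Longrightarrow> x * b \<in> G k" and G_L: "\<lbrakk>x \<in> G k; y \<in> L\<rbrakk> \<Longrightarrow> x * y \<in> G (Suc k)"
    and regular: "\<lbrakk>m < n; y \<in> G (Suc k); \<And>j. j < m \<Longrightarrow> q j \<in> G (Suc k);
        y * g m + (\<Sum>j<m. q j * g j) \<in> G (Suc k)\<rbrakk> \<Longrightarrow>
      \<exists>q' t. (\<forall>j<m. q' j \<in> G k) \<and> t \<in> G k \<and> y = t + (\<Sum>j<m. q' j * g j)"
begin

text \<open>
  Exactness of the Koszul complex of the symbols, stated with representatives of symbols: a chain of
  order \<open>k\<close> whose image drops in order is a boundary up to lower order. As usual the induction splits
  \<open>z = u + e\<^sub>m \<and> v\<close>: first \<open>v\<close> is a cycle in fewer variables (in degree \<open>0\<close>, where it need not bound,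
  regularity replaces this), and after correcting \<open>z\<close> by \<open>e\<^sub>m \<and> w\<close> the rest involves fewer variables too.
  Commutators of the \<open>g\<^sub>i\<close> lie in \<open>L\<close> and only produce terms of lower order.
\<close>
lemma koszul_exact:
  assumes "m \<le> n" "z \<in> graded_chains (G (Suc k)) m (Suc r)" "dK m z \<in> graded_chains (G (Suc k)) m r"
  shows "\<exists>w\<in>graded_chains (G k) m (Suc (Suc r)). z - dK m w \<in> graded_chains (G k) m (Suc r)"
  using assms
proof (induction m arbitrary: r z)
  case 0
  then have "z = 0" by (auto simp: chain_eq_iff graded_chains_def)
  then show ?case
    using additive_groupD(1)[OF chains_group[OF G_group]] by (auto intro!: bexI[of _ 0] simp: dK_additive)
next
  case (Suc m)
  have m: "m \<le> n" "m < n" using Suc.prems(1) by auto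
  note grp = G_group chains_group[OF G_group]
  \<comment> \<open>Split \<open>z\<close> into the part \<open>u\<close> without the last basis vector and \<open>e\<^sub>m \<and> v\<close>.\<close>
  define v where "v = con m z"
  define u where "u = z - ext m v"
  have v1: "v \<in> graded_chains (G (Suc k)) (Suc m) r" unfolding v_def by (intro chains_con grp Suc.prems)
  have cv: "con m v = 0" by (simp add: v_def)
  have v: "v \<in> graded_chains (G (Suc k)) m r" by (rule chains_restrict[OF v1 cv])
  have u: "u \<in> graded_chains (G (Suc k)) m (Suc r)"
  proof (rule chains_restrict)
    show "u \<in> graded_chains (G (Suc k)) (Suc m) (Suc r)"
      unfolding u_def by (intro additive_groupD(2) grp chains_ext v1 Suc.prems) auto
    show "con m u = 0" by (simp add: u_def con_additive con_ext_same cv ext_additive v_def[symmetric])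
  qed
  have con_dK: "con m (dK m c) = - dK m (con m c)" for c
    by (simp add: dK_def con_sum con_rmult con_con[of m] sum_negf rmult_additive)
  have dK_ext: "dK m (ext m c) = - ext m (dK m c)" for c
    by (simp add: dK_def ext_sum con_rmult con_ext sum_negf rmult_additive ext_rmult)
  have dv: "dK m v = - con m (dK (Suc m) z)"
    by (simp add: dK_Suc con_additive con_dK con_rmult v_def rmult_additive)
  have z: "z = u + ext m v" by (simp add: u_def)
  have dz: "dK (Suc m) z = dK m u - ext m (dK m v) + rmult (g m) v"
    by (simp add: dK_Suc v_def[symmetric]) (simp add: z dK_additive dK_ext)
  have "\<exists>w\<in>graded_chains (G k) m (Suc r). v - dK m w \<in> graded_chains (G k) m r"
  proof (cases r)
    case (Suc r')
    have "con m (dK (Suc m) z) \<in> graded_chains (G (Suc k)) m r'"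
      by (rule chains_restrict) (use Suc.prems(3) grp in \<open>auto simp: Suc intro!: chains_con\<close>)
    then have "dK m v \<in> graded_chains (G (Suc k)) m r'" unfolding dv by (intro additive_groupD(3) grp)
    then show ?thesis using Suc.IH[OF m(1), of v r'] v Suc by simp
  next
    case 0
    define y where "y = coef v {}"
    have v_pt: "v = pt y" using chains_0_eq_pt[of v] v 0 by (simp add: y_def)
    have "dK m v = 0" by (simp add: v_pt dK_def rmult_pt)
    then have "dK (Suc m) z = dK m u + rmult (g m) v" using dz by (simp add: ext_additive)
    moreover have "coef (dK m u) {} = (\<Sum>j<m. coef u {j} * g j)"
      by (simp add: dK_def coef_sum con_def rmult_def even_below_def)
    ultimately have "y * g m + (\<Sum>j<m. coef u {j} * g j) = coef (dK (Suc m) z) {}"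
      by (simp add: y_def rmult_def)
    then have "y * g m + (\<Sum>j<m. coef u {j} * g j) \<in> G (Suc k)"
      using chains_values[OF Suc.prems(3)] by simp
    then obtain q' t where q': "\<forall>j<m. q' j \<in> G k" "t \<in> G k" "y = t + (\<Sum>j<m. q' j * g j)"
      using regular[OF m(2), of y k "\<lambda>j. coef u {j}"] chains_values[OF u] chains_values[OF v]
      by (auto simp: y_def)
    define q where "q j = (if j < m then q' j else 0)" for j
    define w where "w = (\<Sum>j<m. ext j (pt (q j)))"
    have "w \<in> graded_chains (G k) m (Suc 0)"
      unfolding w_def by (rule chains_pt_sum[OF G_group]) (use q' in \<open>auto simp: q_def\<close>)
    moreover have "dK m w = pt (\<Sum>j<m. q' j * g j)"
    proof -
      have *: "con i (ext j (pt p)) = (if i = j then pt p else 0)" for i j and p :: 'a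
        by (cases "i = j") (auto simp: con_ext con_ext_same ext_additive)
      have "dK m w = (\<Sum>i<m. \<Sum>j<m. if i = j then pt (q' j * g j) else 0)"
        unfolding dK_def w_def
        by (intro sum.cong refl) (auto simp: con_sum rmult_sum ext_rmult[symmetric] rmult_pt * q_def intro!: sum.cong)
      also have "\<dots> = (\<Sum>j<m. pt (q' j * g j))" by simp
      also have "\<dots> = pt (\<Sum>j<m. q' j * g j)"
        by (rule sum_additive[of pt, symmetric]) (simp_all add: pt_additive)
      finally show ?thesis .
    qed
    moreover have "pt t \<in> graded_chains (G k) m 0" by (intro chains_pt additive_groupD(1)[OF G_group] q')
    ultimately show ?thesis using 0 by (auto intro!: bexI[of _ w] simp: v_pt q'(3) pt_additive)
  qed
  then obtain w where w: "w \<in> graded_chains (G k) m (Suc r)" and vw: "v - dK m w \<in> graded_chains (G k) m r" by blast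
  have cw: "con m w = 0" using con_chains_zero[OF w] by simp
  define u' where "u' = u + rmult (g m) w"
  have u': "u' \<in> graded_chains (G (Suc k)) m (Suc r)"
    unfolding u'_def by (intro additive_groupD(4) grp u chains_rmult[OF w] G_L g_L m)
  have "dK m u' \<in> graded_chains (G (Suc k)) m r"
  proof (rule chains_change_values)
    show "dK m u' \<in> graded_chains (G (Suc (Suc k))) m r"
      by (rule chains_dK[OF G_group _ u']) (use G_L g_L m in auto)
    fix I
    have "dK m u' = dK (Suc m) z + ext m (dK m v) - rmult (g m) (v - dK m w) +
        (\<Sum>i<m. con i (rmult (g m * g i - g i * g m) w))"
      by (simp add: dz u'_def dK_additive rmult_additive con_additive)
         (simp add: dK_def con_rmult rmult_sum rmult_rmult sum_subtractf)
    also have "coef \<dots> I = coef (dK (Suc m) z) I + coef (ext m (dK m v)) I - coef (rmult (g m) (v - dK m w)) I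
        + (\<Sum>i<m. coef (con i (rmult (g m * g i - g i * g m) w)) I)"
      by (simp add: coef_sum)
    also have "\<dots> \<in> G (Suc k)"
    proof (intro additive_groupD(2) additive_groupD(4) G_group additive_group_sum)
      show "coef (dK (Suc m) z) I \<in> G (Suc k)" by (rule chains_values[OF Suc.prems(3)])
      have "coef (con m (dK (Suc m) z)) J \<in> G (Suc k)" for J
        using chains_values[OF Suc.prems(3)] by (auto simp: con_def intro: additive_groupD[OF G_group])
      then show "coef (ext m (dK m v)) I \<in> G (Suc k)"
        unfolding dv by (auto simp: ext_def intro: additive_groupD[OF G_group])
      show "coef (rmult (g m) (v - dK m w)) I \<in> G (Suc k)"
        using chains_values[OF vw, of I] m by (simp only: rmult_def coef_Chain) (intro G_L g_L)
      fix i assume "i \<in> {..<m}"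
      then have "g m * g i - g i * g m \<in> L" using m by (intro L_bracket g_L) auto
      then have "coef w J * (g m * g i - g i * g m) \<in> G (Suc k)" for J
        by (intro G_L chains_values[OF w])
      then show "coef (con i (rmult (g m * g i - g i * g m) w)) I \<in> G (Suc k)"
        by (auto simp: con_def rmult_def intro: additive_groupD[OF G_group])
    qed
    finally show "coef (dK m u') I \<in> G (Suc k)" .
  qed
  then obtain w' where w': "w' \<in> graded_chains (G k) m (Suc (Suc r))" "u' - dK m w' \<in> graded_chains (G k) m (Suc r)"
    using Suc.IH[OF m(1) u'] by blast
  have cw': "con m w' = 0" using con_chains_zero[OF w'(1)] by simp
  note up = subsetD[OF chains_mono[of m "Suc m"]]
  show ?case
  proof (rule bexI[of _ "w' - ext m w"])
    show "w' - ext m w \<in> graded_chains (G k) (Suc m) (Suc (Suc r))"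
      by (intro additive_groupD(2) grp chains_ext up w' w) auto
    have "z - dK (Suc m) (w' - ext m w) = (u' - dK m w') + ext m (v - dK m w)"
      by (simp add: dK_Suc dK_additive con_additive cw cw' con_ext_same dK_ext ext_additive rmult_additive z u'_def)
    moreover have "\<dots> \<in> graded_chains (G k) (Suc m) (Suc r)"
      by (intro additive_groupD(4) grp chains_ext up w' vw) auto
    ultimately show "z - dK (Suc m) (w' - ext m w) \<in> graded_chains (G k) (Suc m) (Suc r)" by simp
  qed
qed

text \<open>
  The bracket terms preserve the order of coefficients while the Koszul part raises it by one, so the
  order of a cycle can be lowered by boundaries until the cycle vanishes.
\<close>
lemma exact: "exact_at (Suc r)"
proof -
  have *: "\<exists>w\<in>graded_chains C n (Suc (Suc r)). z = d w" if "z \<in> graded_chains (G k) n (Suc r)" "d z = 0" for z k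
    using that
  proof (induction k arbitrary: z)
    case 0
    then have "z = 0" by (simp add: chain_eq_iff graded_chains_def G_0)
    then show ?case
      using additive_groupD(1)[OF chains_group[OF C_group]] by (auto intro!: bexI[of _ 0] simp: d_additive)
  next
    case (Suc k)
    have "dK n z = d2 z" using Suc.prems(2) by (simp add: d_def d1_eq_dK)
    then have "dK n z \<in> graded_chains (G (Suc k)) n r"
      using chains_d2[OF G_group G_B Suc.prems(1)] by simp
    then obtain w where w: "w \<in> graded_chains (G k) n (Suc (Suc r))" "z - dK n w \<in> graded_chains (G k) n (Suc r)"
      using koszul_exact[OF order.refl Suc.prems(1)] by blast
    have wC: "w \<in> graded_chains C n (Suc (Suc r))" by (rule chains_values_mono[OF G_C w(1)])
    have "z - d w = (z - dK n w) + d2 w" by (simp add: d_def d1_eq_dK)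
    moreover have "(z - dK n w) + d2 w \<in> graded_chains (G k) n (Suc r)"
      by (intro additive_groupD(4) chains_group G_group w(2) chains_d2 G_B w(1))
    ultimately have "z - d w \<in> graded_chains (G k) n (Suc r)" by (simp only:)
    moreover have "d (z - d w) = 0" using Suc.prems(2) d_d[OF wC] by (simp add: d_additive)
    ultimately obtain w' where "w' \<in> graded_chains C n (Suc (Suc r))" "z - d w = d w'" using Suc.IH by blast
    then show ?case
      using additive_groupD(4)[OF chains_group[OF C_group] _ wC, of w']
      by (auto intro!: bexI[of _ "w' + w"] simp: d_additive algebra_simps)
  qed
  show ?thesis unfolding exact_at_def
  proof (intro ballI impI)
    fix z assume z: "z \<in> graded_chains C n (Suc r)" "d z = 0"
    have mono: "G i \<subseteq> G k" if "i \<le> k" for i k by (rule lift_Suc_mono_le[of G, OF G_mono that])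
    have "\<exists>k. \<forall>I\<in>\<I>. coef z I \<in> G k" if "finite \<I>" for \<I>
      using that
    proof (induction \<I>)
      case (insert I \<I>)
      then obtain k where k: "\<forall>I\<in>\<I>. coef z I \<in> G k" by blast
      obtain k' where k': "coef z I \<in> G k'" using C_G chains_values[OF z(1)] by blast
      have "\<forall>J\<in>insert I \<I>. coef z J \<in> G (max k k')"
        using k k' mono[of k "max k k'"] mono[of k' "max k k'"] by auto
      then show ?case by blast
    qed auto
    then obtain k where k: "\<forall>I\<in>Pow {..<n}. coef z I \<in> G k" by (metis finite_Pow_iff finite_lessThan)
    have "coef z I \<in> G k" for I
      using k z(1) additive_groupD(1)[OF G_group] by (cases "coef z I = 0") (auto simp: graded_chains_def)
    then have "z \<in> graded_chains (G k) n (Suc r)" by (rule chains_change_values[OF z(1)])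
    then show "\<exists>w\<in>graded_chains C n (Suc (Suc r)). z = d w" using * z(2) by blast
  qed
qed

end

section \<open>Specialization at s = 0\<close>

definition cmap :: "('r \<Rightarrow> 's) \<Rightarrow> 'r chain \<Rightarrow> 's chain" where
  "cmap h c = Chain (\<lambda>I. h (coef c I))"

lemma coef_cmap [simp]: "coef (cmap h c) I = h (coef c I)"
  by (simp add: cmap_def)

lemma chains_cmap:
  assumes "c \<in> graded_chains S m r" "\<And>x. x \<in> S \<Longrightarrow> h x \<in> S'" "h 0 = 0"
  shows "cmap h c \<in> graded_chains S' m r"
  unfolding graded_chains_def
proof (intro CollectI allI conjI impI)
  fix I show "coef (cmap h c) I \<in> S'" using assms by (simp add: graded_chains_def)
  assume "coef (cmap h c) I \<noteq> 0"
  then have "coef c I \<noteq> 0" using assms(3) by auto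
  then show "I \<subseteq> {..<m}" "card I = r" using assms(1) by (auto simp: graded_chains_def)
qed

locale additive_map =
  fixes h :: "'r::ring_1 \<Rightarrow> 's::ring_1"
  assumes minus: "h (x - y) = h x - h y"
begin

lemma zero: "h 0 = 0" using minus[of 0 0] by simp
lemma uminus: "h (- x) = - h x" using minus[of 0 x] zero by simp
lemma plus: "h (x + y) = h x + h y" using minus[of x "- y"] uminus by simp
lemma sum: "h (\<Sum>a\<in>A. t a) = (\<Sum>a\<in>A. h (t a))"
  by (rule sum_additive[of h]) (simp_all add: plus zero)

lemma cmap_ext: "cmap h (ext i c) = ext i (cmap h c)" and cmap_con: "cmap h (con i c) = con i (cmap h c)"
  and cmap_minus: "cmap h (c - c') = cmap h c - cmap h c'" and cmap_sum: "cmap h (\<Sum>a\<in>A. t' a) = (\<Sum>a\<in>A. cmap h (t' a))"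
  and cmap_pt: "cmap h (pt P) = pt (h P)"
proof -
  have P: "h (pm b x) = pm b (h x)" for b x by (simp add: pm_def uminus)
  show "cmap h (ext i c) = ext i (cmap h c)" "cmap h (con i c) = con i (cmap h c)"
    "cmap h (c - c') = cmap h c - cmap h c'" "cmap h (pt P) = pt (h P)"
    by (auto simp: chain_eq_iff ext_def con_def P zero minus pt_def)
  show "cmap h (\<Sum>a\<in>A. t' a) = (\<Sum>a\<in>A. cmap h (t' a))"
    by (auto simp: chain_eq_iff coef_sum sum)
qed

end

text \<open>
  The situation of \<open>D[s]\<close> and \<open>D\<close>: \<open>\<pi>\<close> is the evaluation at \<open>s = 0\<close>, \<open>\<kappa>\<close> the inclusion of constants, used
  only to lift elements, and \<open>\<sigma>\<close> the multiplication by \<open>s\<close>, which spans the kernel of \<open>\<pi>\<close>.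
\<close>
locale specialization =
  D: lie_basis e C B L n g co + S: lie_basis e' C' B' L' n g' co'
  for e :: "'r::ring_1" and C B L n g co and e' :: "'s::ring_1" and C' B' L' g' co' +
  fixes \<pi> :: "'s \<Rightarrow> 'r" and \<kappa> :: "'r \<Rightarrow> 's" and \<sigma> :: "'s \<Rightarrow> 's"
  assumes \<pi>_minus: "\<pi> (x - y) = \<pi> x - \<pi> y" and \<pi>_times: "\<pi> (x * y) = \<pi> x * \<pi> y"
    and \<pi>_C: "x \<in> C' \<Longrightarrow> \<pi> x \<in> C" and \<pi>_B: "x \<in> B' \<Longrightarrow> \<pi> x \<in> B" and \<pi>_g: "i < n \<Longrightarrow> \<pi> (g' i) = g i"
    and \<kappa>_C: "p \<in> C \<Longrightarrow> \<kappa> p \<in> C'" and \<pi>_\<kappa>: "p \<in> C \<Longrightarrow> \<pi> (\<kappa> p) = p" and \<kappa>_0: "\<kappa> 0 = 0"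
    and \<sigma>_minus: "\<sigma> (x - y) = \<sigma> x - \<sigma> y" and \<sigma>_times: "\<sigma> (x * y) = \<sigma> x * y"
    and \<sigma>_C: "x \<in> C' \<Longrightarrow> \<sigma> x \<in> C'" and \<sigma>_inj: "\<sigma> x = 0 \<Longrightarrow> x = 0"
    and \<pi>_\<sigma>: "\<pi> (\<sigma> x) = 0" and \<pi>_kernel: "x \<in> C' \<Longrightarrow> \<pi> x = 0 \<Longrightarrow> \<exists>y\<in>C'. x = \<sigma> y"
begin

sublocale \<pi>: additive_map \<pi> by unfold_locales (rule \<pi>_minus)
sublocale \<sigma>: additive_map \<sigma> by unfold_locales (rule \<sigma>_minus)

lemma \<pi>_L: "x \<in> L' \<Longrightarrow> \<pi> x = (\<Sum>i<n. \<pi> (co' x i) * g i)"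
proof -
  assume x: "x \<in> L'"
  have "\<pi> (\<Sum>i<n. co' x i * g' i) = (\<Sum>i<n. \<pi> (co' x i) * g i)"
    unfolding \<pi>.sum by (rule sum.cong) (auto simp: \<pi>_times \<pi>_g)
  then show ?thesis using S.co_expand[OF x] by simp
qed

lemma co_\<pi>: "x \<in> L' \<Longrightarrow> i < n \<Longrightarrow> co (\<pi> x) i = \<pi> (co' x i)"
  by (subst \<pi>_L) (auto intro!: D.co_unique \<pi>_B S.co_B)

lemma cmap_\<pi>_rmult: "cmap \<pi> (rmult x c) = rmult (\<pi> x) (cmap \<pi> c)"
  by (simp add: chain_eq_iff rmult_def \<pi>_times)

lemma cmap_\<pi>_W: "x \<in> L' \<Longrightarrow> cmap \<pi> (S.W x c) = D.W (\<pi> x) (cmap \<pi> c)"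
  unfolding S.W_def D.W_def by (simp add: \<pi>.cmap_sum \<pi>.cmap_ext cmap_\<pi>_rmult co_\<pi>)

lemma cmap_\<pi>_d: "cmap \<pi> (S.d c) = D.d (cmap \<pi> c)"
proof -
  have "cmap \<pi> (S.W (g' i * g' j - g' j * g' i) c') = D.W (g i * g j - g j * g i) (cmap \<pi> c')"
    if "i < j" "j < n" for i j c'
    using that by (simp add: cmap_\<pi>_W S.L_bracket S.g_L \<pi>_minus \<pi>_times \<pi>_g)
  then have "cmap \<pi> (S.d2 c) = D.d2 (cmap \<pi> c)"
    unfolding S.d2_def D.d2_def by (simp add: \<pi>.cmap_sum \<pi>.cmap_con)
  moreover have "cmap \<pi> (S.d1 c) = D.d1 (cmap \<pi> c)"
    unfolding S.d1_def D.d1_def by (simp add: \<pi>.cmap_sum \<pi>.cmap_con cmap_\<pi>_rmult \<pi>_g)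
  ultimately show ?thesis by (simp add: S.d_def D.d_def \<pi>.cmap_minus)
qed

lemma cmap_\<sigma>_d: "cmap \<sigma> (S.d c) = S.d (cmap \<sigma> c)"
proof -
  have R: "cmap \<sigma> (rmult x c) = rmult x (cmap \<sigma> c)" for x c
    by (simp add: chain_eq_iff rmult_def \<sigma>_times)
  show ?thesis
    by (simp add: S.d_def S.d1_def S.d2_def S.W_def \<sigma>.cmap_minus \<sigma>.cmap_sum \<sigma>.cmap_con \<sigma>.cmap_ext R)
qed

lemma cmap_\<sigma>_eq_0: "cmap \<sigma> c = 0 \<Longrightarrow> c = 0"
  by (auto simp: chain_eq_iff intro: \<sigma>_inj)

lemma divide_\<sigma>:
  assumes "c \<in> graded_chains C' n r" "cmap \<pi> c = 0"
  shows "\<exists>y\<in>graded_chains C' n r. c = cmap \<sigma> y"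
proof -
  have "\<forall>I. \<exists>y. y \<in> C' \<and> coef c I = \<sigma> y"
    using assms \<pi>_kernel by (simp add: chain_eq_iff graded_chains_def) blast
  then obtain y where y: "\<And>I. y I \<in> C'" "\<And>I. coef c I = \<sigma> (y I)" by metis
  have "Chain y \<in> graded_chains C' n r"
    using assms(1) y by (auto simp: graded_chains_def intro: \<sigma>_inj)
  then show ?thesis using y by (intro bexI[of _ "Chain y"]) (auto simp: chain_eq_iff)
qed

definition left_ideal :: "'s set" where
  "left_ideal = {(\<Sum>i<n. q i * g' i) | q. \<forall>i<n. q i \<in> C'}"

lemma left_ideal_iff: "Y \<in> left_ideal \<longleftrightarrow> (\<exists>w\<in>graded_chains C' n (Suc 0). S.d w = pt Y)"
proof
  assume "Y \<in> left_ideal"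
  then obtain q where q: "\<forall>i<n. q i \<in> C'" "Y = (\<Sum>i<n. q i * g' i)" by (auto simp: left_ideal_def)
  then show "\<exists>w\<in>graded_chains C' n (Suc 0). S.d w = pt Y"
    by (intro bexI[of _ "\<Sum>j<n. ext j (pt (q j))"] S.chains_pt_sum S.C_group) (auto simp: S.d_pt_sum)
next
  assume "\<exists>w\<in>graded_chains C' n (Suc 0). S.d w = pt Y"
  then obtain w where w: "w \<in> graded_chains C' n (Suc 0)" "S.d w = pt Y" by blast
  then have "coef (pt (\<Sum>i<n. coef w {i} * g' i)) {} = coef (pt Y) {}" using S.d_degree_1 by metis
  then show "Y \<in> left_ideal" using chains_values[OF w(1)] by (auto simp: left_ideal_def pt_def)
qed

definition torsion_free :: bool where
  "torsion_free \<longleftrightarrow> (\<forall>Y\<in>C'. \<sigma> Y \<in> left_ideal \<longrightarrow> Y \<in> left_ideal)"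

text \<open>
  If \<open>s Y\<close> is the boundary of \<open>w\<close>, then the image of \<open>w\<close> at \<open>s = 0\<close> is a cycle, hence a boundary; changing
  \<open>w\<close> by the boundary of a lift makes it divisible by \<open>s\<close>, and the quotient bounds \<open>Y\<close>. This direction
  holds for every equation of the divisor.
\<close>
lemma exact_imp_torsion_free:
  assumes "D.exact_at 1" shows torsion_free
  unfolding torsion_free_def
proof (intro ballI impI)
  fix Y assume Y: "Y \<in> C'" "\<sigma> Y \<in> left_ideal"
  then obtain w where w: "w \<in> graded_chains C' n (Suc 0)" "S.d w = pt (\<sigma> Y)" by (auto simp: left_ideal_iff)
  have "D.d (cmap \<pi> w) = 0"
    by (simp add: cmap_\<pi>_d[symmetric] w \<pi>.cmap_pt \<pi>_\<sigma> pt_additive)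
  moreover have "cmap \<pi> w \<in> graded_chains C n 1" using w by (auto intro!: chains_cmap[of w C'] \<pi>_C \<pi>.zero)
  ultimately obtain v where v: "v \<in> graded_chains C n (Suc 1)" "cmap \<pi> w = D.d v"
    using assms by (auto simp: D.exact_at_def)
  define v' where "v' = cmap \<kappa> v"
  have v': "v' \<in> graded_chains C' n (Suc 1)" unfolding v'_def by (rule chains_cmap[OF v(1), of \<kappa>]) (simp_all add: \<kappa>_C \<kappa>_0)
  have "cmap \<pi> v' = v" using chains_values[OF v(1)] by (simp add: v'_def chain_eq_iff \<pi>_\<kappa>)
  then have "cmap \<pi> (w - S.d v') = 0" using v(2) by (simp add: \<pi>.cmap_minus cmap_\<pi>_d)
  moreover have "w - S.d v' \<in> graded_chains C' n (Suc 0)"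
    using v' w(1) by (intro additive_groupD(2)[OF chains_group[OF S.C_group]] S.chains_d) auto
  ultimately obtain y where y: "y \<in> graded_chains C' n (Suc 0)" "w - S.d v' = cmap \<sigma> y" using divide_\<sigma> by blast
  have "S.d w = S.d (w - S.d v')" using S.d_d[OF v'] by (simp add: S.d_additive)
  also have "\<dots> = cmap \<sigma> (S.d y)" by (simp add: y cmap_\<sigma>_d)
  finally have "cmap \<sigma> (S.d y - pt Y) = 0" using w(2) by (simp add: \<sigma>.cmap_minus \<sigma>.cmap_pt)
  then have "S.d y = pt Y" using cmap_\<sigma>_eq_0 by fastforce
  then show "Y \<in> left_ideal" using y(1) by (auto simp: left_ideal_iff)
qed

text \<open>
  The diagram chase of the long exact sequence: the obstruction to lifting a cycle of \<open>D\<close> to a cycle over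
  \<open>D[s]\<close> is an element killed by \<open>s\<close> in homology one degree lower.
\<close>
lemma exact_lift:
  assumes S: "S.exact_at (Suc r)"
    and lift: "\<And>y. y \<in> graded_chains C' n r \<Longrightarrow> S.d y = 0 \<Longrightarrow> \<exists>w\<in>graded_chains C' n (Suc r). S.d w = cmap \<sigma> y \<Longrightarrow>
      \<exists>w\<in>graded_chains C' n (Suc r). S.d w = y"
  shows "D.exact_at (Suc r)"
  unfolding D.exact_at_def
proof (intro ballI impI)
  fix z assume z: "z \<in> graded_chains C n (Suc r)" "D.d z = 0"
  note grp = chains_group[OF S.C_group]
  define z' where "z' = cmap \<kappa> z"
  have z': "z' \<in> graded_chains C' n (Suc r)" unfolding z'_def by (rule chains_cmap[OF z(1), of \<kappa>]) (simp_all add: \<kappa>_C \<kappa>_0)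
  have \<pi>z': "cmap \<pi> z' = z" using chains_values[OF z(1)] by (simp add: z'_def chain_eq_iff \<pi>_\<kappa>)
  then have "cmap \<pi> (S.d z') = 0" using z(2) by (simp add: cmap_\<pi>_d)
  then obtain y where y: "y \<in> graded_chains C' n r" "S.d z' = cmap \<sigma> y" using divide_\<sigma>[OF S.chains_d[OF z']] by blast
  have "cmap \<sigma> (S.d y) = S.d (S.d z')" by (simp add: cmap_\<sigma>_d y)
  then have "S.d y = 0" using S.d_d[OF z'] cmap_\<sigma>_eq_0 by simp
  then obtain w where w: "w \<in> graded_chains C' n (Suc r)" "S.d w = y" using lift y z' by blast
  have \<sigma>w: "cmap \<sigma> w \<in> graded_chains C' n (Suc r)" by (rule chains_cmap[OF w(1), of \<sigma>]) (simp_all add: \<sigma>_C \<sigma>.zero)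
  have "S.d (z' - cmap \<sigma> w) = 0" by (simp add: S.d_additive y w cmap_\<sigma>_d[symmetric])
  then obtain v where v: "v \<in> graded_chains C' n (Suc (Suc r))" "z' - cmap \<sigma> w = S.d v"
    using S additive_groupD(2)[OF grp z' \<sigma>w] by (auto simp: S.exact_at_def)
  have "cmap \<pi> (cmap \<sigma> w) = 0" by (simp add: chain_eq_iff \<pi>_\<sigma>)
  then have "z = cmap \<pi> (z' - cmap \<sigma> w)" by (simp add: \<pi>.cmap_minus \<pi>z')
  then have "z = D.d (cmap \<pi> v)" by (simp add: v cmap_\<pi>_d)
  then show "\<exists>w\<in>graded_chains C n (Suc (Suc r)). z = D.d w"
    using chains_cmap[OF v(1), of \<pi> C] \<pi>_C \<pi>.zero by blast
qed

lemma torsion_free_imp_exact: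
  assumes "S.exact_at 1" torsion_free shows "D.exact_at 1"
proof -
  have "D.exact_at (Suc 0)"
  proof (rule exact_lift)
    fix y assume y: "y \<in> graded_chains C' n 0" "\<exists>w\<in>graded_chains C' n (Suc 0). S.d w = cmap \<sigma> y"
    have "y = pt (coef y {})" by (rule chains_0_eq_pt[OF y(1)])
    moreover from this have "cmap \<sigma> y = pt (\<sigma> (coef y {}))" using \<sigma>.cmap_pt by metis
    then have "\<sigma> (coef y {}) \<in> left_ideal" using y(2) by (simp add: left_ideal_iff)
    then have "coef y {} \<in> left_ideal"
      using assms(2) chains_values[OF y(1)] by (simp add: torsion_free_def)
    ultimately show "\<exists>w\<in>graded_chains C' n (Suc 0). S.d w = y" by (simp add: left_ideal_iff)
  qed (use assms(1) in simp)
  then show ?thesis by simp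
qed

lemma exact_higher:
  assumes "S.exact_at (Suc r)" "S.exact_at (Suc (Suc r))" shows "D.exact_at (Suc (Suc r))"
  by (rule exact_lift[OF assms(2)]) (use assms(1) in \<open>auto simp: S.exact_at_def\<close>)

end

section \<open>The Spencer complex as a quotient of a free group\<close>

definition zscale :: "int \<Rightarrow> 'r chain \<Rightarrow> 'r::ring_1 chain" where
  "zscale k c = Chain (\<lambda>I. of_int k * coef c I)"

locale presented_lie_basis =
  ring_embedding R j + lie_basis e "j ` carrier R" "j ` B0" "j ` L0" n g co
  for R :: "('d, 'x) ring_scheme" (structure) and j :: "'d \<Rightarrow> 'r::ring_1" and e B0 L0 n g co +
  assumes B0: "B0 \<subseteq> carrier R" and L0: "L0 \<subseteq> carrier R"
begin

lemma C_B_times: "y \<in> j ` carrier R \<Longrightarrow> b \<in> j ` B0 \<Longrightarrow> y * b \<in> j ` carrier R"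
  by (rule C_times) (use B_C in auto)

lemma carrier_L0: "x \<in> L0 \<Longrightarrow> x \<in> carrier R" and carrier_B0: "b \<in> B0 \<Longrightarrow> b \<in> carrier R"
  using L0 B0 by auto

lemma L0_mem: "x \<in> carrier R \<Longrightarrow> j x \<in> j ` L0 \<Longrightarrow> x \<in> L0"
  using eq_iff carrier_L0 by auto

lemma L0_add: "x \<in> L0 \<Longrightarrow> y \<in> L0 \<Longrightarrow> x \<oplus> y \<in> L0"
  using L_plus[of "j x" "j y"] by (intro L0_mem) (auto simp: carrier_L0 add)

lemma L0_scale: "b \<in> B0 \<Longrightarrow> x \<in> L0 \<Longrightarrow> b \<otimes> x \<in> L0"
  using L_scale[of "j b" "j x"] by (intro L0_mem) (auto simp: carrier_L0 carrier_B0 mult)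

lemma L0_bracket: "x \<in> L0 \<Longrightarrow> y \<in> L0 \<Longrightarrow> x \<otimes> y \<ominus> y \<otimes> x \<in> L0"
  using L_bracket[of "j x" "j y"] by (intro L0_mem) (auto simp: carrier_L0 mult minus)

definition val :: "'d \<times> 'd list \<Rightarrow> 'r chain" where
  "val k = Phi (j (fst k)) (map j (snd k))"

text \<open>
  The comparison map from the free abelian group on symbols \<open>(P, [\<lambda>\<^sub>1, \<dots>, \<lambda>\<^sub>r])\<close> to chains. The main point
  of this section is \<open>null_iff\<close>: its kernel is generated by the defining relations.
\<close>
definition evaluate :: "('d \<times> 'd list \<Rightarrow>\<^sub>0 int) \<Rightarrow> 'r chain" where
  "evaluate x = (\<Sum>k\<in>Poly_Mapping.keys x. zscale (Poly_Mapping.lookup x k) (val k))"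

lemma zscale_diff: "zscale (a - b) c = zscale a c - zscale b c" and zscale_0: "zscale 0 c = 0"
  and zscale_1: "zscale 1 c = c"
  by (auto simp: zscale_def chain_eq_iff algebra_simps)

lemma evaluate_superset:
  "finite A \<Longrightarrow> Poly_Mapping.keys x \<subseteq> A \<Longrightarrow> evaluate x = (\<Sum>k\<in>A. zscale (Poly_Mapping.lookup x k) (val k))"
  unfolding evaluate_def by (rule sum.mono_neutral_left) (auto simp: in_keys_iff zscale_0)

lemma evaluate_diff: "evaluate (x - y) = evaluate x - evaluate y"
proof -
  let ?A = "Poly_Mapping.keys x \<union> Poly_Mapping.keys y"
  have "evaluate (x - y) = (\<Sum>k\<in>?A. zscale (Poly_Mapping.lookup (x - y) k) (val k))"
    by (rule evaluate_superset) (auto simp: keys_diff)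
  also have "\<dots> = evaluate x - evaluate y"
    by (simp add: lookup_minus zscale_diff sum_subtractf evaluate_superset[of ?A x] evaluate_superset[of ?A y])
  finally show ?thesis .
qed

lemma evaluate_0 [simp]: "evaluate 0 = 0"
  by (simp add: evaluate_def)

lemma evaluate_uminus: "evaluate (- x) = - evaluate x"
  using evaluate_diff[of 0 x] by simp

lemma evaluate_add: "evaluate (x + y) = evaluate x + evaluate y"
  using evaluate_diff[of x "- y"] by (simp add: evaluate_uminus)

lemma evaluate_sum: "evaluate (\<Sum>a\<in>A. t a) = (\<Sum>a\<in>A. evaluate (t a))"
  by (rule sum_additive[of evaluate]) (simp_all add: evaluate_add)

lemma evaluate_frag_of [simp]: "evaluate (frag_of k) = val k"
  by (simp add: evaluate_def zscale_1)

abbreviation gens where "gens r \<equiv> wedge_gens R L0 r"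
abbreviation null where "null r \<equiv> wedge_null R B0 L0 r"
abbreviation Free where "Free r \<equiv> free_Abelian_group (gens r)"

lemma gens_iff: "(P, ls) \<in> gens r \<longleftrightarrow> P \<in> carrier R \<and> length ls = r \<and> set ls \<subseteq> L0"
  by (simp add: wedge_gens_def)

lemma in_Free: "x \<in> carrier (Free r) \<longleftrightarrow> Poly_Mapping.keys x \<subseteq> gens r"
  by (simp add: free_Abelian_group_def)

lemma frag_of_in_Free: "frag_of k \<in> carrier (Free r) \<longleftrightarrow> k \<in> gens r"
  by (simp add: in_Free)

lemma Free_diff: "x \<in> carrier (Free r) \<Longrightarrow> y \<in> carrier (Free r) \<Longrightarrow> x - y \<in> carrier (Free r)"
  using keys_diff[of x y] by (auto simp: in_Free)

lemma Free_add: "x \<in> carrier (Free r) \<Longrightarrow> y \<in> carrier (Free r) \<Longrightarrow> x + y \<in> carrier (Free r)"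
  using keys_add[of x y] by (auto simp: in_Free)

lemma rels_in_Free: "wedge_rels R B0 L0 r \<subseteq> carrier (Free r)"
proof -
  have upd: "set (ls[i := l]) \<subseteq> L0" if "set ls \<subseteq> L0" "l \<in> L0" for ls i l
    using set_update_subset_insert[of ls i l] that by auto
  have nth: "ls ! i \<in> L0" if "set ls \<subseteq> L0" "i < length ls" for ls i using that by auto
  note F = Free_diff frag_of_in_Free[THEN iffD2]
  show ?thesis
  proof
    fix x assume "x \<in> wedge_rels R B0 L0 r"
    then show "x \<in> carrier (Free r)"
      unfolding wedge_rels_def
    proof (elim UnE CollectE exE conjE)
      fix P Q ls assume *: "x = frag_of (P \<oplus> Q, ls) - frag_of (P, ls) - frag_of (Q, ls)" "(P, ls) \<in> gens r" "Q \<in> carrier R"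
      show ?thesis unfolding *(1) by (intro F) (use *(2,3) in \<open>simp_all add: gens_iff\<close>)
    next
      fix P ls i l m
      assume *: "x = frag_of (P, ls[i := l \<oplus> m]) - frag_of (P, ls[i := l]) - frag_of (P, ls[i := m])"
        "(P, ls) \<in> gens r" "i < r" "l \<in> L0" "m \<in> L0"
      show ?thesis unfolding *(1) by (intro F) (use *(2-) in \<open>simp_all add: gens_iff upd L0_add\<close>)
    next
      fix P b ls i assume *: "x = frag_of (P \<otimes> b, ls) - frag_of (P, ls[i := b \<otimes> ls ! i])" "(P, ls) \<in> gens r" "i < r" "b \<in> B0"
      then have "b \<otimes> ls ! i \<in> L0" by (intro L0_scale nth) (simp_all add: gens_iff)
      then show ?thesis unfolding *(1) by (intro F) (use *(2-) in \<open>simp_all add: gens_iff upd carrier_B0\<close>)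
    next
      fix P ls i k assume "x = frag_of (P, ls)" "(P, ls) \<in> gens r"
      then show ?thesis by (simp add: frag_of_in_Free)
    qed
  qed
qed

lemma null_subgroup: "subgroup (null r) (Free r)"
  unfolding wedge_null_def
  by (rule group.generate_is_subgroup) (simp_all add: rels_in_Free)

lemma null_in_Free: "x \<in> null r \<Longrightarrow> x \<in> carrier (Free r)"
  using subgroup.subset[OF null_subgroup] by blast

lemma null_0: "0 \<in> null r"
  using subgroup.one_closed[OF null_subgroup, of r] by simp

lemma null_add: "x \<in> null r \<Longrightarrow> y \<in> null r \<Longrightarrow> x + y \<in> null r"
  using subgroup.m_closed[OF null_subgroup, of x r y] by simp

lemma null_uminus: "x \<in> null r \<Longrightarrow> - x \<in> null r"
  using subgroup.m_inv_closed[OF null_subgroup, of x r] null_in_Free[of x r] by (simp add: in_Free)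

lemma null_group: "additive_group (null r)"
  unfolding additive_group_def using null_0 null_add null_uminus by (metis diff_conv_add_uminus)

lemma null_rel: "x \<in> wedge_rels R B0 L0 r \<Longrightarrow> x \<in> null r"
  unfolding wedge_null_def by (rule generate.incl)

lemma null_induct:
  assumes "x \<in> null r" and rel: "\<And>x. x \<in> wedge_rels R B0 L0 r \<Longrightarrow> Q x" and "Q 0"
    and diff: "\<And>x y. Q x \<Longrightarrow> Q y \<Longrightarrow> Q (x - y)"
  shows "Q x"
  using assms(1) unfolding wedge_null_def
proof (induction rule: generate.induct)
  case (inv h)
  have "h \<in> carrier (Free r)" by (rule subsetD[OF rels_in_Free inv])
  then have "Poly_Mapping.keys h \<subseteq> gens r" by (simp only: in_Free)
  then have "inv\<^bsub>Free r\<^esub> h = 0 - h" by simp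
  then show ?case using diff[OF \<open>Q 0\<close> rel[OF inv]] by simp
next
  case (eng h1 h2)
  then show ?case using diff[of h1 "0 - h2"] diff[OF \<open>Q 0\<close>, of h2] by simp
qed (use assms in auto)

lemma Phi_plus_left: "Phi (P + Q) ls = Phi P ls + Phi Q ls"
  by (induction ls) (simp_all add: pt_additive W_additive)

lemma Phi_update_plus:
  "i < length ls \<Longrightarrow> x \<in> j ` L0 \<Longrightarrow> y \<in> j ` L0 \<Longrightarrow>
    Phi P (ls[i := x + y]) = Phi P (ls[i := x]) + Phi P (ls[i := y])"
  by (induction ls arbitrary: i) (auto simp: W_plus_left W_additive split: nat.split)

lemma Phi_scale_left:
  "b \<in> j ` B0 \<Longrightarrow> set ls \<subseteq> j ` L0 \<Longrightarrow> Phi (P * b) ls = rmult b (Phi P ls)"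
  by (induction ls) (simp_all add: rmult_pt rmult_W W_scale)

lemma Phi_update_scale:
  "i < length ls \<Longrightarrow> b \<in> j ` B0 \<Longrightarrow> set ls \<subseteq> j ` L0 \<Longrightarrow> Phi P (ls[i := b * ls ! i]) = Phi (P * b) ls"
proof (induction ls arbitrary: i)
  case (Cons x ls)
  then show ?case
    by (cases i) (simp_all add: Phi_scale_left rmult_W W_scale)
qed simp

lemma W_Phi_member: "x \<in> set ls \<Longrightarrow> set ls \<subseteq> j ` L0 \<Longrightarrow> W x (Phi P ls) = 0"
proof (induction ls)
  case (Cons y ls)
  show ?case
  proof (cases "x = y")
    case False
    then have "W x (Phi P ls) = 0" using Cons by auto
    moreover have "W x (W y (Phi P ls)) = - W y (W x (Phi P ls))" using Cons.prems by (intro W_W) auto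
    ultimately show ?thesis by (simp add: W_additive)
  qed (use Cons.prems W_W_same in auto)
qed simp

lemma Phi_repeat: "i < k \<Longrightarrow> k < length ls \<Longrightarrow> ls ! i = ls ! k \<Longrightarrow> set ls \<subseteq> j ` L0 \<Longrightarrow> Phi P ls = 0"
proof (induction ls arbitrary: i k)
  case (Cons y ls)
  show ?case
  proof (cases i)
    case 0
    then have "y \<in> set ls" using Cons.prems by (cases k) auto
    then show ?thesis using W_Phi_member[of y ls P] Cons.prems by auto
  next
    case (Suc i')
    then obtain k' where "k = Suc k'" using Cons.prems by (cases k) auto
    then have "Phi P ls = 0" using Cons.IH[of i' k'] Cons.prems Suc by auto
    then show ?thesis by (simp add: W_additive)
  qed
qed simp

lemma evaluate_null: "x \<in> null r \<Longrightarrow> evaluate x = 0"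
proof (erule null_induct)
  have S: "set (map j ls) \<subseteq> j ` L0" if "set ls \<subseteq> L0" for ls using that by auto
  fix x assume "x \<in> wedge_rels R B0 L0 r"
  then show "evaluate x = 0"
    unfolding wedge_rels_def
  proof (elim UnE CollectE exE conjE)
    fix P Q ls assume "x = frag_of (P \<oplus> Q, ls) - frag_of (P, ls) - frag_of (Q, ls)" "(P, ls) \<in> gens r" "Q \<in> carrier R"
    then show ?thesis by (simp add: evaluate_diff val_def add Phi_plus_left gens_iff)
  next
    fix P ls i l m
    assume "x = frag_of (P, ls[i := l \<oplus> m]) - frag_of (P, ls[i := l]) - frag_of (P, ls[i := m])"
      "(P, ls) \<in> gens r" "i < r" "l \<in> L0" "m \<in> L0"
    then show ?thesis
      by (simp add: evaluate_diff val_def add carrier_L0 map_update Phi_update_plus gens_iff)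
  next
    fix P b ls i assume *: "x = frag_of (P \<otimes> b, ls) - frag_of (P, ls[i := b \<otimes> ls ! i])" "(P, ls) \<in> gens r" "i < r" "b \<in> B0"
    then have "set ls \<subseteq> L0" "i < length ls" by (simp_all add: gens_iff)
    then have "ls ! i \<in> carrier R" by (intro carrier_L0 subsetD[OF _ nth_mem])
    then show ?thesis
      using * S Phi_update_scale[of i "map j ls" "j b" "j P"]
      by (simp add: evaluate_diff val_def mult carrier_B0 map_update gens_iff)
  next
    fix P ls i k assume "x = frag_of (P, ls)" "(P, ls) \<in> gens r" "i < k" "k < r" "ls ! i = ls ! k"
    then show ?thesis using Phi_repeat[of i k "map j ls"] S by (simp add: val_def gens_iff)
  qed
qed (simp_all add: evaluate_diff)

text \<open>
  Calculations modulo the relations; they bring every element into the normal form \<open>expansion\<close>.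
\<close>
definition equiv_null :: "nat \<Rightarrow> ('d \<times> 'd list \<Rightarrow>\<^sub>0 int) \<Rightarrow> ('d \<times> 'd list \<Rightarrow>\<^sub>0 int) \<Rightarrow> bool" where
  "equiv_null r x y \<longleftrightarrow> x - y \<in> null r"

lemma equiv_refl: "equiv_null r x x"
  by (simp add: equiv_null_def null_0)

lemma equiv_sym: "equiv_null r x y \<Longrightarrow> equiv_null r y x"
  unfolding equiv_null_def using null_uminus[of "x - y" r] by simp

lemma equiv_trans [trans]: "equiv_null r x y \<Longrightarrow> equiv_null r y z \<Longrightarrow> equiv_null r x z"
  unfolding equiv_null_def using null_add[of "x - y" r "y - z"] by simp

lemma equiv_add: "equiv_null r x y \<Longrightarrow> equiv_null r x' y' \<Longrightarrow> equiv_null r (x + x') (y + y')"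
  unfolding equiv_null_def using null_add[of "x - y" r "x' - y'"] by (simp add: algebra_simps)

lemma equiv_uminus: "equiv_null r x y \<Longrightarrow> equiv_null r (- x) (- y)"
  unfolding equiv_null_def using null_uminus[of "x - y" r] by simp

lemma equiv_diff: "equiv_null r x y \<Longrightarrow> equiv_null r x' y' \<Longrightarrow> equiv_null r (x - x') (y - y')"
  using equiv_add[OF _ equiv_uminus[of r x' y'], of x y] by simp

lemma equiv_sum: "(\<And>a. a \<in> A \<Longrightarrow> equiv_null r (t a) (t' a)) \<Longrightarrow> equiv_null r (\<Sum>a\<in>A. t a) (\<Sum>a\<in>A. t' a)"
  by (induction A rule: infinite_finite_induct) (auto intro: equiv_refl equiv_add)

lemma equiv_plus_left:
  "\<lbrakk>(P, ls) \<in> gens r; Q \<in> carrier R\<rbrakk> \<Longrightarrow> equiv_null r (frag_of (P \<oplus> Q, ls)) (frag_of (P, ls) + frag_of (Q, ls))"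
  unfolding equiv_null_def diff_diff_add[symmetric] by (rule null_rel) (auto simp: wedge_rels_def)

lemma equiv_plus_at:
  assumes "P \<in> carrier R" "length us + length vs + 1 = r" "set us \<subseteq> L0" "set vs \<subseteq> L0" "x \<in> L0" "y \<in> L0"
  shows "equiv_null r (frag_of (P, us @ (x \<oplus> y) # vs)) (frag_of (P, us @ x # vs) + frag_of (P, us @ y # vs))"
proof -
  have "frag_of (P, (us @ x # vs)[length us := x \<oplus> y]) - frag_of (P, (us @ x # vs)[length us := x]) -
      frag_of (P, (us @ x # vs)[length us := y]) \<in> wedge_rels R B0 L0 r"
    unfolding wedge_rels_def
    by (rule UnI1, rule UnI1, rule UnI2, rule CollectI, intro exI conjI, rule refl)
       (use assms in \<open>auto simp: gens_iff\<close>)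
  then show ?thesis unfolding equiv_null_def diff_diff_add[symmetric] by (intro null_rel) simp
qed

lemma equiv_scale:
  assumes "P \<in> carrier R" "length vs + 1 = r" "set vs \<subseteq> L0" "x \<in> L0" "b \<in> B0"
  shows "equiv_null r (frag_of (P, (b \<otimes> x) # vs)) (frag_of (P \<otimes> b, x # vs))"
proof -
  have "frag_of (P \<otimes> b, x # vs) - frag_of (P, (x # vs)[0 := b \<otimes> (x # vs) ! 0]) \<in> wedge_rels R B0 L0 r"
    unfolding wedge_rels_def
    by (rule UnI1, rule UnI2, rule CollectI, intro exI conjI, rule refl)
       (use assms in \<open>auto simp: gens_iff\<close>)
  then have "equiv_null r (frag_of (P \<otimes> b, x # vs)) (frag_of (P, (b \<otimes> x) # vs))"
    by (simp add: equiv_null_def null_rel)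
  then show ?thesis by (rule equiv_sym)
qed

lemma null_repeat:
  "\<lbrakk>(P, ls) \<in> gens r; i < k; k < r; ls ! i = ls ! k\<rbrakk> \<Longrightarrow> frag_of (P, ls) \<in> null r"
  by (rule null_rel) (auto simp: wedge_rels_def)

lemma equiv_0_iff: "equiv_null r x 0 \<longleftrightarrow> x \<in> null r"
  by (simp add: equiv_null_def)

lemma equiv_zero_left:
  assumes "(P, ls) \<in> gens r" shows "equiv_null r (frag_of (\<zero>, ls)) 0"
  using equiv_plus_left[of \<zero> ls r \<zero>] assms null_uminus[of "- frag_of (\<zero>, ls)" r]
  by (simp add: gens_iff equiv_null_def)

lemma equiv_minus_left:
  assumes "(P, ls) \<in> gens r" shows "equiv_null r (frag_of (\<ominus> P, ls)) (- frag_of (P, ls))"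
proof -
  have "equiv_null r (frag_of (P \<oplus> \<ominus> P, ls)) (frag_of (P, ls) + frag_of (\<ominus> P, ls))"
    using assms by (intro equiv_plus_left) (auto simp: gens_iff)
  moreover have "equiv_null r (frag_of (P \<oplus> \<ominus> P, ls)) 0"
    using assms equiv_zero_left[OF assms] by (simp add: R.r_neg gens_iff)
  ultimately have "equiv_null r (frag_of (P, ls) + frag_of (\<ominus> P, ls)) 0" by (metis equiv_sym equiv_trans)
  then show ?thesis by (simp add: equiv_null_def add.commute)
qed

text \<open>
  Antisymmetry from alternation, by polarizing with \<open>x + y\<close> in both places.
\<close>
lemma equiv_swap:
  assumes "P \<in> carrier R" "length us + length vs + 2 = r" "set us \<subseteq> L0" "set vs \<subseteq> L0" "x \<in> L0" "y \<in> L0"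
  shows "equiv_null r (frag_of (P, us @ x # y # vs)) (- frag_of (P, us @ y # x # vs))"
proof -
  let ?f = "\<lambda>x y. frag_of (P, us @ x # y # vs)"
  let ?z = "x \<oplus> y"
  have z: "?z \<in> L0" using assms L0_add by auto
  have rep: "equiv_null r (?f u u) 0" if "u \<in> L0" for u
    unfolding equiv_0_iff
    by (rule null_repeat[of _ _ _ "length us" "Suc (length us)"])
       (use assms that in \<open>auto simp: gens_iff nth_append\<close>)
  have left: "equiv_null r (?f ?z u) (?f x u + ?f y u)" if "u \<in> L0" for u
    using equiv_plus_at[of P us "u # vs" r x y] assms that by simp
  have right: "equiv_null r (?f u ?z) (?f u x + ?f u y)" if "u \<in> L0" for u
    using equiv_plus_at[of P "us @ [u]" vs r x y] assms that by simp
  have "equiv_null r 0 (?f ?z ?z)" using rep[OF z] by (rule equiv_sym)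
  also have "equiv_null r \<dots> (?f x ?z + ?f y ?z)" by (rule left[OF z])
  also have "equiv_null r \<dots> ((?f x x + ?f x y) + (?f y x + ?f y y))"
    by (intro equiv_add right assms)
  also have "equiv_null r \<dots> ((0 + ?f x y) + (?f y x + 0))"
    by (intro equiv_add equiv_refl rep assms)
  finally have "equiv_null r (?f x y + ?f y x) 0" by (simp add: equiv_sym)
  then show ?thesis by (simp add: equiv_null_def)
qed

definition jinv :: "'r \<Rightarrow> 'd" where "jinv = inv_into (carrier R) j"

lemma jinv: "x \<in> j ` carrier R \<Longrightarrow> j (jinv x) = x" "x \<in> j ` carrier R \<Longrightarrow> jinv x \<in> carrier R"
  by (auto simp: jinv_def f_inv_into_f inv_into_into)

lemma jinv_j: "x \<in> carrier R \<Longrightarrow> jinv (j x) = x"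
  using inj by (simp add: jinv_def)

lemma jinv_0: "jinv 0 = \<zero>" using jinv_j[of \<zero>] by simp

lemma jinv_L: "x \<in> j ` L0 \<Longrightarrow> jinv x \<in> L0" using carrier_L0 jinv_j by auto

definition basis_list :: "nat set \<Rightarrow> 'd list" where
  "basis_list I = map (\<lambda>i. jinv (g i)) (sorted_list_of_set I)"

definition subsets :: "nat \<Rightarrow> nat set set" where
  "subsets r = {I. I \<subseteq> {..<n} \<and> card I = r}"

lemma subsets_finite: "finite (subsets r)" "I \<in> subsets r \<Longrightarrow> finite I"
  by (auto simp: subsets_def intro: finite_subset[of _ "Pow {..<n}"] finite_subset[of _ "{..<n}"])

lemma basis_list_gens: "I \<in> subsets r \<Longrightarrow> P \<in> carrier R \<Longrightarrow> (P, basis_list I) \<in> gens r"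
  using subsets_finite(2)[of I r]
  by (auto simp: gens_iff basis_list_def subsets_def intro!: jinv_L g_L)

lemma map_j_basis_list: "I \<in> subsets r \<Longrightarrow> map j (basis_list I) = map g (sorted_list_of_set I)"
  using subsets_finite(2)[of I r] g_L L_C by (auto simp: basis_list_def subsets_def intro!: jinv(1) subsetD[OF L_C])

text \<open>
  The normal form: a combination of wedge products of basis elements in increasing order.
\<close>
definition expansion :: "nat \<Rightarrow> 'r chain \<Rightarrow> ('d \<times> 'd list \<Rightarrow>\<^sub>0 int)" where
  "expansion r c = (\<Sum>I\<in>subsets r. frag_of (jinv (coef c I), basis_list I))"

abbreviation Ch where "Ch r \<equiv> graded_chains (j ` carrier R) n r"

lemma expansion_in_Free: "c \<in> Ch r \<Longrightarrow> expansion r c \<in> carrier (Free r)"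
proof -
  assume c: "c \<in> Ch r"
  have "Poly_Mapping.keys (expansion r c) \<subseteq> (\<Union>I\<in>subsets r. {(jinv (coef c I), basis_list I)})"
    unfolding expansion_def using keys_sum[of "\<lambda>I. frag_of (jinv (coef c I), basis_list I)" "subsets r"] by simp
  also have "\<dots> \<subseteq> gens r"
    by (intro UN_least) (simp add: basis_list_gens jinv(2) chainsD(1)[OF c])
  finally show ?thesis by (simp add: in_Free)
qed

lemma evaluate_expansion: "c \<in> Ch r \<Longrightarrow> evaluate (expansion r c) = c"
proof -
  assume c: "c \<in> Ch r"
  have "evaluate (expansion r c) = (\<Sum>I\<in>subsets r. single I (coef c I))"
    unfolding expansion_def evaluate_sum
  proof (rule sum.cong)
    fix I assume I: "I \<in> subsets r"
    then have "I \<subseteq> {..<n}" by (simp add: subsets_def)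
    then show "evaluate (frag_of (jinv (coef c I), basis_list I)) = single I (coef c I)"
      using I chainsD(1)[OF c] by (simp add: val_def map_j_basis_list jinv Phi_basis)
  qed simp
  also have "\<dots> = c"
    using chainsD(2)[OF c] subsets_finite(1)[of r] by (auto simp: chain_eq_iff coef_sum subsets_def)
  finally show ?thesis .
qed

lemma expansion_diff:
  assumes "c \<in> Ch r" "c' \<in> Ch r"
  shows "equiv_null r (expansion r (c - c')) (expansion r c - expansion r c')"
  unfolding expansion_def sum_subtractf[symmetric]
proof (rule equiv_sum)
  fix I assume I: "I \<in> subsets r"
  let ?p = "jinv (coef c I)" and ?q = "jinv (coef c' I)"
  have pq: "?p \<in> carrier R" "?q \<in> carrier R" using assms chainsD(1) jinv(2) by blast+
  have "j (?p \<oplus> \<ominus> ?q) = coef (c - c') I"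
    using pq jinv(1)[OF chainsD(1)[OF assms(1)]] jinv(1)[OF chainsD(1)[OF assms(2)]] by (simp add: add a_inv)
  then have eq: "jinv (coef (c - c') I) = ?p \<oplus> \<ominus> ?q" using pq jinv_j[of "?p \<oplus> \<ominus> ?q"] by simp
  have "equiv_null r (frag_of (?p \<oplus> \<ominus> ?q, basis_list I)) (frag_of (?p, basis_list I) + frag_of (\<ominus> ?q, basis_list I))"
    using pq by (intro equiv_plus_left basis_list_gens I) auto
  also have "equiv_null r \<dots>
      (frag_of (?p, basis_list I) + - frag_of (?q, basis_list I))"
    using pq by (intro equiv_add equiv_refl equiv_minus_left[of ?q] basis_list_gens I)
  finally show "equiv_null r (frag_of (jinv (coef (c - c') I), basis_list I))
     (frag_of (?p, basis_list I) - frag_of (?q, basis_list I))"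
    unfolding eq by simp
qed

lemma expansion_0: "equiv_null r (expansion r 0) 0"
proof -
  have "equiv_null r (expansion r 0) (\<Sum>I\<in>subsets r. 0)"
    unfolding expansion_def
    by (rule equiv_sum) (use basis_list_gens[of _ r \<zero>] in \<open>auto simp: jinv_0 intro!: equiv_zero_left\<close>)
  then show ?thesis by simp
qed

lemma Ch_group: "additive_group (Ch r)"
  by (rule chains_group[OF C_group])

lemma expansion_add:
  assumes "c \<in> Ch r" "c' \<in> Ch r"
  shows "equiv_null r (expansion r (c + c')) (expansion r c + expansion r c')"
proof -
  have u: "- c' \<in> Ch r" using Ch_group assms by (auto intro: additive_groupD)
  have z: "0 \<in> Ch r" using Ch_group by (auto intro: additive_groupD)
  have "equiv_null r (expansion r (c + c')) (expansion r c - expansion r (- c'))"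
    using expansion_diff[OF assms(1) u] by simp
  also have "equiv_null r \<dots> (expansion r c - (expansion r 0 - expansion r c'))"
    using expansion_diff[OF z assms(2)] by (intro equiv_diff equiv_refl) simp
  also have "equiv_null r \<dots> (expansion r c - (0 - expansion r c'))"
    by (intro equiv_diff equiv_refl expansion_0)
  finally show ?thesis by simp
qed

lemma expansion_sum:
  "(\<And>a. a \<in> A \<Longrightarrow> t a \<in> Ch r) \<Longrightarrow> equiv_null r (expansion r (\<Sum>a\<in>A. t a)) (\<Sum>a\<in>A. expansion r (t a))"
proof (induction A rule: infinite_finite_induct)
  case (insert a A)
  then have "equiv_null r (expansion r (t a + (\<Sum>a\<in>A. t a))) (expansion r (t a) + expansion r (\<Sum>a\<in>A. t a))"
    by (intro expansion_add additive_group_sum Ch_group) auto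
  also have "equiv_null r \<dots> (expansion r (t a) + (\<Sum>a\<in>A. expansion r (t a)))"
    using insert by (intro equiv_add equiv_refl) auto
  finally show ?case using insert by simp
qed (simp_all add: expansion_0)

lemma single_Ch: "I \<in> subsets r \<Longrightarrow> P \<in> j ` carrier R \<Longrightarrow> single I P \<in> Ch r"
  by (rule chainsI) (auto simp: subsets_def C_zero split: if_splits)

lemma expansion_single:
  assumes "I \<in> subsets r" "q \<in> carrier R"
  shows "equiv_null r (expansion r (single I (j q))) (frag_of (q, basis_list I))"
proof -
  have "equiv_null r (expansion r (single I (j q))) (\<Sum>J\<in>subsets r. if J = I then frag_of (q, basis_list I) else 0)"
    unfolding expansion_def
  proof (rule equiv_sum)
    fix J assume "J \<in> subsets r"
    then show "equiv_null r (frag_of (jinv (coef (single I (j q)) J), basis_list J)) (if J = I then frag_of (q, basis_list I) else 0)"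
      using assms basis_list_gens[of J r \<zero>]
      by (auto simp: jinv_j jinv_0 equiv_refl intro: equiv_zero_left)
  qed
  then show ?thesis using assms subsets_finite(1)[of r] by simp
qed

text \<open>
  A basis element moves to its place in an increasing list with the sign that is built into \<open>ext\<close>.
\<close>
lemma equiv_insort:
  assumes P: "P \<in> carrier R" and i: "i < n"
  shows "\<lbrakk>length ps + length xs + 1 = r; set ps \<subseteq> L0; set xs \<subseteq> {..<n}; sorted xs\<rbrakk> \<Longrightarrow>
    equiv_null r (frag_of (P, ps @ jinv (g i) # map (\<lambda>k. jinv (g k)) xs))
      (pm (even (length (filter (\<lambda>k. k < i) xs))) (frag_of (P, ps @ map (\<lambda>k. jinv (g k)) (insort i xs))))"
proof (induction xs arbitrary: ps)
  case (Cons y ys)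
  have L: "jinv (g k) \<in> L0" if "k < n" for k using that by (intro jinv_L g_L)
  show ?case
  proof (cases "i \<le> y")
    case True
    have "filter (\<lambda>k. k < i) ys = []" using True Cons.prems(4) by (auto simp: filter_empty_conv)
    then show ?thesis using True by (simp add: equiv_refl)
  next
    case False
    have "equiv_null r (frag_of (P, ps @ jinv (g i) # jinv (g y) # map (\<lambda>k. jinv (g k)) ys))
        (- frag_of (P, ps @ jinv (g y) # jinv (g i) # map (\<lambda>k. jinv (g k)) ys))"
      by (rule equiv_swap) (use Cons.prems P L i in auto)
    also have "equiv_null r \<dots>
        (- pm (even (length (filter (\<lambda>k. k < i) ys))) (frag_of (P, ps @ jinv (g y) # map (\<lambda>k. jinv (g k)) (insort i ys))))"
      using Cons.IH[of "ps @ [jinv (g y)]"] Cons.prems L by (intro equiv_uminus) auto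
    finally show ?thesis using False by simp
  qed
qed (simp add: equiv_refl)

lemma equiv_cons_basis:
  assumes J: "J \<in> subsets r" and i: "i < n" and q: "q \<in> carrier R"
  shows "equiv_null (Suc r) (frag_of (q, jinv (g i) # basis_list J)) (expansion (Suc r) (ext i (single J (j q))))"
proof (cases "i \<in> J")
  case True
  have gJ: "(q, basis_list J) \<in> gens r" by (rule basis_list_gens[OF J q])
  have gi: "jinv (g i) \<in> L0" using i by (intro jinv_L g_L)
  have "i \<in> set (sorted_list_of_set J)" using True subsets_finite(2)[OF J] by simp
  then obtain k where k: "k < length (sorted_list_of_set J)" "sorted_list_of_set J ! k = i" by (metis in_set_conv_nth)
  have "frag_of (q, jinv (g i) # basis_list J) \<in> null (Suc r)"
    by (rule null_repeat[of _ _ _ 0 "Suc k"])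
       (use gJ gi k in \<open>auto simp: gens_iff basis_list_def\<close>)
  moreover have "ext i (single J (j q)) = 0"
    using True by (auto simp: chain_eq_iff ext_def)
  ultimately show ?thesis using expansion_0 equiv_0_iff equiv_sym equiv_trans by metis
next
  case False
  have fin: "finite J" by (rule subsets_finite(2)[OF J])
  have iJ: "insert i J \<in> subsets (Suc r)" using J i False fin by (auto simp: subsets_def)
  define xs where "xs = sorted_list_of_set J"
  have xs: "sorted xs" "distinct xs" "set xs = J" using fin by (auto simp: xs_def)
  let ?b = "even_below i J"
  have "J - {i} = J" using False by simp
  then have bl: "basis_list (insert i J) = map (\<lambda>k. jinv (g k)) (insort i xs)" "basis_list J = map (\<lambda>k. jinv (g k)) xs"
    using fin by (simp_all add: basis_list_def xs_def sorted_list_of_set_insert_remove)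
  have "length (filter (\<lambda>k. k < i) xs) = card {k \<in> J. k < i}"
    using xs by (simp add: distinct_length_filter Int_def conj_commute)
  moreover have "length xs = r" "set xs \<subseteq> {..<n}" using J xs distinct_card[of xs] by (simp_all add: subsets_def)
  ultimately have 1: "equiv_null (Suc r) (frag_of (q, jinv (g i) # basis_list J)) (pm ?b (frag_of (q, basis_list (insert i J))))"
    using equiv_insort[OF q i, of "[]" xs "Suc r"] xs(1) by (simp add: bl even_below_def)
  define q' where "q' = (if ?b then q else \<ominus> q)"
  have q': "q' \<in> carrier R" using q by (simp add: q'_def)
  have 2: "equiv_null (Suc r) (frag_of (q', basis_list (insert i J))) (pm ?b (frag_of (q, basis_list (insert i J))))"
    using equiv_minus_left[OF basis_list_gens[OF iJ q]] by (auto simp: q'_def pm_def equiv_refl)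
  have "ext i (single J (j q)) = single (insert i J) (j q')"
    unfolding chain_eq_iff
  proof
    fix I
    have eb: "even_below i (insert i J) = ?b" by (simp add: even_below_insert)
    show "coef (ext i (single J (j q))) I = coef (single (insert i J) (j q')) I"
    proof (cases "I = insert i J")
      case True
      have "insert i J - {i} = J" using False by auto
      then show ?thesis unfolding True using q by (simp add: ext_def eb q'_def a_inv pm_def)
    next
      case ne: False
      then have "i \<in> I \<Longrightarrow> I - {i} \<noteq> J" by auto
      then show ?thesis using ne by (simp add: ext_def)
    qed
  qed
  then have 3: "equiv_null (Suc r) (expansion (Suc r) (ext i (single J (j q)))) (frag_of (q', basis_list (insert i J)))"
    using expansion_single[OF iJ q'] by simp
  show ?thesis using 1 2 3 by (meson equiv_sym equiv_trans)
qed

lemma equiv_cons: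
  assumes J: "J \<in> subsets r" and x: "x \<in> L0" and q: "q \<in> carrier R"
  shows "equiv_null (Suc r) (frag_of (q, x # basis_list J)) (expansion (Suc r) (W (j x) (single J (j q))))"
proof -
  define b where "b i = jinv (co (j x) i)" for i
  define y where "y i = b i \<otimes> jinv (g i)" for i
  have bB: "b i \<in> B0" if "i < n" for i
    using co_B[of "j x" i] x that jinv_j carrier_B0 by (auto simp: b_def)
  have jb: "j (b i) = co (j x) i" if "i < n" for i
    using co_B[of "j x" i] x that carrier_B0 by (auto simp: b_def intro!: jinv(1))
  have gi: "jinv (g i) \<in> L0" "j (jinv (g i)) = g i" if "i < n" for i
    using g_L[OF that] L_C by (auto intro!: jinv_L jinv(1))
  have yL: "y i \<in> L0" if "i < n" for i using that by (auto simp: y_def intro!: L0_scale bB gi)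
  have bl: "set (basis_list J) \<subseteq> L0" "length (basis_list J) = r" using basis_list_gens[OF J q] by (auto simp: gens_iff)
  have partial: "equiv_null (Suc r) (frag_of (q, (\<Oplus>i\<in>{..<m}. y i) # basis_list J)) (\<Sum>i<m. frag_of (q, y i # basis_list J))
      \<and> (\<Oplus>i\<in>{..<m}. y i) \<in> L0" if "m \<le> n" for m
    using that
  proof (induction m)
    case 0
    have "\<zero> \<in> L0" using L_zero L0_mem[of \<zero>] by simp
    moreover have "equiv_null (Suc r) (frag_of (q, \<zero> # basis_list J)) 0"
      using equiv_plus_at[of q "[]" "basis_list J" "Suc r" \<zero> \<zero>] \<open>\<zero> \<in> L0\<close> q bl
        null_uminus[of "- frag_of (q, \<zero> # basis_list J)" "Suc r"] by (simp add: equiv_null_def)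
    ultimately show ?case by simp
  next
    case (Suc m)
    let ?s = "\<Oplus>i\<in>{..<m}. y i"
    have m: "m < n" using Suc.prems by simp
    have s: "?s \<in> L0" using Suc by simp
    have yc: "y \<in> {..<m} \<rightarrow> carrier R" using m yL carrier_L0 by auto
    have eq: "(\<Oplus>i\<in>{..<Suc m}. y i) = y m \<oplus> ?s"
      unfolding lessThan_Suc by (rule R.finsum_insert) (use yc yL[OF m] carrier_L0 in auto)
    have "equiv_null (Suc r) (frag_of (q, [] @ (y m \<oplus> ?s) # basis_list J))
        (frag_of (q, [] @ y m # basis_list J) + frag_of (q, [] @ ?s # basis_list J))"
      by (rule equiv_plus_at) (use q bl yL[OF m] s in auto)
    then have "equiv_null (Suc r) (frag_of (q, (y m \<oplus> ?s) # basis_list J))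
        (frag_of (q, y m # basis_list J) + frag_of (q, ?s # basis_list J))" by simp
    also have "equiv_null (Suc r) \<dots>
        (frag_of (q, y m # basis_list J) + (\<Sum>i<m. frag_of (q, y i # basis_list J)))"
      by (rule equiv_add[OF equiv_refl]) (use Suc in simp)
    finally have "equiv_null (Suc r) (frag_of (q, (y m \<oplus> ?s) # basis_list J)) (\<Sum>i<Suc m. frag_of (q, y i # basis_list J))"
      by (simp add: add.commute)
    then show ?case unfolding eq using L0_add[OF yL[OF m] s] by blast
  qed
  have "j (\<Oplus>i\<in>{..<n}. y i) = (\<Sum>i<n. j (y i))"
    by (rule finsum) (use yL carrier_L0 in auto)
  also have "\<dots> = (\<Sum>i<n. co (j x) i * g i)"
    by (rule sum.cong) (auto simp: y_def mult carrier_B0 carrier_L0 bB gi jb)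
  also have "\<dots> = j x" using x by (intro co_expand) auto
  finally have sum_y: "(\<Oplus>i\<in>{..<n}. y i) = x"
    using partial[of n] x carrier_L0 eq_iff by simp
  have "equiv_null (Suc r) (frag_of (q, x # basis_list J)) (\<Sum>i<n. frag_of (q, y i # basis_list J))"
    using partial[of n] sum_y by simp
  also have "equiv_null (Suc r) \<dots>
      (\<Sum>i<n. frag_of (q \<otimes> b i, jinv (g i) # basis_list J))"
    unfolding y_def by (intro equiv_sum equiv_scale) (use q bl gi bB in auto)
  also have "equiv_null (Suc r) \<dots>
      (\<Sum>i<n. expansion (Suc r) (ext i (single J (j (q \<otimes> b i)))))"
    by (intro equiv_sum equiv_cons_basis J) (use q bB carrier_B0 in auto)
  also have "equiv_null (Suc r) \<dots>
      (expansion (Suc r) (\<Sum>i<n. ext i (single J (j (q \<otimes> b i)))))"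
    by (rule equiv_sym, rule expansion_sum)
       (use q bB carrier_B0 in \<open>auto intro!: chains_ext C_group single_Ch J\<close>)
  also have "(\<Sum>i<n. ext i (single J (j (q \<otimes> b i)))) = W (j x) (single J (j q))"
    unfolding W_def
    by (intro sum.cong refl arg_cong[where f = "ext _"])
       (use q bB carrier_B0 in \<open>auto simp: chain_eq_iff rmult_def mult jb\<close>)
  finally show ?thesis .
qed

definition prefix_map :: "'d \<Rightarrow> ('d \<times> 'd list \<Rightarrow>\<^sub>0 int) \<Rightarrow> ('d \<times> 'd list \<Rightarrow>\<^sub>0 int)" where
  "prefix_map x = frag_extend (\<lambda>(P, ls). frag_of (P, x # ls))"

lemma prefix_map_null:
  assumes "y \<in> null r" "x \<in> L0" shows "prefix_map x y \<in> null (Suc r)"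
  using assms(1)
proof (rule null_induct)
  fix y assume "y \<in> wedge_rels R B0 L0 r"
  then show "prefix_map x y \<in> null (Suc r)"
    unfolding wedge_rels_def
  proof (elim UnE CollectE exE conjE)
    fix P Q ls assume "y = frag_of (P \<oplus> Q, ls) - frag_of (P, ls) - frag_of (Q, ls)" "(P, ls) \<in> gens r" "Q \<in> carrier R"
    then show ?thesis
      using assms(2) equiv_plus_left[of P "x # ls" "Suc r" Q, unfolded equiv_null_def diff_diff_eq[symmetric]]
      by (simp add: prefix_map_def frag_extend_diff gens_iff)
  next
    fix P ls i l m
    assume *: "y = frag_of (P, ls[i := l \<oplus> m]) - frag_of (P, ls[i := l]) - frag_of (P, ls[i := m])"
      "(P, ls) \<in> gens r" "i < r" "l \<in> L0" "m \<in> L0"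
    have "frag_of (P, (x # ls)[Suc i := l \<oplus> m]) - frag_of (P, (x # ls)[Suc i := l]) - frag_of (P, (x # ls)[Suc i := m])
        \<in> wedge_rels R B0 L0 (Suc r)"
      unfolding wedge_rels_def
      by (rule UnI1, rule UnI1, rule UnI2, rule CollectI, intro exI conjI, rule refl) (use * assms in \<open>auto simp: gens_iff\<close>)
    then show ?thesis using * by (simp add: prefix_map_def frag_extend_diff null_rel)
  next
    fix P b ls i assume *: "y = frag_of (P \<otimes> b, ls) - frag_of (P, ls[i := b \<otimes> ls ! i])" "(P, ls) \<in> gens r" "i < r" "b \<in> B0"
    have "frag_of (P \<otimes> b, x # ls) - frag_of (P, (x # ls)[Suc i := b \<otimes> (x # ls) ! Suc i]) \<in> wedge_rels R B0 L0 (Suc r)"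
      unfolding wedge_rels_def
      by (rule UnI1, rule UnI2, rule CollectI, intro exI conjI, rule refl) (use * assms in \<open>auto simp: gens_iff\<close>)
    then show ?thesis using * by (simp add: prefix_map_def frag_extend_diff null_rel)
  next
    fix P ls i k assume "y = frag_of (P, ls)" "(P, ls) \<in> gens r" "i < k" "k < r" "ls ! i = ls ! k"
    then show ?thesis using null_repeat[of P "x # ls" "Suc r" "Suc i" "Suc k"] assms(2)
      by (simp add: prefix_map_def gens_iff)
  qed
qed (simp_all add: prefix_map_def null_0 frag_extend_diff additive_groupD(2)[OF null_group])

lemma val_Ch: "(P, ls) \<in> gens r \<Longrightarrow> val (P, ls) \<in> Ch r"
proof (induction ls arbitrary: r)
  case Nil
  then show ?case by (auto simp: val_def gens_iff intro!: chains_pt C_zero)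
next
  case (Cons x ls)
  then have "val (P, ls) \<in> Ch (length ls)" by (auto simp: gens_iff)
  then have "W (j x) (val (P, ls)) \<in> Ch (Suc (length ls))"
    by (intro chains_W[OF C_group C_B_times]) (use Cons.prems in \<open>auto simp: gens_iff\<close>)
  then show ?case using Cons.prems by (simp add: val_def gens_iff)
qed

lemma equiv_expansion_val:
  "(P, ls) \<in> gens r \<Longrightarrow> equiv_null r (frag_of (P, ls)) (expansion r (val (P, ls)))"
proof (induction ls arbitrary: r)
  case Nil
  then have r: "r = 0" and P: "P \<in> carrier R" by (auto simp: gens_iff)
  have "I = {}" if "I \<in> subsets 0" for I
    using subsets_finite(2)[OF that] that by (simp add: subsets_def)
  moreover have "{} \<in> subsets 0" by (simp add: subsets_def)
  ultimately have "subsets 0 = {{}}" by blast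
  then show ?case
    using P by (simp add: r expansion_def val_def pt_def jinv_j basis_list_def equiv_refl)
next
  case (Cons x ls)
  define r' where "r' = length ls"
  have r: "r = Suc r'" and x: "x \<in> L0" and gen: "(P, ls) \<in> gens r'" using Cons.prems by (auto simp: gens_iff r'_def)
  define c where "c = val (P, ls)"
  have c: "c \<in> Ch r'" unfolding c_def by (rule val_Ch[OF gen])
  have "prefix_map x (frag_of (P, ls) - expansion r' c) \<in> null (Suc r')"
    using Cons.IH[OF gen] x by (intro prefix_map_null) (simp_all add: equiv_null_def c_def)
  moreover have "prefix_map x (expansion r' c) = (\<Sum>J\<in>subsets r'. frag_of (jinv (coef c J), x # basis_list J))"
    unfolding prefix_map_def expansion_def by (simp add: frag_extend_sum subsets_finite(1) comp_def)
  ultimately have "equiv_null r (frag_of (P, x # ls)) (\<Sum>J\<in>subsets r'. frag_of (jinv (coef c J), x # basis_list J))"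
    by (simp add: equiv_null_def prefix_map_def frag_extend_diff r)
  also have "equiv_null r \<dots>
      (\<Sum>J\<in>subsets r'. expansion r (W (j x) (single J (j (jinv (coef c J))))))"
    unfolding r by (intro equiv_sum equiv_cons x jinv(2) chainsD(1)[OF c])
  also have "equiv_null r \<dots>
      (expansion r (\<Sum>J\<in>subsets r'. W (j x) (single J (j (jinv (coef c J))))))"
  proof (rule equiv_sym, rule expansion_sum)
    fix J assume "J \<in> subsets r'"
    then show "W (j x) (single J (j (jinv (coef c J)))) \<in> Ch r"
      unfolding r by (intro chains_W[OF C_group C_B_times] single_Ch) (use x chainsD(1)[OF c] jinv(2) in auto)
  qed
  also have "(\<Sum>J\<in>subsets r'. W (j x) (single J (j (jinv (coef c J))))) = W (j x) (\<Sum>J\<in>subsets r'. single J (coef c J))"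
    unfolding W_sum by (intro sum.cong refl) (use chainsD(1)[OF c] in \<open>simp add: jinv(1)\<close>)
  also have "(\<Sum>J\<in>subsets r'. single J (coef c J)) = c"
    using chainsD(2)[OF c] subsets_finite(1)[of r'] by (auto simp: chain_eq_iff coef_sum subsets_def)
  also have "W (j x) c = val (P, x # ls)" by (simp add: c_def val_def)
  finally show ?case .
qed

lemma evaluate_Ch_equiv:
  assumes "x \<in> carrier (Free r)"
  shows "evaluate x \<in> Ch r \<and> equiv_null r x (expansion r (evaluate x))"
  using assms[unfolded in_Free]
proof (induction x rule: frag_induction)
  case zero
  show ?case using equiv_sym[OF expansion_0] additive_groupD(1)[OF Ch_group] by simp
next
  case (one k)
  then show ?case using val_Ch equiv_expansion_val by (cases k) auto
next
  case (diff a b)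
  then have "equiv_null r (a - b) (expansion r (evaluate a) - expansion r (evaluate b))"
    by (intro equiv_diff) auto
  also have "equiv_null r \<dots> (expansion r (evaluate a - evaluate b))"
    by (rule equiv_sym, rule expansion_diff) (use diff in auto)
  finally show ?case
    using diff additive_groupD(2)[OF Ch_group, of "evaluate a" r "evaluate b"] by (simp add: evaluate_diff)
qed

theorem null_iff: "x \<in> carrier (Free r) \<Longrightarrow> x \<in> null r \<longleftrightarrow> evaluate x = 0"
  using evaluate_Ch_equiv[of x r] evaluate_null[of x r] expansion_0[of r] equiv_trans equiv_0_iff by metis

lemma evaluate_sign: "evaluate (frag_cmul ((-1) ^ k) x) = pm (even k) (evaluate x)"
  by (cases "even k") (simp_all add: pm_def evaluate_uminus)

lemma evaluate_bdry:
  assumes "(P, ls) \<in> gens r" shows "evaluate (spencer_bdry R (P, ls)) = d (val (P, ls))"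
proof -
  have ls: "set ls \<subseteq> L0" and P: "P \<in> carrier R" using assms by (auto simp: gens_iff)
  have C: "ls ! i \<in> carrier R" if "i < length ls" for i
    by (rule carrier_L0, rule subsetD[OF ls], rule nth_mem[OF that])
  have "evaluate (spencer_bdry R (P, ls)) =
    (\<Sum>i<length ls. pm (even i) (val (P \<otimes> ls ! i, nths ls (- {i})))) +
    (\<Sum>k<length ls. \<Sum>i<k. pm (even (i + k)) (val (P, (ls ! i \<otimes> ls ! k \<ominus> ls ! k \<otimes> ls ! i) # nths ls (- {i, k}))))"
    by (simp add: spencer_bdry_def evaluate_add evaluate_sum evaluate_sign)
  also have "\<dots> = d (val (P, ls))"
    unfolding val_def fst_conv snd_conv
    by (subst d_Phi) (use ls C P in \<open>auto simp: mult minus nths_map[symmetric] intro!: arg_cong2[where f = "(+)"] sum.cong\<close>)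
  finally show ?thesis .
qed

lemma bdry_in_Free:
  assumes "(P, ls) \<in> gens (Suc r)" shows "spencer_bdry R (P, ls) \<in> carrier (Free r)"
proof -
  have ls: "set ls \<subseteq> L0" "length ls = Suc r" and P: "P \<in> carrier R" using assms by (auto simp: gens_iff)
  have C: "ls ! i \<in> L0" if "i < length ls" for i using that ls by auto
  have len: "length (nths ls (- A)) = Suc r - card A" if "A \<subseteq> {..<Suc r}" for A
  proof -
    have "{i. i < length ls \<and> i \<in> - A} = {..<Suc r} - A" using ls by auto
    then show ?thesis using that by (simp add: length_nths card_Diff_subset finite_subset)
  qed
  have sub: "set (nths ls A) \<subseteq> L0" for A by (rule order_trans[OF set_nths_subset ls(1)])
  have cmul: "frag_cmul ((-1) ^ k) (frag_of y) \<in> carrier (Free r)" if "y \<in> gens r" for y k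
    using that keys_cmul[of "(-1) ^ k" "frag_of y"] by (auto simp: in_Free)
  have sumF: "(\<Sum>a\<in>A. t a) \<in> carrier (Free r)" if "\<And>a. a \<in> A \<Longrightarrow> t a \<in> carrier (Free r)" for A :: "nat set" and t
    using that
  proof (induction A rule: infinite_finite_induct)
    case (insert a A)
    show ?case unfolding sum.insert[OF insert.hyps]
      by (intro Free_add insert.IH insert.prems) auto
  qed (simp_all add: in_Free)
  have 1: "(P \<otimes> ls ! i, nths ls (- {i})) \<in> gens r" if "i < length ls" for i
    using that P C[OF that] sub len[of "{i}"] ls carrier_L0 by (auto simp: gens_iff)
  have 2: "(P, (ls ! i \<otimes> ls ! k \<ominus> ls ! k \<otimes> ls ! i) # nths ls (- {i, k})) \<in> gens r" if "i < k" "k < length ls" for i k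
    using that P C[of i] C[of k] sub len[of "{i, k}"] ls by (auto simp: gens_iff intro!: L0_bracket)
  show ?thesis
    unfolding spencer_bdry_def prod.case
    by (intro Free_add sumF cmul 1 2) auto
qed

lemma evaluate_frag_extend_bdry:
  assumes "x \<in> carrier (Free (Suc r))"
  shows "frag_extend (spencer_bdry R) x \<in> carrier (Free r) \<and> evaluate (frag_extend (spencer_bdry R) x) = d (evaluate x)"
  using assms[unfolded in_Free]
proof (induction x rule: frag_induction)
  case (one k)
  then show ?case using bdry_in_Free evaluate_bdry by (cases k) auto
next
  case (diff a b)
  then show ?case
    by (simp only: frag_extend_diff evaluate_diff d_additive Free_diff simp_thms)
qed (simp add: in_Free d_additive)

abbreviation coset where "coset r x \<equiv> null r #>\<^bsub>Free r\<^esub> x"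

lemma coset_self: "x \<in> coset r x"
  unfolding r_coset_def using null_0[of r] by (intro UN_I[of 0]) simp_all

lemma coset_eq_iff:
  assumes "x \<in> carrier (Free r)" "y \<in> carrier (Free r)"
  shows "coset r x = coset r y \<longleftrightarrow> evaluate x = evaluate y"
proof -
  have "coset r x = coset r y \<longleftrightarrow> x - y \<in> null r"
  proof
    assume "coset r x = coset r y"
    then have "x \<in> coset r y" using coset_self[of x r] by simp
    then obtain h where "h \<in> null r" "x = h + y" by (auto simp: r_coset_def)
    then show "x - y \<in> null r" by simp
  next
    assume xy: "x - y \<in> null r"
    have "\<exists>h'\<in>null r. h + x = h' + y" if "h \<in> null r" for h
      using null_add[OF that xy] by (intro bexI[of _ "h + (x - y)"]) auto
    moreover have "\<exists>h'\<in>null r. h + y = h' + x" if "h \<in> null r" for h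
      using null_add[OF that null_uminus[OF xy]] by (intro bexI[of _ "h + - (x - y)"]) auto
    ultimately show "coset r x = coset r y" by (auto simp: r_coset_def)
  qed
  then show ?thesis using null_iff[OF Free_diff[OF assms]] by (simp add: evaluate_diff)
qed

lemma spencer_diff_coset:
  assumes "x \<in> carrier (Free (Suc r))"
  shows "spencer_diff R B0 L0 (Suc r) (coset (Suc r) x) = coset r (frag_extend (spencer_bdry R) x)"
proof -
  have "coset r (frag_extend (spencer_bdry R) y) = coset r (frag_extend (spencer_bdry R) x)"
    if "y \<in> coset (Suc r) x" for y
  proof -
    obtain h where h: "h \<in> null (Suc r)" "y = h + x" using \<open>y \<in> coset (Suc r) x\<close> by (auto simp: r_coset_def)
    then have "y \<in> carrier (Free (Suc r))" "evaluate y = evaluate x"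
      using assms null_in_Free Free_add by (auto simp: evaluate_add evaluate_null)
    then show ?thesis using assms evaluate_frag_extend_bdry by (simp add: coset_eq_iff)
  qed
  then have "(\<Union>y\<in>coset (Suc r) x. coset r (frag_extend (spencer_bdry R) y)) =
      (\<Union>y\<in>coset (Suc r) x. coset r (frag_extend (spencer_bdry R) x))"
    by (intro SUP_cong refl)
  also have "\<dots> = coset r (frag_extend (spencer_bdry R) x)"
    using coset_self[of x "Suc r"] by (subst UN_constant) auto
  finally show ?thesis by (simp add: spencer_diff_def)
qed

theorem spencer_exact_iff: "spencer_exact R B0 L0 (Suc r) \<longleftrightarrow> exact_at (Suc r)"
proof -
  let ?D = "frag_extend (spencer_bdry R)"
  have carr: "carrier (spencer_term R B0 L0 k) = coset k ` carrier (Free k)" for k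
    by (auto simp: spencer_term_def FactGroup_def RCOSETS_def)
  have one: "\<one>\<^bsub>spencer_term R B0 L0 r\<^esub> = coset r 0"
    by (auto simp: spencer_term_def FactGroup_def r_coset_def)
  have zeroF: "0 \<in> carrier (Free r)" by (simp add: in_Free)
  have ker: "kernel (spencer_term R B0 L0 (Suc r)) (spencer_term R B0 L0 r) (spencer_diff R B0 L0 (Suc r)) =
      coset (Suc r) ` {x \<in> carrier (Free (Suc r)). d (evaluate x) = 0}"
  proof -
    have "spencer_diff R B0 L0 (Suc r) (coset (Suc r) x) = coset r 0 \<longleftrightarrow> d (evaluate x) = 0"
      if "x \<in> carrier (Free (Suc r))" for x
      using that evaluate_frag_extend_bdry[OF that] zeroF by (simp add: spencer_diff_coset coset_eq_iff)
    then show ?thesis unfolding kernel_def carr one by auto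
  qed
  have im: "spencer_diff R B0 L0 (Suc (Suc r)) ` carrier (spencer_term R B0 L0 (Suc (Suc r))) =
      coset (Suc r) ` ?D ` carrier (Free (Suc (Suc r)))"
    unfolding carr image_image by (rule image_cong) (auto simp: spencer_diff_coset)
  show ?thesis
  proof
    assume "spencer_exact R B0 L0 (Suc r)"
    then have eq: "coset (Suc r) ` {x \<in> carrier (Free (Suc r)). d (evaluate x) = 0} =
        coset (Suc r) ` ?D ` carrier (Free (Suc (Suc r)))"
      unfolding spencer_exact_def using ker im by simp
    show "exact_at (Suc r)"
      unfolding exact_at_def
    proof (intro ballI impI)
      fix z assume z: "z \<in> Ch (Suc r)" "d z = 0"
      define x where "x = expansion (Suc r) z"
      have x: "x \<in> carrier (Free (Suc r))" "evaluate x = z"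
        using z expansion_in_Free evaluate_expansion by (auto simp: x_def)
      then have "coset (Suc r) x \<in> coset (Suc r) ` ?D ` carrier (Free (Suc (Suc r)))" using eq z by blast
      then obtain y where y: "y \<in> carrier (Free (Suc (Suc r)))" "coset (Suc r) x = coset (Suc r) (?D y)" by blast
      then have "z = d (evaluate y)" using evaluate_frag_extend_bdry[OF y(1)] x by (simp add: coset_eq_iff)
      then show "\<exists>w\<in>Ch (Suc (Suc r)). z = d w" using evaluate_Ch_equiv[OF y(1)] by blast
    qed
  next
    assume ex: "exact_at (Suc r)"
    have "coset (Suc r) x \<in> coset (Suc r) ` ?D ` carrier (Free (Suc (Suc r)))"
      if x: "x \<in> carrier (Free (Suc r))" "d (evaluate x) = 0" for x
    proof -
      obtain w where w: "w \<in> Ch (Suc (Suc r))" "evaluate x = d w"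
        using ex x evaluate_Ch_equiv[OF x(1)] by (auto simp: exact_at_def)
      define y where "y = expansion (Suc (Suc r)) w"
      have y: "y \<in> carrier (Free (Suc (Suc r)))" "evaluate y = w"
        using w expansion_in_Free evaluate_expansion by (auto simp: y_def)
      then have "coset (Suc r) x = coset (Suc r) (?D y)"
        using evaluate_frag_extend_bdry[OF y(1)] x w by (simp add: coset_eq_iff)
      then show ?thesis using y by blast
    qed
    moreover have "coset (Suc r) (?D y) \<in> coset (Suc r) ` {x \<in> carrier (Free (Suc r)). d (evaluate x) = 0}"
      if y: "y \<in> carrier (Free (Suc (Suc r)))" for y
      using evaluate_frag_extend_bdry[OF y] evaluate_Ch_equiv[OF y] d_d by auto
    ultimately show "spencer_exact R B0 L0 (Suc r)"
      unfolding spencer_exact_def using ker im by auto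
  qed
qed

end

section \<open>Holomorphic functions of several variables\<close>

definition pd :: "'n::finite \<Rightarrow> (complex ^ 'n \<Rightarrow> complex) \<Rightarrow> complex ^ 'n \<Rightarrow> complex" where
  "pd i F z = deriv (\<lambda>t. F (\<chi> k. if k = i then t else z $ k)) (z $ i)"

lemma slice_eq: "(\<chi> k. if k = i then t else z $ k) = z + (t - z $ i) *s axis i (1::complex)"
  by (auto simp: vec_eq_iff axis_def)

lemma norm_axis_scale: "norm (w *s axis i (1::complex) :: complex ^ 'n::finite) = norm w"
proof -
  have "(\<Sum>k\<in>UNIV. (norm ((w *s axis i (1::complex) :: complex ^ 'n) $ k))\<^sup>2) = (\<Sum>k\<in>UNIV. if k = i then (norm w)\<^sup>2 else 0)"
    by (rule sum.cong) (auto simp: axis_def)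
  then show ?thesis by (simp add: norm_vec_def L2_set_def)
qed

lemma bounded_linear_scale_axis: "bounded_linear (\<lambda>t. t *s (v :: complex ^ 'n::finite))"
  by (rule linear_conv_bounded_linear[THEN iffD1], rule linearI) (auto simp: vec_eq_iff algebra_simps)

lemma slice_derivative:
  fixes F :: "complex ^ 'n::finite \<Rightarrow> complex"
  assumes "(F has_derivative F') (at (z + w *s axis i 1))" "\<And>c v. F' (c *s v) = c * F' v"
  shows "((\<lambda>t. F (z + t *s axis i 1)) has_field_derivative F' (axis i 1)) (at w)"
proof -
  have "((\<lambda>t. z + t *s axis i 1) has_derivative (\<lambda>t. t *s axis i 1)) (at w)"
    using has_derivative_add[OF has_derivative_const bounded_linear_imp_has_derivative[OF bounded_linear_scale_axis]]
    by simp
  then have "((\<lambda>t. F (z + t *s axis i 1)) has_derivative (\<lambda>t. F' (t *s axis i 1))) (at w)"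
    by (rule has_derivative_compose) (rule assms(1))
  then show ?thesis by (simp add: has_field_derivative_def assms(2) mult.commute[of _ "F' _"])
qed

lemma pd_alt: "pd i F z = deriv (\<lambda>t. F (z + t *s axis i 1)) 0"
proof -
  have "(\<lambda>t. F (z + (t - z $ i) *s axis i 1)) = (\<lambda>t. F (z + t *s axis i 1)) \<circ> (\<lambda>t. t - z $ i)" by auto
  moreover have "deriv (h \<circ> (\<lambda>t. t - a)) a = deriv h 0" for h :: "complex \<Rightarrow> complex" and a
  proof -
    have "(h has_field_derivative D) (at 0) \<longleftrightarrow> ((h \<circ> (\<lambda>t. t - a)) has_field_derivative D) (at a)" for D
      using DERIV_at_within_shift[of "h \<circ> (\<lambda>t. t - a)" D a 0 UNIV] by (simp add: o_def)
    then show ?thesis unfolding deriv_def by simp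
  qed
  ultimately show ?thesis unfolding pd_def slice_eq by simp
qed

lemma pd_eq:
  assumes "(F has_derivative F') (at z)" "\<And>c v. F' (c *s v) = c * F' v"
  shows "pd i F z = F' (axis i 1)"
  unfolding pd_alt using slice_derivative[of F F' z 0 i] assms by (simp add: DERIV_imp_deriv)

lemma complex_linear_expand:
  assumes "(F has_derivative F') (at z)" "\<And>c v. F' (c *s v) = c * F' v"
  shows "F' v = (\<Sum>i\<in>UNIV. v $ i * pd i F z)"
proof -
  have "linear F'" using assms(1) has_derivative_linear by blast
  then have "F' (\<Sum>i\<in>UNIV. v $ i *s axis i 1) = (\<Sum>i\<in>UNIV. v $ i * F' (axis i 1))"
    by (simp add: linear_sum assms(2))
  then show ?thesis by (simp add: basis_expansion pd_eq[OF assms])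
qed

lemma holomorphic_Cn_derivative:
  assumes "holomorphic_Cn F V" "z \<in> V"
  shows "(F has_derivative (\<lambda>v. \<Sum>i\<in>UNIV. v $ i * pd i F z)) (at z)"
proof -
  obtain F' where F': "(F has_derivative F') (at z)" "\<And>c v. F' (c *s v) = c * F' v"
    using assms by (auto simp: holomorphic_Cn_def)
  have eq: "F' = (\<lambda>v. \<Sum>i\<in>UNIV. v $ i * pd i F z)"
    by (intro ext complex_linear_expand[OF F'])
  show ?thesis by (rule subst[OF eq, of "\<lambda>D. (F has_derivative D) (at z)"]) (rule F'(1))
qed

lemma holomorphic_CnI:
  assumes "\<And>z. z \<in> V \<Longrightarrow> (F has_derivative (\<lambda>v. \<Sum>i\<in>UNIV. v $ i * a z i)) (at z)"
  shows "holomorphic_Cn F V"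
  unfolding holomorphic_Cn_def
proof
  fix z assume "z \<in> V"
  then show "\<exists>F'. (F has_derivative F') (at z) \<and> (\<forall>c v. F' (c *s v) = c * F' v)"
    using assms by (intro exI[of _ "\<lambda>v. \<Sum>i\<in>UNIV. v $ i * a z i"]) (auto simp: sum_distrib_left mult.assoc)
qed

lemma pd_unique:
  assumes "(F has_derivative (\<lambda>v. \<Sum>i\<in>UNIV. v $ i * a i)) (at z)" shows "pd i F z = a i"
proof -
  have "pd i F z = (\<Sum>k\<in>UNIV. axis i 1 $ k * a k)"
    by (rule pd_eq[OF assms]) (simp add: sum_distrib_left mult.assoc)
  also have "\<dots> = (\<Sum>k\<in>UNIV. if k = i then a i else 0)" by (rule sum.cong) (auto simp: axis_def)
  finally show ?thesis by simp
qed

lemma holomorphic_Cn_subset: "holomorphic_Cn F V \<Longrightarrow> V' \<subseteq> V \<Longrightarrow> holomorphic_Cn F V'"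
  by (auto simp: holomorphic_Cn_def)

lemma holomorphic_Cn_continuous: "holomorphic_Cn F V \<Longrightarrow> continuous_on V F"
  by (rule continuous_at_imp_continuous_on, rule ballI, rule has_derivative_continuous, rule holomorphic_Cn_derivative)

lemma holomorphic_Cn_transform:
  assumes "holomorphic_Cn F V" "open V" "\<And>z. z \<in> V \<Longrightarrow> F z = G z" shows "holomorphic_Cn G V"
proof (rule holomorphic_CnI)
  fix z assume z: "z \<in> V"
  show "(G has_derivative (\<lambda>v. \<Sum>i\<in>UNIV. v $ i * pd i F z)) (at z)"
    by (rule has_derivative_transform_within_open[OF holomorphic_Cn_derivative[OF assms(1) z] assms(2) z assms(3)])
qed

lemma pd_cong:
  assumes "eventually (\<lambda>z. F z = G z) (nhds z)" shows "pd i F z = pd i G z"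
proof -
  obtain S where S: "open S" "z \<in> S" "\<And>x. x \<in> S \<Longrightarrow> F x = G x" using assms by (auto simp: eventually_nhds)
  have "continuous_on UNIV (\<lambda>t. z + t *s axis i 1)"
    by (intro continuous_on_add continuous_on_const linear_continuous_on bounded_linear_scale_axis)
  then have "open ((\<lambda>t. z + t *s axis i 1) -` S)" using S(1) by (simp add: open_vimage)
  then have "eventually (\<lambda>t. F (z + t *s axis i 1) = G (z + t *s axis i 1)) (nhds 0)"
    unfolding eventually_nhds using S(2,3) by (intro exI[of _ "(\<lambda>t. z + t *s axis i 1) -` S"]) auto
  then show ?thesis unfolding pd_alt by (rule deriv_cong_ev) simp
qed

lemma holomorphic_Cn_const:
  fixes V :: "(complex ^ 'n::finite) set"
  shows "holomorphic_Cn (\<lambda>_. c) V" "pd i (\<lambda>_. c) (z :: complex ^ 'n) = 0"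
proof -
  have D: "((\<lambda>_. c) has_derivative (\<lambda>v. \<Sum>i\<in>UNIV. v $ i * 0)) (at z)" for z :: "complex ^ 'n" by simp
  show "holomorphic_Cn (\<lambda>_. c) V" by (rule holomorphic_CnI[OF D])
  show "pd i (\<lambda>_. c) z = 0" by (rule pd_unique[OF D])
qed

lemma holomorphic_Cn_coord:
  fixes V :: "(complex ^ 'n::finite) set"
  shows "holomorphic_Cn (\<lambda>z. z $ k) V" "pd i (\<lambda>z. z $ k) (z :: complex ^ 'n) = (if i = k then 1 else 0)"
proof -
  have e: "(\<Sum>i\<in>UNIV. v $ i * (if i = k then 1 else 0)) = v $ k" for v :: "complex ^ 'n"
  proof -
    have "(\<Sum>i\<in>UNIV. v $ i * (if i = k then 1 else 0)) = (\<Sum>i\<in>UNIV. if i = k then v $ k else 0)"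
      by (rule sum.cong) auto
    then show ?thesis by simp
  qed
  have "((\<lambda>z. z $ k) has_derivative (\<lambda>v. v $ k)) (at z)" for z :: "complex ^ 'n"
    by (rule bounded_linear_imp_has_derivative[OF bounded_linear_vec_nth])
  then have D: "((\<lambda>z. z $ k) has_derivative (\<lambda>v. \<Sum>i\<in>UNIV. v $ i * (if i = k then 1 else 0))) (at z)" for z :: "complex ^ 'n"
    by (simp only: e)
  show "holomorphic_Cn (\<lambda>z. z $ k) V" by (rule holomorphic_CnI[OF D])
  show "pd i (\<lambda>z. z $ k) z = (if i = k then 1 else 0)" by (rule pd_unique[OF D])
qed

lemma holomorphic_Cn_add:
  assumes "holomorphic_Cn F V" "holomorphic_Cn G V"
  shows "holomorphic_Cn (\<lambda>z. F z + G z) V" "z \<in> V \<Longrightarrow> pd i (\<lambda>z. F z + G z) z = pd i F z + pd i G z"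
proof -
  have D: "((\<lambda>z. F z + G z) has_derivative (\<lambda>v. \<Sum>i\<in>UNIV. v $ i * (pd i F z + pd i G z))) (at z)" if "z \<in> V" for z
    using has_derivative_add[OF assms[THEN holomorphic_Cn_derivative, OF that]]
    by (simp add: sum.distrib[symmetric] distrib_left)
  show "holomorphic_Cn (\<lambda>z. F z + G z) V" by (rule holomorphic_CnI[OF D])
  show "z \<in> V \<Longrightarrow> pd i (\<lambda>z. F z + G z) z = pd i F z + pd i G z" by (rule pd_unique[OF D])
qed

lemma holomorphic_Cn_mult:
  assumes "holomorphic_Cn F V" "holomorphic_Cn G V"
  shows "holomorphic_Cn (\<lambda>z. F z * G z) V" "z \<in> V \<Longrightarrow> pd i (\<lambda>z. F z * G z) z = F z * pd i G z + pd i F z * G z"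
proof -
  have D: "((\<lambda>z. F z * G z) has_derivative (\<lambda>v. \<Sum>i\<in>UNIV. v $ i * (F z * pd i G z + pd i F z * G z))) (at z)" if "z \<in> V" for z
  proof -
    have e: "(\<lambda>v. F z * (\<Sum>i\<in>UNIV. v $ i * pd i G z) + (\<Sum>i\<in>UNIV. v $ i * pd i F z) * G z) =
      (\<lambda>v. \<Sum>i\<in>UNIV. v $ i * (F z * pd i G z + pd i F z * G z))"
      by (simp add: sum.distrib distrib_left sum_distrib_left sum_distrib_right mult_ac)
    show ?thesis
      using has_derivative_mult[OF assms[THEN holomorphic_Cn_derivative, OF that]] unfolding e .
  qed
  show "holomorphic_Cn (\<lambda>z. F z * G z) V" by (rule holomorphic_CnI[OF D])
  show "z \<in> V \<Longrightarrow> pd i (\<lambda>z. F z * G z) z = F z * pd i G z + pd i F z * G z" by (rule pd_unique[OF D])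
qed

lemma holomorphic_Cn_compose:
  fixes T :: "complex ^ 'n::finite \<Rightarrow> complex ^ 'n"
  assumes F: "holomorphic_Cn F V" and T: "\<And>k. holomorphic_Cn (\<lambda>z. T z $ k) V'" and sub: "T ` V' \<subseteq> V"
  shows "holomorphic_Cn (\<lambda>z. F (T z)) V'"
    and "z \<in> V' \<Longrightarrow> pd i (\<lambda>z. F (T z)) z = (\<Sum>k\<in>UNIV. pd i (\<lambda>z. T z $ k) z * pd k F (T z))"
proof -
  have D: "((\<lambda>z. F (T z)) has_derivative
     (\<lambda>v. \<Sum>i\<in>UNIV. v $ i * (\<Sum>k\<in>UNIV. pd i (\<lambda>z. T z $ k) z * pd k F (T z)))) (at z)" if z: "z \<in> V'" for z
  proof -
    have "(T has_derivative (\<lambda>v. \<chi> k. \<Sum>i\<in>UNIV. v $ i * pd i (\<lambda>z. T z $ k) z)) (at z)"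
    proof (subst has_derivative_componentwise_within, rule ballI)
      fix b :: "complex ^ 'n" assume "b \<in> Basis"
      then obtain k u where b: "b = axis k u" by (auto simp: Basis_vec_def)
      show "((\<lambda>x. T x \<bullet> b) has_derivative (\<lambda>v. (\<chi> k. \<Sum>i\<in>UNIV. v $ i * pd i (\<lambda>z. T z $ k) z) \<bullet> b)) (at z)"
        unfolding b inner_axis
        by (simp, rule has_derivative_inner_left, rule holomorphic_Cn_derivative[OF T z])
    qed
    then have "((\<lambda>z. F (T z)) has_derivative
        (\<lambda>v. \<Sum>k\<in>UNIV. (\<chi> k. \<Sum>i\<in>UNIV. v $ i * pd i (\<lambda>z. T z $ k) z) $ k * pd k F (T z))) (at z)"
      by (rule has_derivative_compose) (rule holomorphic_Cn_derivative[OF F], use sub z in auto)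
    also have "(\<lambda>v. \<Sum>k\<in>UNIV. (\<chi> k. \<Sum>i\<in>UNIV. v $ i * pd i (\<lambda>z. T z $ k) z) $ k * pd k F (T z)) =
       (\<lambda>v. \<Sum>i\<in>UNIV. v $ i * (\<Sum>k\<in>UNIV. pd i (\<lambda>z. T z $ k) z * pd k F (T z)))"
    proof
      fix v :: "complex ^ 'n"
      have "(\<Sum>k\<in>UNIV. (\<chi> k. \<Sum>i\<in>UNIV. v $ i * pd i (\<lambda>z. T z $ k) z) $ k * pd k F (T z)) =
          (\<Sum>k\<in>UNIV. \<Sum>i\<in>UNIV. v $ i * (pd i (\<lambda>z. T z $ k) z * pd k F (T z)))"
        by (simp add: sum_distrib_right mult.assoc)
      also have "\<dots> = (\<Sum>i\<in>UNIV. \<Sum>k\<in>UNIV. v $ i * (pd i (\<lambda>z. T z $ k) z * pd k F (T z)))" by (rule sum.swap)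
      finally show "(\<Sum>k\<in>UNIV. (\<chi> k. \<Sum>i\<in>UNIV. v $ i * pd i (\<lambda>z. T z $ k) z) $ k * pd k F (T z)) =
         (\<Sum>i\<in>UNIV. v $ i * (\<Sum>k\<in>UNIV. pd i (\<lambda>z. T z $ k) z * pd k F (T z)))"
        by (simp add: sum_distrib_left)
    qed
    finally show ?thesis .
  qed
  show "holomorphic_Cn (\<lambda>z. F (T z)) V'" by (rule holomorphic_CnI[OF D])
  show "z \<in> V' \<Longrightarrow> pd i (\<lambda>z. F (T z)) z = (\<Sum>k\<in>UNIV. pd i (\<lambda>z. T z $ k) z * pd k F (T z))"
    by (rule pd_unique[OF D])
qed

text \<open>
  Cauchy's formula for the first derivative on a circle in the \<open>i\<close>-th variable, as an integral over \<open>[0,1]\<close>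
  whose integrand depends on \<open>z\<close> only through \<open>F\<close>. It allows differentiation under the integral sign.
\<close>
definition cauchy_kernel :: "real \<Rightarrow> real \<Rightarrow> complex" where
  "cauchy_kernel r t = 1 / (of_real r * exp (2 * of_real pi * \<i> * of_real t))"

definition circle_pt :: "real \<Rightarrow> real \<Rightarrow> complex" where
  "circle_pt r t = of_real r * exp (2 * of_real pi * \<i> * of_real t)"

lemma norm_circle_pt: "r > 0 \<Longrightarrow> norm (circle_pt r t) = r"
  by (simp add: circle_pt_def norm_mult)

lemma pd_cauchy:
  assumes F: "holomorphic_Cn F V" and sub: "ball z s \<subseteq> V" and r: "0 < r" "r < s"
  shows "pd i F z = integral (cbox 0 1) (\<lambda>t. F (z + circle_pt r t *s axis i 1) * cauchy_kernel r t)"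
proof -
  define h where "h w = F (z + w *s axis i 1)" for w
  have inV: "z + w *s axis i 1 \<in> V" if "norm w < s" for w
    using that sub by (intro subsetD[OF sub]) (simp add: dist_norm norm_axis_scale)
  have hd: "h field_differentiable at w" if w: "norm w < s" for w
  proof -
    obtain F' where F': "(F has_derivative F') (at (z + w *s axis i 1))" "\<And>c v. F' (c *s v) = c * F' v"
      using F inV[OF w] unfolding holomorphic_Cn_def by blast
    show ?thesis unfolding h_def field_differentiable_def
      by (rule exI, rule slice_derivative[OF F'])
  qed
  have hol: "h holomorphic_on ball 0 s"
    unfolding holomorphic_on_def by (intro ballI field_differentiable_at_within[OF hd]) simp
  have "(h has_field_derivative (1 / (2 * of_real pi * \<i>) * contour_integral (circlepath 0 r) (\<lambda>u. h u / (u - 0)\<^sup>2))) (at 0)"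
    using r by (intro Cauchy_derivative_integral_circlepath holomorphic_on_imp_continuous_on holomorphic_on_subset[OF hol]) auto
  then have "pd i F z = 1 / (2 * of_real pi * \<i>) * contour_integral (circlepath 0 r) (\<lambda>u. h u / u\<^sup>2)"
    unfolding pd_alt h_def[symmetric] by (simp add: DERIV_imp_deriv)
  also have "contour_integral (circlepath 0 r) (\<lambda>u. h u / u\<^sup>2) =
      integral {0..1} (\<lambda>t. 2 * of_real pi * \<i> * (h (circle_pt r t) * cauchy_kernel r t))"
    unfolding contour_integral_integral
  proof (rule integral_cong)
    fix t :: real assume "t \<in> {0..1}"
    have "vector_derivative (circlepath 0 r) (at t) = 2 * pi * \<i> * r * exp (2 * of_real pi * \<i> * t)"
      by (rule vector_derivative_at, rule has_vector_derivative_eq_rhs[OF has_vector_derivative_circlepath]) simp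
    then show "h (circlepath 0 r t) / (circlepath 0 r t)\<^sup>2 * vector_derivative (circlepath 0 r) (at t) =
         2 * of_real pi * \<i> * (h (circle_pt r t) * cauchy_kernel r t)"
      using r by (simp add: circlepath circle_pt_def cauchy_kernel_def power2_eq_square)
  qed
  also have "\<dots> = 2 * of_real pi * \<i> * integral {0..1} (\<lambda>t. h (circle_pt r t) * cauchy_kernel r t)"
    by simp
  finally show ?thesis by (simp add: h_def)
qed

lemma circle_continuous: "continuous_on S (circle_pt r)" "r > 0 \<Longrightarrow> continuous_on S (cauchy_kernel r)"
  unfolding circle_pt_def cauchy_kernel_def by (intro continuous_intros; simp)+

lemma shifted_integrand_continuous:
  assumes G: "continuous_on V G" and sub: "ball z0 (2 * r) \<subseteq> V" and r: "r > 0"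
  shows "continuous_on (ball z0 r \<times> cbox 0 1) (\<lambda>(z, t). G (z + circle_pt r t *s axis i 1) * cauchy_kernel r t)"
    and "z \<in> ball z0 r \<Longrightarrow> z + circle_pt r t *s axis i 1 \<in> V"
proof -
  show inV: "z + circle_pt r t *s axis i 1 \<in> V" if "z \<in> ball z0 r" for z t
  proof (rule subsetD[OF sub])
    have "dist z0 (z + circle_pt r t *s axis i 1) \<le> dist z0 z + norm (circle_pt r t *s axis i (1::complex) :: complex ^ 'a)"
      using dist_triangle[of z0 "z + circle_pt r t *s axis i 1" z] by (simp add: dist_norm)
    also have "\<dots> < 2 * r" using that r by (simp add: norm_axis_scale norm_circle_pt)
    finally show "z + circle_pt r t *s axis i 1 \<in> ball z0 (2 * r)" by simp
  qed
  have c2: "continuous_on (ball z0 r \<times> cbox 0 1) (\<lambda>x. circle_pt r (snd x))"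
    by (rule continuous_on_compose2[OF circle_continuous(1)[of UNIV]]) (auto intro: continuous_intros)
  have c3: "continuous_on (ball z0 r \<times> cbox 0 1) (\<lambda>x. cauchy_kernel r (snd x))"
    by (rule continuous_on_compose2[OF circle_continuous(2)[OF r, of UNIV]]) (auto intro: continuous_intros)
  have c1: "continuous_on (ball z0 r \<times> cbox 0 1) (\<lambda>x. circle_pt r (snd x) *s (axis i 1 :: complex ^ 'a))"
    by (rule continuous_on_compose2[OF linear_continuous_on[OF bounded_linear_scale_axis] c2]) auto
  have "continuous_on (ball z0 r \<times> cbox 0 1) (\<lambda>x. fst x + circle_pt r (snd x) *s axis i 1)"
    by (intro continuous_intros c1)
  then have "continuous_on (ball z0 r \<times> cbox 0 1) (\<lambda>x. G (fst x + circle_pt r (snd x) *s axis i 1))"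
    by (rule continuous_on_compose2[OF G]) (use inV in auto)
  then show "continuous_on (ball z0 r \<times> cbox 0 1) (\<lambda>(z, t). G (z + circle_pt r t *s axis i 1) * cauchy_kernel r t)"
    unfolding split_beta by (intro continuous_intros c3)
qed

text \<open>
  Functions are only assumed to be complex differentiable, so the continuity of the partial derivatives
  has to be extracted from Cauchy's formula.
\<close>
lemma pd_continuous:
  assumes F: "holomorphic_Cn F V" and V: "open V"
  shows "continuous_on V (pd i F)"
proof -
  have "\<exists>S. open S \<and> z0 \<in> S \<and> continuous_on S (pd i F)" if z0: "z0 \<in> V" for z0
  proof -
    obtain e where e: "e > 0" "ball z0 e \<subseteq> V" using V z0 by (metis open_contains_ball)
    define r where "r = e / 3"
    have r: "r > 0" "ball z0 (3 * r) \<subseteq> V" "ball z0 (2 * r) \<subseteq> V" using e subset_ball[of "2 * r" e z0] by (auto simp: r_def)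
    have "continuous_on (ball z0 r) (\<lambda>z. integral (cbox 0 1) (\<lambda>t. F (z + circle_pt r t *s axis i 1) * cauchy_kernel r t))"
      by (rule integral_continuous_on_param shifted_integrand_continuous holomorphic_Cn_continuous F r)+
    moreover have eq: "pd i F z = integral (cbox 0 1) (\<lambda>t. F (z + circle_pt r t *s axis i 1) * cauchy_kernel r t)"
      if "z \<in> ball z0 r" for z
    proof (rule pd_cauchy[OF F])
      show "ball z (2 * r) \<subseteq> V"
      proof
        fix x assume "x \<in> ball z (2 * r)"
        then have "dist z0 x < 3 * r" using that dist_triangle[of z0 x z] by simp
        then show "x \<in> V" using r(2) by auto
      qed
    qed (use r in auto)
    have "continuous_on (ball z0 r) (pd i F) \<longleftrightarrow>
        continuous_on (ball z0 r) (\<lambda>z. integral (cbox 0 1) (\<lambda>t. F (z + circle_pt r t *s axis i 1) * cauchy_kernel r t))"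
      by (rule continuous_on_cong[OF refl eq])
    ultimately have "continuous_on (ball z0 r) (pd i F)" by (simp only:)
    then show ?thesis using r by (intro exI[of _ "ball z0 r"]) auto
  qed
  then have "isCont (pd i F) z0" if "z0 \<in> V" for z0
    using that continuous_on_eq_continuous_at by blast
  then show ?thesis by (simp add: continuous_at_imp_continuous_on)
qed

text \<open>
  Differentiating Cauchy's formula under the integral, with continuous partial derivatives at hand, shows
  that \<open>pd i F\<close> is differentiable, and that its derivative in direction \<open>k\<close> is Cauchy's formula for the
  \<open>i\<close>-th derivative of \<open>pd k F\<close>. Hence the symmetry.
\<close>
lemma pd_holomorphic:
  assumes F: "holomorphic_Cn F V" and V: "open V"
  shows "holomorphic_Cn (pd i F) V" and "z0 \<in> V \<Longrightarrow> pd k (pd i F) z0 = pd i (pd k F) z0"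
proof -
  have ex: "\<exists>a. (pd i F has_derivative (\<lambda>v. \<Sum>k\<in>UNIV. v $ k * a k)) (at z0) \<and>
      (\<exists>r s. 0 < r \<and> r < s \<and> ball z0 s \<subseteq> V \<and> (\<forall>k. a k = integral (cbox 0 1) (\<lambda>t. pd k F (z0 + circle_pt r t *s axis i 1) * cauchy_kernel r t)))"
    if z0: "z0 \<in> V" for z0 i
  proof -
    obtain e where e: "e > 0" "ball z0 e \<subseteq> V" using V z0 by (metis open_contains_ball)
    define r where "r = e / 3"
    have r: "r > 0" "ball z0 (3 * r) \<subseteq> V" "ball z0 (2 * r) \<subseteq> V" using e subset_ball[of "2 * r" e z0] by (auto simp: r_def)
    let ?U = "ball z0 r"
    define D where "D z t v = (\<Sum>k\<in>UNIV. v $ k * (pd k F (z + circle_pt r t *s axis i 1) * cauchy_kernel r t))" for z t v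
    have bl: "bounded_linear (D z t)" for z t
      unfolding D_def by (intro bounded_linear_sum bounded_linear_mult_const bounded_linear_vec_nth)
    define fx where "fx z t = Blinfun (D z t)" for z t
    have fx: "blinfun_apply (fx z t) = D z t" for z t
      unfolding fx_def by (rule bounded_linear_Blinfun_apply[OF bl])
    have cont: "continuous_on (?U \<times> cbox 0 1) (\<lambda>(z, t). F (z + circle_pt r t *s axis i 1) * cauchy_kernel r t)"
      by (rule shifted_integrand_continuous holomorphic_Cn_continuous F r)+
    have cont_pd: "continuous_on (?U \<times> cbox 0 1) (\<lambda>(z, t). pd k F (z + circle_pt r t *s axis i 1) * cauchy_kernel r t)" for k
      by (rule shifted_integrand_continuous pd_continuous[OF F V] r)+
    have cont_fx: "continuous_on (?U \<times> cbox 0 1) (\<lambda>(z, t). fx z t)"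
    proof (rule continuous_on_blinfun_componentwise)
      fix b :: "complex ^ 'a"
      show "continuous_on (?U \<times> cbox 0 1) (\<lambda>x. blinfun_apply (case x of (z, t) \<Rightarrow> fx z t) b)"
        unfolding split_beta fx D_def
        by (intro continuous_on_sum continuous_on_mult_left cont_pd[unfolded split_beta])
    qed
    have der: "((\<lambda>z. integral (cbox 0 1) (\<lambda>t. F (z + circle_pt r t *s axis i 1) * cauchy_kernel r t))
        has_derivative blinfun_apply (integral (cbox 0 1) (fx z0))) (at z0 within ?U)"
    proof (rule leibniz_rule)
      fix z t assume z: "z \<in> ?U"
      have "(F has_derivative (\<lambda>v. \<Sum>k\<in>UNIV. v $ k * pd k F (z + circle_pt r t *s axis i 1))) (at (z + circle_pt r t *s axis i 1))"
        by (rule holomorphic_Cn_derivative[OF F shifted_integrand_continuous(2)[OF holomorphic_Cn_continuous[OF F] r(3,1) z]])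
      then have "((\<lambda>z. F (z + circle_pt r t *s axis i 1)) has_derivative (\<lambda>v. \<Sum>k\<in>UNIV. v $ k * pd k F (z + circle_pt r t *s axis i 1))) (at z)"
        by (rule has_derivative_compose[rotated]) (auto intro!: derivative_eq_intros)
      from has_derivative_mult_left[OF this, of "cauchy_kernel r t"]
      show "((\<lambda>z. F (z + circle_pt r t *s axis i 1) * cauchy_kernel r t) has_derivative blinfun_apply (fx z t)) (at z within ?U)"
        unfolding fx D_def by (simp add: sum_distrib_right mult.assoc has_derivative_at_withinI)
    next
      fix z assume z: "z \<in> ?U"
      have "continuous_on (cbox 0 1) (\<lambda>t. (\<lambda>(z, t). F (z + circle_pt r t *s axis i 1) * cauchy_kernel r t) (z, t))"
        by (rule continuous_on_compose2[OF cont]) (use z in \<open>auto intro!: continuous_intros\<close>)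
      then show "(\<lambda>t. F (z + circle_pt r t *s axis i 1) * cauchy_kernel r t) integrable_on cbox 0 1"
        by (intro integrable_continuous) (simp only: prod.case)
    qed (use cont_fx r in auto)
    have int_fx: "fx z0 integrable_on cbox 0 1"
    proof (rule integrable_continuous)
      have "continuous_on (cbox 0 1) (\<lambda>t. (\<lambda>(z, t). fx z t) (z0, t))"
        by (rule continuous_on_compose2[OF cont_fx]) (use r in \<open>auto intro!: continuous_intros\<close>)
      then show "continuous_on (cbox 0 1) (fx z0)" by simp
    qed
    define a where "a k = integral (cbox 0 1) (\<lambda>t. pd k F (z0 + circle_pt r t *s axis i 1) * cauchy_kernel r t)" for k
    have int_pd: "(\<lambda>t. pd k F (z0 + circle_pt r t *s axis i 1) * cauchy_kernel r t) integrable_on cbox 0 1" for k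
    proof (rule integrable_continuous)
      have "continuous_on (cbox 0 1) (\<lambda>t. (\<lambda>(z, t). pd k F (z + circle_pt r t *s axis i 1) * cauchy_kernel r t) (z0, t))"
        by (rule continuous_on_compose2[OF cont_pd]) (use r in \<open>auto intro!: continuous_intros\<close>)
      then show "continuous_on (cbox 0 1) (\<lambda>t. pd k F (z0 + circle_pt r t *s axis i 1) * cauchy_kernel r t)" by simp
    qed
    have app: "blinfun_apply (integral (cbox 0 1) (fx z0)) = (\<lambda>v. \<Sum>k\<in>UNIV. v $ k * a k)"
    proof
      fix v
      have "blinfun_apply (integral (cbox 0 1) (fx z0)) v = integral (cbox 0 1) (\<lambda>t. \<Sum>k\<in>UNIV. v $ k * (pd k F (z0 + circle_pt r t *s axis i 1) * cauchy_kernel r t))"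
        by (simp only: blinfun_apply_integral[OF int_fx] fx D_def)
      also have "\<dots> = (\<Sum>k\<in>UNIV. integral (cbox 0 1) (\<lambda>t. v $ k * (pd k F (z0 + circle_pt r t *s axis i 1) * cauchy_kernel r t)))"
        by (rule integral_sum) (use int_pd in \<open>auto intro: integrable_on_mult_right\<close>)
      finally show "blinfun_apply (integral (cbox 0 1) (fx z0)) v = (\<Sum>k\<in>UNIV. v $ k * a k)" by (simp add: a_def)
    qed
    have "pd i F z = integral (cbox 0 1) (\<lambda>t. F (z + circle_pt r t *s axis i 1) * cauchy_kernel r t)" if "z \<in> ?U" for z
    proof (rule pd_cauchy[OF F])
      show "ball z (2 * r) \<subseteq> V"
      proof
        fix x assume "x \<in> ball z (2 * r)"
        then have "dist z0 x < 3 * r" using that dist_triangle[of z0 x z] by simp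
        then show "x \<in> V" using r(2) by auto
      qed
    qed (use r in auto)
    then have "(pd i F has_derivative (\<lambda>v. \<Sum>k\<in>UNIV. v $ k * a k)) (at z0)"
      using der r unfolding app
      by (subst at_within_open[symmetric, of z0 ?U]) (auto intro: has_derivative_transform[rotated 2])
    then show ?thesis using r a_def by (intro exI[of _ a] conjI exI[of _ r] exI[of _ "2 * r"]) auto
  qed
  show hol: "holomorphic_Cn (pd i F) V" for i
    unfolding holomorphic_Cn_def
  proof
    fix z assume "z \<in> V"
    then obtain a where "(pd i F has_derivative (\<lambda>v. \<Sum>k\<in>UNIV. v $ k * a k)) (at z)" using ex[of z i] by blast
    then show "\<exists>F'. (pd i F has_derivative F') (at z) \<and> (\<forall>c v. F' (c *s v) = c * F' v)"
      by (intro exI[of _ "\<lambda>v. \<Sum>k\<in>UNIV. v $ k * a k"]) (simp add: sum_distrib_left mult.assoc)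
  qed
  show "pd k (pd i F) z0 = pd i (pd k F) z0" if z0: "z0 \<in> V"
  proof -
    obtain a r s where a: "(pd i F has_derivative (\<lambda>v. \<Sum>k\<in>UNIV. v $ k * a k)) (at z0)"
      "0 < r" "r < s" "ball z0 s \<subseteq> V"
      "\<And>k. a k = integral (cbox 0 1) (\<lambda>t. pd k F (z0 + circle_pt r t *s axis i 1) * cauchy_kernel r t)"
      using ex[OF z0, of i] by blast
    have "pd k (pd i F) z0 = a k" by (rule pd_unique[OF a(1)])
    also have "\<dots> = pd i (pd k F) z0" unfolding a(5) by (rule pd_cauchy[OF hol a(4) a(2,3), symmetric])
    finally show ?thesis .
  qed
qed

section \<open>Germs of holomorphic functions\<close>

locale manifold_at =
  fixes X :: "'a topology" and A :: "('a, 'n::finite) chart set" and p :: 'a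
  assumes manifold: "complex_manifold X A" and p: "p \<in> topspace X"
begin

lemma chart_facts:
  assumes "(U, \<phi>) \<in> A"
  shows "openin X U" "U \<subseteq> topspace X" "open (\<phi> ` U)" "inj_on \<phi> U"
    "homeomorphic_map (subtopology X U) (top_of_set (\<phi> ` U)) \<phi>"
proof -
  have c: "complex_chart X (U, \<phi>)" using manifold assms by (auto simp: complex_manifold_def)
  then show U: "openin X U" and "open (\<phi> ` U)" and h: "homeomorphic_map (subtopology X U) (top_of_set (\<phi> ` U)) \<phi>"
    by (auto simp: complex_chart_def)
  show sub: "U \<subseteq> topspace X" using U by (rule openin_subset)
  show "inj_on \<phi> U" using homeomorphic_imp_injective_map[OF h] sub by (simp add: Int_absorb1)
qed

lemma inv_chart [simp]: "(U, \<phi>) \<in> A \<Longrightarrow> x \<in> U \<Longrightarrow> inv_into U \<phi> (\<phi> x) = x"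
  using chart_facts(4) by simp

lemma open_chart_image:
  assumes "(U, \<phi>) \<in> A" "openin X W" shows "open (\<phi> ` (U \<inter> W))"
proof -
  note c = chart_facts[OF assms(1)]
  have "openin X (U \<inter> W)" using c(1) assms(2) by (rule openin_Int)
  then have "openin (subtopology X U) (U \<inter> W)" using c(1) by (simp add: openin_open_subtopology)
  then have "openin (top_of_set (\<phi> ` U)) (\<phi> ` (U \<inter> W))"
    using homeomorphic_map_openness_eq[OF c(5)] by blast
  then show ?thesis using c(3) by (simp add: openin_open_eq)
qed

lemma open_chart_vimage:
  assumes "(U, \<phi>) \<in> A" "open V" shows "openin X {x \<in> U. \<phi> x \<in> V}"
proof -
  note c = chart_facts[OF assms(1)]
  have "openin (top_of_set (\<phi> ` U)) (\<phi> ` U \<inter> V)" using assms(2) by (rule openin_open_Int)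
  then have "openin (subtopology X U) {x \<in> topspace (subtopology X U). \<phi> x \<in> \<phi> ` U \<inter> V}"
    by (rule openin_continuous_map_preimage[OF homeomorphic_imp_continuous_map[OF c(5)]])
  moreover have "{x \<in> topspace (subtopology X U). \<phi> x \<in> \<phi> ` U \<inter> V} = {x \<in> U. \<phi> x \<in> V}"
    using c(2) by auto
  ultimately show ?thesis using c(1) by (simp add: openin_open_subtopology)
qed

lemma eventually_chart:
  assumes "(U, \<phi>) \<in> A" "q \<in> U"
  shows "eventually P (nhdsin X q) \<longleftrightarrow> eventually (\<lambda>z. P (inv_into U \<phi> z)) (nhds (\<phi> q))"
proof
  assume "eventually P (nhdsin X q)"
  then obtain S where S: "openin X S" "q \<in> S" "\<And>x. x \<in> S \<Longrightarrow> P x"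
    using assms chart_facts(2)[OF assms(1)] by (auto simp: eventually_nhdsin)
  have "P (inv_into U \<phi> z)" if "z \<in> \<phi> ` (U \<inter> S)" for z using that S(3) assms(1) by auto
  moreover have "\<phi> q \<in> \<phi> ` (U \<inter> S)" using assms S by auto
  ultimately show "eventually (\<lambda>z. P (inv_into U \<phi> z)) (nhds (\<phi> q))"
    using open_chart_image[OF assms(1) S(1)] unfolding eventually_nhds by blast
next
  assume "eventually (\<lambda>z. P (inv_into U \<phi> z)) (nhds (\<phi> q))"
  then obtain V where V: "open V" "\<phi> q \<in> V" "\<And>z. z \<in> V \<Longrightarrow> P (inv_into U \<phi> z)"
    by (auto simp: eventually_nhds)
  have "P x" if "x \<in> {x \<in> U. \<phi> x \<in> V}" for x using that V(3)[of "\<phi> x"] assms(1) by auto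
  moreover have "q \<in> {x \<in> U. \<phi> x \<in> V}" using assms V by simp
  ultimately show "eventually P (nhdsin X q)"
    using open_chart_vimage[OF assms(1) V(1)] unfolding eventually_nhdsin by blast
qed

lemma transition_holomorphic:
  assumes c: "(U, \<phi>) \<in> A" and c': "(U', \<phi>') \<in> A"
  shows "holomorphic_Cn (\<lambda>z. \<phi>' (inv_into U \<phi> z) $ k) (\<phi> ` (U \<inter> U'))"
proof -
  have all: "\<forall>(U, \<phi>)\<in>A. \<forall>(V, \<psi>)\<in>A. \<forall>i. holomorphic_Cn (\<lambda>z. \<psi> (inv_into U \<phi> z) $ i) (\<phi> ` (U \<inter> V))"
    using manifold by (simp add: complex_manifold_def)
  from bspec[OF all c]
  have "\<forall>(V, \<psi>)\<in>A. \<forall>i. holomorphic_Cn (\<lambda>z. \<psi> (inv_into U \<phi> z) $ i) (\<phi> ` (U \<inter> V))" by simp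
  from bspec[OF this c'] show ?thesis by simp
qed

definition hol :: "('a \<Rightarrow> complex) \<Rightarrow> bool" where
  "hol g \<longleftrightarrow> (\<exists>W. p \<in> W \<and> holomorphic_fun X A g W)"

abbreviation in_chart :: "'a set \<Rightarrow> ('a \<Rightarrow> complex ^ 'n) \<Rightarrow> ('a \<Rightarrow> complex) \<Rightarrow> complex ^ 'n \<Rightarrow> complex" where
  "in_chart U \<phi> g \<equiv> \<lambda>z. g (inv_into U \<phi> z)"

lemma hol_in_chart:
  assumes c: "(U, \<phi>) \<in> A" and pU: "p \<in> U"
  shows "hol g \<longleftrightarrow> (\<exists>V. open V \<and> \<phi> p \<in> V \<and> V \<subseteq> \<phi> ` U \<and> holomorphic_Cn (in_chart U \<phi> g) V)"
proof
  assume "hol g"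
  then obtain W where W: "p \<in> W" "openin X W" "holomorphic_Cn (in_chart U \<phi> g) (\<phi> ` (U \<inter> W))"
    using c by (auto simp: hol_def holomorphic_fun_def)
  then show "\<exists>V. open V \<and> \<phi> p \<in> V \<and> V \<subseteq> \<phi> ` U \<and> holomorphic_Cn (in_chart U \<phi> g) V"
    using open_chart_image[OF c W(2)] pU by (intro exI[of _ "\<phi> ` (U \<inter> W)"]) auto
next
  assume "\<exists>V. open V \<and> \<phi> p \<in> V \<and> V \<subseteq> \<phi> ` U \<and> holomorphic_Cn (in_chart U \<phi> g) V"
  then obtain V where V: "open V" "\<phi> p \<in> V" "V \<subseteq> \<phi> ` U" "holomorphic_Cn (in_chart U \<phi> g) V" by blast
  define W where "W = {x \<in> U. \<phi> x \<in> V}"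
  have W: "openin X W" "p \<in> W" using open_chart_vimage[OF c V(1)] pU V(2) by (auto simp: W_def)
  have "holomorphic_Cn (in_chart U' \<phi>' g) (\<phi>' ` (U' \<inter> W))" if c': "(U', \<phi>') \<in> A" for U' \<phi>'
  proof (rule holomorphic_Cn_transform)
    show "open (\<phi>' ` (U' \<inter> W))" by (rule open_chart_image[OF c' W(1)])
    have sub: "\<phi>' ` (U' \<inter> W) \<subseteq> \<phi>' ` (U' \<inter> U)" by (auto simp: W_def)
    have T: "holomorphic_Cn (\<lambda>z. \<phi> (inv_into U' \<phi>' z) $ k) (\<phi>' ` (U' \<inter> W))" for k
      by (rule holomorphic_Cn_subset[OF transition_holomorphic[OF c' c] sub])
    have im: "(\<lambda>z. \<phi> (inv_into U' \<phi>' z)) ` \<phi>' ` (U' \<inter> W) \<subseteq> V"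
      using c' by (auto simp: W_def)
    show "holomorphic_Cn (\<lambda>z. in_chart U \<phi> g (\<phi> (inv_into U' \<phi>' z))) (\<phi>' ` (U' \<inter> W))"
      by (rule holomorphic_Cn_compose(1)[OF V(4) T im])
    fix z assume "z \<in> \<phi>' ` (U' \<inter> W)"
    then show "in_chart U \<phi> g (\<phi> (inv_into U' \<phi>' z)) = in_chart U' \<phi>' g z"
      using c c' by (auto simp: W_def)
  qed
  then show "hol g" unfolding hol_def holomorphic_fun_def using W by auto
qed

lemma chart_at_p: obtains U \<phi> where "(U, \<phi>) \<in> A" "p \<in> U"
proof -
  have "p \<in> (\<Union>c\<in>A. fst c)" using manifold p by (simp add: complex_manifold_def)
  then show ?thesis using that by auto
qed

abbreviation germ where "germ \<equiv> germ_at X p"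
abbreviation Op where "Op \<equiv> O_stalk X A p"
abbreviation germ_times (infixl "\<otimes>\<^sub>p" 70) where "a \<otimes>\<^sub>p b \<equiv> a \<otimes>\<^bsub>Op\<^esub> b"
abbreviation germ_plus (infixl "\<oplus>\<^sub>p" 65) where "a \<oplus>\<^sub>p b \<equiv> a \<oplus>\<^bsub>Op\<^esub> b"
abbreviation zero_germ ("\<zero>\<^sub>p") where "\<zero>\<^sub>p \<equiv> \<zero>\<^bsub>Op\<^esub>"
abbreviation one_germ ("\<one>\<^sub>p") where "\<one>\<^sub>p \<equiv> \<one>\<^bsub>Op\<^esub>"

lemma germ_eq_iff: "germ g = germ h \<longleftrightarrow> eventually (\<lambda>x. g x = h x) (nhdsin X p)"
proof
  assume "germ g = germ h"
  moreover have "g \<in> germ g" by (simp add: germ_at_def)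
  ultimately show "eventually (\<lambda>x. g x = h x) (nhdsin X p)" by (simp add: germ_at_def)
next
  assume gh: "eventually (\<lambda>x. g x = h x) (nhdsin X p)"
  have "eventually (\<lambda>x. k x = g x) (nhdsin X p) \<longleftrightarrow> eventually (\<lambda>x. k x = h x) (nhdsin X p)" for k
  proof
    assume "eventually (\<lambda>x. k x = g x) (nhdsin X p)"
    with gh show "eventually (\<lambda>x. k x = h x) (nhdsin X p)" by eventually_elim simp
  next
    assume "eventually (\<lambda>x. k x = h x) (nhdsin X p)"
    with gh show "eventually (\<lambda>x. k x = g x) (nhdsin X p)" by eventually_elim simp
  qed
  then show "germ g = germ h" by (simp add: germ_at_def)
qed

lemma rep_germ: "eventually (\<lambda>x. rep (germ g) x = g x) (nhdsin X p)"
proof -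
  have "g \<in> germ g" by (simp add: germ_at_def)
  then have "rep (germ g) \<in> germ g" unfolding rep_def by (rule someI[of "\<lambda>x. x \<in> germ g"])
  then show ?thesis by (simp add: germ_at_def)
qed

lemma carrier_Op: "a \<in> carrier Op \<longleftrightarrow> (\<exists>g. hol g \<and> a = germ g)"
  by (auto simp: O_stalk_def hol_def)

lemma carrier_OpE: "a \<in> carrier Op \<Longrightarrow> (\<And>g. hol g \<Longrightarrow> a = germ g \<Longrightarrow> thesis) \<Longrightarrow> thesis"
  unfolding carrier_Op by blast

lemma germ_carrier [simp]: "hol g \<Longrightarrow> germ g \<in> carrier Op"
  unfolding carrier_Op by blast

lemma germ_mult: "germ g \<otimes>\<^sub>p germ h = germ (\<lambda>x. g x * h x)"
proof -
  have "eventually (\<lambda>x. rep (germ g) x * rep (germ h) x = g x * h x) (nhdsin X p)"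
    using rep_germ[of g] rep_germ[of h] by eventually_elim simp
  then show ?thesis by (simp add: O_stalk_def germ_eq_iff)
qed

lemma germ_add: "germ g \<oplus>\<^sub>p germ h = germ (\<lambda>x. g x + h x)"
proof -
  have "eventually (\<lambda>x. rep (germ g) x + rep (germ h) x = g x + h x) (nhdsin X p)"
    using rep_germ[of g] rep_germ[of h] by eventually_elim simp
  then show ?thesis by (simp add: O_stalk_def germ_eq_iff)
qed

lemma germ_one: "\<one>\<^sub>p = germ (\<lambda>_. 1)" and germ_zero: "\<zero>\<^sub>p = germ (\<lambda>_. 0)"
  by (simp_all add: O_stalk_def)

lemma hol_pair:
  assumes "hol g" "hol h" "(U, \<phi>) \<in> A" "p \<in> U"
  obtains V where "open V" "\<phi> p \<in> V" "V \<subseteq> \<phi> ` U" "holomorphic_Cn (in_chart U \<phi> g) V" "holomorphic_Cn (in_chart U \<phi> h) V"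
proof -
  obtain V where V: "open V" "\<phi> p \<in> V" "V \<subseteq> \<phi> ` U" "holomorphic_Cn (in_chart U \<phi> g) V"
    using assms(1) unfolding hol_in_chart[OF assms(3,4)] by blast
  obtain V' where V': "open V'" "\<phi> p \<in> V'" "V' \<subseteq> \<phi> ` U" "holomorphic_Cn (in_chart U \<phi> h) V'"
    using assms(2) unfolding hol_in_chart[OF assms(3,4)] by blast
  show ?thesis
    by (rule that[of "V \<inter> V'"])
      (use V V' holomorphic_Cn_subset[OF V(4), of "V \<inter> V'"] holomorphic_Cn_subset[OF V'(4), of "V \<inter> V'"] in auto)
qed

lemma hol_const: "hol (\<lambda>_. c)"
proof -
  obtain U \<phi> where c: "(U, \<phi>) \<in> A" "p \<in> U" by (rule chart_at_p)
  show ?thesis unfolding hol_in_chart[OF c]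
    using chart_facts(3)[OF c(1)] c(2) holomorphic_Cn_const(1) by (intro exI[of _ "\<phi> ` U"]) simp
qed

lemma hol_add: "hol g \<Longrightarrow> hol h \<Longrightarrow> hol (\<lambda>x. g x + h x)" and hol_mult: "hol g \<Longrightarrow> hol h \<Longrightarrow> hol (\<lambda>x. g x * h x)"
proof -
  assume gh: "hol g" "hol h"
  obtain U \<phi> where c: "(U, \<phi>) \<in> A" "p \<in> U" by (rule chart_at_p)
  obtain V where V: "open V" "\<phi> p \<in> V" "V \<subseteq> \<phi> ` U" "holomorphic_Cn (in_chart U \<phi> g) V" "holomorphic_Cn (in_chart U \<phi> h) V"
    by (rule hol_pair[OF gh c])
  show "hol (\<lambda>x. g x + h x)" "hol (\<lambda>x. g x * h x)"
    unfolding hol_in_chart[OF c]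
    using V(1-3) holomorphic_Cn_add(1)[OF V(4,5)] holomorphic_Cn_mult(1)[OF V(4,5)] by blast+
qed

lemma cring_Op: "cring Op"
proof (rule cringI)
  show "abelian_group Op"
  proof (rule abelian_groupI)
    fix x assume "x \<in> carrier Op"
    then obtain g where g: "hol g" "x = germ g" unfolding carrier_Op by blast
    have "germ (\<lambda>x. (-1) * g x) \<oplus>\<^sub>p x = \<zero>\<^sub>p" by (simp add: g germ_add germ_zero)
    moreover have "germ (\<lambda>x. (-1) * g x) \<in> carrier Op" by (intro germ_carrier hol_mult hol_const g)
    ultimately show "\<exists>y\<in>carrier Op. y \<oplus>\<^sub>p x = \<zero>\<^sub>p" by blast
  qed (auto elim!: carrier_OpE simp: germ_add germ_zero add_ac intro!: germ_carrier hol_add hol_const)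
  show "comm_monoid Op"
    by (rule comm_monoidI) (auto elim!: carrier_OpE simp: germ_mult germ_one mult_ac intro!: germ_carrier hol_mult hol_const)
qed (auto elim!: carrier_OpE simp: germ_add germ_mult distrib_right)

sublocale O: cring Op by (rule cring_Op)

lemma pd_in_chart:
  assumes c: "(U, \<phi>) \<in> A" and z: "z \<in> \<phi> ` U"
  shows "in_chart U \<phi> (partial_deriv (U, \<phi>) i g) z = pd i (in_chart U \<phi> g) z"
proof -
  from z obtain x where x: "z = \<phi> x" "x \<in> U" by blast
  have "partial_deriv (U, \<phi>) i g x = pd i (in_chart U \<phi> g) (\<phi> x)"
    by (simp add: partial_deriv_def pd_def)
  then show ?thesis unfolding x(1) inv_chart[OF c x(2)] .
qed

lemma hol_partial:
  assumes c: "(U, \<phi>) \<in> A" "p \<in> U" and g: "hol g"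
  shows "hol (partial_deriv (U, \<phi>) i g)"
    and "eventually (\<lambda>z. in_chart U \<phi> (partial_deriv (U, \<phi>) i g) z = pd i (in_chart U \<phi> g) z) (nhds (\<phi> p))"
proof -
  have eq: "in_chart U \<phi> (partial_deriv (U, \<phi>) i g) z = pd i (in_chart U \<phi> g) z" if "z \<in> \<phi> ` U" for z
    by (rule pd_in_chart[OF c(1) that])
  have op: "open (\<phi> ` U)" by (rule chart_facts(3)[OF c(1)])
  show "eventually (\<lambda>z. in_chart U \<phi> (partial_deriv (U, \<phi>) i g) z = pd i (in_chart U \<phi> g) z) (nhds (\<phi> p))"
    unfolding eventually_nhds using op c(2) eq by (intro exI[of _ "\<phi> ` U"]) simp
  obtain V where V: "open V" "\<phi> p \<in> V" "V \<subseteq> \<phi> ` U" "holomorphic_Cn (in_chart U \<phi> g) V"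
    using g unfolding hol_in_chart[OF c] by blast
  have "holomorphic_Cn (in_chart U \<phi> (partial_deriv (U, \<phi>) i g)) V"
    by (rule holomorphic_Cn_transform[OF pd_holomorphic(1)[OF V(4,1)] V(1)]) (use eq V(3) in \<open>auto simp: subset_eq\<close>)
  then show "hol (partial_deriv (U, \<phi>) i g)" unfolding hol_in_chart[OF c] using V by blast
qed

lemma partial_deriv_cong:
  assumes c: "(U, \<phi>) \<in> A" "p \<in> U" and "eventually (\<lambda>x. g x = h x) (nhdsin X p)"
  shows "germ (partial_deriv (U, \<phi>) i g) = germ (partial_deriv (U, \<phi>) i h)"
proof -
  have "eventually (\<lambda>z. in_chart U \<phi> g z = in_chart U \<phi> h z) (nhds (\<phi> p))"
    using assms(3) unfolding eventually_chart[OF c] .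
  then have "eventually (\<lambda>z. pd i (in_chart U \<phi> g) z = pd i (in_chart U \<phi> h) z) (nhds (\<phi> p))"
    by (subst (asm) eventually_eventually[symmetric]) (elim eventually_mono, rule pd_cong)
  moreover have "eventually (\<lambda>z. z \<in> \<phi> ` U) (nhds (\<phi> p))"
    using chart_facts(3)[OF c(1)] c(2) by (intro eventually_nhds_in_open) auto
  ultimately have "eventually (\<lambda>z. partial_deriv (U, \<phi>) i g (inv_into U \<phi> z) = partial_deriv (U, \<phi>) i h (inv_into U \<phi> z)) (nhds (\<phi> p))"
    by eventually_elim (simp add: pd_in_chart[OF c(1)])
  then show ?thesis by (simp only: germ_eq_iff eventually_chart[OF c])
qed

lemma partial_op_germ:
  assumes "(U, \<phi>) \<in> A" "p \<in> U" "hol g"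
  shows "partial_op X A p (U, \<phi>) i (germ g) = germ (partial_deriv (U, \<phi>) i g)"
  using assms partial_deriv_cong[OF assms(1,2) rep_germ] by (simp add: partial_op_def)

lemma germ_partial_eqI:
  assumes c: "(U, \<phi>) \<in> A" "p \<in> U" and g: "hol g"
    and "eventually (\<lambda>z. pd i (in_chart U \<phi> g) z = in_chart U \<phi> h z) (nhds (\<phi> p))"
  shows "partial_op X A p (U, \<phi>) i (germ g) = germ h"
proof -
  have "eventually (\<lambda>z. in_chart U \<phi> (partial_deriv (U, \<phi>) i g) z = in_chart U \<phi> h z) (nhds (\<phi> p))"
    using hol_partial(2)[OF c g, of i] assms(4) by eventually_elim simp
  then show ?thesis
    by (simp only: partial_op_germ[OF c g] germ_eq_iff eventually_chart[OF c])
qed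

lemma partial_op_closed: "(U, \<phi>) \<in> A \<Longrightarrow> p \<in> U \<Longrightarrow> a \<in> carrier Op \<Longrightarrow> partial_op X A p (U, \<phi>) i a \<in> carrier Op"
  by (auto elim!: carrier_OpE simp: partial_op_germ hol_partial(1))

lemma eventually_openI: "open V \<Longrightarrow> z \<in> V \<Longrightarrow> (\<And>w. w \<in> V \<Longrightarrow> P w) \<Longrightarrow> eventually P (nhds z)"
  unfolding eventually_nhds by blast

lemma partial_op_add_mult:
  fixes i :: 'n
  assumes c: "(U, \<phi>) \<in> A" "p \<in> U" and ab: "a \<in> carrier Op" "b \<in> carrier Op"
  defines "D \<equiv> partial_op X A p (U, \<phi>) i"
  shows "D (a \<oplus>\<^sub>p b) = D a \<oplus>\<^sub>p D b" and "D (a \<otimes>\<^sub>p b) = a \<otimes>\<^sub>p D b \<oplus>\<^sub>p D a \<otimes>\<^sub>p b"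
proof -
  obtain g h where gh: "hol g" "a = germ g" "hol h" "b = germ h" using ab unfolding carrier_Op by blast
  obtain V where V: "open V" "\<phi> p \<in> V" "V \<subseteq> \<phi> ` U" "holomorphic_Cn (in_chart U \<phi> g) V" "holomorphic_Cn (in_chart U \<phi> h) V"
    by (rule hol_pair[OF gh(1,3) c])
  have pdg: "in_chart U \<phi> (partial_deriv (U, \<phi>) i k) z = pd i (in_chart U \<phi> k) z" if "z \<in> V" for z k
    by (rule pd_in_chart[OF c(1) subsetD[OF V(3) that]])
  show "D (a \<oplus>\<^sub>p b) = D a \<oplus>\<^sub>p D b"
    unfolding D_def gh germ_add partial_op_germ[OF c gh(1)] partial_op_germ[OF c gh(3)]
    by (intro germ_partial_eqI c hol_add gh eventually_openI[OF V(1,2)])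
       (simp add: pdg holomorphic_Cn_add(2)[OF V(4,5)])
  show "D (a \<otimes>\<^sub>p b) = a \<otimes>\<^sub>p D b \<oplus>\<^sub>p D a \<otimes>\<^sub>p b"
    unfolding D_def gh germ_mult partial_op_germ[OF c gh(1)] partial_op_germ[OF c gh(3)] germ_add
    by (intro germ_partial_eqI c hol_mult gh eventually_openI[OF V(1,2)])
       (simp add: pdg holomorphic_Cn_mult(2)[OF V(4,5)])
qed

lemma partial_op_commute:
  assumes c: "(U, \<phi>) \<in> A" "p \<in> U" and a: "a \<in> carrier Op"
  shows "partial_op X A p (U, \<phi>) i (partial_op X A p (U, \<phi>) k a) = partial_op X A p (U, \<phi>) k (partial_op X A p (U, \<phi>) i a)"
proof -
  obtain g where g: "hol g" "a = germ g" using a unfolding carrier_Op by blast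
  obtain V where V: "open V" "\<phi> p \<in> V" "V \<subseteq> \<phi> ` U" "holomorphic_Cn (in_chart U \<phi> g) V"
    using g(1) unfolding hol_in_chart[OF c] by blast
  have pdg: "in_chart U \<phi> (partial_deriv (U, \<phi>) i h) z = pd i (in_chart U \<phi> h) z" if "z \<in> V" for z i h
    by (rule pd_in_chart[OF c(1) subsetD[OF V(3) that]])
  have pdpd: "pd i (in_chart U \<phi> (partial_deriv (U, \<phi>) k g)) z = pd i (pd k (in_chart U \<phi> g)) z" if "z \<in> V" for z i k
    by (rule pd_cong, rule eventually_openI[OF V(1) that pdg])
  show ?thesis
    unfolding g(2) partial_op_germ[OF c g(1)] partial_op_germ[OF c hol_partial(1)[OF c g(1)]]
    unfolding germ_eq_iff eventually_chart[OF c]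
    by (rule eventually_openI[OF V(1,2)]) (simp add: pdg pdpd pd_holomorphic(2)[OF V(4,1)])
qed

definition coordinate :: "('a \<Rightarrow> complex ^ 'n) \<Rightarrow> 'n \<Rightarrow> 'a germ" where
  "coordinate \<phi> k = germ (\<lambda>x. \<phi> x $ k)"

lemma hol_coordinate:
  assumes c: "(U, \<phi>) \<in> A" "p \<in> U" shows "hol (\<lambda>x. \<phi> x $ k)"
proof -
  have "holomorphic_Cn (in_chart U \<phi> (\<lambda>x. \<phi> x $ k)) (\<phi> ` U)"
    by (rule holomorphic_Cn_transform[OF holomorphic_Cn_coord(1)[of k] chart_facts(3)[OF c(1)]]) (use c in auto)
  then show ?thesis unfolding hol_in_chart[OF c] using chart_facts(3)[OF c(1)] c(2) by blast
qed

lemma partial_coordinate: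
  assumes c: "(U, \<phi>) \<in> A" "p \<in> U"
  shows "partial_op X A p (U, \<phi>) i (coordinate \<phi> k) = (if i = k then \<one>\<^sub>p else \<zero>\<^sub>p)"
proof -
  have "partial_op X A p (U, \<phi>) i (germ (\<lambda>x. \<phi> x $ k)) = germ (\<lambda>_. if i = k then 1 else 0)"
  proof (rule germ_partial_eqI[OF c hol_coordinate[OF c]], rule eventually_openI)
    show "open (\<phi> ` U)" "\<phi> p \<in> \<phi> ` U" using chart_facts(3)[OF c(1)] c(2) by auto
    fix z assume z: "z \<in> \<phi> ` U"
    have "pd i (in_chart U \<phi> (\<lambda>x. \<phi> x $ k)) z = pd i (\<lambda>z. z $ k) z"
      by (rule pd_cong, rule eventually_openI[OF chart_facts(3)[OF c(1)] z]) (use c in auto)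
    then show "pd i (in_chart U \<phi> (\<lambda>x. \<phi> x $ k)) z = (if i = k then 1 else 0)" by (simp add: holomorphic_Cn_coord(2))
  qed
  then show ?thesis by (simp add: coordinate_def germ_one germ_zero)
qed

lemma partial_change_chart:
  assumes c: "(U, \<phi>) \<in> A" "p \<in> U" and c': "(U', \<phi>') \<in> A" "p \<in> U'" and a: "a \<in> carrier Op"
  shows "partial_op X A p (U, \<phi>) i a =
    (\<Oplus>\<^bsub>Op\<^esub>k\<in>UNIV. partial_op X A p (U, \<phi>) i (coordinate \<phi>' k) \<otimes>\<^sub>p partial_op X A p (U', \<phi>') k a)"
proof -
  obtain g where g: "hol g" "a = germ g" using a unfolding carrier_Op by blast
  have germ_sum: "(\<Oplus>\<^bsub>Op\<^esub>k\<in>K. germ (h k)) = germ (\<lambda>x. \<Sum>k\<in>K. h k x)" if "\<And>k. hol (h k)" "finite K" for h :: "'n \<Rightarrow> 'a \<Rightarrow> complex" and K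
    using that(2)
  proof (induction K)
    case (insert k K)
    have "(\<Oplus>\<^bsub>Op\<^esub>k\<in>insert k K. germ (h k)) = germ (h k) \<oplus>\<^sub>p (\<Oplus>\<^bsub>Op\<^esub>k\<in>K. germ (h k))"
      using insert that by (intro O.finsum_insert) auto
    with insert show ?case by (simp add: germ_add)
  qed (simp add: germ_zero)
  have hc: "hol (partial_deriv (U, \<phi>) i (\<lambda>x. \<phi>' x $ k))" "hol (partial_deriv (U', \<phi>') k g)" for k
    by (rule hol_partial(1)[OF c hol_coordinate[OF c']], rule hol_partial(1)[OF c' g(1)])
  have rhs: "(\<Oplus>\<^bsub>Op\<^esub>k\<in>UNIV. partial_op X A p (U, \<phi>) i (coordinate \<phi>' k) \<otimes>\<^sub>p partial_op X A p (U', \<phi>') k a) =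
    germ (\<lambda>x. \<Sum>k\<in>UNIV. partial_deriv (U, \<phi>) i (\<lambda>x. \<phi>' x $ k) x * partial_deriv (U', \<phi>') k g x)"
    unfolding coordinate_def g(2) partial_op_germ[OF c hol_coordinate[OF c']] partial_op_germ[OF c' g(1)] germ_mult
    by (rule germ_sum) (auto intro: hol_mult hc)
  obtain V' where V': "open V'" "\<phi>' p \<in> V'" "V' \<subseteq> \<phi>' ` U'" "holomorphic_Cn (in_chart U' \<phi>' g) V'"
    using g(1) unfolding hol_in_chart[OF c'] by blast
  define W where "W = {x \<in> U'. \<phi>' x \<in> V'}"
  have W: "openin X W" "p \<in> W" using open_chart_vimage[OF c'(1) V'(1)] V'(2) c' by (auto simp: W_def)
  define V where "V = \<phi> ` (U \<inter> W)"
  have V: "open V" "\<phi> p \<in> V" using open_chart_image[OF c(1) W(1)] W c by (auto simp: V_def)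
  define T where "T z = \<phi>' (inv_into U \<phi> z)" for z
  have T: "holomorphic_Cn (\<lambda>z. T z $ k) V" for k
  proof (rule holomorphic_Cn_subset)
    show "holomorphic_Cn (\<lambda>z. T z $ k) (\<phi> ` (U \<inter> U'))"
      unfolding T_def by (rule transition_holomorphic[OF c(1) c'(1)])
    show "V \<subseteq> \<phi> ` (U \<inter> U')" by (auto simp: V_def W_def)
  qed
  have im: "T ` V \<subseteq> V'" using c by (auto simp: T_def V_def W_def)
  show ?thesis
    unfolding rhs unfolding g(2)
  proof (rule germ_partial_eqI[OF c g(1)], rule eventually_openI[OF V])
    fix z assume z: "z \<in> V"
    then obtain x where x: "z = \<phi> x" "x \<in> U" "x \<in> W" by (auto simp: V_def)
    have eq: "in_chart U \<phi> g w = in_chart U' \<phi>' g (T w)" if "w \<in> V" for w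
      using that c c' by (auto simp: T_def V_def W_def)
    have "pd i (in_chart U \<phi> g) z = pd i (\<lambda>w. in_chart U' \<phi>' g (T w)) z"
      by (rule pd_cong, rule eventually_openI[OF V(1) z eq])
    also have "\<dots> = (\<Sum>k\<in>UNIV. pd i (\<lambda>w. T w $ k) z * pd k (in_chart U' \<phi>' g) (T z))"
      by (rule holomorphic_Cn_compose(2)[OF V'(4) T im z])
    also have "\<dots> = (\<Sum>k\<in>UNIV. partial_deriv (U, \<phi>) i (\<lambda>x. \<phi>' x $ k) x * partial_deriv (U', \<phi>') k g x)"
      using x c c' by (simp add: T_def partial_deriv_def pd_def)
    finally show "pd i (in_chart U \<phi> g) z = in_chart U \<phi> (\<lambda>x. \<Sum>k\<in>UNIV. partial_deriv (U, \<phi>) i (\<lambda>x. \<phi>' x $ k) x * partial_deriv (U', \<phi>') k g x) z"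
      using x c by simp
  qed
qed

lemma one_neq_zero_Op: "\<one>\<^sub>p \<noteq> \<zero>\<^sub>p"
  unfolding germ_one germ_zero germ_eq_iff eventually_nhdsin using p by auto

end

section \<open>Endomorphism rings\<close>

lemma (in abelian_group) ring_End: "Ring.ring (End_ring G)"
proof -
  let ?E = "End_ring G"
  have hom: "P \<in> carrier ?E \<longleftrightarrow> P \<in> extensional (carrier G) \<and> (\<forall>x\<in>carrier G. P x \<in> carrier G) \<and>
      (\<forall>x\<in>carrier G. \<forall>y\<in>carrier G. P (x \<oplus> y) = P x \<oplus> P y)" for P
    by (auto simp: End_ring_def hom_def)
  have P0: "P \<zero> = \<zero>" if "P \<in> carrier ?E" for P
    using that unfolding hom by (metis zero_closed r_zero add.r_cancel_one)
  note ext = extensionalityI[of _ "carrier G"]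
  show ?thesis
  proof (rule ringI)
    show "abelian_group ?E"
    proof (rule abelian_groupI)
      fix P assume P: "P \<in> carrier ?E"
      let ?N = "\<lambda>x\<in>carrier G. \<ominus> P x"
      have "?N \<in> carrier ?E" using P by (auto simp: hom minus_add)
      moreover have "?N \<oplus>\<^bsub>?E\<^esub> P = \<zero>\<^bsub>?E\<^esub>"
        using P unfolding hom by (auto simp: End_ring_def l_neg intro!: restrict_ext)
      ultimately show "\<exists>Q\<in>carrier ?E. Q \<oplus>\<^bsub>?E\<^esub> P = \<zero>\<^bsub>?E\<^esub>" by blast
    next
      fix P Q assume PQ: "P \<in> carrier ?E" "Q \<in> carrier ?E"
      then show "P \<oplus>\<^bsub>?E\<^esub> Q \<in> carrier ?E" unfolding hom by (auto simp: End_ring_def a_ac)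
      show "P \<oplus>\<^bsub>?E\<^esub> Q = Q \<oplus>\<^bsub>?E\<^esub> P" using PQ unfolding hom by (auto simp: End_ring_def a_comm intro!: restrict_ext)
    next
      show "\<zero>\<^bsub>?E\<^esub> \<in> carrier ?E" unfolding hom by (auto simp: End_ring_def)
    next
      fix P Q S assume "P \<in> carrier ?E" "Q \<in> carrier ?E" "S \<in> carrier ?E"
      then show "(P \<oplus>\<^bsub>?E\<^esub> Q) \<oplus>\<^bsub>?E\<^esub> S = P \<oplus>\<^bsub>?E\<^esub> (Q \<oplus>\<^bsub>?E\<^esub> S)"
        unfolding hom by (auto simp: End_ring_def a_assoc intro!: restrict_ext)
    next
      fix P assume "P \<in> carrier ?E"
      then show "\<zero>\<^bsub>?E\<^esub> \<oplus>\<^bsub>?E\<^esub> P = P" unfolding hom by (intro ext) (auto simp: End_ring_def)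
    qed
    show "Group.monoid ?E"
    proof (rule monoidI)
      fix P Q assume "P \<in> carrier ?E" "Q \<in> carrier ?E"
      then show "P \<otimes>\<^bsub>?E\<^esub> Q \<in> carrier ?E" unfolding hom by (auto simp: End_ring_def compose_def)
    next
      show "\<one>\<^bsub>?E\<^esub> \<in> carrier ?E" unfolding hom by (auto simp: End_ring_def)
    next
      fix P Q S assume "P \<in> carrier ?E" "Q \<in> carrier ?E" "S \<in> carrier ?E"
      then show "(P \<otimes>\<^bsub>?E\<^esub> Q) \<otimes>\<^bsub>?E\<^esub> S = P \<otimes>\<^bsub>?E\<^esub> (Q \<otimes>\<^bsub>?E\<^esub> S)"
        unfolding hom by (auto simp: End_ring_def compose_def intro!: restrict_ext)
    next
      fix P assume "P \<in> carrier ?E"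
      then show "\<one>\<^bsub>?E\<^esub> \<otimes>\<^bsub>?E\<^esub> P = P" "P \<otimes>\<^bsub>?E\<^esub> \<one>\<^bsub>?E\<^esub> = P" unfolding hom by (auto simp: End_ring_def compose_def intro!: ext)
    qed
  next
    fix P Q S assume "P \<in> carrier ?E" "Q \<in> carrier ?E" "S \<in> carrier ?E"
    then show "(P \<oplus>\<^bsub>?E\<^esub> Q) \<otimes>\<^bsub>?E\<^esub> S = P \<otimes>\<^bsub>?E\<^esub> S \<oplus>\<^bsub>?E\<^esub> Q \<otimes>\<^bsub>?E\<^esub> S"
      "S \<otimes>\<^bsub>?E\<^esub> (P \<oplus>\<^bsub>?E\<^esub> Q) = S \<otimes>\<^bsub>?E\<^esub> P \<oplus>\<^bsub>?E\<^esub> S \<otimes>\<^bsub>?E\<^esub> Q"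
      unfolding hom by (auto simp: End_ring_def compose_def intro!: restrict_ext)
  qed
qed

lemma ring_embeddingI:
  fixes R :: "('d, 'x) ring_scheme" (structure) and j :: "'d \<Rightarrow> 'r::ring_1"
  assumes inj: "inj_on j (carrier R)"
    and closed: "\<zero> \<in> carrier R" "\<one> \<in> carrier R" "\<And>x y. \<lbrakk>x \<in> carrier R; y \<in> carrier R\<rbrakk> \<Longrightarrow> x \<oplus> y \<in> carrier R"
      "\<And>x y. \<lbrakk>x \<in> carrier R; y \<in> carrier R\<rbrakk> \<Longrightarrow> x \<otimes> y \<in> carrier R"
      "\<And>x. x \<in> carrier R \<Longrightarrow> \<exists>y\<in>carrier R. j y = - j x"
    and j: "j \<zero> = 0" "\<And>x. x \<in> carrier R \<Longrightarrow> j \<one> * j x = j x" "\<And>x. x \<in> carrier R \<Longrightarrow> j x * j \<one> = j x"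
      "\<And>x y. \<lbrakk>x \<in> carrier R; y \<in> carrier R\<rbrakk> \<Longrightarrow> j (x \<oplus> y) = j x + j y"
      "\<And>x y. \<lbrakk>x \<in> carrier R; y \<in> carrier R\<rbrakk> \<Longrightarrow> j (x \<otimes> y) = j x * j y"
  shows "ring_embedding R j"
proof -
  note eq = inj_onD[OF inj]
  have "Ring.ring R"
  proof (rule ringI)
    show "abelian_group R"
    proof (rule abelian_groupI)
      fix x assume x: "x \<in> carrier R"
      from bexE[OF closed(5)[OF x]] obtain y where y: "y \<in> carrier R" "j y = - j x" .
      have "y \<oplus> x = \<zero>" by (rule eq) (simp_all add: x y closed j)
      then show "\<exists>y\<in>carrier R. y \<oplus> x = \<zero>" using y by blast
    qed (rule closed eq; simp add: closed j add_ac)+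
    show "Group.monoid R"
      by (rule monoidI) (rule closed eq; simp add: closed j mult.assoc)+
  qed (rule eq; simp add: closed j algebra_simps)+
  then show ?thesis
    by (intro ring_embedding.intro ring_embedding_axioms.intro inj j)
qed

section \<open>Abstract rings of differential operators\<close>

text \<open>
  Differential operators in a frame of commuting fields \<open>X\<^sub>i\<close> over a commutative ring \<open>B\<close> of functions. The
  predicate \<open>diffop k\<close> is the order filtration; its closure rules are those of left multiplication, which is
  what inductions need. The comparison with combinations of words in the \<open>X\<^sub>i\<close> is \<open>diffop_iff_words\<close>.
\<close>
locale diffops =
  fixes e :: "'r::ring_1" and B :: "'r set" and X :: "'n::finite \<Rightarrow> 'r"
  assumes B_e: "e \<in> B" and B_plus: "\<lbrakk>x \<in> B; y \<in> B\<rbrakk> \<Longrightarrow> x + y \<in> B" and B_minus: "\<lbrakk>x \<in> B; y \<in> B\<rbrakk> \<Longrightarrow> x - y \<in> B"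
    and B_times: "\<lbrakk>x \<in> B; y \<in> B\<rbrakk> \<Longrightarrow> x * y \<in> B" and B_commute: "\<lbrakk>x \<in> B; y \<in> B\<rbrakk> \<Longrightarrow> x * y = y * x"
    and e_B: "x \<in> B \<Longrightarrow> e * x = x" and e_X: "e * X i = X i" and X_e: "X i * e = X i"
    and X_B: "x \<in> B \<Longrightarrow> X i * x - x * X i \<in> B" and X_commute: "X i * X k = X k * X i"
begin

inductive diffop :: "nat \<Rightarrow> 'r \<Rightarrow> bool" where
  const: "b \<in> B \<Longrightarrow> diffop k b"
| plus: "diffop k P \<Longrightarrow> diffop k Q \<Longrightarrow> diffop k (P + Q)"
| step: "diffop k P \<Longrightarrow> diffop (Suc k) (X i * P)"

lemma B_zero: "0 \<in> B" using B_minus[OF B_e B_e] by simp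

lemma diffop_zero: "diffop k 0" using B_zero by (rule const)

lemma diffop_Suc: "diffop k P \<Longrightarrow> diffop (Suc k) P"
  by (induction rule: diffop.induct) (auto intro: diffop.intros)

lemma diffop_mono: "diffop k P \<Longrightarrow> k \<le> l \<Longrightarrow> diffop l P"
  by (induction l) (auto simp: le_Suc_eq intro: diffop_Suc)

lemma diffop_e: "diffop k P \<Longrightarrow> e * P = P \<and> P * e = P"
proof (induction rule: diffop.induct)
  case (const b k)
  then show ?case using e_B[of b] B_commute[of b e] B_e by simp
next
  case (step k P i)
  then show ?case by (simp add: mult.assoc[symmetric] e_X) (simp add: mult.assoc)
qed (simp_all add: algebra_simps)

lemma diffop_0: "diffop 0 P \<Longrightarrow> P \<in> B"
  by (induction "0::nat" P rule: diffop.induct) (auto intro: B_plus)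

lemma diffop_B_left: "diffop k P \<Longrightarrow> b \<in> B \<Longrightarrow> diffop k (b * P)"
proof (induction arbitrary: b rule: diffop.induct)
  case (step k P i)
  have "diffop (Suc k) (X i * (b * P) + - ((X i * b - b * X i) * P))"
  proof (rule plus)
    show "diffop (Suc k) (X i * (b * P))" using step by (intro diffop.step) auto
    have "0 - (X i * b - b * X i) \<in> B" using step by (intro B_minus B_zero X_B)
    moreover have "- ((X i * b - b * X i) * P) = (0 - (X i * b - b * X i)) * P" by (simp only: diff_0 minus_mult_left)
    ultimately show "diffop (Suc k) (- ((X i * b - b * X i) * P))" using diffop_Suc[OF step.IH] by (simp only:)
  qed
  then show ?case by (simp add: algebra_simps)
qed (auto simp: distrib_left intro: diffop.const B_times diffop.plus)

lemma diffop_uminus: "diffop k P \<Longrightarrow> diffop k (- P)"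
  using diffop_B_left[of k P "0 - e"] B_minus[OF B_zero B_e] diffop_e[of k P] by simp

lemma diffop_minus: "diffop k P \<Longrightarrow> diffop k Q \<Longrightarrow> diffop k (P - Q)"
  using plus[of k P "- Q"] diffop_uminus[of k Q] by simp

lemma diffop_sum: "(\<And>a. a \<in> A \<Longrightarrow> diffop k (t a)) \<Longrightarrow> diffop k (\<Sum>a\<in>A. t a)"
  by (induction A rule: infinite_finite_induct) (auto intro: plus diffop_zero)

lemma diffop_times: "diffop k P \<Longrightarrow> diffop l Q \<Longrightarrow> diffop (k + l) (P * Q)"
proof (induction rule: diffop.induct)
  case (const b k)
  then show ?case using diffop_mono[OF diffop_B_left] by simp
next
  case (plus k P P')
  then show ?case by (simp add: distrib_right diffop.plus)
next
  case (step k P i)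
  then show ?case using diffop.step[of "k + l" "P * Q" i] by (simp add: mult.assoc)
qed

lemma diffop_X: "diffop (Suc k) (X i)"
  using diffop_mono[OF step[OF const[OF B_e], of 0 i], of "Suc k"] X_e by simp

lemma X_diffop_commutator: "diffop k P \<Longrightarrow> diffop k (X i * P - P * X i)"
proof (induction rule: diffop.induct)
  case (const b k)
  then show ?case using X_B by (auto intro: diffop.const)
next
  case (plus k P Q)
  then have "diffop k ((X i * P - P * X i) + (X i * Q - Q * X i))" by (intro diffop.plus)
  then show ?case by (simp add: algebra_simps)
next
  case (step k P m)
  have "X i * (X m * P) = X m * (X i * P)" by (simp add: mult.assoc[symmetric] X_commute[of i m])
  then have "X i * (X m * P) - X m * P * X i = X m * (X i * P - P * X i)" by (simp add: algebra_simps)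
  then show ?case using diffop.step[OF step.IH] by simp
qed

text \<open>
  Shifted by one, so that order \<open>< 0\<close> is available as index \<open>0\<close>.
\<close>
definition G :: "nat \<Rightarrow> 'r set" where
  "G k = (case k of 0 \<Rightarrow> {0} | Suc m \<Rightarrow> Collect (diffop m))"

lemma G_simps: "G 0 = {0}" "P \<in> G (Suc k) \<longleftrightarrow> diffop k P"
  by (auto simp: G_def)

lemma G_group: "additive_group (G k)"
  by (cases k) (auto simp: additive_group_def G_simps diffop_zero diffop_minus)

lemma G_mono: "G k \<subseteq> G (Suc k)"
  by (cases k) (auto simp: G_simps diffop_zero diffop_Suc)

lemma G_mono_le: "k \<le> l \<Longrightarrow> G k \<subseteq> G l"
  by (rule lift_Suc_mono_le[of G, OF G_mono])

lemma X_G: "P \<in> G k \<Longrightarrow> X i * P \<in> G (Suc k)"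
  by (cases k) (auto simp: G_simps diffop_zero intro: step)

lemma G_times: "P \<in> G k \<Longrightarrow> diffop l Q \<Longrightarrow> P * Q \<in> G (k + l) \<and> Q * P \<in> G (k + l)"
  using additive_groupD(1)[OF G_group]
  by (cases k) (auto simp: G_simps diffop_times add.commute dest: diffop_times[of l Q])

lemma B_diffop_commutator: "diffop k P \<Longrightarrow> b \<in> B \<Longrightarrow> P * b - b * P \<in> G k"
proof (induction rule: diffop.induct)
  case (const c k)
  then show ?case using B_commute[of c b] additive_groupD(1)[OF G_group] by simp
next
  case (plus k P Q)
  then have "(P * b - b * P) + (Q * b - b * Q) \<in> G k" by (intro additive_groupD(4) G_group)
  then show ?case by (simp add: algebra_simps)
next
  case (step k P i)
  have "X i * P * b - b * (X i * P) = X i * (P * b - b * P) + (X i * b - b * X i) * P"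
    by (simp add: algebra_simps)
  moreover have "X i * (P * b - b * P) \<in> G (Suc k)" using step by (intro X_G) auto
  moreover have "(X i * b - b * X i) * P \<in> G (Suc k)" using step by (simp add: G_simps diffop_B_left X_B)
  ultimately show ?case using additive_groupD(4)[OF G_group] by metis
qed

text \<open>
  The graded ring of the order filtration is commutative.
\<close>
lemma diffop_commutator: "diffop k P \<Longrightarrow> diffop l Q \<Longrightarrow> P * Q - Q * P \<in> G (k + l)"
proof (induction rule: diffop.induct)
  case (const b k)
  then have "- (Q * b - b * Q) \<in> G l" by (intro additive_groupD(3) G_group B_diffop_commutator)
  then show ?case using G_mono_le[of l "k + l"] by auto
next
  case (plus k P P')
  then have "(P * Q - Q * P) + (P' * Q - Q * P') \<in> G (k + l)" by (intro additive_groupD(4) G_group)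
  then show ?case by (simp add: algebra_simps)
next
  case (step k P i)
  have "X i * P * Q - Q * (X i * P) = X i * (P * Q - Q * P) + (X i * Q - Q * X i) * P"
    by (simp add: algebra_simps)
  moreover have "X i * (P * Q - Q * P) \<in> G (Suc (k + l))" using step by (intro X_G) auto
  moreover have "(X i * Q - Q * X i) * P \<in> G (Suc (k + l))"
    using diffop_times[OF X_diffop_commutator[OF step.prems] step.hyps, of i] by (simp add: G_simps add.commute)
  ultimately show ?case using additive_groupD(4)[OF G_group] by (metis add_Suc)
qed

definition word :: "'n list \<Rightarrow> 'r" where
  "word w = foldr (\<lambda>i P. X i * P) w e"

lemma word_simps [simp]: "word [] = e" "word (i # w) = X i * word w"
  by (simp_all add: word_def)

lemma diffop_word: "length w \<le> k \<Longrightarrow> diffop k (word w)"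
proof (induction w arbitrary: k)
  case (Cons i w)
  obtain k' where "k = Suc k'" "length w \<le> k'" using Cons.prems by (cases k) auto
  then show ?case using step[OF Cons.IH] by simp
qed (simp add: const B_e)

lemma finite_words: "finite {w :: 'n list. length w \<le> k}"
  using finite_lists_length_le[of "UNIV :: 'n set" k] by simp

theorem diffop_iff_words:
  "diffop k P \<longleftrightarrow> (\<exists>a. (\<forall>w. a w \<in> B) \<and> P = (\<Sum>w\<in>{w. length w \<le> k}. a w * word w))"
proof
  assume "diffop k P"
  then show "\<exists>a. (\<forall>w. a w \<in> B) \<and> P = (\<Sum>w\<in>{w. length w \<le> k}. a w * word w)"
  proof (induction rule: diffop.induct)
    case (const b k)
    define a where "a w = (if w = [] then b else 0)" for w :: "'n list"
    have "(\<Sum>w\<in>{w. length w \<le> k}. a w * word w) = (\<Sum>w\<in>{w :: 'n list. length w \<le> k}. if w = [] then b * e else 0)"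
      by (rule sum.cong[OF refl]) (auto simp: a_def)
    also have "\<dots> = b * e" by (simp add: finite_words)
    also have "\<dots> = b" using const e_B B_commute B_e by metis
    finally show ?case using const B_zero by (intro exI[of _ a]) (auto simp: a_def)
  next
    case (plus k P Q)
    then obtain a a' where "\<forall>w. a w \<in> B" "P = (\<Sum>w\<in>{w. length w \<le> k}. a w * word w)"
      "\<forall>w. a' w \<in> B" "Q = (\<Sum>w\<in>{w. length w \<le> k}. a' w * word w)" by blast
    then show ?case
      by (intro exI[of _ "\<lambda>w. a w + a' w"]) (simp add: B_plus distrib_right sum.distrib)
  next
    case (step k P i)
    then obtain a where a: "\<forall>w. a w \<in> B" "P = (\<Sum>w\<in>{w. length w \<le> k}. a w * word w)" by blast
    define c where "c w = (case w of [] \<Rightarrow> 0 | v # w' \<Rightarrow> if v = i then a w' else 0) +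
      (if length w \<le> k then X i * a w - a w * X i else 0)" for w
    have cB: "c w \<in> B" for w
      using a(1) B_zero by (auto simp: c_def intro!: B_plus X_B split: list.split)
    have 1: "(\<Sum>w\<in>{w. length w \<le> Suc k}. (case w of [] \<Rightarrow> 0 | v # w' \<Rightarrow> if v = i then a w' else 0) * word w) =
        (\<Sum>w\<in>{w. length w \<le> k}. a w * (X i * word w))"
    proof -
      have "(\<Sum>w\<in>{w. length w \<le> Suc k}. (case w of [] \<Rightarrow> 0 | v # w' \<Rightarrow> if v = i then a w' else 0) * word w) =
          (\<Sum>w\<in>Cons i ` {w. length w \<le> k}. (case w of [] \<Rightarrow> 0 | v # w' \<Rightarrow> if v = i then a w' else 0) * word w)"
        by (rule sum.mono_neutral_right) (auto simp: finite_words image_iff split: list.splits)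
      also have "\<dots> = (\<Sum>w\<in>{w. length w \<le> k}. a w * (X i * word w))"
        by (subst sum.reindex) (auto simp: inj_on_def)
      finally show ?thesis .
    qed
    have 2: "(\<Sum>w\<in>{w. length w \<le> Suc k}. (if length w \<le> k then X i * a w - a w * X i else 0) * word w) =
        (\<Sum>w\<in>{w. length w \<le> k}. (X i * a w - a w * X i) * word w)"
      by (rule sum.mono_neutral_cong_right) (auto simp: finite_words)
    have "X i * P = (\<Sum>w\<in>{w. length w \<le> k}. a w * (X i * word w) + (X i * a w - a w * X i) * word w)"
      unfolding a(2) sum_distrib_left by (rule sum.cong) (simp_all add: algebra_simps)
    also have "\<dots> = (\<Sum>w\<in>{w. length w \<le> Suc k}. c w * word w)"
      unfolding c_def distrib_right sum.distrib 1 2 ..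
    finally show ?case using cB by blast
  qed
next
  assume "\<exists>a. (\<forall>w. a w \<in> B) \<and> P = (\<Sum>w\<in>{w. length w \<le> k}. a w * word w)"
  then show "diffop k P" by (auto intro!: diffop_sum diffop_B_left diffop_word)
qed

definition field :: "('n \<Rightarrow> 'r) \<Rightarrow> 'r" where
  "field a = (\<Sum>i\<in>UNIV. a i * X i)"

definition fields :: "'r set" where
  "fields = {field a | a. \<forall>i. a i \<in> B}"

lemma fields_plus: "v \<in> fields \<Longrightarrow> w \<in> fields \<Longrightarrow> v + w \<in> fields"
proof -
  assume "v \<in> fields" "w \<in> fields"
  then obtain a c where "v = field a" "\<forall>i. a i \<in> B" "w = field c" "\<forall>i. c i \<in> B" by (auto simp: fields_def)
  then show ?thesis unfolding fields_def
    by (intro CollectI exI[of _ "\<lambda>i. a i + c i"]) (simp add: field_def B_plus distrib_right sum.distrib)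
qed

lemma fields_scale: "b \<in> B \<Longrightarrow> v \<in> fields \<Longrightarrow> b * v \<in> fields"
proof -
  assume b: "b \<in> B" and "v \<in> fields"
  then obtain a where "v = field a" "\<forall>i. a i \<in> B" by (auto simp: fields_def)
  then show ?thesis unfolding fields_def using b
    by (intro CollectI exI[of _ "\<lambda>i. b * a i"]) (simp add: field_def B_times sum_distrib_left mult.assoc)
qed

lemma fields_zero: "0 \<in> fields"
  unfolding fields_def using B_zero by (intro CollectI exI[of _ "\<lambda>_. 0"]) (simp add: field_def)

lemma fields_sum: "(\<And>a. a \<in> A \<Longrightarrow> t a \<in> fields) \<Longrightarrow> (\<Sum>a\<in>A. t a) \<in> fields"
  by (induction A rule: infinite_finite_induct) (auto intro: fields_zero fields_plus)

lemma X_fields: "X i \<in> fields"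
proof -
  have "(\<Sum>k\<in>UNIV. (if k = i then e else 0) * X k) = (\<Sum>k\<in>UNIV. if k = i then e * X i else 0)"
    by (rule sum.cong) auto
  then show ?thesis unfolding fields_def using B_e B_zero
    by (intro CollectI exI[of _ "\<lambda>k. if k = i then e else 0"]) (simp add: field_def e_X)
qed

lemma fields_diffop: "v \<in> fields \<Longrightarrow> diffop (Suc k) v"
  by (auto simp: fields_def field_def intro!: diffop_sum diffop_B_left diffop_X)

lemma fields_B: "v \<in> fields \<Longrightarrow> b \<in> B \<Longrightarrow> v * b - b * v \<in> B"
  using B_diffop_commutator[OF fields_diffop[of v 0], of b] by (auto simp: G_simps intro: diffop_0)

lemma fields_bracket: "v \<in> fields \<Longrightarrow> w \<in> fields \<Longrightarrow> v * w - w * v \<in> fields"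
proof -
  assume v: "v \<in> fields" and "w \<in> fields"
  then obtain c where c: "w = field c" "\<forall>i. c i \<in> B" by (auto simp: fields_def)
  have X: "v * X i - X i * v \<in> fields" for i
  proof -
    obtain a where a: "v = field a" "\<forall>i. a i \<in> B" using v by (auto simp: fields_def)
    have "v * X i - X i * v = (\<Sum>k\<in>UNIV. (0 - (X i * a k - a k * X i)) * X k)"
      unfolding a(1) field_def sum_distrib_left sum_distrib_right sum_subtractf[symmetric]
      by (rule sum.cong) (simp_all add: algebra_simps X_commute[of i])
    also have "\<dots> \<in> fields"
      using a(2) by (intro fields_sum fields_scale X_fields B_minus[OF B_zero] X_B) auto
    finally show ?thesis .
  qed
  have "v * w - w * v = (\<Sum>i\<in>UNIV. (v * c i - c i * v) * X i + c i * (v * X i - X i * v))"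
    unfolding c(1) field_def sum_distrib_left sum_distrib_right sum_subtractf[symmetric]
    by (rule sum.cong) (simp_all add: algebra_simps)
  also have "\<dots> \<in> fields"
    using c(2) v by (intro fields_sum fields_plus fields_scale X_fields X fields_B) auto
  finally show ?thesis .
qed

end

text \<open>
  The order of an operator and the notion of vector field do not depend on the chart.
\<close>
lemma diffop_change_frame:
  fixes X X' :: "'n::finite \<Rightarrow> 'r::ring_1"
  assumes "diffops e B X" "diffops e B X'"
    and "\<And>i. \<exists>b. (\<forall>k. b k \<in> B) \<and> X i = (\<Sum>k\<in>UNIV. b k * X' k)"
  shows "diffops.diffop B X k P \<Longrightarrow> diffops.diffop B X' k P"
    and "diffops.fields B X \<subseteq> diffops.fields B X'"
proof -
  interpret x: diffops e B X by fact
  interpret x': diffops e B X' by fact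
  show "x.diffop k P \<Longrightarrow> x'.diffop k P"
  proof (induction rule: x.diffop.induct)
    case (step k P i)
    obtain b where b: "\<forall>k. b k \<in> B" "X i = (\<Sum>k\<in>UNIV. b k * X' k)" using assms(3) by blast
    have "x'.diffop (Suc k) (\<Sum>k\<in>UNIV. b k * (X' k * P))"
      using b(1) step by (intro x'.diffop_sum x'.diffop_B_left x'.step) auto
    then show ?case by (simp add: b(2) sum_distrib_right mult.assoc)
  qed (auto intro: x'.diffop.intros)
  have X: "X i \<in> x'.fields" for i
    using assms(3)[of i] by (auto intro!: x'.fields_sum x'.fields_scale x'.X_fields)
  show "x.fields \<subseteq> x'.fields"
    by (auto simp: x.fields_def x.field_def intro!: x'.fields_sum x'.fields_scale X)
qed

section \<open>Coordinate vector fields\<close>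

text \<open>
  Coordinate functions \<open>y\<^sub>k\<close> dual to the frame. They determine the coefficients of vector fields, and the
  commutator with \<open>y\<^sub>k\<close> acts on symbols as the derivative by the symbol of \<open>X\<^sub>k\<close>.
\<close>
locale diffops_coordinates = diffops +
  fixes y :: "'b \<Rightarrow> 'a" and idx :: "nat \<Rightarrow> 'b"
  assumes y_B: "y k \<in> B" and X_y: "X i * y k - y k * X i = (if i = k then e else 0)"
    and inverse_nat: "m > 0 \<Longrightarrow> \<exists>q\<in>B. q * of_nat m = e"
    and idx: "bij_betw idx {..<CARD('b)} UNIV"
begin

abbreviation ops where "ops \<equiv> {P. \<exists>k. diffop k P}"

lemma field_y: "field a * y k - y k * field a = a k" if "\<forall>i. a i \<in> B"
proof -
  have "field a * y k - y k * field a = (\<Sum>i\<in>UNIV. a i * (X i * y k - y k * X i) + (a i * y k - y k * a i) * X i)"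
    unfolding field_def sum_distrib_left sum_distrib_right sum_subtractf[symmetric]
    by (rule sum.cong) (simp_all add: algebra_simps)
  also have "\<dots> = (\<Sum>i\<in>UNIV. if i = k then a k else 0)"
  proof (rule sum.cong)
    fix i
    have "a i * y k = y k * a i" using that y_B by (intro B_commute) auto
    moreover have "a k * e = a k" using that diffop_e[OF const] by blast
    ultimately show "a i * (X i * y k - y k * X i) + (a i * y k - y k * a i) * X i = (if i = k then a k else 0)"
      by (simp add: X_y)
  qed simp
  finally show ?thesis by simp
qed

lemma lie_basis_fields:
  "lie_basis e ops B fields CARD('b) (\<lambda>i. X (idx i)) (\<lambda>v i. v * y (idx i) - y (idx i) * v)"
proof unfold_locales
  have reindex: "(\<Sum>i<CARD('b). t (idx i)) = (\<Sum>k\<in>UNIV. t k)" for t :: "'b \<Rightarrow> 'a"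
    using sum.reindex_bij_betw[OF idx, of t] by simp
  have inj: "inj_on idx {..<CARD('b)}" using idx by (simp add: bij_betw_def)
  fix x y' :: 'a
  show "x + y' \<in> ops" "x - y' \<in> ops" "x * y' \<in> ops" if xy: "x \<in> ops" "y' \<in> ops"
  proof -
    obtain k l where "diffop k x" "diffop l y'" using xy by blast
    then have "diffop (max k l) x" "diffop (max k l) y'" "diffop (k + l) (x * y')"
      by (auto intro: diffop_mono diffop_times)
    then show "x + y' \<in> ops" "x - y' \<in> ops" "x * y' \<in> ops" by (blast intro: plus diffop_minus)+
  qed
  show "e * x = x" "x * e = x" if "x \<in> ops" using that diffop_e by blast+
  show "B \<subseteq> ops" "fields \<subseteq> ops" using const fields_diffop by blast+
  show "x * y' - y' * x \<in> fields" if "x \<in> fields" "y' \<in> fields" by (rule fields_bracket[OF that])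
  show "x * b - b * x \<in> B" if "x \<in> fields" "b \<in> B" for b by (rule fields_B[OF that])
  show "x * y (idx i) - y (idx i) * x \<in> B" if "x \<in> fields" for i by (rule fields_B[OF that y_B])
  show "(\<Sum>i<CARD('b). (x * y (idx i) - y (idx i) * x) * X (idx i)) = x" if "x \<in> fields"
  proof -
    obtain a where a: "\<forall>i. a i \<in> B" "x = field a" using \<open>x \<in> fields\<close> by (auto simp: fields_def)
    then show ?thesis using reindex[of "\<lambda>k. a k * X k"] by (simp add: field_y) (simp add: field_def)
  qed
  fix u k assume u: "\<And>i. i < CARD('b) \<Longrightarrow> u i \<in> B" and k: "k < CARD('b)"
  define a where "a i = u (the_inv_into {..<CARD('b)} idx i)" for i
  have a_idx: "a (idx i) = u i" if "i < CARD('b)" for i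
    using that by (simp add: a_def the_inv_into_f_f[OF inj])
  have "a i \<in> B" for i
  proof -
    have "i \<in> idx ` {..<CARD('b)}" using idx by (simp add: bij_betw_def)
    then show ?thesis using u a_idx by auto
  qed
  moreover have "(\<Sum>i<CARD('b). u i * X (idx i)) = field a"
    unfolding field_def reindex[of "\<lambda>k. a k * X k", symmetric] by (rule sum.cong) (simp_all add: a_idx)
  ultimately show "(\<Sum>i<CARD('b). u i * X (idx i)) * y (idx k) - y (idx k) * (\<Sum>i<CARD('b). u i * X (idx i)) = u k"
    using field_y[of a "idx k"] a_idx[OF k] by simp
qed (auto intro: B_e B_plus B_minus B_times B_commute fields_zero fields_plus fields_scale X_fields)

text \<open>
  Operators of order \<open>\<le> k\<close> whose symbol of order \<open>k\<close> lies in the ideal of the symbols of the first \<open>m\<close>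
  coordinate fields. Such operators are called small below.
\<close>
definition N :: "nat \<Rightarrow> nat \<Rightarrow> 'a set" where
  "N m k = {t + (\<Sum>j<m. q j * X (idx j)) | q t. t \<in> G k \<and> (\<forall>j<m. q j \<in> G k)}"

lemma NE:
  assumes "P \<in> N m k" obtains t q where "P = t + (\<Sum>j<m. q j * X (idx j))" "t \<in> G k" "\<forall>j<m. q j \<in> G k"
  using assms unfolding N_def by blast

lemma NI: "t \<in> G k \<Longrightarrow> (\<And>j. j < m \<Longrightarrow> q j \<in> G k) \<Longrightarrow> t + (\<Sum>j<m. q j * X (idx j)) \<in> N m k"
  unfolding N_def by (intro CollectI exI[of _ q] exI[of _ t]) simp

lemma N_minus: assumes "P \<in> N m k" "Q \<in> N m k" shows "P - Q \<in> N m k"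
proof -
  obtain t q where P: "P = t + (\<Sum>j<m. q j * X (idx j))" "t \<in> G k" "\<forall>j<m. q j \<in> G k" using assms(1) by (rule NE)
  obtain t' q' where Q: "Q = t' + (\<Sum>j<m. q' j * X (idx j))" "t' \<in> G k" "\<forall>j<m. q' j \<in> G k" using assms(2) by (rule NE)
  have eq: "P - Q = (t - t') + (\<Sum>j<m. (q j - q' j) * X (idx j))"
    by (simp add: P(1) Q(1) left_diff_distrib sum_subtractf algebra_simps)
  show ?thesis unfolding eq using P(2,3) Q(2,3) by (intro NI additive_groupD(2)[OF G_group]) auto
qed

lemma N_B: assumes "P \<in> N m k" "b \<in> B" shows "b * P \<in> N m k"
proof -
  obtain t q where P: "P = t + (\<Sum>j<m. q j * X (idx j))" "t \<in> G k" "\<forall>j<m. q j \<in> G k" using assms(1) by (rule NE)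
  have bG: "b * c \<in> G k" if "c \<in> G k" for c using that assms(2) by (cases k) (auto simp: G_simps diffop_B_left)
  have "b * P = b * t + (\<Sum>j<m. (b * q j) * X (idx j))"
    by (simp add: P(1) distrib_left sum_distrib_left mult.assoc)
  then show ?thesis using P bG by (simp add: NI)
qed

lemma G_X: "P \<in> G k \<Longrightarrow> P * X i \<in> G (Suc k)"
  using G_times[OF _ diffop_X[of 0 i], of P k] by simp

lemma N_X: assumes "P \<in> N m k" shows "P * X i \<in> N m (Suc k)"
proof -
  obtain t q where P: "P = t + (\<Sum>j<m. q j * X (idx j))" "t \<in> G k" "\<forall>j<m. q j \<in> G k" using assms(1) by (rule NE)
  have "P * X i = t * X i + (\<Sum>j<m. (q j * X i) * X (idx j))"
    by (simp add: P(1) distrib_right sum_distrib_right mult.assoc X_commute[of i])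
  then show ?thesis using P G_X by (simp add: NI)
qed

lemma N_commutator:
  assumes "P \<in> N m (Suc k)" "m < CARD('b)"
  shows "P * y (idx m) - y (idx m) * P \<in> N m k"
proof -
  obtain t q where P: "P = t + (\<Sum>j<m. q j * X (idx j))" "t \<in> G (Suc k)" "\<forall>j<m. q j \<in> G (Suc k)" using assms(1) by (rule NE)
  let ?y = "y (idx m)"
  have ad: "c * ?y - ?y * c \<in> G k" if "c \<in> G (Suc k)" for c
    using that B_diffop_commutator y_B by (simp add: G_simps)
  have X: "X (idx j) * ?y = ?y * X (idx j)" if "j < m" for j
  proof -
    have "idx j \<noteq> idx m" using that assms(2) idx by (auto simp: bij_betw_def inj_on_def)
    then show ?thesis using X_y[of "idx j" "idx m"] by simp
  qed
  have "P * ?y - ?y * P = (t * ?y - ?y * t) + (\<Sum>j<m. q j * (X (idx j) * ?y) - ?y * (q j * X (idx j)))"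
    by (simp add: P(1) distrib_left distrib_right sum_distrib_left sum_distrib_right sum_subtractf mult.assoc)
  also have "(\<Sum>j<m. q j * (X (idx j) * ?y) - ?y * (q j * X (idx j))) = (\<Sum>j<m. (q j * ?y - ?y * q j) * X (idx j))"
    by (rule sum.cong) (simp_all add: X algebra_simps)
  finally show ?thesis using P ad by (simp add: NI)
qed

lemma times_X_power_y:
  assumes "P * e = P"
  shows "P * (X i ^ s * y i - y i * X i ^ s) = of_nat s * (P * X i ^ (s - 1))"
proof (induction s)
  case (Suc s)
  have "P * X i ^ s * e = P * X i ^ s"
  proof (cases s)
    case (Suc s')
    then show ?thesis by (simp only: power_Suc2 mult.assoc X_e)
  qed (simp add: assms)
  moreover have "of_nat s * (P * X i ^ (s - 1)) * X i = of_nat s * (P * X i ^ s)"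
    by (cases s) (simp_all only: power_Suc2 mult.assoc diff_Suc_1 of_nat_0 mult_zero_left)
  moreover have "P * (X i ^ Suc s * y i - y i * X i ^ Suc s) =
      P * X i ^ s * (X i * y i - y i * X i) + P * (X i ^ s * y i - y i * X i ^ s) * X i"
    by (simp only: power_Suc2) (simp add: algebra_simps)
  ultimately show ?case by (simp add: Suc X_y distrib_right)
qed simp

lemma N_0: "0 \<in> N m k"
  using NI[of 0 k m "\<lambda>_. 0"] additive_groupD(1)[OF G_group] by simp

lemma N_of_nat: "P \<in> N m k \<Longrightarrow> of_nat s * P \<in> N m k"
proof (induction s)
  case (Suc s)
  then have "of_nat s * P - (0 - P) \<in> N m k" by (intro N_minus N_0) auto
  then show ?case by (simp add: algebra_simps)
qed (simp add: N_0)

lemma N_X_power: "P \<in> N m k \<Longrightarrow> P * X i ^ s \<in> N m (k + s)"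
proof (induction s)
  case (Suc s)
  then have "P * X i ^ s * X i \<in> N m (Suc (k + s))" by (intro N_X) auto
  then show ?case by (simp only: power_Suc2 mult.assoc add_Suc_right)
qed simp

lemma N_cancel_aux:
  assumes m: "m < CARD('b)" and P: "P \<in> G (Suc k)"
  defines "A \<equiv> P * y (idx m) - y (idx m) * P"
  assumes H: "P * X (idx m) ^ Suc s \<in> N m (k + Suc s)"
  shows "A * X (idx m) ^ Suc s + of_nat (Suc s) * (P * X (idx m) ^ s) \<in> N m (k + s)"
proof -
  let ?X = "X (idx m)" and ?y = "y (idx m)"
  have Pe: "P * e = P" using P diffop_e by (simp add: G_simps)
  have "P * ?X ^ Suc s * ?y - ?y * (P * ?X ^ Suc s) = A * ?X ^ Suc s + P * (?X ^ Suc s * ?y - ?y * ?X ^ Suc s)"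
    unfolding A_def by (simp only: left_diff_distrib right_diff_distrib mult.assoc) simp
  also have "\<dots> = A * ?X ^ Suc s + of_nat (Suc s) * (P * ?X ^ s)"
    by (simp only: times_X_power_y[OF Pe] diff_Suc_1)
  finally show ?thesis using N_commutator[of "P * ?X ^ Suc s" m "k + s"] H m by simp
qed

text \<open>
  The symbol of the \<open>m\<close>-th field \<open>X\<close> is regular modulo those of the earlier ones, without reference to a
  polynomial ring. If \<open>P X\<^sup>s\<close> is small, then so is its commutator \<open>[P, y] X\<^sup>s + s P X\<^sup>s\<^sup>-\<^sup>1\<close>, and hence
  \<open>[P, y] X\<^sup>s\<^sup>+\<^sup>1\<close>. By induction on the order \<open>[P, y]\<close> is small, so \<open>P X\<^sup>s\<^sup>-\<^sup>1\<close> is small as well, \<open>s\<close> being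
  invertible. The exponent is there for the induction; the result is applied with \<open>s = 1\<close>.
\<close>
lemma N_cancel:
  assumes m: "m < CARD('b)"
  shows "P \<in> G (Suc k) \<Longrightarrow> P * X (idx m) ^ s \<in> N m (k + s) \<Longrightarrow> P \<in> N m k"
proof (induction k arbitrary: P s)
  let ?X = "X (idx m)" and ?y = "y (idx m)"
  have descend: "P \<in> N m k"
    if P: "P \<in> G (Suc k)"
      and A: "\<And>s. P * ?X ^ Suc s \<in> N m (k + Suc s) \<Longrightarrow> (P * ?y - ?y * P) * ?X ^ Suc s \<in> N m (k + s)"
      and H: "P * ?X ^ s \<in> N m (k + s)" for P k s
    using H
  proof (induction s)
    case (Suc s)
    have "(P * ?y - ?y * P) * ?X ^ Suc s + of_nat (Suc s) * (P * ?X ^ s) - (P * ?y - ?y * P) * ?X ^ Suc s \<in> N m (k + s)"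
      by (intro N_minus N_cancel_aux m P A Suc.prems)
    then have sP: "of_nat (Suc s) * (P * ?X ^ s) \<in> N m (k + s)" by simp
    obtain q where q: "q \<in> B" "q * of_nat (Suc s) = e" using inverse_nat[of "Suc s"] by auto
    have "q * (of_nat (Suc s) * (P * ?X ^ s)) = e * P * ?X ^ s" by (simp only: mult.assoc[symmetric] q(2))
    also have "e * P = P" using P diffop_e by (simp add: G_simps)
    finally have "P * ?X ^ s \<in> N m (k + s)" using N_B[OF sP q(1)] by simp
    then show ?case by (rule Suc.IH)
  qed simp
  {
    case 0
    have "P * ?y - ?y * P = 0" using 0(1) B_diffop_commutator[of 0 P ?y] y_B by (simp add: G_simps)
    then show ?case using descend[OF 0(1) _ 0(2)] N_0 by simp
  next
    case (Suc k)
    let ?A = "P * ?y - ?y * P"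
    have AG: "?A \<in> G (Suc k)" using Suc.prems(1) B_diffop_commutator[of "Suc k" P ?y] y_B by (simp add: G_simps)
    show ?case
    proof (rule descend[OF Suc.prems(1) _ Suc.prems(2)])
      fix s assume H: "P * ?X ^ Suc s \<in> N m (Suc k + Suc s)"
      have "(?A * ?X ^ Suc s + of_nat (Suc s) * (P * ?X ^ s)) * ?X - of_nat (Suc s) * (P * ?X ^ Suc s) \<in> N m (Suc k + Suc s)"
        using N_X[OF N_cancel_aux[OF m Suc.prems(1) H], of "idx m"] by (intro N_minus N_of_nat H) simp
      moreover have "(?A * ?X ^ Suc s + of_nat (Suc s) * (P * ?X ^ s)) * ?X - of_nat (Suc s) * (P * ?X ^ Suc s) = ?A * ?X ^ Suc (Suc s)"
        by (simp only: power_Suc2[of ?X "Suc s"] power_Suc2[of ?X s] distrib_right mult.assoc) simp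
      ultimately have "?A * ?X ^ Suc (Suc s) \<in> N m (k + Suc (Suc s))" by simp
      then have "?A \<in> N m k" by (rule Suc.IH[OF AG])
      from N_X_power[OF this, of "idx m" "Suc s"] show "?A * ?X ^ Suc s \<in> N m (Suc k + s)" by simp
    qed
  }
qed

lemma regular_lie_basis_fields:
  "regular_lie_basis e ops B fields CARD('b) (\<lambda>i. X (idx i)) (\<lambda>v i. v * y (idx i) - y (idx i) * v) G"
proof (rule regular_lie_basis.intro[OF lie_basis_fields], unfold_locales)
  show "G 0 = {0}" "\<And>k. additive_group (G k)" "\<And>k. G k \<subseteq> G (Suc k)" by (simp_all add: G_simps G_group G_mono)
  show "G k \<subseteq> ops" for k by (cases k) (auto simp: G_simps intro: diffop_zero)
  show "\<exists>k. x \<in> G k" if x: "x \<in> ops" for x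
  proof -
    obtain k where "x \<in> G (Suc k)" using x by (auto simp: G_simps)
    then show ?thesis by blast
  qed
  show "x * b \<in> G k" if "x \<in> G k" "b \<in> B" for x k b using G_times[OF that(1) const[OF that(2)], of 0] by simp
  show "x * v \<in> G (Suc k)" if "x \<in> G k" "v \<in> fields" for x k v
    using G_times[OF that(1) fields_diffop[OF that(2)], of 0] by simp
  fix m P k q
  assume m: "m < CARD('b)" and P: "P \<in> G (Suc k)" and q: "\<And>j. j < m \<Longrightarrow> q j \<in> G (Suc k)"
    and G: "P * X (idx m) + (\<Sum>j<m. q j * X (idx j)) \<in> G (Suc k)"
  have "P * X (idx m) + (\<Sum>j<m. q j * X (idx j)) + (\<Sum>j<m. - q j * X (idx j)) \<in> N m (Suc k)"
    by (rule NI[OF G]) (use q additive_groupD(3)[OF G_group] in auto)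
  then have "P * X (idx m) ^ 1 \<in> N m (k + 1)" by (simp add: sum_negf)
  then have "P \<in> N m k" by (rule N_cancel[OF m P])
  then show "\<exists>q' t. (\<forall>j<m. q' j \<in> G k) \<and> t \<in> G k \<and> P = t + (\<Sum>j<m. q' j * X (idx j))"
    unfolding N_def by blast
qed

end

section \<open>Differential operators at a point\<close>

text \<open>
  Operators act on germs; \<open>J\<close> embeds their ring into a type-class ring, and \<open>M a\<close> is the multiplication by
  the germ \<open>a\<close> there.
\<close>
context manifold_at
begin

abbreviation E where "E \<equiv> End_ring Op"
abbreviation op_times (infixl "\<otimes>\<^sub>E" 70) where "P \<otimes>\<^sub>E Q \<equiv> P \<otimes>\<^bsub>E\<^esub> Q"
abbreviation op_plus (infixl "\<oplus>\<^sub>E" 65) where "P \<oplus>\<^sub>E Q \<equiv> P \<oplus>\<^bsub>E\<^esub> Q"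

definition J :: "('a germ \<Rightarrow> 'a germ) \<Rightarrow> ('a germ \<Rightarrow> 'a germ) ring_product" where
  "J = ring_inclusion E"

sublocale J: ring_embedding E J
  unfolding J_def by (rule ring_embedding_inclusion[OF O.ring_End])

lemma carrier_E: "P \<in> carrier E \<longleftrightarrow> P \<in> extensional (carrier Op) \<and> (\<forall>x\<in>carrier Op. P x \<in> carrier Op) \<and>
    (\<forall>x\<in>carrier Op. \<forall>y\<in>carrier Op. P (x \<oplus>\<^sub>p y) = P x \<oplus>\<^sub>p P y)"
  by (auto simp: End_ring_def hom_def)

lemma E_apply:
  assumes "x \<in> carrier Op"
  shows "(P \<otimes>\<^sub>E Q) x = P (Q x)" "(P \<oplus>\<^sub>E Q) x = P x \<oplus>\<^sub>p Q x" "\<one>\<^bsub>E\<^esub> x = x" "\<zero>\<^bsub>E\<^esub> x = \<zero>\<^sub>p"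
  using assms by (simp_all add: End_ring_def compose_def)

lemma E_eqI: "P \<in> carrier E \<Longrightarrow> Q \<in> carrier E \<Longrightarrow> (\<And>x. x \<in> carrier Op \<Longrightarrow> P x = Q x) \<Longrightarrow> P = Q"
  unfolding carrier_E by (rule extensionalityI) auto

lemma E_finsum_apply:
  "finite I \<Longrightarrow> (\<And>i. i \<in> I \<Longrightarrow> f i \<in> carrier E) \<Longrightarrow> x \<in> carrier Op \<Longrightarrow> (\<Oplus>\<^bsub>E\<^esub>i\<in>I. f i) x = (\<Oplus>\<^bsub>Op\<^esub>i\<in>I. f i x)"
proof (induction I rule: finite_induct)
  case (insert i I)
  have "(\<Oplus>\<^bsub>E\<^esub>i\<in>insert i I. f i) = f i \<oplus>\<^sub>E (\<Oplus>\<^bsub>E\<^esub>i\<in>I. f i)"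
    by (rule J.R.finsum_insert) (use insert in auto)
  moreover have "(\<Oplus>\<^bsub>Op\<^esub>i\<in>insert i I. f i x) = f i x \<oplus>\<^sub>p (\<Oplus>\<^bsub>Op\<^esub>i\<in>I. f i x)"
    by (rule O.finsum_insert) (use insert carrier_E in auto)
  ultimately show ?case using insert by (simp add: E_apply)
qed (simp add: E_apply)

lemma mult_op_apply: "x \<in> carrier Op \<Longrightarrow> mult_op Op a x = a \<otimes>\<^sub>p x"
  by (simp add: mult_op_def)

lemma mult_op_E: "a \<in> carrier Op \<Longrightarrow> mult_op Op a \<in> carrier E"
  unfolding carrier_E by (auto simp: mult_op_def O.r_distr)

lemma partial_E: "(U, \<phi>) \<in> A \<Longrightarrow> p \<in> U \<Longrightarrow> partial_op X A p (U, \<phi>) i \<in> carrier E"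
  unfolding carrier_E using partial_op_closed partial_op_add_mult(1) by (auto simp: partial_op_def)

definition M :: "'a germ \<Rightarrow> ('a germ \<Rightarrow> 'a germ) ring_product" where
  "M a = J (mult_op Op a)"

definition Bp where "Bp = M ` carrier Op"
definition ep where "ep = J \<one>\<^bsub>E\<^esub>"

lemma M_mult: "a \<in> carrier Op \<Longrightarrow> b \<in> carrier Op \<Longrightarrow> M (a \<otimes>\<^sub>p b) = M a * M b"
proof -
  assume ab: "a \<in> carrier Op" "b \<in> carrier Op"
  have "mult_op Op (a \<otimes>\<^sub>p b) = mult_op Op a \<otimes>\<^sub>E mult_op Op b"
    by (rule E_eqI) (use ab in \<open>auto simp: mult_op_E E_apply mult_op_apply O.m_assoc\<close>)
  then show ?thesis using ab by (simp add: M_def J.mult mult_op_E)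
qed

lemma M_add: "a \<in> carrier Op \<Longrightarrow> b \<in> carrier Op \<Longrightarrow> M (a \<oplus>\<^sub>p b) = M a + M b"
proof -
  assume ab: "a \<in> carrier Op" "b \<in> carrier Op"
  have "mult_op Op (a \<oplus>\<^sub>p b) = mult_op Op a \<oplus>\<^sub>E mult_op Op b"
    by (rule E_eqI) (use ab in \<open>auto simp: mult_op_E E_apply mult_op_apply O.l_distr\<close>)
  then show ?thesis using ab by (simp add: M_def J.add mult_op_E)
qed

lemma M_one: "M \<one>\<^sub>p = ep"
proof -
  have "mult_op Op \<one>\<^sub>p = \<one>\<^bsub>E\<^esub>" by (rule E_eqI) (auto simp: mult_op_E E_apply mult_op_apply)
  then show ?thesis by (simp add: M_def ep_def)
qed

lemma M_zero: "M \<zero>\<^sub>p = 0"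
  using M_add[of "\<zero>\<^sub>p" "\<zero>\<^sub>p"] by simp

lemma M_uminus: "a \<in> carrier Op \<Longrightarrow> M (\<ominus>\<^bsub>Op\<^esub> a) = - M a"
  using M_add[of a "\<ominus>\<^bsub>Op\<^esub> a"] by (simp add: O.r_neg M_zero minus_unique)

lemma M_minus: "a \<in> carrier Op \<Longrightarrow> b \<in> carrier Op \<Longrightarrow> M (a \<ominus>\<^bsub>Op\<^esub> b) = M a - M b"
  by (simp add: a_minus_def M_add M_uminus)

lemma M_inj: "a \<in> carrier Op \<Longrightarrow> b \<in> carrier Op \<Longrightarrow> M a = M b \<Longrightarrow> a = b"
proof -
  assume ab: "a \<in> carrier Op" "b \<in> carrier Op" "M a = M b"
  then have "mult_op Op a = mult_op Op b" by (simp add: M_def J.eq_iff mult_op_E)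
  then have "mult_op Op a \<one>\<^sub>p = mult_op Op b \<one>\<^sub>p" by simp
  then show "a = b" using ab by (simp add: mult_op_apply)
qed

lemma BpE: assumes "b \<in> Bp" obtains a where "a \<in> carrier Op" "b = M a"
  using assms unfolding Bp_def by blast

lemma M_Bp: "a \<in> carrier Op \<Longrightarrow> M a \<in> Bp"
  by (simp add: Bp_def)

definition Xp :: "('a, 'n) chart \<Rightarrow> 'n \<Rightarrow> ('a germ \<Rightarrow> 'a germ) ring_product" where
  "Xp c i = J (partial_op X A p c i)"

lemma Xp_M:
  assumes c: "(U, \<phi>) \<in> A" "p \<in> U" and a: "a \<in> carrier Op"
  shows "Xp (U, \<phi>) i * M a - M a * Xp (U, \<phi>) i = M (partial_op X A p (U, \<phi>) i a)"
proof -
  let ?D = "partial_op X A p (U, \<phi>) i"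
  have D: "?D \<in> carrier E" by (rule partial_E[OF c])
  have Da: "?D a \<in> carrier Op" by (rule partial_op_closed[OF c a])
  have "?D \<otimes>\<^sub>E mult_op Op a = mult_op Op a \<otimes>\<^sub>E ?D \<oplus>\<^sub>E mult_op Op (?D a)"
  proof (rule E_eqI)
    fix x assume x: "x \<in> carrier Op"
    then show "(?D \<otimes>\<^sub>E mult_op Op a) x = (mult_op Op a \<otimes>\<^sub>E ?D \<oplus>\<^sub>E mult_op Op (?D a)) x"
      using a by (simp add: E_apply mult_op_apply partial_op_closed[OF c] partial_op_add_mult(2)[OF c])
  qed (use D Da a mult_op_E in auto)
  then have "J (?D \<otimes>\<^sub>E mult_op Op a) = J (mult_op Op a \<otimes>\<^sub>E ?D \<oplus>\<^sub>E mult_op Op (?D a))" by simp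
  then show ?thesis using D Da a by (simp add: J.add J.mult mult_op_E Xp_def M_def)
qed

lemma diffops_Xp:
  assumes c: "(U, \<phi>) \<in> A" "p \<in> U" shows "diffops ep Bp (Xp (U, \<phi>))"
proof
  have D: "partial_op X A p (U, \<phi>) i \<in> carrier E" for i by (rule partial_E[OF c])
  show "ep \<in> Bp" unfolding M_one[symmetric] by (rule M_Bp) simp
  fix x y i k
  show "x + y \<in> Bp" "x - y \<in> Bp" "x * y \<in> Bp" "x * y = y * x" if xy: "x \<in> Bp" "y \<in> Bp"
  proof -
    obtain a b where ab: "a \<in> carrier Op" "x = M a" "b \<in> carrier Op" "y = M b" using xy by (metis BpE)
    show "x + y \<in> Bp" "x - y \<in> Bp" "x * y \<in> Bp" "x * y = y * x"
      using ab by (simp_all add: M_add[symmetric] M_minus[symmetric] M_mult[symmetric] M_Bp O.m_comm)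
  qed
  show "ep * x = x" if "x \<in> Bp"
    using that by (elim BpE) (simp add: M_one[symmetric] M_mult[symmetric])
  show "ep * Xp (U, \<phi>) i = Xp (U, \<phi>) i" "Xp (U, \<phi>) i * ep = Xp (U, \<phi>) i"
    unfolding ep_def Xp_def by (rule J.one_mult[OF D])+
  show "Xp (U, \<phi>) i * x - x * Xp (U, \<phi>) i \<in> Bp" if "x \<in> Bp"
    using that by (elim BpE) (simp add: Xp_M[OF c] M_Bp partial_op_closed[OF c])
  have "partial_op X A p (U, \<phi>) i \<otimes>\<^sub>E partial_op X A p (U, \<phi>) k = partial_op X A p (U, \<phi>) k \<otimes>\<^sub>E partial_op X A p (U, \<phi>) i"
    by (rule E_eqI) (simp_all add: D E_apply partial_op_commute[OF c])
  then show "Xp (U, \<phi>) i * Xp (U, \<phi>) k = Xp (U, \<phi>) k * Xp (U, \<phi>) i"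
    by (simp add: Xp_def J.mult[symmetric] D)
qed

lemma Xp_change:
  assumes c: "(U, \<phi>) \<in> A" "p \<in> U" and c': "(U', \<phi>') \<in> A" "p \<in> U'"
  shows "\<exists>b. (\<forall>k. b k \<in> Bp) \<and> Xp (U, \<phi>) i = (\<Sum>k\<in>UNIV. b k * Xp (U', \<phi>') k)"
proof -
  let ?b = "\<lambda>k. partial_op X A p (U, \<phi>) i (coordinate \<phi>' k)"
  have b: "?b k \<in> carrier Op" for k
    using partial_op_closed[OF c] hol_coordinate[OF c'] by (simp add: coordinate_def)
  have D: "partial_op X A p (U', \<phi>') k \<in> carrier E" for k by (rule partial_E[OF c'])
  have T: "mult_op Op (?b k) \<otimes>\<^sub>E partial_op X A p (U', \<phi>') k \<in> carrier E" for k using b D by (simp add: mult_op_E)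
  have "partial_op X A p (U, \<phi>) i = (\<Oplus>\<^bsub>E\<^esub>k\<in>UNIV. mult_op Op (?b k) \<otimes>\<^sub>E partial_op X A p (U', \<phi>') k)"
  proof (rule E_eqI)
    show "(\<Oplus>\<^bsub>E\<^esub>k\<in>UNIV. mult_op Op (?b k) \<otimes>\<^sub>E partial_op X A p (U', \<phi>') k) \<in> carrier E"
      using T by (intro J.R.finsum_closed) auto
    fix x assume x: "x \<in> carrier Op"
    show "partial_op X A p (U, \<phi>) i x = (\<Oplus>\<^bsub>E\<^esub>k\<in>UNIV. mult_op Op (?b k) \<otimes>\<^sub>E partial_op X A p (U', \<phi>') k) x"
      using x T by (simp add: E_finsum_apply E_apply mult_op_apply partial_op_closed[OF c'] partial_change_chart[OF c c'])
  qed (rule partial_E[OF c])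
  then have "Xp (U, \<phi>) i = J (\<Oplus>\<^bsub>E\<^esub>k\<in>UNIV. mult_op Op (?b k) \<otimes>\<^sub>E partial_op X A p (U', \<phi>') k)" by (simp add: Xp_def)
  also have "\<dots> = (\<Sum>k\<in>UNIV. J (mult_op Op (?b k) \<otimes>\<^sub>E partial_op X A p (U', \<phi>') k))"
    using T by (intro J.finsum) auto
  also have "\<dots> = (\<Sum>k\<in>UNIV. M (?b k) * Xp (U', \<phi>') k)"
    using b D by (simp add: J.mult mult_op_E M_def Xp_def)
  finally show ?thesis using b M_Bp by (intro exI[of _ "\<lambda>k. M (?b k)"]) auto
qed

definition cp :: "('a, 'n) chart" where
  "cp = (SOME c. c \<in> A \<and> p \<in> fst c)"

lemma cp: "cp \<in> A" "p \<in> fst cp"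
proof -
  obtain U \<phi> where "(U, \<phi>) \<in> A" "p \<in> U" by (rule chart_at_p)
  then have "\<exists>c. c \<in> A \<and> p \<in> fst c" by (intro exI[of _ "(U, \<phi>)"]) simp
  then have "cp \<in> A \<and> p \<in> fst cp" unfolding cp_def by (rule someI_ex)
  then show "cp \<in> A" "p \<in> fst cp" by auto
qed

lemma diffops_chart: "c \<in> A \<Longrightarrow> p \<in> fst c \<Longrightarrow> diffops ep Bp (Xp c)"
  using diffops_Xp by (cases c) auto

sublocale d: diffops ep Bp "Xp cp"
  by (rule diffops_chart[OF cp])

lemma chart_independence:
  assumes "c \<in> A" "p \<in> fst c"
  shows "diffops.diffop Bp (Xp c) k P \<longleftrightarrow> d.diffop k P" and "diffops.fields Bp (Xp c) = d.fields"
proof -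
  have ch: "\<exists>b. (\<forall>k. b k \<in> Bp) \<and> Xp c i = (\<Sum>k\<in>UNIV. b k * Xp c' k)"
    if "c \<in> A" "p \<in> fst c" "c' \<in> A" "p \<in> fst c'" for c c' i
    using that Xp_change by (cases c; cases c') auto
  note 1 = diffop_change_frame[OF diffops_chart[OF assms] diffops_chart[OF cp] ch[OF assms cp]]
  note 2 = diffop_change_frame[OF diffops_chart[OF cp] diffops_chart[OF assms] ch[OF cp assms]]
  show "diffops.diffop Bp (Xp c) k P \<longleftrightarrow> d.diffop k P" using 1(1) 2(1) by blast
  show "diffops.fields Bp (Xp c) = d.fields" using 1(2) 2(2) by blast
qed

lemma iterated_partial_J:
  assumes "c \<in> A" "p \<in> fst c"
  shows "iterated_partial X A p c w \<in> carrier E \<and> J (iterated_partial X A p c w) = diffops.word ep (Xp c) w"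
proof -
  interpret c: diffops ep Bp "Xp c" by (rule diffops_chart[OF assms])
  have D: "partial_op X A p c i \<in> carrier E" for i using assms partial_E by (cases c) auto
  have JX: "J (partial_op X A p c i) = Xp c i" for i by (simp add: Xp_def)
  show ?thesis
    by (induction w) (simp_all add: iterated_partial_def Let_def ep_def[symmetric] D J.mult JX)
qed

lemma D_order_sum:
  fixes k :: nat
  assumes "c \<in> A" "p \<in> fst c" "\<forall>w. a w \<in> carrier Op"
  defines "P \<equiv> (\<Oplus>\<^bsub>E\<^esub>w\<in>{w. length w \<le> k}. mult_op Op (a w) \<otimes>\<^sub>E iterated_partial X A p c w)"
  shows "P \<in> carrier E" "J P = (\<Sum>w\<in>{w. length w \<le> k}. M (a w) * diffops.word ep (Xp c) w)"
proof -
  have T: "mult_op Op (a w) \<otimes>\<^sub>E iterated_partial X A p c w \<in> carrier E" for w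
    using assms iterated_partial_J by (simp add: mult_op_E)
  show "P \<in> carrier E" unfolding P_def using T by (intro J.R.finsum_closed) auto
  have "J P = (\<Sum>w\<in>{w. length w \<le> k}. J (mult_op Op (a w) \<otimes>\<^sub>E iterated_partial X A p c w))"
    unfolding P_def using T by (intro J.finsum) auto
  then show "J P = (\<Sum>w\<in>{w. length w \<le> k}. M (a w) * diffops.word ep (Xp c) w)"
    using assms iterated_partial_J[OF assms(1,2)] by (simp add: J.mult mult_op_E M_def)
qed

lemma D_orderE:
  assumes "P \<in> D_order X A p k"
  obtains c a where "c \<in> A" "p \<in> fst c" "\<forall>w. a w \<in> carrier Op"
    "P = (\<Oplus>\<^bsub>E\<^esub>w\<in>{w. length w \<le> k}. mult_op Op (a w) \<otimes>\<^sub>E iterated_partial X A p c w)"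
  using assms unfolding D_order_def Let_def by blast

lemma D_order_E: "P \<in> D_order X A p k \<Longrightarrow> P \<in> carrier E"
  by (elim D_orderE) (simp add: D_order_sum(1))

lemma D_order_diffop: "P \<in> D_order X A p k \<Longrightarrow> d.diffop k (J P)"
proof (elim D_orderE)
  fix c a assume c: "c \<in> A" "p \<in> fst c" and a: "\<forall>w. a w \<in> carrier Op"
    and P: "P = (\<Oplus>\<^bsub>E\<^esub>w\<in>{w. length w \<le> k}. mult_op Op (a w) \<otimes>\<^sub>E iterated_partial X A p c w)"
  interpret c: diffops ep Bp "Xp c" by (rule diffops_chart[OF c])
  have "c.diffop k (J P)"
    unfolding c.diffop_iff_words P D_order_sum(2)[OF c a]
    by (intro exI[of _ "\<lambda>w. M (a w)"]) (use a M_Bp in auto)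
  then show "d.diffop k (J P)" by (simp add: chart_independence(1)[OF c])
qed

lemma diffop_D_order: "d.diffop k Q \<Longrightarrow> \<exists>P\<in>D_order X A p k. J P = Q"
proof -
  assume "d.diffop k Q"
  then obtain b where b: "\<forall>w. b w \<in> Bp" "Q = (\<Sum>w\<in>{w. length w \<le> k}. b w * d.word w)"
    unfolding d.diffop_iff_words by blast
  have "\<forall>w. \<exists>a. a \<in> carrier Op \<and> b w = M a" using b(1) by (metis BpE)
  then obtain a where a: "\<forall>w. a w \<in> carrier Op" "\<forall>w. b w = M (a w)" by metis
  let ?P = "\<Oplus>\<^bsub>E\<^esub>w\<in>{w. length w \<le> k}. mult_op Op (a w) \<otimes>\<^sub>E iterated_partial X A p cp w"
  have "?P \<in> D_order X A p k" unfolding D_order_def Let_def using cp a(1) by blast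
  moreover have "J ?P = Q" unfolding D_order_sum(2)[OF cp a(1)] b(2) using a(2) by simp
  ultimately show ?thesis by blast
qed

lemma D_order_iff: "P \<in> carrier E \<Longrightarrow> P \<in> D_order X A p k \<longleftrightarrow> d.diffop k (J P)"
proof
  assume P: "P \<in> carrier E" "d.diffop k (J P)"
  then obtain P' where P': "P' \<in> D_order X A p k" "J P' = J P" using diffop_D_order by blast
  then have "P' = P" using P J.eq_iff D_order_E by metis
  then show "P \<in> D_order X A p k" using P' by simp
qed (rule D_order_diffop)

abbreviation Dp where "Dp \<equiv> D_stalk X A p"

lemma carrier_Dp: "P \<in> carrier Dp \<longleftrightarrow> (\<exists>k. P \<in> D_order X A p k)"
  by (simp add: D_stalk_def)

lemma Dp_ops [simp]: "mult Dp = mult E" "\<one>\<^bsub>Dp\<^esub> = \<one>\<^bsub>E\<^esub>" "add Dp = add E" "\<zero>\<^bsub>Dp\<^esub> = \<zero>\<^bsub>E\<^esub>"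
  by (simp_all add: D_stalk_def)

lemma Dp_E: "P \<in> carrier Dp \<Longrightarrow> P \<in> carrier E"
  using D_order_E carrier_Dp by blast

lemma Dp_iff: "P \<in> carrier E \<Longrightarrow> P \<in> carrier Dp \<longleftrightarrow> (\<exists>k. d.diffop k (J P))"
  unfolding carrier_Dp using D_order_iff by simp

definition opsp where "opsp = {P. \<exists>k. d.diffop k P}"

lemma J_Dp: "J ` carrier Dp = opsp"
proof
  show "J ` carrier Dp \<subseteq> opsp"
  proof
    fix Q assume "Q \<in> J ` carrier Dp"
    then obtain P k where "P \<in> D_order X A p k" "Q = J P" using carrier_Dp by blast
    then show "Q \<in> opsp" using D_order_diffop unfolding opsp_def by blast
  qed
  show "opsp \<subseteq> J ` carrier Dp"
  proof
    fix Q assume "Q \<in> opsp"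
    then obtain k where "d.diffop k Q" by (auto simp: opsp_def)
    then obtain P where "P \<in> D_order X A p k" "J P = Q" using diffop_D_order by blast
    then show "Q \<in> J ` carrier Dp" using carrier_Dp by blast
  qed
qed

lemma opsp_closed:
  assumes "P \<in> opsp" "Q \<in> opsp" shows "P + Q \<in> opsp" "P - Q \<in> opsp" "P * Q \<in> opsp"
proof -
  obtain k l where "d.diffop k P" "d.diffop l Q" using assms by (auto simp: opsp_def)
  then have "d.diffop (max k l) P" "d.diffop (max k l) Q" "d.diffop (k + l) (P * Q)"
    by (auto intro: d.diffop_mono d.diffop_times)
  then show "P + Q \<in> opsp" "P - Q \<in> opsp" "P * Q \<in> opsp"
    unfolding opsp_def by (blast intro: d.plus d.diffop_minus)+
qed

lemma opsp_Bp: "b \<in> Bp \<Longrightarrow> b \<in> opsp"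
  unfolding opsp_def using d.const by blast

lemma opsp_e: "P \<in> opsp \<Longrightarrow> ep * P = P" "P \<in> opsp \<Longrightarrow> P * ep = P"
  unfolding opsp_def using d.diffop_e by blast+

lemma Dp_mem: "P \<in> carrier E \<Longrightarrow> J P \<in> opsp \<Longrightarrow> P \<in> carrier Dp"
  by (simp add: Dp_iff opsp_def)

lemma Dp_opsp: "P \<in> carrier Dp \<Longrightarrow> J P \<in> opsp"
  using J_Dp by blast

sublocale DS: ring_embedding Dp J
proof (rule ring_embeddingI)
  show "inj_on J (carrier Dp)" using J.inj Dp_E by (meson inj_on_subset subsetI)
  have z: "0 \<in> opsp" and u: "ep \<in> opsp" using d.B_zero d.B_e by (auto intro: opsp_Bp)
  show "\<zero>\<^bsub>Dp\<^esub> \<in> carrier Dp" "\<one>\<^bsub>Dp\<^esub> \<in> carrier Dp"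
    using z u by (auto intro!: Dp_mem simp: ep_def[symmetric])
  show "J \<zero>\<^bsub>Dp\<^esub> = 0" by simp
  fix x assume x: "x \<in> carrier Dp"
  have "J (\<ominus>\<^bsub>E\<^esub> x) \<in> opsp" using opsp_closed(2)[OF z Dp_opsp[OF x]] Dp_E[OF x] by (simp add: J.a_inv)
  then have "\<ominus>\<^bsub>E\<^esub> x \<in> carrier Dp" using Dp_E[OF x] by (intro Dp_mem) auto
  then show "\<exists>y\<in>carrier Dp. J y = - J x" using J.a_inv[OF Dp_E[OF x]] by blast
  show "J \<one>\<^bsub>Dp\<^esub> * J x = J x" "J x * J \<one>\<^bsub>Dp\<^esub> = J x" using J.one_mult[OF Dp_E[OF x]] by simp_all
  fix y assume y: "y \<in> carrier Dp"
  show "x \<oplus>\<^bsub>Dp\<^esub> y \<in> carrier Dp" "x \<otimes>\<^bsub>Dp\<^esub> y \<in> carrier Dp"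
    using opsp_closed[OF Dp_opsp[OF x] Dp_opsp[OF y]] Dp_E[OF x] Dp_E[OF y]
    by (auto intro!: Dp_mem simp: J.add J.mult)
  show "J (x \<oplus>\<^bsub>Dp\<^esub> y) = J x + J y" "J (x \<otimes>\<^bsub>Dp\<^esub> y) = J x * J y"
    using Dp_E[OF x] Dp_E[OF y] by (simp_all add: J.add J.mult)
qed

lemma Der_fields: "\<delta> \<in> Der_stalk X A p \<longleftrightarrow> \<delta> \<in> carrier E \<and> J \<delta> \<in> d.fields"
proof -
  have vf: "vector_field_germ X A p c a \<in> carrier E \<and> J (vector_field_germ X A p c a) = diffops.field (Xp c) (\<lambda>i. M (a i))"
    if "c \<in> A" "p \<in> fst c" "\<forall>i. a i \<in> carrier Op" for c a
  proof -
    interpret c: diffops ep Bp "Xp c" by (rule diffops_chart[OF that(1,2)])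
    have T: "mult_op Op (a i) \<otimes>\<^sub>E partial_op X A p c i \<in> carrier E" "partial_op X A p c i \<in> carrier E" for i
      using that partial_E mult_op_E by (cases c; simp)+
    show ?thesis unfolding vector_field_germ_def Let_def c.field_def
      using T that by (auto simp: J.finsum J.mult mult_op_E M_def Xp_def intro!: J.R.finsum_closed)
  qed
  show ?thesis
  proof
    assume "\<delta> \<in> Der_stalk X A p"
    then obtain c a where ca: "\<delta> = vector_field_germ X A p c a" "c \<in> A" "p \<in> fst c" "\<forall>i. a i \<in> carrier Op"
      unfolding Der_stalk_def by blast
    interpret c: diffops ep Bp "Xp c" by (rule diffops_chart[OF ca(2,3)])
    have "J \<delta> \<in> c.fields" unfolding c.fields_def using vf[OF ca(2-4)] ca(1,4) M_Bp by auto
    then show "\<delta> \<in> carrier E \<and> J \<delta> \<in> d.fields" using vf[OF ca(2-4)] ca chart_independence(2)[OF ca(2,3)] by simp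
  next
    assume \<delta>: "\<delta> \<in> carrier E \<and> J \<delta> \<in> d.fields"
    then obtain b where b: "J \<delta> = d.field b" "\<forall>i. b i \<in> Bp" unfolding d.fields_def by blast
    have "\<forall>i. \<exists>a. a \<in> carrier Op \<and> b i = M a" using b(2) by (metis BpE)
    then obtain a where a: "\<forall>i. a i \<in> carrier Op" "\<forall>i. b i = M (a i)" by metis
    have "J \<delta> = J (vector_field_germ X A p cp a)" using vf[OF cp a(1)] b(1) a(2) by (simp add: d.field_def)
    then have "\<delta> = vector_field_germ X A p cp a" using \<delta> vf[OF cp a(1)] J.eq_iff by blast
    then show "\<delta> \<in> Der_stalk X A p" unfolding Der_stalk_def using cp a(1) by blast
  qed
qed

lemma Der_Dp: "\<delta> \<in> Der_stalk X A p \<Longrightarrow> \<delta> \<in> carrier Dp"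
proof -
  assume "\<delta> \<in> Der_stalk X A p"
  then have "\<delta> \<in> carrier E" "d.diffop (Suc 0) (J \<delta>)" by (auto simp: Der_fields intro: d.fields_diffop)
  then show ?thesis unfolding Dp_iff[OF \<open>\<delta> \<in> carrier E\<close>] by blast
qed

lemma Der_closed: "\<delta> \<in> Der_stalk X A p \<Longrightarrow> a \<in> carrier Op \<Longrightarrow> \<delta> a \<in> carrier Op"
  unfolding Der_fields carrier_E by blast

text \<open>
  A vector field annihilates constants, so its commutator with a function \<open>a\<close>, which is a function by the
  order filtration, must be \<open>\<delta>(a)\<close>.
\<close>
lemma Der_M:
  assumes \<delta>: "\<delta> \<in> Der_stalk X A p" and a: "a \<in> carrier Op"
  shows "J \<delta> * M a - M a * J \<delta> = M (\<delta> a)"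
proof -
  have \<delta>E: "\<delta> \<in> carrier E" using \<delta> Der_fields by blast
  have one: "\<delta> \<one>\<^sub>p = \<zero>\<^sub>p"
  proof -
    obtain c b where cb: "\<delta> = vector_field_germ X A p c b" "c \<in> A" "p \<in> fst c" "\<forall>i. b i \<in> carrier Op"
      using \<delta> unfolding Der_stalk_def by blast
    obtain U \<phi> where c: "c = (U, \<phi>)" by (cases c)
    have D: "partial_op X A p c i \<in> carrier E" for i using cb partial_E by (simp add: c)
    have "partial_op X A p c i \<one>\<^sub>p = \<zero>\<^sub>p" for i
      using cb(2,3) unfolding c germ_one germ_zero
      by (intro germ_partial_eqI hol_const) (auto simp: holomorphic_Cn_const(2))
    then have "(mult_op Op (b i) \<otimes>\<^sub>E partial_op X A p c i) \<one>\<^sub>p = \<zero>\<^sub>p" for i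
      using cb(4) by (simp add: E_apply mult_op_apply)
    moreover have "\<delta> \<one>\<^sub>p = (\<Oplus>\<^bsub>Op\<^esub>i\<in>UNIV. (mult_op Op (b i) \<otimes>\<^sub>E partial_op X A p c i) \<one>\<^sub>p)"
      unfolding cb(1) vector_field_germ_def Let_def
      by (rule E_finsum_apply) (use D cb(4) mult_op_E in auto)
    ultimately show ?thesis by simp
  qed
  have "J \<delta> * M a - M a * J \<delta> \<in> Bp" using \<delta> a by (intro d.fields_B M_Bp) (simp_all add: Der_fields)
  then obtain b where b: "b \<in> carrier Op" "J \<delta> * M a - M a * J \<delta> = M b" by (rule BpE)
  have "J (\<delta> \<otimes>\<^sub>E mult_op Op a) = J (mult_op Op a \<otimes>\<^sub>E \<delta> \<oplus>\<^sub>E mult_op Op b)"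
    using b(2) \<delta>E a b(1) by (simp add: J.mult J.add mult_op_E M_def algebra_simps)
  then have "\<delta> \<otimes>\<^sub>E mult_op Op a = mult_op Op a \<otimes>\<^sub>E \<delta> \<oplus>\<^sub>E mult_op Op b"
    using \<delta>E a b(1) by (simp add: J.eq_iff mult_op_E)
  then have "(\<delta> \<otimes>\<^sub>E mult_op Op a) \<one>\<^sub>p = (mult_op Op a \<otimes>\<^sub>E \<delta> \<oplus>\<^sub>E mult_op Op b) \<one>\<^sub>p" by simp
  then have "\<delta> a = b" using a b(1) by (simp add: E_apply mult_op_apply one)
  then show ?thesis using b by simp
qed

lemma Der_mult:
  assumes "\<delta> \<in> Der_stalk X A p" "a \<in> carrier Op" "b \<in> carrier Op"
  shows "\<delta> (a \<otimes>\<^sub>p b) = a \<otimes>\<^sub>p \<delta> b \<oplus>\<^sub>p \<delta> a \<otimes>\<^sub>p b"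
proof (rule M_inj)
  have "M (\<delta> (a \<otimes>\<^sub>p b)) = J \<delta> * (M a * M b) - M a * M b * J \<delta>"
    using assms by (simp add: Der_M[symmetric] M_mult)
  also have "\<dots> = M a * (J \<delta> * M b - M b * J \<delta>) + (J \<delta> * M a - M a * J \<delta>) * M b"
    by (simp add: algebra_simps)
  also have "\<dots> = M (a \<otimes>\<^sub>p \<delta> b \<oplus>\<^sub>p \<delta> a \<otimes>\<^sub>p b)"
    using assms Der_closed by (simp add: Der_M M_add M_mult)
  finally show "M (\<delta> (a \<otimes>\<^sub>p b)) = M (a \<otimes>\<^sub>p \<delta> b \<oplus>\<^sub>p \<delta> a \<otimes>\<^sub>p b)" .
qed (use assms Der_closed in auto)

lemma M_const_of_nat: "M (germ (\<lambda>_. c)) * of_nat m = M (germ (\<lambda>_. of_nat m * c))"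
proof (induction m)
  case 0
  then show ?case by (simp add: germ_zero[symmetric] M_zero)
next
  case (Suc m)
  have "M (germ (\<lambda>_. c)) * of_nat (Suc m) = M (germ (\<lambda>_. c)) + M (germ (\<lambda>_. of_nat m * c))"
    by (simp add: distrib_left Suc)
  also have "\<dots> = M (germ (\<lambda>_. c + of_nat m * c))"
    by (simp add: M_add[symmetric] hol_const germ_add)
  finally show ?case by (simp add: distrib_right)
qed

lemma Bp_inverse_nat: "m > 0 \<Longrightarrow> \<exists>q\<in>Bp. q * of_nat m = ep"
  by (intro bexI[of _ "M (germ (\<lambda>_. 1 / of_nat m))"])
     (simp_all add: M_const_of_nat germ_one[symmetric] M_one M_Bp hol_const)

definition yp :: "'n \<Rightarrow> ('a germ \<Rightarrow> 'a germ) ring_product" where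
  "yp k = M (coordinate (snd cp) k)"

definition index :: "nat \<Rightarrow> 'n" where
  "index = (SOME f. bij_betw f {..<CARD('n)} UNIV)"

sublocale d: diffops_coordinates ep Bp "Xp cp" yp index
proof
  obtain U \<phi> where c: "cp = (U, \<phi>)" by (cases cp)
  have cU: "(U, \<phi>) \<in> A" "p \<in> U" using cp c by auto
  have co: "coordinate \<phi> k \<in> carrier Op" for k using hol_coordinate[OF cU] by (simp add: coordinate_def)
  show "yp k \<in> Bp" for k by (simp add: yp_def c M_Bp co)
  show "Xp cp i * yp k - yp k * Xp cp i = (if i = k then ep else 0)" for i k
    unfolding c yp_def snd_conv Xp_M[OF cU co] partial_coordinate[OF cU] by (simp add: M_one M_zero)
  show "\<And>m. m > 0 \<Longrightarrow> \<exists>q\<in>Bp. q * of_nat m = ep" by (rule Bp_inverse_nat)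
  have "\<exists>f. bij_betw f {..<CARD('n)} (UNIV :: 'n set)"
    using ex_bij_betw_nat_finite[of "UNIV :: 'n set"] by (simp add: atLeast0LessThan)
  then show "bij_betw index {..<CARD('n)} UNIV" unfolding index_def by (rule someI_ex)
qed

end

section \<open>Adjoining the variable s\<close>

unbundle no vec_syntax
unbundle fps_syntax

lemma fps_X_commute: "fps_X * (a :: 'r::ring_1 fps) = a * fps_X"
  by (rule fps_ext) simp

text \<open>
  Polynomials in the central variable \<open>s\<close>, represented as power series in \<open>fps_X\<close> with finite support.
\<close>
definition polys :: "'r::zero set \<Rightarrow> 'r fps set" where
  "polys C = {Q. (\<forall>i. Q $ i \<in> C) \<and> (\<exists>N. \<forall>i\<ge>N. Q $ i = 0)}"

lemma polysI: "(\<And>i. Q $ i \<in> C) \<Longrightarrow> (\<And>i. N \<le> i \<Longrightarrow> Q $ i = 0) \<Longrightarrow> Q \<in> polys C"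
  by (auto simp: polys_def)

lemma polysE:
  assumes "Q \<in> polys C" obtains N where "\<forall>i. Q $ i \<in> C" "\<forall>i\<ge>N. Q $ i = 0"
  using assms unfolding polys_def by blast

context lie_basis
begin

lemma polys_closed:
  assumes "P \<in> polys C" "Q \<in> polys C"
  shows "P + Q \<in> polys C" "P - Q \<in> polys C" "P * Q \<in> polys C"
proof -
  obtain N where N: "\<forall>i. P $ i \<in> C" "\<forall>i\<ge>N. P $ i = 0" using assms(1) by (rule polysE)
  obtain N' where N': "\<forall>i. Q $ i \<in> C" "\<forall>i\<ge>N'. Q $ i = 0" using assms(2) by (rule polysE)
  show "P + Q \<in> polys C" "P - Q \<in> polys C"
    by (rule polysI[of _ _ "max N N'"]; use N N' in \<open>simp add: C_plus C_minus\<close>)+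
  show "P * Q \<in> polys C"
  proof (rule polysI[of _ _ "N + N'"])
    show "(P * Q) $ i \<in> C" for i
      unfolding fps_mult_nth using N N' by (intro C_sum C_times) auto
    fix i assume i: "N + N' \<le> i"
    have "P $ k * Q $ (i - k) = 0" if "k \<in> {0..i}" for k
    proof (cases "N \<le> k")
      case True
      then show ?thesis using N(2) by simp
    next
      case False
      then have "N' \<le> i - k" using i by linarith
      then show ?thesis using N'(2) by simp
    qed
    then show "(P * Q) $ i = 0" unfolding fps_mult_nth by (intro sum.neutral) auto
  qed
qed

lemma polys_const: "c \<in> C \<Longrightarrow> fps_const c \<in> polys C"
  by (rule polysI[of _ _ 1]) (auto simp: C_zero)

lemma polys_X: "P \<in> polys C \<Longrightarrow> fps_X * P \<in> polys C"
proof -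
  assume "P \<in> polys C"
  then obtain N where N: "\<forall>i. P $ i \<in> C" "\<forall>i\<ge>N. P $ i = 0" by (rule polysE)
  show ?thesis by (rule polysI[of _ _ "Suc N"]) (use N C_zero in auto)
qed

lemma polys_e: "P \<in> polys C \<Longrightarrow> fps_const e * P = P" "P \<in> polys C \<Longrightarrow> P * fps_const e = P"
  by (auto simp: polys_def fps_eq_iff e_left e_right)

end

text \<open>
  \<open>H\<close> plays the role of an equation of the divisor, and \<open>al v\<close> of the quotient \<open>v(H) / H\<close>.
\<close>
locale log_lie_basis = lie_basis +
  fixes H :: 'a
  assumes H_B: "H \<in> B" and H_regular: "\<lbrakk>b \<in> B; b * H = 0\<rbrakk> \<Longrightarrow> b = 0"
    and H_log: "v \<in> L \<Longrightarrow> \<exists>a\<in>B. v * H - H * v = a * H"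
begin

definition al :: "'a \<Rightarrow> 'a" where
  "al v = (THE a. a \<in> B \<and> v * H - H * v = a * H)"

lemma al_eqI: "a \<in> B \<Longrightarrow> v * H - H * v = a * H \<Longrightarrow> al v = a"
  unfolding al_def
proof (rule the_equality)
  fix b assume a: "a \<in> B" "v * H - H * v = a * H" and b: "b \<in> B \<and> v * H - H * v = b * H"
  then have "(b - a) * H = 0" by (simp add: left_diff_distrib)
  then show "b = a" using H_regular[of "b - a"] a b B_minus by simp
qed simp

lemma al: assumes "v \<in> L" shows "al v \<in> B" "v * H - H * v = al v * H"
proof -
  obtain a where a: "a \<in> B" "v * H - H * v = a * H" using H_log[OF assms] by blast
  then have "al v = a" by (rule al_eqI)
  then show "al v \<in> B" "v * H - H * v = al v * H" using a by simp_all
qed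

lemma al_plus: "v \<in> L \<Longrightarrow> w \<in> L \<Longrightarrow> al (v + w) = al v + al w"
proof (rule al_eqI)
  assume v: "v \<in> L" and w: "w \<in> L"
  show "al v + al w \<in> B" using v w by (simp add: al(1) B_plus)
  have "(v + w) * H - H * (v + w) = (v * H - H * v) + (w * H - H * w)" by (simp add: algebra_simps)
  then show "(v + w) * H - H * (v + w) = (al v + al w) * H" using v w by (simp only: al(2) distrib_right)
qed

lemma al_scale: "v \<in> L \<Longrightarrow> b \<in> B \<Longrightarrow> al (b * v) = b * al v"
proof (rule al_eqI)
  assume v: "v \<in> L" and b: "b \<in> B"
  show "b * al v \<in> B" using v b by (simp add: al B_times)
  have "H * b = b * H" using H_B b by (rule B_commute)
  then have "b * v * H - H * (b * v) = b * (v * H - H * v)" by (simp add: right_diff_distrib mult.assoc[symmetric])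
  then show "b * v * H - H * (b * v) = b * al v * H" using v by (simp add: al(2) mult.assoc)
qed

lemma al_zero: "al 0 = 0"
  by (rule al_eqI) (simp_all add: B_zero)

lemma al_bracket: "v \<in> L \<Longrightarrow> w \<in> L \<Longrightarrow> al (v * w - w * v) = (v * al w - al w * v) - (w * al v - al v * w)"
proof (rule al_eqI)
  assume v: "v \<in> L" and w: "w \<in> L"
  show "(v * al w - al w * v) - (w * al v - al v * w) \<in> B"
    using v w by (intro B_minus L_anchor al) auto
  have c: "al v * al w = al w * al v" using v w by (intro B_commute al)
  have "(v * w - w * v) * H - H * (v * w - w * v) =
      (v * (w * H - H * w) - (w * H - H * w) * v) - (w * (v * H - H * v) - (v * H - H * v) * w)"
    by (simp add: algebra_simps)
  also have "\<dots> = (v * (al w * H) - al w * H * v) - (w * (al v * H) - al v * H * w)"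
    using v w by (simp add: al(2))
  also have "\<dots> = (v * al w - al w * v) * H + al w * (v * H - H * v) - ((w * al v - al v * w) * H + al v * (w * H - H * w))"
    by (simp add: algebra_simps)
  also have "al w * (v * H - H * v) = al v * (w * H - H * w)"
    using v w c by (simp add: al(2) mult.assoc[symmetric])
  finally show "(v * w - w * v) * H - H * (v * w - w * v) = (v * al w - al w * v - (w * al v - al v * w)) * H"
    by (simp add: left_diff_distrib)
qed

definition theta :: "'a \<Rightarrow> 'a fps" where
  "theta v = fps_const v - fps_const (al v) * fps_X"

lemma theta_nth: "theta v $ 0 = v" "theta v $ i = (if i = 0 then v else if i = 1 then - al v else 0)"
  by (auto simp: theta_def)

lemma theta_plus: "v \<in> L \<Longrightarrow> w \<in> L \<Longrightarrow> theta (v + w) = theta v + theta w"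
  by (auto simp: fps_eq_iff theta_nth al_plus)

lemma theta_scale: "v \<in> L \<Longrightarrow> b \<in> B \<Longrightarrow> fps_const b * theta v = theta (b * v)"
  by (auto simp: fps_eq_iff theta_nth al_scale)

lemma theta_zero: "theta 0 = 0"
  by (auto simp: fps_eq_iff theta_nth al_zero)

lemma theta_sum: "(\<And>a. a \<in> A \<Longrightarrow> t a \<in> L) \<Longrightarrow> theta (\<Sum>a\<in>A. t a) = (\<Sum>a\<in>A. theta (t a))"
  by (induction A rule: infinite_finite_induct) (auto simp: theta_zero theta_plus L_sum)

lemma theta_bracket:
  assumes v: "v \<in> L" and w: "w \<in> L"
  shows "theta v * theta w - theta w * theta v = theta (v * w - w * v)"
proof -
  have prod: "(fps_const v - fps_const a * fps_X) * (fps_const w - fps_const b * fps_X) =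
      fps_const (v * w) - fps_const (v * b + a * w) * fps_X + fps_const (a * b) * (fps_X * fps_X)" for v w a b :: 'a
  proof -
    have "(fps_const v - fps_const a * fps_X) * (fps_const w - fps_const b * fps_X) =
        (fps_const v - fps_const a * fps_X) * fps_const w - (fps_const v - fps_const a * fps_X) * fps_const b * fps_X"
      by (simp only: right_diff_distrib mult.assoc)
    also have "\<dots> = fps_const (v * w) - fps_const (v * b + a * w) * fps_X + fps_const (a * b) * fps_X * fps_X"
      by (rule fps_ext) (simp split: if_split)
    finally show ?thesis by (simp only: mult.assoc)
  qed
  have c: "al v * al w = al w * al v" using v w by (intro B_commute al)
  have "theta v * theta w - theta w * theta v =
      fps_const (v * w - w * v) - fps_const ((v * al w + al v * w) - (w * al v + al w * v)) * fps_X"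
    unfolding theta_def prod c by (simp only: fps_const_sub[symmetric] left_diff_distrib) simp
  also have "(v * al w + al v * w) - (w * al v + al w * v) = al (v * w - w * v)"
    using v w by (simp add: al_bracket algebra_simps)
  finally show ?thesis by (simp only: theta_def)
qed

lemma theta_anchor: "v \<in> L \<Longrightarrow> b \<in> B \<Longrightarrow> theta v * fps_const b - fps_const b * theta v = fps_const (v * b - b * v)"
  using al(1)[of v] B_commute[of "al v" b] by (auto simp: fps_eq_iff theta_nth)

lemma theta_polys: "v \<in> L \<Longrightarrow> theta v \<in> polys C"
  by (rule polysI[of _ _ 2]) (use al(1)[of v] L_C B_C C_zero C_uminus in \<open>auto simp: theta_nth\<close>)

lemma lie_basis_theta:
  "lie_basis (fps_const e) (polys C) (fps_const ` B) (theta ` L) n (\<lambda>i. theta (g i)) (\<lambda>x i. fps_const (co (x $ 0) i))"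
proof
  fix x y :: "'a fps"
  show "x + y \<in> polys C" "x - y \<in> polys C" "x * y \<in> polys C" if "x \<in> polys C" "y \<in> polys C"
    using polys_closed[OF that] .
  show "fps_const e * x = x" "x * fps_const e = x" if "x \<in> polys C" using polys_e that by blast+
  show "fps_const ` B \<subseteq> polys C" using polys_const B_C by blast
  show "fps_const e \<in> fps_const ` B" using B_e by blast
  show "x + y \<in> fps_const ` B" "x - y \<in> fps_const ` B" "x * y \<in> fps_const ` B" "x * y = y * x"
    if xy: "x \<in> fps_const ` B" "y \<in> fps_const ` B"
  proof -
    obtain a b where "x = fps_const a" "y = fps_const b" "a \<in> B" "b \<in> B" using xy by blast
    then show "x + y \<in> fps_const ` B" "x - y \<in> fps_const ` B" "x * y \<in> fps_const ` B" "x * y = y * x"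
      using B_plus B_minus B_times B_commute by auto
  qed
  show "theta ` L \<subseteq> polys C" using theta_polys by blast
  show "0 \<in> theta ` L" using theta_zero L_zero by (metis imageI)
  show "x + y \<in> theta ` L" if "x \<in> theta ` L" "y \<in> theta ` L"
    using that by (auto simp: theta_plus[symmetric] L_plus)
  show "b * x \<in> theta ` L" if "b \<in> fps_const ` B" "x \<in> theta ` L" for b
    using that by (auto simp: theta_scale L_scale)
  show "x * y - y * x \<in> theta ` L" if "x \<in> theta ` L" "y \<in> theta ` L"
    using that by (auto simp: theta_bracket L_bracket)
  show "x * b - b * x \<in> fps_const ` B" if "x \<in> theta ` L" "b \<in> fps_const ` B" for b
    using that by (auto simp: theta_anchor L_anchor)
  show "theta (g i) \<in> theta ` L" if "i < n" for i using g_L[OF that] by blast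
  show "fps_const (co (x $ 0) i) \<in> fps_const ` B" if "x \<in> theta ` L" "i < n" for i
    using that by (auto simp: theta_nth co_B)
  show "(\<Sum>i<n. fps_const (co (x $ 0) i) * theta (g i)) = x" if "x \<in> theta ` L"
  proof -
    obtain v where v: "v \<in> L" "x = theta v" using \<open>x \<in> theta ` L\<close> by blast
    have "(\<Sum>i<n. fps_const (co v i) * theta (g i)) = (\<Sum>i<n. theta (co v i * g i))"
      by (rule sum.cong) (use v in \<open>simp_all add: theta_scale g_L co_B\<close>)
    also have "\<dots> = theta (\<Sum>i<n. co v i * g i)"
      by (rule theta_sum[symmetric]) (use v in \<open>simp add: L_scale co_B g_L\<close>)
    finally show ?thesis using v co_expand by (simp add: theta_nth)
  qed
  fix u k assume u: "\<And>i. i < n \<Longrightarrow> u i \<in> fps_const ` B" and k: "k < n"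
  define a where "a i = u i $ 0" for i
  have a: "a i \<in> B" "u i = fps_const (a i)" if "i < n" for i using u[OF that] by (auto simp: a_def)
  have "(\<Sum>i<n. u i * theta (g i)) $ 0 = (\<Sum>i<n. a i * g i)"
    unfolding fps_sum_nth by (rule sum.cong) (simp_all add: a theta_nth)
  then show "fps_const (co ((\<Sum>i<n. u i * theta (g i)) $ 0) k) = u k"
    using co_unique[of a k] a k by simp
qed

sublocale spec: specialization e C B L n g co "fps_const e" "polys C" "fps_const ` B" "theta ` L"
    "\<lambda>i. theta (g i)" "\<lambda>x i. fps_const (co (x $ 0) i)" "\<lambda>x. x $ 0" fps_const "\<lambda>x. fps_X * x"
proof (rule specialization.intro[OF lie_basis_axioms lie_basis_theta], unfold_locales)
  fix x y :: "'a fps" and p :: 'a and i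
  show "(x - y) $ 0 = x $ 0 - y $ 0" "(x * y) $ 0 = x $ 0 * y $ 0" "fps_const p $ 0 = p"
    "fps_const (0 :: 'a) = 0" "fps_X * (x - y) = fps_X * x - fps_X * y" "fps_X * (x * y) = fps_X * x * y"
    "(fps_X * x) $ 0 = 0"
    by (simp_all add: right_diff_distrib mult.assoc)
  show "x $ 0 \<in> C" if "x \<in> polys C" using that by (auto simp: polys_def)
  show "x $ 0 \<in> B" if "x \<in> fps_const ` B" using that by auto
  show "theta (g i) $ 0 = g i" by (rule theta_nth)
  show "fps_const p \<in> polys C" if "p \<in> C" using that by (rule polys_const)
  show "fps_X * x \<in> polys C" if "x \<in> polys C" using that by (rule polys_X)
  show "x = 0" if X: "fps_X * x = 0"
  proof (rule fps_ext)
    fix i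
    have "(fps_X * x) $ Suc i = 0" by (simp only: X fps_zero_nth)
    then show "x $ i = 0 $ i" by simp
  qed
  show "\<exists>z\<in>polys C. x = fps_X * z" if x: "x \<in> polys C" "x $ 0 = 0"
  proof -
    obtain N where N: "\<forall>i. x $ i \<in> C" "\<forall>i\<ge>N. x $ i = 0" using x(1) by (rule polysE)
    have "Abs_fps (\<lambda>i. x $ Suc i) \<in> polys C" by (rule polysI[of _ _ N]) (use N in auto)
    moreover have "x = fps_X * Abs_fps (\<lambda>i. x $ Suc i)" using x(2) by (auto simp: fps_eq_iff)
    ultimately show ?thesis by blast
  qed
qed

end

section \<open>Evaluation at natural numbers\<close>

text \<open>
  The automorphism \<open>P \<mapsto> u\<^sup>-\<^sup>s P u\<^sup>s\<close> makes sense without logarithms once \<open>s\<close> is specialized to a natural number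
  \<open>m\<close>, and the values at all \<open>m\<close> determine a polynomial, since there is no additive torsion.
\<close>
definition eval_at :: "nat \<Rightarrow> 'r::ring_1 fps \<Rightarrow> 'r" where
  "eval_at m P = (\<Sum>i<(LEAST N. \<forall>i\<ge>N. P $ i = 0). P $ i * of_nat m ^ i)"

lemma eval_at_eq:
  assumes "\<forall>i\<ge>N. P $ i = 0" shows "eval_at m P = (\<Sum>i<N. P $ i * of_nat m ^ i)"
proof -
  let ?L = "LEAST N. \<forall>i\<ge>N. P $ i = 0"
  have L: "\<forall>i\<ge>?L. P $ i = 0" by (rule LeastI[of "\<lambda>N. \<forall>i\<ge>N. P $ i = 0", OF assms])
  have "?L \<le> N" by (rule Least_le[of "\<lambda>N. \<forall>i\<ge>N. P $ i = 0", OF assms])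
  moreover have "(\<Sum>i<k. P $ i * of_nat m ^ i) = (\<Sum>i<N. P $ i * of_nat m ^ i)" if "k \<le> N" "\<forall>i\<ge>k. P $ i = 0" for k
    by (rule sum.mono_neutral_left) (use that in auto)
  ultimately show ?thesis unfolding eval_at_def using L by blast
qed

lemma eval_at_add:
  assumes "P \<in> polys C" "Q \<in> polys C'" shows "eval_at m (P + Q) = eval_at m P + eval_at m Q"
proof -
  obtain N where N: "\<forall>i\<ge>N. P $ i = 0" using assms(1) by (rule polysE)
  obtain N' where N': "\<forall>i\<ge>N'. Q $ i = 0" using assms(2) by (rule polysE)
  have e: "\<forall>i\<ge>max N N'. P $ i = 0" "\<forall>i\<ge>max N N'. Q $ i = 0" "\<forall>i\<ge>max N N'. (P + Q) $ i = 0" using N N' by auto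
  show ?thesis by (simp only: eval_at_eq[OF e(1)] eval_at_eq[OF e(2)] eval_at_eq[OF e(3)] fps_add_nth distrib_right sum.distrib)
qed

lemma eval_at_const: "eval_at m (fps_const c) = c"
  by (subst eval_at_eq[of 1]) auto

lemma eval_at_X:
  assumes "P \<in> polys C" shows "eval_at m (fps_X * P) = eval_at m P * of_nat m"
proof -
  obtain N where N: "\<forall>i\<ge>N. P $ i = 0" using assms by (rule polysE)
  have "\<forall>i\<ge>Suc N. (fps_X * P) $ i = 0" using N by auto
  then have "eval_at m (fps_X * P) = (\<Sum>i<Suc N. (fps_X * P) $ i * of_nat m ^ i)" by (rule eval_at_eq)
  also have "\<dots> = (\<Sum>i<N. P $ i * of_nat m ^ i) * of_nat m"
    unfolding sum.lessThan_Suc_shift by (simp add: sum_distrib_right mult.assoc power_commutes)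
  finally show ?thesis using eval_at_eq[OF N] by simp
qed

lemma eval_at_times_const:
  assumes "P \<in> polys C" shows "eval_at m (P * fps_const c) = eval_at m P * c"
proof -
  obtain N where N: "\<forall>i\<ge>N. P $ i = 0" using assms by (rule polysE)
  have "\<forall>i\<ge>N. (P * fps_const c) $ i = 0" using N by auto
  then have "eval_at m (P * fps_const c) = (\<Sum>i<N. (P * fps_const c) $ i * of_nat m ^ i)" by (rule eval_at_eq)
  also have "\<dots> = (\<Sum>i<N. P $ i * of_nat m ^ i * c)"
  proof (rule sum.cong)
    fix i
    have "c * of_nat m ^ i = of_nat m ^ i * c" by (metis mult_of_nat_commute of_nat_power)
    then show "(P * fps_const c) $ i * of_nat m ^ i = P $ i * of_nat m ^ i * c" by (simp add: mult.assoc)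
  qed simp
  finally show ?thesis by (simp only: eval_at_eq[OF N] sum_distrib_right)
qed

lemma fps_split_constant:
  fixes P :: "'r::ring_1 fps"
  shows "P = fps_const (P $ 0) + fps_X * Abs_fps (\<lambda>i. P $ Suc i)"
  by (auto simp: fps_eq_iff)

context lie_basis
begin

lemma polys_induct [consumes 1, case_names const X]:
  assumes "P \<in> polys C" and const: "\<And>c. c \<in> C \<Longrightarrow> R (fps_const c)"
    and X: "\<And>c Q. c \<in> C \<Longrightarrow> Q \<in> polys C \<Longrightarrow> R Q \<Longrightarrow> R (fps_const c + fps_X * Q)"
  shows "R P"
proof -
  obtain N where N: "\<forall>i. P $ i \<in> C" "\<forall>i\<ge>N. P $ i = 0" using assms(1) by (rule polysE)
  then show ?thesis
  proof (induction N arbitrary: P)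
    case 0
    then have "P = fps_const 0" by (auto simp: fps_eq_iff)
    then show ?case using const[OF C_zero] by simp
  next
    case (Suc N)
    let ?Q = "Abs_fps (\<lambda>i. P $ Suc i)"
    have "?Q \<in> polys C" by (rule polysI[of _ _ N]) (use Suc.prems in auto)
    moreover have "R ?Q" by (rule Suc.IH) (use Suc.prems in auto)
    ultimately have "R (fps_const (P $ 0) + fps_X * ?Q)" using Suc.prems by (intro X) auto
    then show ?case using fps_split_constant[of P] by simp
  qed
qed

lemma eval_at_mult:
  assumes "P \<in> polys C" "Q \<in> polys C" shows "eval_at m (P * Q) = eval_at m P * eval_at m Q"
  using assms(2)
proof (induction rule: polys_induct)
  case (const c)
  show ?case by (simp add: eval_at_const eval_at_times_const[OF assms(1)])
next
  case (X c Q)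
  have PQ: "P * Q \<in> polys C" by (rule polys_closed(3)[OF assms(1) X(2)])
  have "P * (fps_const c + fps_X * Q) = P * fps_const c + fps_X * (P * Q)"
    by (simp only: distrib_left fps_X_commute[of "P * Q"] fps_X_commute[of Q] mult.assoc)
  also have "eval_at m \<dots> = eval_at m (P * fps_const c) + eval_at m (fps_X * (P * Q))"
    by (rule eval_at_add[OF polys_closed(3)[OF assms(1) polys_const[OF X(1)]] polys_X[OF PQ]])
  also have "\<dots> = eval_at m P * (c + eval_at m Q * of_nat m)"
    by (simp add: eval_at_times_const[OF assms(1)] eval_at_X[OF PQ] X(3) distrib_left mult.assoc)
  also have "c + eval_at m Q * of_nat m = eval_at m (fps_const c + fps_X * Q)"
    by (subst eval_at_add[OF polys_const[OF X(1)] polys_X[OF X(2)]]) (simp add: eval_at_const eval_at_X[OF X(2)])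
  finally show ?case .
qed

lemma eval_at_C: "P \<in> polys C \<Longrightarrow> eval_at m P \<in> C"
proof (induction rule: polys_induct)
  case (X c Q)
  have "x * of_nat k \<in> C" if "x \<in> C" for x k
    by (induction k) (simp_all add: distrib_left C_plus C_zero that)
  then show ?case using X
    by (subst eval_at_add[OF polys_const[OF X(1)] polys_X[OF X(2)]])
       (simp add: eval_at_const eval_at_X[OF X(2)] C_plus)
qed (simp add: eval_at_const)

text \<open>
  If \<open>x(m) = \<Sum> x\<^sub>i m\<^sup>i\<close> vanishes for all \<open>m\<close>, so does \<open>2\<^sup>N x(m) - x(2m)\<close>, in which the leading term cancels and
  the coefficient \<open>x\<^sub>i\<close> is multiplied by \<open>2\<^sup>N - 2\<^sup>i\<close>.
\<close>
lemma vanishing_coefficients: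
  assumes torsion: "\<And>x m. x \<in> C \<Longrightarrow> m > 0 \<Longrightarrow> of_nat m * x = 0 \<Longrightarrow> x = 0"
  shows "(\<And>i. x i \<in> C) \<Longrightarrow> (\<And>m. (\<Sum>i<N. x i * of_nat m ^ i) = 0) \<Longrightarrow> i < N \<Longrightarrow> x i = 0"
proof (induction N arbitrary: x i)
  case (Suc N)
  have C_nat: "of_nat k * y \<in> C" if "y \<in> C" for y k
    by (induction k) (simp_all add: distrib_right C_plus C_zero that)
  \<comment> \<open>The coefficients of \<open>2\<^sup>N x(m) - x(2m)\<close>.\<close>
  define z where "z i = of_nat (2 ^ N) * x i - of_nat (2 ^ i) * x i" for i
  have zz: "z i = 0" if "i < N" for i
  proof (rule Suc.IH[OF _ _ that])
    show "z i \<in> C" for i unfolding z_def by (intro C_minus C_nat Suc.prems)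
    fix m
    have "(\<Sum>i<Suc N. x i * of_nat (2 * m) ^ i) = (\<Sum>i<Suc N. of_nat (2 ^ i) * x i * of_nat m ^ i)"
    proof (rule sum.cong)
      fix i
      have "x i * of_nat (2 * m) ^ i = x i * (of_nat (2 ^ i) * of_nat m ^ i)"
        by (simp only: of_nat_power[symmetric] power_mult_distrib of_nat_mult[symmetric])
      also have "\<dots> = of_nat (2 ^ i) * x i * of_nat m ^ i"
        by (simp only: mult.assoc[symmetric] mult_of_nat_commute[symmetric])
      finally show "x i * of_nat (2 * m) ^ i = of_nat (2 ^ i) * x i * of_nat m ^ i" .
    qed simp
    then have "(\<Sum>i<Suc N. of_nat (2 ^ i) * x i * of_nat m ^ i) = 0" using Suc.prems(2)[of "2 * m"] by simp
    moreover have "(\<Sum>i<Suc N. of_nat (2 ^ N) * x i * of_nat m ^ i) = of_nat (2 ^ N) * (\<Sum>i<Suc N. x i * of_nat m ^ i)"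
      by (simp only: sum_distrib_left mult.assoc)
    moreover have "(\<Sum>i<Suc N. z i * of_nat m ^ i) =
       (\<Sum>i<Suc N. of_nat (2 ^ N) * x i * of_nat m ^ i) - (\<Sum>i<Suc N. of_nat (2 ^ i) * x i * of_nat m ^ i)"
      unfolding z_def by (simp only: left_diff_distrib sum_subtractf)
    ultimately have "(\<Sum>i<Suc N. z i * of_nat m ^ i) = 0" using Suc.prems(2)[of m] by (simp only: mult_zero_right diff_self)
    moreover have "z N = 0" by (simp add: z_def)
    ultimately show "(\<Sum>i<N. z i * of_nat m ^ i) = 0" by simp
  qed
  have low: "x i = 0" if "i < N" for i
  proof (rule torsion[OF Suc.prems(1), of "2 ^ N - 2 ^ i"])
    have "(2::nat) ^ i < 2 ^ N" using that by simp
    then show "0 < (2::nat) ^ N - 2 ^ i" by simp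
    have "of_nat (2 ^ N - 2 ^ i) * x i = z i"
      unfolding z_def using \<open>(2::nat) ^ i < 2 ^ N\<close> by (simp only: of_nat_diff less_imp_le left_diff_distrib)
    then show "of_nat (2 ^ N - 2 ^ i) * x i = 0" using zz that by simp
  qed
  have "x N = 0" using Suc.prems(2)[of 1] low by simp
  then show ?case using low Suc.prems(3) by (auto simp: less_Suc_eq)
qed simp

lemma eval_at_inj:
  assumes torsion: "\<And>x m. x \<in> C \<Longrightarrow> m > 0 \<Longrightarrow> of_nat m * x = 0 \<Longrightarrow> x = 0"
    and P: "P \<in> polys C" and zero: "\<And>m. eval_at m P = 0"
  shows "P = 0"
proof -
  obtain N where N: "\<forall>i. P $ i \<in> C" "\<forall>i\<ge>N. P $ i = 0" using P by (rule polysE)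
  have "P $ i = 0" if "i < N" for i
    by (rule vanishing_coefficients[OF torsion _ _ that]) (use N zero eval_at_eq[OF N(2)] in auto)
  then show ?thesis using N(2) by (auto simp: fps_eq_iff not_less[symmetric])
qed

end

lemma (in log_lie_basis) torsion_free_iff:
  "spec.torsion_free \<longleftrightarrow> (\<forall>Y\<in>polys C. \<forall>q. (\<forall>i<n. q i \<in> polys C) \<longrightarrow> fps_X * Y = (\<Sum>i<n. q i * theta (g i)) \<longrightarrow>
     (\<exists>q. (\<forall>i<n. q i \<in> polys C) \<and> Y = (\<Sum>i<n. q i * theta (g i))))"
proof -
  have LI: "Z \<in> spec.left_ideal \<longleftrightarrow> (\<exists>q. (\<forall>i<n. q i \<in> polys C) \<and> Z = (\<Sum>i<n. q i * theta (g i)))" for Z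
    unfolding spec.left_ideal_def mem_Collect_eq by (rule iffI; elim exE conjE; intro exI conjI; assumption)
  show ?thesis unfolding spec.torsion_free_def LI by blast
qed

context diffops_coordinates
begin

sublocale ops: lie_basis e ops B fields "CARD('b)" "\<lambda>i. X (idx i)" "\<lambda>v i. v * y (idx i) - y (idx i) * v"
  by (rule lie_basis_fields)

lemma ops_torsion: assumes "x \<in> ops" "m > 0" "of_nat m * x = 0" shows "x = 0"
proof -
  obtain q where q: "q \<in> B" "q * of_nat m = e" using inverse_nat[OF assms(2)] by blast
  have "x = q * of_nat m * x" using q(2) ops.e_left[OF assms(1)] by simp
  then show ?thesis using assms(3) by (simp add: mult.assoc)
qed

lemma eval_at_eqI:
  assumes P: "P \<in> polys ops" and Q: "Q \<in> polys ops" and eq: "\<And>m. eval_at m P = eval_at m Q" shows "P = Q"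
proof -
  have PQ: "P - Q \<in> polys ops" by (rule ops.polys_closed(2)[OF P Q])
  have "eval_at m (P - Q) = 0" for m
  proof -
    have "eval_at m (P - Q + Q) = eval_at m (P - Q) + eval_at m Q" by (rule eval_at_add[OF PQ Q])
    then show ?thesis using eq[of m] by simp
  qed
  then have "P - Q = 0" by (intro ops.eval_at_inj[OF ops_torsion PQ])
  then show ?thesis by simp
qed

end

section \<open>Change of the equation\<close>

locale change_of_equation = diffops_coordinates +
  fixes U V :: 'a
  assumes U_B: "U \<in> B" and V_B: "V \<in> B" and UV: "U * V = e"
begin

lemma VU: "V * U = e" using UV B_commute[OF U_B V_B] by simp

lemma unit_times: assumes "P \<in> ops" shows "U * P \<in> ops" "V * P \<in> ops" "P * U \<in> ops" "P * V \<in> ops"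
proof -
  have "U \<in> ops" "V \<in> ops" using U_B V_B ops.B_C by blast+
  then show "U * P \<in> ops" "V * P \<in> ops" "P * U \<in> ops" "P * V \<in> ops" by (simp_all only: ops.C_times assms)
qed

lemma U_power_V_power: "P \<in> ops \<Longrightarrow> U ^ m * (V ^ m * P) = P"
proof (induction m arbitrary: P)
  case (Suc m)
  have "U ^ Suc m * (V ^ Suc m * P) = U * (U ^ m * (V ^ m * (V * P)))"
    by (simp only: power_Suc[of U] power_Suc2[of V] mult.assoc)
  also have "\<dots> = U * (V * P)" by (simp only: Suc.IH[OF unit_times(2)[OF Suc.prems]])
  also have "\<dots> = P" using ops.e_left[OF Suc.prems] by (simp add: mult.assoc[symmetric] UV)
  finally show ?case .
qed simp

lemma power_U_power_V: "P \<in> ops \<Longrightarrow> P * U ^ m * V ^ m = P"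
proof (induction m arbitrary: P)
  case (Suc m)
  have "P * U ^ Suc m * V ^ Suc m = (P * U) * U ^ m * V ^ m * V"
    by (simp only: power_Suc[of U] power_Suc2[of V] mult.assoc)
  also have "\<dots> = P * U * V" by (simp only: Suc.IH[OF unit_times(3)[OF Suc.prems]])
  also have "\<dots> = P" using ops.e_right[OF Suc.prems] by (simp add: mult.assoc UV)
  finally show ?case .
qed simp

lemma conjugate_Suc: "V ^ Suc m * P * U ^ Suc m = V * (V ^ m * P * U ^ m) * U"
  by (simp only: power_Suc[of V] power_Suc2[of U] mult.assoc)

lemma conjugate_B: "b \<in> B \<Longrightarrow> V ^ m * b * U ^ m = b"
proof (induction m)
  case (Suc m)
  have "V * b * U = b * (V * U)" using B_commute[OF V_B Suc.prems] by (simp only: mult.assoc)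
  then show ?case using Suc e_B[of b] B_commute[OF B_e, of b] by (simp add: conjugate_Suc VU del: power_Suc)
qed simp

text \<open>
  For a fixed power this is \<open>u\<^sup>-\<^sup>m v u\<^sup>m = v + m v(u)/u\<close>: conjugation is polynomial in \<open>m\<close>.
\<close>
lemma conjugate_field:
  assumes v: "v \<in> fields"
  shows "V ^ m * v * U ^ m = v + (v * U - U * v) * V * of_nat m"
proof (induction m)
  case (Suc m)
  define w where "w = v * U - U * v"
  have w: "w \<in> B" unfolding w_def by (rule fields_B[OF v U_B])
  have ev: "e * v = v" using v ops.L_C ops.e_left by blast
  have we: "w * e = w" using w ops.B_C ops.e_right by blast
  have Vw: "V * w = w * V" by (rule B_commute[OF V_B w])
  have Um: "of_nat m * U = U * of_nat m" by (rule mult_of_nat_commute)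
  have "V * v * U = V * (U * v) + V * w" by (simp add: w_def algebra_simps)
  also have "\<dots> = v + w * V" by (simp only: mult.assoc[symmetric] VU ev Vw)
  finally have 1: "V * v * U = v + w * V" .
  have wVe: "w * V * e = w * V" using B_times[OF w V_B] ops.B_C ops.e_right by blast
  have "V * (w * V * of_nat m) * U = w * V * (V * U) * of_nat m"
    by (simp only: mult.assoc Um) (simp only: mult.assoc[symmetric] Vw)
  also have "\<dots> = w * V * of_nat m" by (simp only: mult.assoc VU) (simp only: mult.assoc[symmetric] wVe)
  finally have 2: "V * (w * V * of_nat m) * U = w * V * of_nat m" .
  have "V ^ Suc m * v * U ^ Suc m = V * v * U + V * (w * V * of_nat m) * U"
    unfolding conjugate_Suc Suc w_def by (simp only: distrib_left distrib_right)
  then show ?case unfolding 1 2 w_def[symmetric] by (simp add: distrib_left add.commute add.left_commute)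
qed simp

text \<open>
  \<open>Q = u\<^sup>-\<^sup>s P u\<^sup>s\<close>, as a relation that is tested at all natural numbers.
\<close>
definition conjugate :: "'a fps \<Rightarrow> 'a fps \<Rightarrow> bool" where
  "conjugate P Q \<longleftrightarrow> P \<in> polys ops \<and> Q \<in> polys ops \<and> (\<forall>m. V ^ m * eval_at m P * U ^ m = eval_at m Q)"

lemma conjugate_plus:
  assumes "conjugate P Q" "conjugate P' Q'" shows "conjugate (P + P') (Q + Q')"
proof -
  have "V ^ m * (eval_at m P + eval_at m P') * U ^ m = V ^ m * eval_at m P * U ^ m + V ^ m * eval_at m P' * U ^ m" for m
    by (simp only: distrib_left distrib_right)
  then show ?thesis using assms ops.polys_closed(1) unfolding conjugate_def
    by (simp add: eval_at_add[where C = ops and C' = ops])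
qed

lemma conjugate_times:
  assumes "conjugate P Q" "conjugate P' Q'" shows "conjugate (P * P') (Q * Q')"
proof -
  have P: "P \<in> polys ops" "P' \<in> polys ops" "Q \<in> polys ops" "Q' \<in> polys ops" using assms by (auto simp: conjugate_def)
  have "V ^ m * eval_at m (P * P') * U ^ m = eval_at m (Q * Q')" for m
  proof -
    have "eval_at m (Q * Q') = (V ^ m * eval_at m P * U ^ m) * (V ^ m * eval_at m P' * U ^ m)"
      using assms by (simp add: ops.eval_at_mult[OF P(3,4)] conjugate_def)
    also have "\<dots> = V ^ m * eval_at m P * (U ^ m * (V ^ m * eval_at m P')) * U ^ m" by (simp only: mult.assoc)
    also have "U ^ m * (V ^ m * eval_at m P') = eval_at m P'" by (rule U_power_V_power[OF ops.eval_at_C[OF P(2)]])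
    finally show ?thesis by (simp only: ops.eval_at_mult[OF P(1,2)] mult.assoc)
  qed
  then show ?thesis using ops.polys_closed(3)[OF P(1,2)] ops.polys_closed(3)[OF P(3,4)] by (simp add: conjugate_def)
qed

lemma conjugate_X:
  assumes "conjugate P Q" shows "conjugate (fps_X * P) (fps_X * Q)"
proof -
  have P: "P \<in> polys ops" "Q \<in> polys ops" using assms by (auto simp: conjugate_def)
  have "of_nat m * U ^ m = U ^ m * of_nat m" for m by (rule mult_of_nat_commute)
  then have "V ^ m * (eval_at m P * of_nat m) * U ^ m = V ^ m * eval_at m P * U ^ m * of_nat m" for m
    by (simp only: mult.assoc)
  then have "V ^ m * eval_at m (fps_X * P) * U ^ m = eval_at m (fps_X * Q)" for m
    using assms by (simp add: eval_at_X[OF P(1)] eval_at_X[OF P(2)] conjugate_def)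
  then show ?thesis using P ops.polys_X by (simp add: conjugate_def)
qed

lemma conjugate_const_B: "b \<in> B \<Longrightarrow> conjugate (fps_const b) (fps_const b)"
  using ops.polys_const ops.B_C by (simp add: conjugate_def eval_at_const conjugate_B) blast

lemma conjugate_const_field:
  assumes v: "v \<in> fields"
  shows "conjugate (fps_const v) (fps_const v + fps_X * fps_const ((v * U - U * v) * V))"
proof -
  have w: "(v * U - U * v) * V \<in> B" by (intro B_times fields_B[OF v] U_B V_B)
  have p: "fps_const v \<in> polys ops" "fps_const ((v * U - U * v) * V) \<in> polys ops"
    using v w ops.L_C ops.B_C by (blast intro: ops.polys_const)+
  show ?thesis unfolding conjugate_def
    using p ops.polys_X[OF p(2)] ops.polys_closed(1)[OF p(1) ops.polys_X[OF p(2)]] conjugate_field[OF v]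
    by (simp add: eval_at_const eval_at_add[OF p(1) ops.polys_X[OF p(2)]] eval_at_X[OF p(2)])
qed

lemma conjugate_exists: "P \<in> polys ops \<Longrightarrow> \<exists>Q. conjugate P Q"
proof -
  have const: "\<exists>Q. conjugate (fps_const c) Q" if c: "c \<in> ops" for c
  proof -
    obtain k where "diffop k c" using c by blast
    then show ?thesis
    proof (induction rule: diffop.induct)
      case (const b k)
      then show ?case using conjugate_const_B by blast
    next
      case (plus k P Q)
      then show ?case using conjugate_plus by (metis fps_const_add)
    next
      case (step k P i)
      then show ?case using conjugate_times[OF conjugate_const_field[OF X_fields]] by (metis fps_const_mult)
    qed
  qed
  assume "P \<in> polys ops"
  then show ?thesis
  proof (induction rule: ops.polys_induct)
    case (X c Q)
    then show ?case using const[OF X(1)] conjugate_plus[OF _ conjugate_X] by blast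
  qed (rule const)
qed

lemma conjugate_unique: "conjugate P Q \<Longrightarrow> conjugate P Q' \<Longrightarrow> Q = Q'"
  by (rule eval_at_eqI) (auto simp: conjugate_def)

lemma conjugate_zero: "conjugate 0 0"
  using conjugate_const_B[OF B_zero] by simp

lemma conjugate_sum:
  "(\<And>i. i \<in> I \<Longrightarrow> conjugate (P i) (Q i)) \<Longrightarrow> conjugate (\<Sum>i\<in>I. P i) (\<Sum>i\<in>I. Q i)"
  by (induction I rule: infinite_finite_induct) (auto intro: conjugate_zero conjugate_plus)

sublocale inv: change_of_equation e B X y idx V U
  by unfold_locales (rule V_B U_B VU)+

lemma conjugate_inverse: assumes "conjugate P Q" shows "inv.conjugate Q P"
proof -
  have P: "P \<in> polys ops" "Q \<in> polys ops" using assms by (auto simp: conjugate_def)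
  have "U ^ m * eval_at m Q * V ^ m = eval_at m P" for m
  proof -
    have E: "eval_at m P \<in> ops" by (rule ops.eval_at_C[OF P(1)])
    have "U ^ m * eval_at m Q * V ^ m = U ^ m * (V ^ m * (eval_at m P * U ^ m * V ^ m))"
      using assms by (simp add: conjugate_def mult.assoc[symmetric])
    then show ?thesis by (simp only: power_U_power_V[OF E] U_power_V_power[OF E])
  qed
  then show ?thesis using P by (simp add: inv.conjugate_def)
qed

text \<open>
  \<open>v(uH)/(uH) = v(H)/H + v(u)/u\<close>, so conjugation by \<open>u\<^sup>s\<close> maps the generators for \<open>uH\<close> to those for \<open>H\<close>. It
  fixes \<open>s\<close> and has the conjugation by \<open>u\<^sup>-\<^sup>s\<close> as inverse, so that the quotients correspond.
\<close>
theorem torsion_free_change_of_equation: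
  assumes "log_lie_basis e ops B L n g co H" "log_lie_basis e ops B L n g co (U * H)" and L: "L \<subseteq> fields"
  shows "specialization.torsion_free n (polys ops) (\<lambda>i. log_lie_basis.theta B H (g i)) (\<lambda>x. fps_X * x) \<Longrightarrow>
    specialization.torsion_free n (polys ops) (\<lambda>i. log_lie_basis.theta B (U * H) (g i)) (\<lambda>x. fps_X * x)"
proof -
  interpret f: log_lie_basis e ops B L n g co H by fact
  interpret h: log_lie_basis e ops B L n g co "U * H" by fact
  have theta: "conjugate (h.theta v) (f.theta v)" if v: "v \<in> L" for v
  proof -
    have vf: "v \<in> fields" using v L by blast
    define w where "w = (v * U - U * v) * V"
    have w: "w \<in> B" unfolding w_def by (intro B_times fields_B[OF vf] U_B V_B)
    have al: "h.al v = f.al v + w"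
    proof (rule h.al_eqI)
      show "f.al v + w \<in> B" by (intro B_plus f.al(1)[OF v] w)
      have "w * (U * H) = (v * U - U * v) * (V * U) * H" by (simp only: w_def mult.assoc)
      also have "(v * U - U * v) * (V * U) = v * U - U * v"
        using fields_B[OF vf U_B] ops.B_C ops.e_right by (simp only: VU) blast
      finally have "w * (U * H) = (v * U - U * v) * H" .
      moreover have "f.al v * (U * H) = U * (v * H - H * v)"
        using B_commute[OF f.al(1)[OF v] U_B] by (simp only: f.al(2)[OF v] mult.assoc[symmetric])
      ultimately have "(f.al v + w) * (U * H) = U * (v * H - H * v) + (v * U - U * v) * H"
        by (simp only: distrib_right)
      then show "v * (U * H) - U * H * v = (f.al v + w) * (U * H)" by (simp add: algebra_simps)
    qed
    have nal: "0 - h.al v \<in> B" by (intro B_minus B_zero h.al(1)[OF v])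
    have "conjugate (fps_const v + fps_X * fps_const (0 - h.al v))
        ((fps_const v + fps_X * fps_const w) + fps_X * fps_const (0 - h.al v))"
      unfolding w_def by (intro conjugate_plus conjugate_const_field[OF vf] conjugate_X conjugate_const_B nal)
    moreover have "fps_const v + fps_X * fps_const (0 - h.al v) = h.theta v"
      by (auto simp: fps_eq_iff h.theta_nth)
    moreover have "(fps_const v + fps_X * fps_const w) + fps_X * fps_const (0 - h.al v) = f.theta v"
      by (auto simp: fps_eq_iff f.theta_nth al)
    ultimately show ?thesis by simp
  qed
  assume "f.spec.torsion_free"
  then have tf: "\<exists>q. (\<forall>i<n. q i \<in> polys ops) \<and> Y = (\<Sum>i<n. q i * f.theta (g i))"
    if "Y \<in> polys ops" "\<forall>i<n. q i \<in> polys ops" "fps_X * Y = (\<Sum>i<n. q i * f.theta (g i))" for Y q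
    unfolding f.torsion_free_iff using that by blast
  show "h.spec.torsion_free"
    unfolding h.torsion_free_iff
  proof (intro ballI allI impI)
    fix Y q assume Y: "Y \<in> polys ops" and q: "\<forall>i<n. q i \<in> polys ops" and eq: "fps_X * Y = (\<Sum>i<n. q i * h.theta (g i))"
    obtain Y' where Y': "conjugate Y Y'" using conjugate_exists[OF Y] by blast
    have "\<forall>i. \<exists>Q. i < n \<longrightarrow> conjugate (q i) Q" using q conjugate_exists by blast
    then obtain q' where q': "\<forall>i. i < n \<longrightarrow> conjugate (q i) (q' i)" by (rule choice[THEN exE])
    have "conjugate (\<Sum>i<n. q i * h.theta (g i)) (\<Sum>i<n. q' i * f.theta (g i))"
      by (intro conjugate_sum conjugate_times theta f.g_L) (use q' in auto)
    then have "fps_X * Y' = (\<Sum>i<n. q' i * f.theta (g i))"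
      using conjugate_unique[OF conjugate_X[OF Y']] by (simp only: eq)
    moreover have "Y' \<in> polys ops" "\<forall>i<n. q' i \<in> polys ops" using Y' q' by (auto simp: conjugate_def)
    ultimately obtain p where p: "\<forall>i<n. p i \<in> polys ops" "Y' = (\<Sum>i<n. p i * f.theta (g i))" using tf by blast
    have "\<forall>i. \<exists>Q. i < n \<longrightarrow> inv.conjugate (p i) Q" using p(1) inv.conjugate_exists by blast
    then obtain r where r: "\<forall>i. i < n \<longrightarrow> inv.conjugate (p i) (r i)" by (rule choice[THEN exE])
    have "inv.conjugate (\<Sum>i<n. p i * f.theta (g i)) (\<Sum>i<n. r i * h.theta (g i))"
      by (intro inv.conjugate_sum inv.conjugate_times conjugate_inverse[OF theta] f.g_L) (use r in auto)
    then have "Y = (\<Sum>i<n. r i * h.theta (g i))"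
      using inv.conjugate_unique[OF conjugate_inverse[OF Y']] by (simp only: p(2))
    then show "\<exists>q. (\<forall>i<n. q i \<in> polys ops) \<and> Y = (\<Sum>i<n. q i * h.theta (g i))"
      using r by (intro exI[of _ r]) (auto simp: inv.conjugate_def)
  qed
qed

end

section \<open>The total order filtration\<close>

context diffops
begin

lemma G_0D: "P \<in> G 0 \<Longrightarrow> P = 0" by (simp add: G_simps)

lemma G_zero: "0 \<in> G k" using additive_groupD(1)[OF G_group] .

lemma G_product: assumes "P \<in> G k" "Q \<in> G l" shows "P * Q \<in> G (k + l - 1)"
proof (cases l)
  case (Suc l')
  then show ?thesis using G_times[OF assms(1), of l' Q] assms(2) by (simp add: G_simps)
qed (use assms G_zero in \<open>auto simp: G_simps\<close>)

lemma G_commutator: assumes "P \<in> G k" "Q \<in> G l" shows "P * Q - Q * P \<in> G (k + l - 2)"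
proof (cases "k = 0 \<or> l = 0")
  case False
  then obtain k' l' where "k = Suc k'" "l = Suc l'" by (auto simp: gr0_conv_Suc)
  then show ?thesis using diffop_commutator[of k' P l' Q] assms by (simp add: G_simps)
qed (use assms G_zero in \<open>auto simp: G_simps\<close>)

text \<open>
  The total order filtration: \<open>s\<close> has order \<open>1\<close>. Truncated subtraction and \<open>G 0 = 0\<close> force the coefficients
  of high powers of \<open>s\<close> to vanish.
\<close>
definition Gs :: "nat \<Rightarrow> 'r fps set" where
  "Gs k = {Q. \<forall>i. Q $ i \<in> G (k - i)}"

lemma Gs_0: "Gs 0 = {0}"
  by (auto simp: Gs_def G_simps fps_eq_iff)

lemma Gs_group: "additive_group (Gs k)"
  by (auto simp: additive_group_def Gs_def G_zero intro: additive_groupD(2)[OF G_group])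

lemma Gs_mono: "Gs k \<subseteq> Gs (Suc k)"
  unfolding Gs_def using G_mono_le[of "k - i" "Suc k - i" for i] by fastforce

lemma Gs_polys: "Gs k \<subseteq> polys {P. \<exists>k. diffop k P}"
proof
  fix Q assume Q: "Q \<in> Gs k"
  show "Q \<in> polys {P. \<exists>k. diffop k P}"
  proof (rule polysI[of _ _ k])
    show "Q $ i \<in> {P. \<exists>k. diffop k P}" for i
    proof -
      have "Q $ i \<in> G (Suc (k - i))" using Q G_mono by (auto simp: Gs_def)
      then show ?thesis by (auto simp: G_simps)
    qed
    show "Q $ i = 0" if "k \<le> i" for i
    proof -
      have "Q $ i \<in> G (k - i)" using Q by (simp add: Gs_def)
      then show ?thesis using that by (simp add: G_simps)
    qed
  qed
qed

lemma Gs_exhaustive: assumes "Q \<in> polys {P. \<exists>k. diffop k P}" shows "\<exists>k. Q \<in> Gs k"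
proof -
  obtain N where N: "\<forall>i. Q $ i \<in> {P. \<exists>k. diffop k P}" "\<forall>i\<ge>N. Q $ i = 0" using assms by (rule polysE)
  have "\<forall>i. \<exists>k. diffop k (Q $ i)" using N(1) by blast
  then obtain d where d: "\<forall>i. diffop (d i) (Q $ i)" by (rule choice[THEN exE])
  have "Q $ i \<in> G (Suc (\<Sum>i<N. d i) + N - i)" for i
  proof (cases "i < N")
    case True
    have "d i \<le> (\<Sum>i<N. d i)" by (rule member_le_sum) (use True in auto)
    then have "diffop ((\<Sum>i<N. d i) + (N - i)) (Q $ i)" by (intro diffop_mono[OF d[rule_format]]) simp
    moreover have "Suc (\<Sum>i<N. d i) + N - i = Suc ((\<Sum>i<N. d i) + (N - i))" using True by simp
    ultimately show ?thesis by (simp only: G_simps)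
  qed (use N(2) G_zero in auto)
  then show ?thesis unfolding Gs_def by blast
qed

lemma Gs_product: assumes "P \<in> Gs k" "Q \<in> Gs l" shows "P * Q \<in> Gs (k + l - 1)"
  unfolding Gs_def
proof (intro CollectI allI)
  fix i
  show "(P * Q) $ i \<in> G (k + l - 1 - i)"
    unfolding fps_mult_nth
  proof (rule additive_group_sum[OF G_group])
    fix a assume "a \<in> {0..i}"
    have P: "P $ a \<in> G (k - a)" and Q: "Q $ (i - a) \<in> G (l - (i - a))" using assms by (auto simp: Gs_def)
    show "P $ a * Q $ (i - a) \<in> G (k + l - 1 - i)"
    proof (cases "k - a = 0 \<or> l - (i - a) = 0")
      case True
      then have "P $ a = 0 \<or> Q $ (i - a) = 0" using P Q G_0D by metis
      then show ?thesis using G_zero by auto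
    next
      case False
      have "P $ a * Q $ (i - a) \<in> G (k - a + (l - (i - a)) - 1)" using P Q by (rule G_product)
      then show ?thesis using G_mono_le[of "k - a + (l - (i - a)) - 1" "k + l - 1 - i"] False \<open>a \<in> {0..i}\<close> by auto
    qed
  qed
qed

lemma Gs_commutator: assumes "P \<in> Gs k" "Q \<in> Gs l" shows "P * Q - Q * P \<in> Gs (k + l - 2)"
  unfolding Gs_def
proof (intro CollectI allI)
  fix i
  have "(Q * P) $ i = (\<Sum>a = 0..i. Q $ (i - a) * P $ a)"
    unfolding fps_mult_nth by (rule sum.reindex_bij_witness[of _ "\<lambda>a. i - a" "\<lambda>a. i - a"]) auto
  then have "(P * Q - Q * P) $ i = (\<Sum>a = 0..i. P $ a * Q $ (i - a) - Q $ (i - a) * P $ a)"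
    by (simp add: fps_mult_nth sum_subtractf)
  also have "\<dots> \<in> G (k + l - 2 - i)"
  proof (rule additive_group_sum[OF G_group])
    fix a assume "a \<in> {0..i}"
    have P: "P $ a \<in> G (k - a)" and Q: "Q $ (i - a) \<in> G (l - (i - a))" using assms by (auto simp: Gs_def)
    show "P $ a * Q $ (i - a) - Q $ (i - a) * P $ a \<in> G (k + l - 2 - i)"
    proof (cases "k - a = 0 \<or> l - (i - a) = 0")
      case True
      then have "P $ a = 0 \<or> Q $ (i - a) = 0" using P Q G_0D by metis
      then show ?thesis using G_zero by auto
    next
      case False
      have "P $ a * Q $ (i - a) - Q $ (i - a) * P $ a \<in> G (k - a + (l - (i - a)) - 2)" using P Q by (rule G_commutator)
      then show ?thesis using G_mono_le[of "k - a + (l - (i - a)) - 2" "k + l - 2 - i"] False \<open>a \<in> {0..i}\<close> by auto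
    qed
  qed
  finally show "(P * Q - Q * P) $ i \<in> G (k + l - 2 - i)" .
qed

lemma Gs_const: "P \<in> G k \<Longrightarrow> fps_const P \<in> Gs k"
  using G_zero by (auto simp: Gs_def)

end

context diffops_coordinates
begin

lemma fields_inter_B: assumes "v \<in> fields" "v \<in> B" shows "v = 0"
proof -
  obtain a where a: "v = field a" "\<forall>i. a i \<in> B" using assms(1) by (auto simp: fields_def)
  have "a k = 0" for k using field_y[OF a(2), of k] B_commute[OF assms(2) y_B, of k] a(1) by simp
  then show ?thesis by (simp add: a(1) field_def)
qed

lemma regular_lie_basis_theta:
  assumes "log_lie_basis e ops B L n g co H" and L: "L \<subseteq> fields"
  defines "th \<equiv> \<lambda>i. log_lie_basis.theta B H (g i)"
  assumes regular: "\<And>m y k q. \<lbrakk>m < n; y \<in> Gs (Suc k); \<And>j. j < m \<Longrightarrow> q j \<in> Gs (Suc k);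
        y * th m + (\<Sum>j<m. q j * th j) \<in> Gs (Suc k)\<rbrakk> \<Longrightarrow>
      \<exists>q' t. (\<forall>j<m. q' j \<in> Gs k) \<and> t \<in> Gs k \<and> y = t + (\<Sum>j<m. q' j * th j)"
  shows "regular_lie_basis (fps_const e) (polys ops) (fps_const ` B) (log_lie_basis.theta B H ` L) n th
      (\<lambda>x i. fps_const (co (x $ 0) i)) Gs"
proof -
  interpret f: log_lie_basis e ops B L n g co H by fact
  have theta: "f.theta v \<in> Gs 2" if "v \<in> L" for v
    unfolding Gs_def
  proof (intro CollectI allI)
    fix i
    have "v \<in> G 2" "- f.al v \<in> G (Suc 0)"
      using that L fields_diffop[of v 0] f.al(1)[OF that] f.B_uminus const by (auto simp: G_simps numeral_2_eq_2)
    then show "f.theta v $ i \<in> G (2 - i)" by (auto simp: f.theta_nth G_zero)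
  qed
  show ?thesis unfolding th_def
  proof (rule regular_lie_basis.intro[OF f.lie_basis_theta], unfold_locales)
    show "Gs 0 = {0}" "\<And>k. additive_group (Gs k)" "\<And>k. Gs k \<subseteq> Gs (Suc k)" "\<And>k. Gs k \<subseteq> polys ops"
      by (rule Gs_0 Gs_group Gs_mono Gs_polys)+
    show "\<exists>k. x \<in> Gs k" if "x \<in> polys ops" for x using that by (rule Gs_exhaustive)
    show "x * b \<in> Gs k" if "x \<in> Gs k" "b \<in> fps_const ` B" for x b k
    proof -
      have "b \<in> Gs 1" using that(2) const by (auto intro!: Gs_const simp: G_simps)
      then show ?thesis using Gs_product[OF that(1), of b 1] by simp
    qed
    show "x * v \<in> Gs (Suc k)" if "x \<in> Gs k" "v \<in> f.theta ` L" for x v k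
      using Gs_product[OF that(1), of v 2] that(2) theta by auto
  qed (rule regular[unfolded th_def])
qed

text \<open>
  The operators \<open>\<theta>\<^sub>i\<close> have order exactly \<open>1\<close>, since a nonzero vector field is not a function. This determines
  the degree of their symbols.
\<close>
lemma log_lie_basis_leading:
  assumes "log_lie_basis e ops B L n g co H" and L: "L \<subseteq> fields" and i: "i < n" and e: "e \<noteq> 0"
  shows "log_lie_basis.theta B H (g i) \<in> Gs 2" "log_lie_basis.theta B H (g i) \<notin> Gs 1"
proof -
  interpret f: log_lie_basis e ops B L n g co H by fact
  have gL: "g i \<in> L" by (rule f.g_L[OF i])
  then have g: "g i \<in> fields" using L by blast
  have "g i \<in> G 2" "- f.al (g i) \<in> G (Suc 0)"
    using fields_diffop[OF g, of 0] f.al(1)[OF gL] f.B_uminus const by (auto simp: G_simps numeral_2_eq_2)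
  then have "f.theta (g i) $ k \<in> G (2 - k)" for k by (auto simp: f.theta_nth G_zero)
  then show "f.theta (g i) \<in> Gs 2" by (simp add: Gs_def)
  have "g i \<noteq> 0"
  proof
    assume g0: "g i = 0"
    have "co (\<Sum>k<n. (if k = i then e else 0) * g k) i = (if i = i then e else 0)"
      by (rule f.co_unique[of "\<lambda>k. if k = i then e else 0" i]) (use i B_e B_zero in auto)
    moreover have "(\<Sum>k<n. (if k = i then e else 0) * g k) = 0" using g0 by (intro sum.neutral) auto
    ultimately show False using f.co_zero[OF i] e by simp
  qed
  then have "g i \<notin> B" using fields_inter_B[OF g] by blast
  then have "\<not> diffop 0 (g i)" using diffop_0 by blast
  then have "g i \<notin> G (1 - 0)" by (simp add: G_simps)
  then show "f.theta (g i) \<notin> Gs 1" using f.theta_nth(1)[of "g i"] unfolding Gs_def mem_Collect_eq by metis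
qed

end

section \<open>Left ideals and quotients of embedded rings\<close>

context ring_embedding
begin

lemma coset_eq:
  assumes \<Gamma>: "additive_group \<Gamma>" and H: "H = {x \<in> carrier R. j x \<in> \<Gamma>}" and a: "a \<in> carrier R"
  shows "H +>\<^bsub>R\<^esub> a = {b \<in> carrier R. j b - j a \<in> \<Gamma>}"
proof
  show "H +>\<^bsub>R\<^esub> a \<subseteq> {b \<in> carrier R. j b - j a \<in> \<Gamma>}"
    unfolding a_r_coset_def' H using a by (auto simp: add)
  show "{b \<in> carrier R. j b - j a \<in> \<Gamma>} \<subseteq> H +>\<^bsub>R\<^esub> a"
  proof
    fix b assume b: "b \<in> {b \<in> carrier R. j b - j a \<in> \<Gamma>}"
    then have "b \<ominus> a \<in> H" using a by (simp add: minus H)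
    moreover have "b = (b \<ominus> a) \<oplus> a" using a b by (simp add: R.minus_eq R.a_assoc R.l_neg)
    ultimately show "b \<in> H +>\<^bsub>R\<^esub> a" unfolding a_r_coset_def' by blast
  qed
qed

lemma coset_eq_iff:
  assumes \<Gamma>: "additive_group \<Gamma>" and H: "H = {x \<in> carrier R. j x \<in> \<Gamma>}" and a: "a \<in> carrier R" and b: "b \<in> carrier R"
  shows "H +>\<^bsub>R\<^esub> a = H +>\<^bsub>R\<^esub> b \<longleftrightarrow> j a - j b \<in> \<Gamma>"
proof
  assume eq: "H +>\<^bsub>R\<^esub> a = H +>\<^bsub>R\<^esub> b"
  have "a \<in> H +>\<^bsub>R\<^esub> a" unfolding coset_eq[OF \<Gamma> H a] using a additive_groupD(1)[OF \<Gamma>] by simp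
  then have "a \<in> H +>\<^bsub>R\<^esub> b" by (simp only: eq)
  then show "j a - j b \<in> \<Gamma>" unfolding coset_eq[OF \<Gamma> H b] by simp
next
  assume d: "j a - j b \<in> \<Gamma>"
  have "j x - j a \<in> \<Gamma> \<longleftrightarrow> j x - j b \<in> \<Gamma>" for x
    using additive_groupD(4)[OF \<Gamma> _ d, of "j x - j a"] additive_groupD(2)[OF \<Gamma> _ d, of "j x - j b"] by auto
  then show "H +>\<^bsub>R\<^esub> a = H +>\<^bsub>R\<^esub> b" by (simp add: coset_eq[OF \<Gamma> H a] coset_eq[OF \<Gamma> H b])
qed

lemma left_ideal_gen_eq:
  assumes S: "S \<subseteq> carrier R" and jS: "j ` S \<subseteq> LI" and gS: "\<And>i. i < (n::nat) \<Longrightarrow> g i \<in> j ` S"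
    and LI: "LI = {(\<Sum>i<n. q i * g i) | q. \<forall>i<n. q i \<in> j ` carrier R}"
  shows "left_ideal_gen R S = {x \<in> carrier R. j x \<in> LI}" and "additive_group LI"
proof -
  have LI_I: "(\<Sum>i<n. q i * g i) \<in> LI" if "\<And>i. i < n \<Longrightarrow> q i \<in> j ` carrier R" for q
    unfolding LI using that by blast
  have LI_E: "\<exists>q. (\<forall>i<n. q i \<in> j ` carrier R) \<and> x = (\<Sum>i<n. q i * g i)" if "x \<in> LI" for x
    using that unfolding LI by blast
  have C: "x + y \<in> j ` carrier R" "x - y \<in> j ` carrier R" "x * y \<in> j ` carrier R"
    if x: "x \<in> j ` carrier R" and y: "y \<in> j ` carrier R" for x y
  proof -
    obtain a b where ab: "a \<in> carrier R" "b \<in> carrier R" "x = j a" "y = j b" using x y by blast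
    have "x + y = j (a \<oplus> b)" "x - y = j (a \<ominus> b)" "x * y = j (a \<otimes> b)" using ab by (simp_all add: add minus mult)
    then show "x + y \<in> j ` carrier R" "x - y \<in> j ` carrier R" "x * y \<in> j ` carrier R" using ab by auto
  qed
  show group: "additive_group LI"
    unfolding additive_group_def
  proof (intro conjI ballI)
    have "0 \<in> j ` carrier R" using zero by (metis R.zero_closed imageI)
    then show "0 \<in> LI" using LI_I[of "\<lambda>_. 0"] by simp
    fix x y assume x: "x \<in> LI" and y: "y \<in> LI"
    obtain q where q: "\<forall>i<n. q i \<in> j ` carrier R" "x = (\<Sum>i<n. q i * g i)" using LI_E[OF x] by blast
    obtain q' where q': "\<forall>i<n. q' i \<in> j ` carrier R" "y = (\<Sum>i<n. q' i * g i)" using LI_E[OF y] by blast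
    have "x - y = (\<Sum>i<n. (q i - q' i) * g i)" by (simp add: q q' left_diff_distrib sum_subtractf)
    also have "\<dots> \<in> LI" by (rule LI_I) (use q q' C in auto)
    finally show "x - y \<in> LI" .
  qed
  show "left_ideal_gen R S = {x \<in> carrier R. j x \<in> LI}" (is "_ = ?I")
  proof
    have I: "additive_subgroup ?I R"
    proof (rule additive_subgroup.intro, rule R.add.subgroupI)
      show "?I \<subseteq> carrier R" by blast
      show "?I \<noteq> {}" using additive_groupD(1)[OF group] R.zero_closed zero by (metis (mono_tags, lifting) empty_iff mem_Collect_eq)
      show "\<ominus> x \<in> ?I" if "x \<in> ?I" for x using that additive_groupD(3)[OF group] by (simp add: a_inv)
      show "x \<oplus> y \<in> ?I" if "x \<in> ?I" "y \<in> ?I" for x y using that additive_groupD(4)[OF group] by (simp add: add)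
    qed
    have abs: "r \<otimes> x \<in> ?I" if r: "r \<in> carrier R" and x: "x \<in> ?I" for r x
    proof -
      have "j x \<in> LI" using x by simp
      then obtain q where q: "\<forall>i<n. q i \<in> j ` carrier R" "j x = (\<Sum>i<n. q i * g i)" using LI_E by blast
      have "j (r \<otimes> x) = (\<Sum>i<n. (j r * q i) * g i)" using r x by (simp add: mult q(2) sum_distrib_left mult.assoc)
      also have "\<dots> \<in> LI" by (rule LI_I) (use q r C in auto)
      finally show ?thesis using r x by simp
    qed
    have "S \<subseteq> ?I" using S jS by auto
    then show "left_ideal_gen R S \<subseteq> ?I" unfolding left_ideal_gen_def using I abs by (intro Inter_lower) blast
    show "?I \<subseteq> left_ideal_gen R S"
      unfolding left_ideal_gen_def
    proof (intro subsetI InterI)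
      fix x I' assume x: "x \<in> ?I"
        and "I' \<in> {I. additive_subgroup I R \<and> S \<subseteq> I \<and> (\<forall>r\<in>carrier R. \<forall>x\<in>I. r \<otimes> x \<in> I)}"
      then have I': "additive_subgroup I' R" "S \<subseteq> I'" "\<And>r x. r \<in> carrier R \<Longrightarrow> x \<in> I' \<Longrightarrow> r \<otimes> x \<in> I'" by auto
      have "j x \<in> LI" using x by simp
      then obtain q where q: "\<forall>i<n. q i \<in> j ` carrier R" "j x = (\<Sum>i<n. q i * g i)" using LI_E by blast
      have "m \<le> n \<Longrightarrow> \<exists>y\<in>I'. y \<in> carrier R \<and> j y = (\<Sum>i<m. q i * g i)" for m
      proof (induction m)
        case 0
        show ?case using additive_subgroup.zero_closed[OF I'(1)] by (intro bexI[of _ \<zero>]) simp_all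
      next
        case (Suc m)
        then obtain y where y: "y \<in> I'" "y \<in> carrier R" "j y = (\<Sum>i<m. q i * g i)" by auto
        obtain s where s: "s \<in> S" "g m = j s" using gS[of m] Suc.prems by auto
        have "q m \<in> j ` carrier R" using q(1) Suc.prems by simp
        then obtain r where r: "r \<in> carrier R" "q m = j r" by blast
        have sc: "s \<in> carrier R" using s(1) S by blast
        have "y \<oplus> r \<otimes> s \<in> I'"
          using I' r s y by (intro additive_subgroup.a_closed[OF I'(1)]) auto
        moreover have "j (y \<oplus> r \<otimes> s) = (\<Sum>i<Suc m. q i * g i)" using y r s sc by (simp add: add mult)
        ultimately show ?case using y r sc by (intro bexI[of _ "y \<oplus> r \<otimes> s"]) auto
      qed
      then obtain y where "y \<in> I'" "y \<in> carrier R" "j y = (\<Sum>i<n. q i * g i)" by blast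
      then show "x \<in> I'" using q(2) x eq_iff[of x y] by auto
    qed
  qed
qed

lemma quotient_torsion_free_iff:
  assumes \<Gamma>: "additive_group \<Gamma>" and H: "H = {x \<in> carrier R. j x \<in> \<Gamma>}" and s: "s \<in> carrier R"
  shows "quotient_torsion_free R H s \<longleftrightarrow> (\<forall>Y\<in>j ` carrier R. j s * Y \<in> \<Gamma> \<longrightarrow> Y \<in> \<Gamma>)"
proof -
  have "quotient_torsion_free R H s \<longleftrightarrow>
      (\<forall>P\<in>carrier R. \<forall>Q\<in>carrier R. j s * (j P - j Q) \<in> \<Gamma> \<longrightarrow> j P - j Q \<in> \<Gamma>)"
    unfolding quotient_torsion_free_def
    by (intro ball_cong refl) (simp add: coset_eq_iff[OF \<Gamma> H] s mult right_diff_distrib)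
  also have "\<dots> \<longleftrightarrow> (\<forall>Y\<in>j ` carrier R. j s * Y \<in> \<Gamma> \<longrightarrow> Y \<in> \<Gamma>)"
  proof (intro iffI ballI impI)
    fix Y assume h: "\<forall>P\<in>carrier R. \<forall>Q\<in>carrier R. j s * (j P - j Q) \<in> \<Gamma> \<longrightarrow> j P - j Q \<in> \<Gamma>"
      and Y: "Y \<in> j ` carrier R" "j s * Y \<in> \<Gamma>"
    obtain P where P: "P \<in> carrier R" "Y = j P" using Y(1) by blast
    show "Y \<in> \<Gamma>" using h[rule_format, OF P(1) R.zero_closed] Y(2) P(2) by simp
  next
    fix P Q assume h: "\<forall>Y\<in>j ` carrier R. j s * Y \<in> \<Gamma> \<longrightarrow> Y \<in> \<Gamma>"
      and P: "P \<in> carrier R" "Q \<in> carrier R" "j s * (j P - j Q) \<in> \<Gamma>"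
    have "j (P \<ominus> Q) \<in> j ` carrier R" using P by blast
    then show "j P - j Q \<in> \<Gamma>" using h[rule_format, of "j (P \<ominus> Q)"] P by (simp add: minus)
  qed
  finally show ?thesis .
qed

end

section \<open>The associated graded ring\<close>

text \<open>
  A filtered ring whose graded ring is commutative; \<open>\<Phi>\<close> is the image of the filtration, shifted by one.
\<close>
locale filtered_embedding = ring_embedding R K for R :: "('d, 'x) ring_scheme" (structure) and K :: "'d \<Rightarrow> 't::ring_1" +
  fixes F :: "nat \<Rightarrow> 'd set" and \<Phi> :: "nat \<Rightarrow> 't set"
  assumes F_carrier: "F k \<subseteq> carrier R"
    and \<Phi>_0: "\<Phi> 0 = {0}" and \<Phi>_Suc: "\<Phi> (Suc k) = K ` F k"
    and \<Phi>_group: "additive_group (\<Phi> k)" and \<Phi>_mono: "\<Phi> k \<subseteq> \<Phi> (Suc k)" and \<Phi>_one: "K \<one> \<in> \<Phi> 1"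
    and \<Phi>_times: "\<lbrakk>x \<in> \<Phi> k; y \<in> \<Phi> l\<rbrakk> \<Longrightarrow> x * y \<in> \<Phi> (k + l - 1)"
    and \<Phi>_commutator: "\<lbrakk>x \<in> \<Phi> k; y \<in> \<Phi> l\<rbrakk> \<Longrightarrow> x * y - y * x \<in> \<Phi> (k + l - 2)"
begin

lemma \<Phi>_zero: "0 \<in> \<Phi> k" and \<Phi>_minus: "x \<in> \<Phi> k \<Longrightarrow> y \<in> \<Phi> k \<Longrightarrow> x - y \<in> \<Phi> k"
  and \<Phi>_uminus: "x \<in> \<Phi> k \<Longrightarrow> - x \<in> \<Phi> k" and \<Phi>_plus: "x \<in> \<Phi> k \<Longrightarrow> y \<in> \<Phi> k \<Longrightarrow> x + y \<in> \<Phi> k"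
  using additive_groupD[OF \<Phi>_group] by blast+

lemma \<Phi>_sum: "(\<And>a. a \<in> I \<Longrightarrow> t a \<in> \<Phi> k) \<Longrightarrow> (\<Sum>a\<in>I. t a) \<in> \<Phi> k"
  by (rule additive_group_sum[OF \<Phi>_group])

lemma gr_coset_eq: assumes a: "a \<in> carrier R" shows "gr_coset R F k a = {b \<in> carrier R. K b - K a \<in> \<Phi> k}"
proof -
  have H: "(case k of 0 \<Rightarrow> {\<zero>} | Suc m \<Rightarrow> F m) = {h \<in> carrier R. K h \<in> \<Phi> k}" (is "?H = _")
  proof (cases k)
    case 0
    then show ?thesis using eq_iff[OF _ R.zero_closed] by (auto simp: \<Phi>_0)
  next
    case (Suc m)
    have "h \<in> F m" if "h \<in> carrier R" "K h \<in> K ` F m" for h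
    proof -
      obtain h' where h': "h' \<in> F m" "K h = K h'" using \<open>K h \<in> K ` F m\<close> by blast
      moreover have "h' \<in> carrier R" using F_carrier h'(1) by blast
      ultimately have "h = h'" using eq_iff[OF \<open>h \<in> carrier R\<close>] by blast
      then show ?thesis using h'(1) by simp
    qed
    then show ?thesis using Suc F_carrier \<Phi>_Suc by auto
  qed
  show ?thesis unfolding gr_coset_def by (rule coset_eq[OF \<Phi>_group H a])
qed

text \<open>
  A Rees ring: power series whose \<open>k\<close>-th coefficient has order \<open>\<le> k\<close>, and order \<open>< k\<close> for large \<open>k\<close>.
  The map \<open>q\<close> takes the class of each coefficient and is a surjection onto the graded ring, so the ring
  axioms there follow from those for power series.
\<close>
definition T :: "'t fps set" where
  "T = {x. (\<forall>k. x $ k \<in> \<Phi> (Suc k)) \<and> finite {k. x $ k \<notin> \<Phi> k}}"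

definition q :: "'t fps \<Rightarrow> nat \<Rightarrow> 'd set" where
  "q x = (\<lambda>k. {b \<in> carrier R. K b - x $ k \<in> \<Phi> k})"

lemma TI: "(\<And>k. x $ k \<in> \<Phi> (Suc k)) \<Longrightarrow> (\<And>k. N \<le> k \<Longrightarrow> x $ k \<in> \<Phi> k) \<Longrightarrow> x \<in> T"
  unfolding T_def
proof (intro CollectI conjI allI)
  assume "\<And>k. N \<le> k \<Longrightarrow> x $ k \<in> \<Phi> k"
  then have "{k. x $ k \<notin> \<Phi> k} \<subseteq> {..<N}" by (auto simp: not_le[symmetric])
  then show "finite {k. x $ k \<notin> \<Phi> k}" by (rule finite_subset) simp
qed

lemma TE:
  assumes "x \<in> T" obtains N where "\<forall>k. x $ k \<in> \<Phi> (Suc k)" "\<forall>k\<ge>N. x $ k \<in> \<Phi> k"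
proof -
  have fin: "finite {k. x $ k \<notin> \<Phi> k}" using assms by (simp add: T_def)
  then obtain N where "\<forall>k\<in>{k. x $ k \<notin> \<Phi> k}. k < N" by (metis finite_nat_set_iff_bounded)
  then have "\<forall>k\<ge>N. x $ k \<in> \<Phi> k" by (auto simp: not_le[symmetric])
  then show ?thesis using that assms by (simp add: T_def)
qed

lemma T_lift:
  assumes "x \<in> T" shows "\<exists>a\<in>F k. K a = x $ k"
proof -
  have "x $ k \<in> K ` F k" using assms \<Phi>_Suc by (auto simp: T_def)
  then show ?thesis by auto
qed

lemma q_eq_coset: "a \<in> carrier R \<Longrightarrow> K a - x $ k \<in> \<Phi> k \<Longrightarrow> q x k = gr_coset R F k a"
proof -
  assume a: "a \<in> carrier R" "K a - x $ k \<in> \<Phi> k"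
  have "K b - x $ k \<in> \<Phi> k \<longleftrightarrow> K b - K a \<in> \<Phi> k" for b
    using \<Phi>_plus[OF _ a(2), of "K b - K a"] \<Phi>_minus[OF _ a(2), of "K b - x $ k"] by auto
  then show ?thesis using a(1) by (simp add: q_def gr_coset_eq)
qed

lemma q_eq_iff:
  assumes x: "x \<in> T" and y: "y \<in> T" shows "q x = q y \<longleftrightarrow> (\<forall>k. x $ k - y $ k \<in> \<Phi> k)"
proof
  assume eq: "q x = q y"
  show "\<forall>k. x $ k - y $ k \<in> \<Phi> k"
  proof
    fix k
    obtain a where a: "a \<in> F k" "K a = x $ k" using T_lift[OF x] by blast
    then have "a \<in> q x k" using F_carrier \<Phi>_zero by (auto simp: q_def)
    then have "a \<in> q y k" by (simp add: eq)
    then show "x $ k - y $ k \<in> \<Phi> k" using a(2) by (simp add: q_def)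
  qed
next
  assume d: "\<forall>k. x $ k - y $ k \<in> \<Phi> k"
  show "q x = q y"
  proof
    fix k
    obtain a where a: "a \<in> F k" "K a = x $ k" using T_lift[OF x] by blast
    have ac: "a \<in> carrier R" using a(1) F_carrier by blast
    have "q x k = gr_coset R F k a" by (rule q_eq_coset[OF ac]) (simp add: a(2) \<Phi>_zero)
    moreover have "q y k = gr_coset R F k a" by (rule q_eq_coset[OF ac]) (use a(2) d in simp)
    ultimately show "q x k = q y k" by simp
  qed
qed

lemma rep_q:
  assumes "x \<in> T" shows "rep (q x k) \<in> carrier R" "K (rep (q x k)) - x $ k \<in> \<Phi> k" "K (rep (q x k)) \<in> \<Phi> (Suc k)"
proof -
  obtain a where a: "a \<in> F k" "K a = x $ k" using T_lift[OF assms] by blast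
  then have "a \<in> q x k" using F_carrier \<Phi>_zero by (auto simp: q_def)
  then have "rep (q x k) \<in> q x k" unfolding rep_def by (rule someI)
  then show r: "rep (q x k) \<in> carrier R" "K (rep (q x k)) - x $ k \<in> \<Phi> k" by (auto simp: q_def)
  have "K (rep (q x k)) - x $ k + x $ k \<in> \<Phi> (Suc k)"
    by (rule \<Phi>_plus) (use r(2) \<Phi>_mono assms in \<open>auto simp: T_def\<close>)
  then show "K (rep (q x k)) \<in> \<Phi> (Suc k)" by simp
qed

lemma carrier_Gr: "carrier (Gr R F) = q ` T"
proof
  show "carrier (Gr R F) \<subseteq> q ` T"
  proof
    fix u assume "u \<in> carrier (Gr R F)"
    then have u: "\<forall>k. \<exists>x\<in>F k. u k = gr_coset R F k x" and fin: "finite {k. u k \<noteq> gr_coset R F k \<zero>}"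
      by (simp_all add: Gr_def)
    have "\<forall>k. \<exists>x. x \<in> F k \<and> u k = gr_coset R F k x" using u by blast
    then obtain a where a: "\<forall>k. a k \<in> F k \<and> u k = gr_coset R F k (a k)" by (rule choice[THEN exE])
    have ac: "a k \<in> carrier R" for k using a F_carrier by blast
    have "K (a k) \<in> \<Phi> k" if "u k = gr_coset R F k \<zero>" for k
    proof -
      have "a k \<in> gr_coset R F k (a k)" by (simp add: gr_coset_eq ac \<Phi>_zero)
      then have "a k \<in> gr_coset R F k \<zero>" using a that by metis
      then show ?thesis by (simp add: gr_coset_eq)
    qed
    then have "{k. K (a k) \<notin> \<Phi> k} \<subseteq> {k. u k \<noteq> gr_coset R F k \<zero>}" by blast
    then have "finite {k. K (a k) \<notin> \<Phi> k}" using fin by (rule finite_subset)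
    then have T: "Abs_fps (\<lambda>k. K (a k)) \<in> T" using a \<Phi>_Suc by (auto simp: T_def)
    have "q (Abs_fps (\<lambda>k. K (a k))) k = u k" for k
      using q_eq_coset[OF ac[of k], of "Abs_fps (\<lambda>k. K (a k))" k] a \<Phi>_zero by simp
    then have "u = q (Abs_fps (\<lambda>k. K (a k)))" by auto
    then show "u \<in> q ` T" using T by blast
  qed
  show "q ` T \<subseteq> carrier (Gr R F)"
  proof clarify
    fix x assume x: "x \<in> T"
    have "\<exists>a\<in>F k. q x k = gr_coset R F k a" for k
    proof -
      obtain a where a: "a \<in> F k" "K a = x $ k" using T_lift[OF x] by blast
      have "q x k = gr_coset R F k a" by (rule q_eq_coset) (use a F_carrier \<Phi>_zero in auto)
      then show ?thesis using a(1) by blast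
    qed
    moreover have "{k. q x k \<noteq> gr_coset R F k \<zero>} \<subseteq> {k. x $ k \<notin> \<Phi> k}"
      using q_eq_coset[OF R.zero_closed, of x] \<Phi>_uminus by auto
    ultimately show "q x \<in> carrier (Gr R F)" using x by (auto simp: Gr_def T_def intro: finite_subset)
  qed
qed

lemma T_plus: "x \<in> T \<Longrightarrow> y \<in> T \<Longrightarrow> x + y \<in> T"
proof -
  assume "x \<in> T" "y \<in> T"
  then obtain N N' where "\<forall>k. x $ k \<in> \<Phi> (Suc k)" "\<forall>k\<ge>N. x $ k \<in> \<Phi> k" "\<forall>k. y $ k \<in> \<Phi> (Suc k)" "\<forall>k\<ge>N'. y $ k \<in> \<Phi> k"
    by (metis TE)
  then show ?thesis by (intro TI[of _ "max N N'"]) (auto intro: \<Phi>_plus)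
qed

lemma T_uminus: "x \<in> T \<Longrightarrow> - x \<in> T"
proof -
  assume "x \<in> T"
  then obtain N where "\<forall>k. x $ k \<in> \<Phi> (Suc k)" "\<forall>k\<ge>N. x $ k \<in> \<Phi> k" by (rule TE)
  then show ?thesis by (intro TI[of _ N]) (auto intro: \<Phi>_uminus)
qed

lemma T_times: "x \<in> T \<Longrightarrow> y \<in> T \<Longrightarrow> x * y \<in> T"
proof -
  assume "x \<in> T" "y \<in> T"
  then obtain N N' where x: "\<forall>k. x $ k \<in> \<Phi> (Suc k)" "\<forall>k\<ge>N. x $ k \<in> \<Phi> k"
    and y: "\<forall>k. y $ k \<in> \<Phi> (Suc k)" "\<forall>k\<ge>N'. y $ k \<in> \<Phi> k" by (metis TE)
  show ?thesis
  proof (rule TI[of _ "N + N'"])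
    fix k
    have "x $ i * y $ (k - i) \<in> \<Phi> (Suc k)" if "i \<in> {0..k}" for i
      using \<Phi>_times[of "x $ i" "Suc i" "y $ (k - i)" "Suc (k - i)"] x y that by simp
    then show "(x * y) $ k \<in> \<Phi> (Suc k)" unfolding fps_mult_nth by (rule \<Phi>_sum)
    assume k: "N + N' \<le> k"
    have "x $ i * y $ (k - i) \<in> \<Phi> k" if "i \<in> {0..k}" for i
    proof (cases "N \<le> i")
      case True
      then show ?thesis using \<Phi>_times[of "x $ i" i "y $ (k - i)" "Suc (k - i)"] x y that by simp
    next
      case False
      then have "N' \<le> k - i" using k by linarith
      then show ?thesis using \<Phi>_times[of "x $ i" "Suc i" "y $ (k - i)" "k - i"] x y that by simp
    qed
    then show "(x * y) $ k \<in> \<Phi> k" unfolding fps_mult_nth by (rule \<Phi>_sum)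
  qed
qed

lemma T_monomial: "y \<in> \<Phi> (Suc k) \<Longrightarrow> fps_X ^ k * fps_const y \<in> T"
  by (rule TI[of _ "Suc k"]) (auto simp: fps_X_power_mult_nth \<Phi>_zero)

lemma T_one: "fps_const (K \<one>) \<in> T"
  using T_monomial[of "K \<one>" 0] \<Phi>_one by simp

lemma T_zero: "0 \<in> T"
  using T_monomial[of 0 0] \<Phi>_zero by simp

lemma q_plus: assumes x: "x \<in> T" and y: "y \<in> T" shows "q x \<oplus>\<^bsub>Gr R F\<^esub> q y = q (x + y)"
proof
  fix k
  note r = rep_q[OF x, of k] rep_q[OF y, of k]
  have "K (rep (q x k) \<oplus> rep (q y k)) - (x + y) $ k = (K (rep (q x k)) - x $ k) + (K (rep (q y k)) - y $ k)"
    using r by (simp add: add)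
  also have "\<dots> \<in> \<Phi> k" by (rule \<Phi>_plus[OF r(2) r(5)])
  finally show "(q x \<oplus>\<^bsub>Gr R F\<^esub> q y) k = q (x + y) k"
    using q_eq_coset[of "rep (q x k) \<oplus> rep (q y k)" "x + y" k] r by (simp add: Gr_def)
qed

lemma q_times: assumes x: "x \<in> T" and y: "y \<in> T" shows "q x \<otimes>\<^bsub>Gr R F\<^esub> q y = q (x * y)"
proof
  fix k
  let ?r = "\<lambda>i. rep (q x i)" and ?s = "\<lambda>i. rep (q y i)"
  have c: "?r i \<in> carrier R" "?s i \<in> carrier R" for i by (rule rep_q[OF x] rep_q[OF y])+
  have "K (\<Oplus>i\<in>{..k}. ?r i \<otimes> ?s (k - i)) = (\<Sum>i\<le>k. K (?r i) * K (?s (k - i)))"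
    using c by (subst finsum) (auto simp: mult)
  then have "K (\<Oplus>i\<in>{..k}. ?r i \<otimes> ?s (k - i)) - (x * y) $ k =
      (\<Sum>i\<le>k. K (?r i) * K (?s (k - i)) - x $ i * y $ (k - i))"
    by (simp add: fps_mult_nth sum_subtractf atLeast0AtMost)
  also have "\<dots> \<in> \<Phi> k"
  proof (rule \<Phi>_sum)
    fix i assume i: "i \<in> {..k}"
    have "(K (?r i) - x $ i) * K (?s (k - i)) \<in> \<Phi> (i + Suc (k - i) - 1)" by (intro \<Phi>_times rep_q x y)
    moreover have "x $ i * (K (?s (k - i)) - y $ (k - i)) \<in> \<Phi> (Suc i + (k - i) - 1)"
      by (intro \<Phi>_times rep_q x y) (use x in \<open>simp add: T_def\<close>)
    ultimately have "(K (?r i) - x $ i) * K (?s (k - i)) + x $ i * (K (?s (k - i)) - y $ (k - i)) \<in> \<Phi> k"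
      using i by (intro \<Phi>_plus) simp_all
    then show "K (?r i) * K (?s (k - i)) - x $ i * y $ (k - i) \<in> \<Phi> k" by (simp add: algebra_simps)
  qed
  finally show "(q x \<otimes>\<^bsub>Gr R F\<^esub> q y) k = q (x * y) k"
    using q_eq_coset[of "\<Oplus>i\<in>{..k}. ?r i \<otimes> ?s (k - i)" "x * y" k] c by (simp add: Gr_def)
qed

lemma q_zero: "q 0 = \<zero>\<^bsub>Gr R F\<^esub>"
  by (auto simp: Gr_def q_eq_coset[OF R.zero_closed] \<Phi>_zero)

lemma q_one: "q (fps_const (K \<one>)) = \<one>\<^bsub>Gr R F\<^esub>"
proof
  fix k
  show "q (fps_const (K \<one>)) k = \<one>\<^bsub>Gr R F\<^esub> k"
    using q_eq_coset[of "if k = 0 then \<one> else \<zero>" "fps_const (K \<one>)" k] by (auto simp: Gr_def \<Phi>_zero)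
qed

lemma q_commute: assumes "x \<in> T" "y \<in> T" shows "q (x * y) = q (y * x)"
proof (subst q_eq_iff[OF T_times[OF assms] T_times[OF assms(2,1)]], rule allI)
  fix k
  have "(y * x) $ k = (\<Sum>i = 0..k. y $ (k - i) * x $ i)"
    unfolding fps_mult_nth by (rule sum.reindex_bij_witness[of _ "\<lambda>a. k - a" "\<lambda>a. k - a"]) auto
  then have "(x * y) $ k - (y * x) $ k = (\<Sum>i = 0..k. x $ i * y $ (k - i) - y $ (k - i) * x $ i)"
    by (simp add: fps_mult_nth sum_subtractf)
  also have "\<dots> \<in> \<Phi> k"
  proof (rule \<Phi>_sum)
    fix i assume "i \<in> {0..k}"
    then show "x $ i * y $ (k - i) - y $ (k - i) * x $ i \<in> \<Phi> k"
      using \<Phi>_commutator[of "x $ i" "Suc i" "y $ (k - i)" "Suc (k - i)"] assms by (simp add: T_def)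
  qed
  finally show "(x * y) $ k - (y * x) $ k \<in> \<Phi> k" .
qed

lemma T_one_times: "x \<in> T \<Longrightarrow> fps_const (K \<one>) * x = x"
proof (rule fps_ext)
  fix k assume x: "x \<in> T"
  obtain a where "a \<in> F k" "K a = x $ k" using T_lift[OF x] by blast
  then have "K \<one> * x $ k = x $ k" using one_mult(1)[of a] F_carrier by auto
  then show "(fps_const (K \<one>) * x) $ k = x $ k" by simp
qed

theorem cring_Gr: "cring (Gr R F)"
proof (rule cringI)
  let ?G = "Gr R F"
  have E: "\<exists>x\<in>T. u = q x" if "u \<in> carrier ?G" for u using that carrier_Gr by blast
  have C: "q x \<in> carrier ?G" if "x \<in> T" for x using that carrier_Gr by blast
  note Q = q_plus q_times T_plus T_times C
  show "abelian_group ?G"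
  proof (rule abelian_groupI)
    show "\<zero>\<^bsub>?G\<^esub> \<in> carrier ?G" using C[OF T_zero] by (simp add: q_zero)
    fix u v w assume "u \<in> carrier ?G" "v \<in> carrier ?G" "w \<in> carrier ?G"
    then obtain x y z where xyz: "x \<in> T" "y \<in> T" "z \<in> T" "u = q x" "v = q y" "w = q z" using E by metis
    show "u \<oplus>\<^bsub>?G\<^esub> v \<in> carrier ?G" "u \<oplus>\<^bsub>?G\<^esub> v \<oplus>\<^bsub>?G\<^esub> w = u \<oplus>\<^bsub>?G\<^esub> (v \<oplus>\<^bsub>?G\<^esub> w)" "u \<oplus>\<^bsub>?G\<^esub> v = v \<oplus>\<^bsub>?G\<^esub> u"
      using xyz by (simp_all add: Q add.assoc add.commute add.left_commute)
  next
    fix u assume "u \<in> carrier ?G"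
    then obtain x where x: "x \<in> T" "u = q x" using E by metis
    show "\<zero>\<^bsub>?G\<^esub> \<oplus>\<^bsub>?G\<^esub> u = u" using x q_plus[OF T_zero x(1)] by (simp add: q_zero)
    show "\<exists>v\<in>carrier ?G. v \<oplus>\<^bsub>?G\<^esub> u = \<zero>\<^bsub>?G\<^esub>"
      using q_plus[OF T_uminus[OF x(1)] x(1)] C[OF T_uminus[OF x(1)]] x(2) by (auto simp: q_zero)
  qed
  show "Group.comm_monoid ?G"
  proof (rule comm_monoidI)
    show "\<one>\<^bsub>?G\<^esub> \<in> carrier ?G" using C[OF T_one] by (simp add: q_one)
    fix u v w assume "u \<in> carrier ?G" "v \<in> carrier ?G" "w \<in> carrier ?G"
    then obtain x y z where xyz: "x \<in> T" "y \<in> T" "z \<in> T" "u = q x" "v = q y" "w = q z" using E by metis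
    show "u \<otimes>\<^bsub>?G\<^esub> v \<in> carrier ?G" "u \<otimes>\<^bsub>?G\<^esub> v \<otimes>\<^bsub>?G\<^esub> w = u \<otimes>\<^bsub>?G\<^esub> (v \<otimes>\<^bsub>?G\<^esub> w)"
      using xyz by (simp_all add: Q mult.assoc)
    show "u \<otimes>\<^bsub>?G\<^esub> v = v \<otimes>\<^bsub>?G\<^esub> u"
      using xyz by (simp add: q_times q_commute[OF xyz(1,2)])
  next
    fix u assume "u \<in> carrier ?G"
    then obtain x where x: "x \<in> T" "u = q x" using E by metis
    show "\<one>\<^bsub>?G\<^esub> \<otimes>\<^bsub>?G\<^esub> u = u" using x q_times[OF T_one x(1)] T_one_times[OF x(1)] by (simp add: q_one)
  qed
  fix u v w assume "u \<in> carrier ?G" "v \<in> carrier ?G" "w \<in> carrier ?G"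
  then obtain x y z where xyz: "x \<in> T" "y \<in> T" "z \<in> T" "u = q x" "v = q y" "w = q z" using E by metis
  show "(u \<oplus>\<^bsub>?G\<^esub> v) \<otimes>\<^bsub>?G\<^esub> w = u \<otimes>\<^bsub>?G\<^esub> w \<oplus>\<^bsub>?G\<^esub> v \<otimes>\<^bsub>?G\<^esub> w"
    using xyz by (simp add: Q distrib_right)
qed

lemma q_sum_mem:
  assumes "ideal I (Gr R F)" "\<And>j. j < (m::nat) \<Longrightarrow> x j \<in> T \<and> q (x j) \<in> I"
  shows "(\<Sum>j<m. x j) \<in> T \<and> q (\<Sum>j<m. x j) \<in> I"
  using assms(2)
proof (induction m)
  case 0
  interpret I: ideal I "Gr R F" by fact
  have "q 0 \<in> I" unfolding q_zero by (rule additive_subgroup.zero_closed[OF I.is_additive_subgroup])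
  then show ?case using T_zero by simp
next
  case (Suc m)
  interpret I: ideal I "Gr R F" by fact
  have "q (\<Sum>j<m. x j) \<oplus>\<^bsub>Gr R F\<^esub> q (x m) \<in> I" by (intro additive_subgroup.a_closed[OF I.is_additive_subgroup]) (use Suc in auto)
  then show ?case using Suc q_plus[of "\<Sum>j<m. x j" "x m"] T_plus by simp
qed

text \<open>
  Regularity of the symbols in terms of representatives. The given relation says that the \<open>m\<close>-th symbol
  times the class of \<open>y\<close> in degree \<open>k\<close> lies in the ideal of the earlier symbols; factors may be exchanged,
  as the graded ring is commutative. Hence the class of \<open>y\<close> lies in that ideal, and comparing coefficients
  of degree \<open>k\<close> gives the conclusion.
\<close>
theorem regular_sequence_elements:
  assumes reg: "regular_sequence (Gr R F) (map (gr_symbol R F) ths)"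
    and ths: "\<And>i. i < length ths \<Longrightarrow> ths ! i \<in> carrier R \<and> K (ths ! i) \<in> \<Phi> 2 \<and> K (ths ! i) \<notin> \<Phi> 1"
    and m: "m < length ths" and y: "y \<in> \<Phi> (Suc k)" and qj: "\<And>j. j < m \<Longrightarrow> p j \<in> \<Phi> (Suc k)"
    and rel: "y * K (ths ! m) + (\<Sum>j<m. p j * K (ths ! j)) \<in> \<Phi> (Suc k)"
  shows "\<exists>p' t. (\<forall>j<m. p' j \<in> \<Phi> k) \<and> t \<in> \<Phi> k \<and> y = t + (\<Sum>j<m. p' j * K (ths ! j))"
proof -
  interpret Gr: cring "Gr R F" by (rule cring_Gr)
  define \<sigma> where "\<sigma> i = (fps_X * fps_const (K (ths ! i)) :: 't fps)" for i
  have \<sigma>: "\<sigma> i \<in> T" "gr_symbol R F (ths ! i) = q (\<sigma> i)" if i: "i < length ths" for i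
  proof -
    note h = ths[OF i]
    have "K (ths ! i) \<in> K ` F 1" using h \<Phi>_Suc[of 1] by (simp add: numeral_2_eq_2)
    then obtain b where b: "b \<in> F 1" "K (ths ! i) = K b" by blast
    then have "ths ! i = b" using eq_iff[of "ths ! i" b] h F_carrier by blast
    then have F1: "ths ! i \<in> F 1" using b(1) by simp
    have F0: "ths ! i \<notin> F 0" using h \<Phi>_Suc[of 0] by auto
    have least: "(LEAST d. ths ! i \<in> F d) = 1"
    proof (rule Least_equality)
      show "ths ! i \<in> F 1" by (rule F1)
      fix d assume "ths ! i \<in> F d"
      then show "1 \<le> d" using F0 by (cases d) auto
    qed
    show T: "\<sigma> i \<in> T" using T_monomial[of "K (ths ! i)" 1] h by (simp add: \<sigma>_def numeral_2_eq_2)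
    show "gr_symbol R F (ths ! i) = q (\<sigma> i)"
    proof
      fix d
      have "q (\<sigma> i) d = gr_coset R F d (if d = 1 then ths ! i else \<zero>)"
        by (rule q_eq_coset) (use h in \<open>auto simp: \<sigma>_def \<Phi>_zero\<close>)
      then show "gr_symbol R F (ths ! i) d = q (\<sigma> i) d" by (simp add: gr_symbol_def least)
    qed
  qed
  define S where "S = set (take m (map (gr_symbol R F) ths))"
  have S: "S = (\<lambda>j. q (\<sigma> j)) ` {..<m}"
  proof -
    have "take m (map (gr_symbol R F) ths) = map (\<lambda>j. q (\<sigma> j)) [0..<m]"
      using m \<sigma>(2) by (intro nth_equalityI) auto
    then show ?thesis by (auto simp: S_def)
  qed
  have SC: "S \<subseteq> carrier (Gr R F)" using S \<sigma>(1) m by (auto simp: carrier_Gr)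
  have fin: "\<sigma> m \<in> T" and \<sigma>j: "\<And>j. j < m \<Longrightarrow> \<sigma> j \<in> T" using \<sigma>(1) m by auto
  let ?c = "\<lambda>y. fps_X ^ k * fps_const y :: 't fps"
  have cT: "?c y \<in> T" "\<And>j. j < m \<Longrightarrow> ?c (- p j) \<in> T"
    using y qj by (auto intro!: T_monomial \<Phi>_uminus)
  have prod: "?c x * \<sigma> i = fps_X ^ Suc k * fps_const (x * K (ths ! i))" for x i
  proof -
    have "?c x * \<sigma> i = fps_X ^ k * (fps_const x * fps_X) * fps_const (K (ths ! i))" by (simp only: \<sigma>_def mult.assoc)
    also have "fps_const x * fps_X = fps_X * fps_const x" by (rule fps_X_commute[symmetric])
    finally show ?thesis by (simp only: mult.assoc power_Suc2 fps_const_mult)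
  qed
  have neg: "(\<Sum>j<m. ?c (- p j) * \<sigma> j) = fps_X ^ Suc k * fps_const (- (\<Sum>j<m. p j * K (ths ! j)))"
    unfolding prod by (rule fps_ext) (simp add: fps_sum_nth fps_X_power_mult_nth sum_negf)
  have gen: "q (?c y) \<in> Idl\<^bsub>Gr R F\<^esub> S"
  proof -
    have "q (\<sigma> m) \<otimes>\<^bsub>Gr R F\<^esub> q (?c y) = q (?c y * \<sigma> m)"
      by (simp only: q_times[OF fin cT(1)] q_commute[OF fin cT(1)])
    also have "\<dots> = q (\<Sum>j<m. ?c (- p j) * \<sigma> j)"
    proof -
      have T: "?c y * \<sigma> m \<in> T" by (rule T_times[OF cT(1) fin])
      have T': "(\<Sum>j<m. ?c (- p j) * \<sigma> j) \<in> T"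
        using q_sum_mem[OF Gr.oneideal, of m "\<lambda>j. ?c (- p j) * \<sigma> j"] cT(2) \<sigma>j by (auto simp: carrier_Gr T_times)
      show ?thesis
      proof (subst q_eq_iff[OF T T'], rule allI)
        fix d
        have "(?c y * \<sigma> m) $ d = (if d = Suc k then y * K (ths ! m) else 0)"
          unfolding prod by (auto simp: fps_X_power_mult_nth simp del: power_Suc)
        moreover define s where "s = (\<Sum>j<m. p j * K (ths ! j))"
        moreover have "(\<Sum>j<m. ?c (- p j) * \<sigma> j) $ d = (if d = Suc k then - s else 0)"
          unfolding neg s_def[symmetric] by (auto simp: fps_X_power_mult_nth simp del: power_Suc)
        ultimately show "(?c y * \<sigma> m) $ d - (\<Sum>j<m. ?c (- p j) * \<sigma> j) $ d \<in> \<Phi> d"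
          using rel \<Phi>_zero by auto
      qed
    qed
    also have "\<dots> \<in> Idl\<^bsub>Gr R F\<^esub> S"
    proof -
      interpret I: ideal "Idl\<^bsub>Gr R F\<^esub> S" "Gr R F" by (rule Gr.genideal_ideal[OF SC])
      have c: "?c (- p j) * \<sigma> j \<in> T \<and> q (?c (- p j) * \<sigma> j) \<in> Idl\<^bsub>Gr R F\<^esub> S" if j: "j < m" for j
      proof -
        have "q (\<sigma> j) \<in> Idl\<^bsub>Gr R F\<^esub> S" using Gr.genideal_self[OF SC] S j by blast
        then have "q (?c (- p j)) \<otimes>\<^bsub>Gr R F\<^esub> q (\<sigma> j) \<in> Idl\<^bsub>Gr R F\<^esub> S"
          using cT(2)[OF j] by (intro I.I_l_closed) (auto simp: carrier_Gr)
        then show ?thesis by (simp add: q_times[OF cT(2)[OF j] \<sigma>j[OF j]] T_times[OF cT(2)[OF j] \<sigma>j[OF j]])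
      qed
      show ?thesis by (rule q_sum_mem[OF I.is_ideal c, THEN conjunct2])
    qed
    finally have "q (\<sigma> m) \<otimes>\<^bsub>Gr R F\<^esub> q (?c y) \<in> Idl\<^bsub>Gr R F\<^esub> S" .
    moreover have "map (gr_symbol R F) ths ! m = q (\<sigma> m)" using m \<sigma>(2) by simp
    moreover have "q (?c y) \<in> carrier (Gr R F)" using cT(1) by (simp add: carrier_Gr)
    ultimately show ?thesis using reg m unfolding regular_sequence_def S_def length_map by metis
  qed
  \<comment> \<open>The ideal of the earlier symbols, described by representatives.\<close>
  define I where "I = {q (\<Sum>j<m. Z j * \<sigma> j) | Z. \<forall>j<m. Z j \<in> T}"
  have sumT: "(\<Sum>j<m. Z j * \<sigma> j) \<in> T" if "\<forall>j<m. Z j \<in> T" for Z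
    using q_sum_mem[OF Gr.oneideal, of m "\<lambda>j. Z j * \<sigma> j"] that \<sigma>j by (auto simp: carrier_Gr T_times)
  have II: "q (\<Sum>j<m. Z j * \<sigma> j) \<in> I" if "\<forall>j<m. Z j \<in> T" for Z using that unfolding I_def by blast
  have IE: "\<exists>Z. (\<forall>j<m. Z j \<in> T) \<and> u = q (\<Sum>j<m. Z j * \<sigma> j)" if "u \<in> I" for u
    using that unfolding I_def by blast
  have IC: "I \<subseteq> carrier (Gr R F)" using IE sumT by (fastforce simp: carrier_Gr)
  have left: "w \<otimes>\<^bsub>Gr R F\<^esub> u \<in> I" if u: "u \<in> I" and w: "w \<in> carrier (Gr R F)" for u w
  proof -
    obtain Z where Z: "\<forall>j<m. Z j \<in> T" "u = q (\<Sum>j<m. Z j * \<sigma> j)" using IE[OF u] by blast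
    obtain x where x: "x \<in> T" "w = q x" using w by (auto simp: carrier_Gr)
    have "w \<otimes>\<^bsub>Gr R F\<^esub> u = q (\<Sum>j<m. (x * Z j) * \<sigma> j)"
      unfolding Z(2) x(2) q_times[OF x(1) sumT[OF Z(1)]] by (simp add: sum_distrib_left mult.assoc)
    also have "\<dots> \<in> I" by (rule II) (use Z x T_times in auto)
    finally show ?thesis .
  qed
  have idealI: "ideal I (Gr R F)"
  proof (rule idealI)
    show "Ring.ring (Gr R F)" by (rule Gr.ring_axioms)
    show "subgroup I (add_monoid (Gr R F))"
    proof (rule Gr.add.subgroupI)
      show "I \<subseteq> carrier (Gr R F)" by (rule IC)
      show "I \<noteq> {}" using II[of "\<lambda>_. 0"] T_zero by auto
      fix u assume u: "u \<in> I"
      obtain Z where Z: "\<forall>j<m. Z j \<in> T" "u = q (\<Sum>j<m. Z j * \<sigma> j)" using IE[OF u] by blast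
      have "\<ominus>\<^bsub>Gr R F\<^esub> u = (\<ominus>\<^bsub>Gr R F\<^esub> \<one>\<^bsub>Gr R F\<^esub>) \<otimes>\<^bsub>Gr R F\<^esub> u" using u IC by (simp add: Gr.l_minus subsetD)
      then show "\<ominus>\<^bsub>Gr R F\<^esub> u \<in> I" using left[OF u, of "\<ominus>\<^bsub>Gr R F\<^esub> \<one>\<^bsub>Gr R F\<^esub>"] by simp
      fix v assume v: "v \<in> I"
      obtain Z' where Z': "\<forall>j<m. Z' j \<in> T" "v = q (\<Sum>j<m. Z' j * \<sigma> j)" using IE[OF v] by blast
      have "u \<oplus>\<^bsub>Gr R F\<^esub> v = q (\<Sum>j<m. (Z j + Z' j) * \<sigma> j)"
        unfolding Z(2) Z'(2) q_plus[OF sumT[OF Z(1)] sumT[OF Z'(1)]] by (simp add: distrib_right sum.distrib)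
      also have "\<dots> \<in> I" by (rule II) (use Z Z' T_plus in auto)
      finally show "u \<oplus>\<^bsub>Gr R F\<^esub> v \<in> I" .
    qed
    show "u \<otimes>\<^bsub>Gr R F\<^esub> w \<in> I" "w \<otimes>\<^bsub>Gr R F\<^esub> u \<in> I" if "u \<in> I" "w \<in> carrier (Gr R F)" for u w
      using left[OF that] Gr.m_comm[of u w] that IC by auto
  qed
  have "S \<subseteq> I"
  proof
    fix u assume "u \<in> S"
    then obtain j where j: "j < m" "u = q (\<sigma> j)" using S by auto
    have "(\<Sum>i<m. (if i = j then fps_const (K \<one>) else 0) * \<sigma> i) = (\<Sum>i<m. if i = j then fps_const (K \<one>) * \<sigma> j else 0)"
      by (rule sum.cong) auto
    also have "\<dots> = \<sigma> j" using j(1) T_one_times[OF \<sigma>j[OF j(1)]] by simp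
    finally show "u \<in> I" using II[of "\<lambda>i. if i = j then fps_const (K \<one>) else 0"] T_one T_zero j(2) by simp
  qed
  then have "q (?c y) \<in> I" using gen Gr.genideal_minimal[OF idealI] by blast
  then obtain Z where Z: "\<forall>j<m. Z j \<in> T" "q (?c y) = q (\<Sum>j<m. Z j * \<sigma> j)" using IE by blast
  have "(?c y) $ k - (\<Sum>j<m. Z j * \<sigma> j) $ k \<in> \<Phi> k"
    using Z(2) q_eq_iff[OF cT(1) sumT[OF Z(1)]] by blast
  \<comment> \<open>The \<open>j\<close>-th symbol has degree \<open>1\<close>, so only the coefficient \<open>k - 1\<close> of \<open>Z j\<close> contributes.\<close>
  moreover define p' where "p' j = (if k = 0 then 0 else Z j $ (k - 1))" for j
  have "(Z j * \<sigma> j) $ k = p' j * K (ths ! j)" for j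
  proof -
    have "Z j * \<sigma> j = (Z j * fps_X) * fps_const (K (ths ! j))" by (simp only: \<sigma>_def mult.assoc)
    then show ?thesis by (simp add: p'_def)
  qed
  ultimately have t: "y - (\<Sum>j<m. p' j * K (ths ! j)) \<in> \<Phi> k"
    by (simp add: fps_sum_nth fps_X_power_mult_nth)
  have "p' j \<in> \<Phi> k" if "j < m" for j
  proof (cases k)
    case (Suc l)
    then show ?thesis using Z(1) that by (simp add: p'_def T_def)
  qed (simp add: p'_def \<Phi>_zero)
  then show ?thesis using t
    by (intro exI[of _ p'] exI[of _ "y - (\<Sum>j<m. p' j * K (ths ! j))"]) simp
qed

end

section \<open>The ring D[s] at a point\<close>

context ring_embedding
begin

definition poly_embed :: "(nat \<Rightarrow> 'd) \<Rightarrow> 'r fps" where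
  "poly_embed Q = Abs_fps (\<lambda>i. j (Q i))"

lemma poly_embed_nth [simp]: "poly_embed Q $ i = j (Q i)"
  by (simp add: poly_embed_def)

lemma ring_embedding_UP: "ring_embedding (UP R) poly_embed"
proof -
  have ring: "Ring.ring (UP R)"
    by (rule UP_ring.UP_ring) (simp add: UP_ring_def R.ring_axioms)
  have carrier: "x i \<in> carrier R" if "x \<in> carrier (UP R)" for x i
    using that by (auto simp: UP_def)
  have eq: "x = y" if "x \<in> carrier (UP R)" "y \<in> carrier (UP R)" "poly_embed x = poly_embed y" for x y
  proof
    fix i
    have "poly_embed x $ i = poly_embed y $ i" by (simp only: that)
    then have "j (x i) = j (y i)" by simp
    then show "x i = y i" using eq_iff[OF carrier[OF that(1)] carrier[OF that(2)]] by blast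
  qed
  have add: "poly_embed (x \<oplus>\<^bsub>UP R\<^esub> y) = poly_embed x + poly_embed y"
    if "x \<in> carrier (UP R)" "y \<in> carrier (UP R)" for x y
    using carrier[OF that(1)] carrier[OF that(2)] that by (auto simp: fps_eq_iff UP_def add)
  have mult: "poly_embed (x \<otimes>\<^bsub>UP R\<^esub> y) = poly_embed x * poly_embed y"
    if "x \<in> carrier (UP R)" "y \<in> carrier (UP R)" for x y
  proof (rule fps_ext)
    fix n
    note c = carrier[OF that(1)] carrier[OF that(2)]
    have "(x \<otimes>\<^bsub>UP R\<^esub> y) n = (\<Oplus>i\<in>{..n}. x i \<otimes> y (n - i))" using that by (simp add: UP_def)
    then have "poly_embed (x \<otimes>\<^bsub>UP R\<^esub> y) $ n = (\<Sum>i\<le>n. j (x i \<otimes> y (n - i)))"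
      using c by (simp add: finsum)
    then show "poly_embed (x \<otimes>\<^bsub>UP R\<^esub> y) $ n = (poly_embed x * poly_embed y) $ n"
      using c by (simp add: mult fps_mult_nth atLeast0AtMost)
  qed
  show ?thesis
    by (rule ring_embedding.intro[OF ring], rule ring_embedding_axioms.intro)
       (use eq add mult in \<open>auto intro: inj_onI\<close>)
qed

lemma poly_embed_carrier: "poly_embed ` carrier (UP R) = polys (j ` carrier R)"
proof
  show "poly_embed ` carrier (UP R) \<subseteq> polys (j ` carrier R)"
  proof clarify
    fix x assume "x \<in> carrier (UP R)"
    then obtain n where x: "x i \<in> carrier R" "bound \<zero> n x" for i by (auto simp: UP_def up_def)
    show "poly_embed x \<in> polys (j ` carrier R)"
    proof (rule polysI[of _ _ "Suc n"])
      show "poly_embed x $ i = 0" if "Suc n \<le> i" for i using bound.bound[OF x(2), of i] that by simp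
    qed (use x in auto)
  qed
  show "polys (j ` carrier R) \<subseteq> poly_embed ` carrier (UP R)"
  proof
    fix Q assume "Q \<in> polys (j ` carrier R)"
    then obtain N where N: "\<forall>i. Q $ i \<in> j ` carrier R" "\<forall>i\<ge>N. Q $ i = 0" by (rule polysE)
    define x where "x i = inv_into (carrier R) j (Q $ i)" for i
    have x: "x i \<in> carrier R" "j (x i) = Q $ i" for i
      using N(1) by (simp_all add: x_def inv_into_into f_inv_into_f)
    have "x i = \<zero>" if "N < i" for i using x[of i] N(2) that eq_iff[of "x i" \<zero>] by simp
    then have "x \<in> carrier (UP R)" using x(1) by (auto simp: UP_def up_def intro!: exI[of _ N] bound.intro)
    moreover have "Q = poly_embed x" by (simp add: fps_eq_iff x(2))
    ultimately show "Q \<in> poly_embed ` carrier (UP R)" by blast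
  qed
qed

lemma monom_UP:
  assumes "a \<in> carrier R"
  shows "monom (UP R) a n \<in> carrier (UP R)" "poly_embed (monom (UP R) a n) $ i = (if i = n then j a else 0)"
  using assms by (auto simp: UP_def up_def intro!: exI[of _ n] bound.intro)

end

context manifold_at
begin

abbreviation Dsp where "Dsp \<equiv> Ds_stalk X A p"

definition K :: "(nat \<Rightarrow> 'a germ \<Rightarrow> 'a germ) \<Rightarrow> ('a germ \<Rightarrow> 'a germ) ring_product fps" where
  "K = DS.poly_embed"

sublocale K: ring_embedding Dsp K
  unfolding Ds_stalk_def K_def by (rule DS.ring_embedding_UP)

lemma K_carrier: "K ` carrier Dsp = polys opsp"
  unfolding Ds_stalk_def K_def DS.poly_embed_carrier J_Dp ..

lemma K_nth: "K Q $ i = J (Q i)"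
  by (simp add: K_def)

lemma monom_Dsp:
  assumes "P \<in> carrier Dp"
  shows "monom Dsp P n \<in> carrier Dsp" "K (monom Dsp P n) $ i = (if i = n then J P else 0)"
  unfolding Ds_stalk_def K_def using DS.monom_UP[OF assms] by auto

text \<open>
  The operator \<open>P\<^sub>i\<close> of order \<open>i\<close> goes with \<open>s\<^sup>k\<^sup>-\<^sup>i\<close>, so the coefficient of \<open>s\<^sup>c\<close> is \<open>P\<^sub>k\<^sub>-\<^sub>c\<close>.
\<close>
lemma K_total_order_sum:
  assumes P: "\<forall>i\<le>k. P i \<in> carrier Dp"
  defines "Y \<equiv> (\<Oplus>\<^bsub>Dsp\<^esub>i\<in>{..k}. monom Dsp (P i) (k - i))"
  shows "Y \<in> carrier Dsp" "K Y $ c = (if c \<le> k then J (P (k - c)) else 0)"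
proof -
  have m: "monom Dsp (P i) (k - i) \<in> carrier Dsp" if "i \<le> k" for i using P that monom_Dsp(1) by blast
  then show "Y \<in> carrier Dsp" unfolding Y_def by (intro K.R.finsum_closed) auto
  have "K Y $ c = (\<Sum>i\<le>k. K (monom Dsp (P i) (k - i)) $ c)"
    unfolding Y_def using m by (subst K.finsum) (auto simp: fps_sum_nth)
  also have "\<dots> = (\<Sum>i\<le>k. if c \<le> k \<and> i = k - c then J (P (k - c)) else 0)"
    by (rule sum.cong) (use P in \<open>auto simp: monom_Dsp(2)\<close>)
  also have "\<dots> = (if c \<le> k then J (P (k - c)) else 0)" by auto
  finally show "K Y $ c = (if c \<le> k then J (P (k - c)) else 0)" .
qed

lemma K_total_order: "K ` total_order X A p k = d.Gs (Suc k)"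
proof
  show "K ` total_order X A p k \<subseteq> d.Gs (Suc k)"
  proof clarify
    fix Y assume "Y \<in> total_order X A p k"
    then obtain P where P: "\<forall>i\<le>k. P i \<in> D_order X A p i" "Y = (\<Oplus>\<^bsub>Dsp\<^esub>i\<in>{..k}. monom Dsp (P i) (k - i))"
      unfolding total_order_def by blast
    have c: "\<forall>i\<le>k. P i \<in> carrier Dp" using P(1) carrier_Dp by blast
    show "K Y \<in> d.Gs (Suc k)"
      unfolding d.Gs_def P(2)
    proof (intro CollectI allI)
      fix c
      show "K (\<Oplus>\<^bsub>Dsp\<^esub>i\<in>{..k}. monom Dsp (P i) (k - i)) $ c \<in> d.G (Suc k - c)"
      proof (cases "c \<le> k")
        case True
        have "J (P (k - c)) \<in> d.G (Suc (k - c))" using P(1) D_order_diffop by (simp add: d.G_simps)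
        then show ?thesis using True unfolding K_total_order_sum(2)[OF c] by (simp add: Suc_diff_le)
      qed (unfold K_total_order_sum(2)[OF c], simp add: d.G_zero)
    qed
  qed
  show "d.Gs (Suc k) \<subseteq> K ` total_order X A p k"
  proof
    fix Q assume Q: "Q \<in> d.Gs (Suc k)"
    have "\<exists>P\<in>D_order X A p i. J P = Q $ (k - i)" if "i \<le> k" for i
    proof (rule diffop_D_order)
      have "Q $ (k - i) \<in> d.G (Suc k - (k - i))" using Q by (simp add: d.Gs_def)
      moreover have "Suc k - (k - i) = Suc i" using that by simp
      ultimately show "d.diffop i (Q $ (k - i))" by (simp add: d.G_simps)
    qed
    then have "\<forall>i. \<exists>P. i \<le> k \<longrightarrow> P \<in> D_order X A p i \<and> J P = Q $ (k - i)" by blast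
    then obtain P where P: "\<forall>i. i \<le> k \<longrightarrow> P i \<in> D_order X A p i \<and> J (P i) = Q $ (k - i)" by (rule choice[THEN exE])
    have c: "\<forall>i\<le>k. P i \<in> carrier Dp" using P carrier_Dp by blast
    have "Q = K (\<Oplus>\<^bsub>Dsp\<^esub>i\<in>{..k}. monom Dsp (P i) (k - i))"
    proof (rule fps_ext)
      fix c
      have "Q $ c = 0" if "\<not> c \<le> k"
      proof -
        have "Q $ c \<in> d.G (Suc k - c)" using Q by (simp add: d.Gs_def)
        then show ?thesis using that by (simp add: d.G_simps)
      qed
      then show "Q $ c = K (\<Oplus>\<^bsub>Dsp\<^esub>i\<in>{..k}. monom Dsp (P i) (k - i)) $ c"
        unfolding K_total_order_sum(2)[OF c] using P by simp
    qed
    then show "Q \<in> K ` total_order X A p k" using P unfolding total_order_def by blast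
  qed
qed

lemma K_one: "K \<one>\<^bsub>Dsp\<^esub> = fps_const ep"
  by (auto simp: fps_eq_iff K_nth Ds_stalk_def UP_def ep_def)

sublocale K: filtered_embedding Dsp K "total_order X A p" d.Gs
proof
  show "total_order X A p k \<subseteq> carrier Dsp" for k
  proof
    fix Y assume "Y \<in> total_order X A p k"
    then obtain P where P: "\<forall>i\<le>k. P i \<in> D_order X A p i" "Y = (\<Oplus>\<^bsub>Dsp\<^esub>i\<in>{..k}. monom Dsp (P i) (k - i))"
      unfolding total_order_def by blast
    then show "Y \<in> carrier Dsp" using carrier_Dp K_total_order_sum(1)[of k P] by blast
  qed
  show "d.Gs 0 = {0}" "d.Gs (Suc k) = K ` total_order X A p k" "additive_group (d.Gs k)" "d.Gs k \<subseteq> d.Gs (Suc k)" for k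
    by (simp_all add: d.Gs_0 K_total_order d.Gs_group d.Gs_mono)
  show "K \<one>\<^bsub>Dsp\<^esub> \<in> d.Gs 1"
    unfolding K_one using d.const[OF d.B_e] by (intro d.Gs_const) (simp add: d.G_simps)
  fix x y k l assume xy: "x \<in> d.Gs k" "y \<in> d.Gs l"
  show "x * y \<in> d.Gs (k + l - 1)" "x * y - y * x \<in> d.Gs (k + l - 2)"
    by (rule d.Gs_product[OF xy] d.Gs_commutator[OF xy])+
qed

lemma s_var: "s_var X A p \<in> carrier Dsp" "K (s_var X A p) = fps_X * fps_const ep"
proof -
  have one: "\<one>\<^bsub>Dp\<^esub> \<in> carrier Dp" by (rule DS.R.one_closed)
  show "s_var X A p \<in> carrier Dsp" unfolding s_var_def by (rule monom_Dsp(1)[OF one])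
  show "K (s_var X A p) = fps_X * fps_const ep"
    unfolding s_var_def by (rule fps_ext) (auto simp: monom_Dsp(2)[OF one, simplified] ep_def)
qed

lemma K_s_var: assumes Q: "Q \<in> polys opsp" shows "K (s_var X A p) * Q = fps_X * Q"
proof -
  have "fps_const ep * Q = Q" using Q by (auto simp: polys_def fps_eq_iff opsp_e)
  then show ?thesis by (simp only: s_var(2) mult.assoc)
qed

lemma theta_Dsp:
  assumes \<delta>: "\<delta> \<in> Der_stalk X A p" and \<alpha>: "\<alpha> \<in> carrier Op"
  shows "theta X A p \<delta> \<alpha> \<in> carrier Dsp"
    "K (theta X A p \<delta> \<alpha>) = fps_const (J \<delta>) - fps_const (M \<alpha>) * fps_X"
proof -
  have \<delta>D: "\<delta> \<in> carrier Dp" by (rule Der_Dp[OF \<delta>])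
  have \<alpha>D: "mult_op Op \<alpha> \<in> carrier Dp"
    using M_Bp[OF \<alpha>] by (intro Dp_mem mult_op_E \<alpha>) (simp add: M_def[symmetric] opsp_Bp)
  note c = monom_Dsp(1)[OF \<delta>D, of 0] monom_Dsp(1)[OF \<alpha>D, of 0] s_var(1)
  show "theta X A p \<delta> \<alpha> \<in> carrier Dsp" unfolding theta_def using c by simp
  have 1: "K (monom Dsp \<delta> 0) = fps_const (J \<delta>)" "K (monom Dsp (mult_op Op \<alpha>) 0) = fps_const (M \<alpha>)"
    by (auto simp: fps_eq_iff monom_Dsp(2)[OF \<delta>D] monom_Dsp(2)[OF \<alpha>D] M_def)
  have "fps_const (M \<alpha>) * K (s_var X A p) = fps_const (M \<alpha> * ep) * fps_X"
    by (simp only: s_var(2) fps_X_commute[of "fps_const ep"] mult.assoc[symmetric] fps_const_mult)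
  also have "M \<alpha> * ep = M \<alpha>" using opsp_e(2)[OF opsp_Bp[OF M_Bp[OF \<alpha>]]] .
  finally show "K (theta X A p \<delta> \<alpha>) = fps_const (J \<delta>) - fps_const (M \<alpha>) * fps_X"
    unfolding theta_def using c by (simp add: K.minus K.mult 1)
qed

end

section \<open>Logarithmic vector fields at a point\<close>

context manifold_at
begin

lemma hol_nonzero:
  assumes g: "hol g" and ne: "g p \<noteq> 0" shows "eventually (\<lambda>x. g x \<noteq> 0) (nhdsin X p)"
proof -
  obtain U \<phi> where c: "(U, \<phi>) \<in> A" "p \<in> U" by (rule chart_at_p)
  obtain V where V: "open V" "\<phi> p \<in> V" "holomorphic_Cn (in_chart U \<phi> g) V"
    using g unfolding hol_in_chart[OF c] by blast
  obtain F' where "(in_chart U \<phi> g has_derivative F') (at (\<phi> p))"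
    using V(2,3) unfolding holomorphic_Cn_def by blast
  then have "isCont (in_chart U \<phi> g) (\<phi> p)" by (rule has_derivative_continuous)
  then have "eventually (\<lambda>z. in_chart U \<phi> g z \<noteq> 0) (at (\<phi> p))"
    unfolding isCont_def by (rule tendsto_imp_eventually_ne) (use c ne in simp)
  then have "eventually (\<lambda>z. in_chart U \<phi> g z \<noteq> 0) (nhds (\<phi> p))"
    unfolding eventually_nhds_conv_at using c ne by simp
  then show ?thesis unfolding eventually_chart[OF c] .
qed

lemma hol_at: "holomorphic_fun X A g W \<Longrightarrow> p \<in> W \<Longrightarrow> hol g"
  unfolding hol_def by blast

text \<open>
  By continuity alone: where \<open>g\<close> does not vanish, it does not vanish nearby, and if \<open>g f = 0\<close> then \<open>f\<close>
  vanishes identically there.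
\<close>
lemma germ_regular:
  assumes f: "\<And>x. x \<in> topspace X \<Longrightarrow> germ_at X x f \<noteq> \<zero>\<^bsub>O_stalk X A x\<^esub>"
    and a: "a \<in> carrier Op" "a \<otimes>\<^sub>p germ f = \<zero>\<^sub>p"
  shows "a = \<zero>\<^sub>p"
proof -
  obtain g where g: "hol g" "a = germ g" using a(1) by (rule carrier_OpE)
  obtain W where W: "p \<in> W" "holomorphic_fun X A g W" using g(1) unfolding hol_def by blast
  have "eventually (\<lambda>x. g x * f x = 0) (nhdsin X p)"
    using a(2) unfolding g(2) germ_mult germ_zero germ_eq_iff .
  then obtain S where S: "openin X S" "p \<in> S" "\<forall>x\<in>S. g x * f x = 0"
    unfolding eventually_nhdsin using p by blast
  have "g x = 0" if x: "x \<in> S \<inter> W" for x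
  proof (rule ccontr)
    assume gx: "g x \<noteq> 0"
    have xX: "x \<in> topspace X" using x S(1) openin_subset by blast
    interpret x: manifold_at X A x by unfold_locales (rule manifold xX)+
    have "eventually (\<lambda>y. g y \<noteq> 0) (nhdsin X x)" by (rule x.hol_nonzero[OF x.hol_at[OF W(2)] gx]) (use x in simp)
    moreover have "eventually (\<lambda>y. y \<in> S) (nhdsin X x)" unfolding eventually_nhdsin using S(1) x by blast
    ultimately have "eventually (\<lambda>y. f y = 0) (nhdsin X x)" by eventually_elim (use S(3) in auto)
    then have "germ_at X x f = germ_at X x (\<lambda>_. 0)" unfolding x.germ_eq_iff .
    then show False using f[OF xX] by (simp add: x.germ_zero)
  qed
  moreover have "openin X (S \<inter> W)" using S(1) W(2) by (auto simp: holomorphic_fun_def)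
  ultimately have "eventually (\<lambda>x. g x = 0) (nhdsin X p)"
    unfolding eventually_nhdsin using S(2) W(1) by blast
  then show ?thesis unfolding g(2) germ_zero germ_eq_iff .
qed

lemma PIdl_iff: "a \<in> PIdl\<^bsub>Op\<^esub> h \<longleftrightarrow> (\<exists>x\<in>carrier Op. a = x \<otimes>\<^sub>p h)"
  unfolding cgenideal_def by blast

lemma Der_log_iff:
  assumes h: "h \<in> carrier Op" and I: "ideal_stalk X A D p = PIdl\<^bsub>Op\<^esub> h"
  shows "\<delta> \<in> Der_log_stalk X A D p \<longleftrightarrow> \<delta> \<in> Der_stalk X A p \<and> (\<exists>\<alpha>\<in>carrier Op. \<delta> h = \<alpha> \<otimes>\<^sub>p h)"
proof
  assume "\<delta> \<in> Der_log_stalk X A D p"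
  then have \<delta>: "\<delta> \<in> Der_stalk X A p" "\<And>g. g \<in> PIdl\<^bsub>Op\<^esub> h \<Longrightarrow> \<delta> g \<in> PIdl\<^bsub>Op\<^esub> h" by (auto simp: Der_log_stalk_def I)
  have "h \<in> PIdl\<^bsub>Op\<^esub> h" by (rule O.cgenideal_self[OF h])
  then have "\<delta> h \<in> PIdl\<^bsub>Op\<^esub> h" by (rule \<delta>(2))
  then show "\<delta> \<in> Der_stalk X A p \<and> (\<exists>\<alpha>\<in>carrier Op. \<delta> h = \<alpha> \<otimes>\<^sub>p h)" using \<delta>(1) by (simp add: PIdl_iff)
next
  assume a: "\<delta> \<in> Der_stalk X A p \<and> (\<exists>\<alpha>\<in>carrier Op. \<delta> h = \<alpha> \<otimes>\<^sub>p h)"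
  then obtain \<alpha> where \<alpha>: "\<alpha> \<in> carrier Op" "\<delta> h = \<alpha> \<otimes>\<^sub>p h" by blast
  have "\<delta> g \<in> PIdl\<^bsub>Op\<^esub> h" if g: "g \<in> PIdl\<^bsub>Op\<^esub> h" for g
  proof -
    obtain x where x: "x \<in> carrier Op" "g = x \<otimes>\<^sub>p h" using g by (auto simp: PIdl_iff)
    have \<delta>x: "\<delta> x \<in> carrier Op" using a x(1) Der_closed by blast
    have "\<delta> g = (x \<otimes>\<^sub>p \<alpha> \<oplus>\<^sub>p \<delta> x) \<otimes>\<^sub>p h"
      using a h x \<alpha> \<delta>x by (simp add: Der_mult O.l_distr O.m_assoc)
    then show ?thesis unfolding PIdl_iff using x \<alpha> \<delta>x by blast
  qed
  then show "\<delta> \<in> Der_log_stalk X A D p" using a by (simp add: Der_log_stalk_def I)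
qed

text \<open>
  A vector field is logarithmic as soon as it maps one generator of the ideal into the ideal.
\<close>
lemma J_Der_log:
  assumes h: "h \<in> carrier Op" and I: "ideal_stalk X A D p = PIdl\<^bsub>Op\<^esub> h"
  shows "v \<in> J ` Der_log_stalk X A D p \<longleftrightarrow> v \<in> d.fields \<and> (\<exists>b\<in>Bp. v * M h - M h * v = b * M h)"
proof
  assume "v \<in> J ` Der_log_stalk X A D p"
  then obtain \<delta> where \<delta>: "\<delta> \<in> Der_log_stalk X A D p" "v = J \<delta>" by blast
  then obtain \<alpha> where \<alpha>: "\<delta> \<in> Der_stalk X A p" "\<alpha> \<in> carrier Op" "\<delta> h = \<alpha> \<otimes>\<^sub>p h" unfolding Der_log_iff[OF h I] by blast
  have "v * M h - M h * v = M \<alpha> * M h" using \<alpha> h by (simp add: \<delta>(2) Der_M M_mult)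
  then show "v \<in> d.fields \<and> (\<exists>b\<in>Bp. v * M h - M h * v = b * M h)"
    using \<alpha> M_Bp Der_fields \<delta>(2) by blast
next
  assume v: "v \<in> d.fields \<and> (\<exists>b\<in>Bp. v * M h - M h * v = b * M h)"
  then obtain \<alpha> where \<alpha>: "\<alpha> \<in> carrier Op" "v * M h - M h * v = M \<alpha> * M h" using BpE by metis
  have "v \<in> opsp" using v d.fields_diffop unfolding opsp_def by blast
  then obtain \<delta> where \<delta>: "\<delta> \<in> carrier Dp" "v = J \<delta>" using J_Dp by blast
  then have Der: "\<delta> \<in> Der_stalk X A p" using v Dp_E by (simp add: Der_fields)
  have "M (\<delta> h) = M (\<alpha> \<otimes>\<^sub>p h)" using \<alpha> h by (simp add: Der_M[OF Der h, symmetric] \<delta>(2)[symmetric] M_mult)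
  then have "\<delta> h = \<alpha> \<otimes>\<^sub>p h" by (rule M_inj[rotated 2]) (use Der_closed[OF Der h] \<alpha> h in auto)
  then have "\<delta> \<in> Der_log_stalk X A D p" unfolding Der_log_iff[OF h I] using Der \<alpha>(1) by blast
  then show "v \<in> J ` Der_log_stalk X A D p" using \<delta>(2) by blast
qed

end

context manifold_at
begin

lemma log_lie_basis_at:
  assumes h: "h \<in> carrier Op" and I: "ideal_stalk X A D p = PIdl\<^bsub>Op\<^esub> h"
    and regular: "\<And>a. a \<in> carrier Op \<Longrightarrow> a \<otimes>\<^sub>p h = \<zero>\<^sub>p \<Longrightarrow> a = \<zero>\<^sub>p"
    and basis: "lie_basis ep opsp Bp (J ` Der_log_stalk X A D p) n g co"
  shows "log_lie_basis ep opsp Bp (J ` Der_log_stalk X A D p) n g co (M h)"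
proof (rule log_lie_basis.intro[OF basis], rule log_lie_basis_axioms.intro)
  show "M h \<in> Bp" by (rule M_Bp[OF h])
  show "b = 0" if b: "b \<in> Bp" "b * M h = 0" for b
  proof -
    obtain a where a: "a \<in> carrier Op" "b = M a" using b(1) by (rule BpE)
    have "M (a \<otimes>\<^sub>p h) = M \<zero>\<^sub>p" using a b(2) h by (simp add: M_mult M_zero)
    then have "a \<otimes>\<^sub>p h = \<zero>\<^sub>p" by (rule M_inj[rotated 2]) (use a h in auto)
    then have "a = \<zero>\<^sub>p" by (rule regular[OF a(1)])
    then show ?thesis by (simp add: a(2) M_zero)
  qed
  show "\<exists>a\<in>Bp. v * M h - M h * v = a * M h" if "v \<in> J ` Der_log_stalk X A D p" for v
    using that unfolding J_Der_log[OF h I] by blast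
qed

lemma lift_coefficients:
  assumes "\<forall>i<n. u i \<in> Bp" shows "\<exists>a. a \<in> {..<n} \<rightarrow>\<^sub>E carrier Op \<and> (\<forall>i<n. u i = M (a i))"
proof -
  have "\<forall>i. \<exists>x. i < n \<longrightarrow> x \<in> carrier Op \<and> u i = M x" using assms BpE by metis
  then obtain a where "\<forall>i. i < n \<longrightarrow> a i \<in> carrier Op \<and> u i = M (a i)" by (rule choice[THEN exE])
  then show ?thesis by (intro exI[of _ "restrict a {..<n}"]) auto
qed

lemma lie_basis_Der_log:
  assumes h: "h \<in> carrier Op" and I: "ideal_stalk X A D p = PIdl\<^bsub>Op\<^esub> h"
    and basis: "O_basis Op (Der_log_stalk X A D p) ds"
  shows "\<exists>co. lie_basis ep opsp Bp (J ` Der_log_stalk X A D p) (length ds) (\<lambda>i. J (ds ! i)) co"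
proof -
  define n where "n = length ds"
  define L where "L = J ` Der_log_stalk X A D p"
  note L_iff = J_Der_log[OF h I, folded L_def]
  have Bp_ops: "Bp \<subseteq> opsp" using opsp_Bp by blast
  have hB: "M h \<in> Bp" by (rule M_Bp[OF h])
  have dsL: "ds ! i \<in> Der_log_stalk X A D p" if "i < n" for i
    using basis that unfolding O_basis_def n_def by auto
  then have dsE: "ds ! i \<in> carrier E" if "i < n" for i using that Der_fields Der_log_iff[OF h I] by blast
  have sumJ: "(\<Oplus>\<^bsub>E\<^esub>i\<in>{..<n}. mult_op Op (a i) \<otimes>\<^sub>E ds ! i) \<in> carrier E"
      "J (\<Oplus>\<^bsub>E\<^esub>i\<in>{..<n}. mult_op Op (a i) \<otimes>\<^sub>E ds ! i) = (\<Sum>i<n. M (a i) * J (ds ! i))"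
    if a: "a \<in> {..<n} \<rightarrow>\<^sub>E carrier Op" for a
  proof -
    have aE: "mult_op Op (a i) \<in> carrier E" if "i < n" for i using a that by (intro mult_op_E) auto
    show "(\<Oplus>\<^bsub>E\<^esub>i\<in>{..<n}. mult_op Op (a i) \<otimes>\<^sub>E ds ! i) \<in> carrier E"
      by (intro J.R.finsum_closed) (use aE dsE in auto)
    show "J (\<Oplus>\<^bsub>E\<^esub>i\<in>{..<n}. mult_op Op (a i) \<otimes>\<^sub>E ds ! i) = (\<Sum>i<n. M (a i) * J (ds ! i))"
      using aE dsE by (subst J.finsum) (auto simp: J.mult M_def)
  qed
  have ex1: "\<exists>!a. a \<in> {..<n} \<rightarrow>\<^sub>E carrier Op \<and> \<delta> = (\<Oplus>\<^bsub>E\<^esub>i\<in>{..<n}. mult_op Op (a i) \<otimes>\<^sub>E ds ! i)"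
    if "\<delta> \<in> Der_log_stalk X A D p" for \<delta>
    using basis that unfolding O_basis_def n_def by blast
  have expand: "\<exists>c. (\<forall>i<n. c i \<in> Bp) \<and> (\<Sum>i<n. c i * J (ds ! i)) = v" if v: "v \<in> L" for v
  proof -
    obtain \<delta> where \<delta>: "\<delta> \<in> Der_log_stalk X A D p" "v = J \<delta>" using v unfolding L_def by blast
    obtain a where a: "a \<in> {..<n} \<rightarrow>\<^sub>E carrier Op" "\<delta> = (\<Oplus>\<^bsub>E\<^esub>i\<in>{..<n}. mult_op Op (a i) \<otimes>\<^sub>E ds ! i)"
      using ex1[OF \<delta>(1)] by blast
    have "\<forall>i<n. M (a i) \<in> Bp" using a(1) by (auto intro: M_Bp)
    moreover have "(\<Sum>i<n. M (a i) * J (ds ! i)) = v" by (simp only: sumJ(2)[OF a(1), symmetric] a(2)[symmetric] \<delta>(2))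
    ultimately show ?thesis by (intro exI[of _ "\<lambda>i. M (a i)"]) simp
  qed
  have unique: "u k = u' k"
    if u: "\<forall>i<n. u i \<in> Bp" and u': "\<forall>i<n. u' i \<in> Bp" and eq: "(\<Sum>i<n. u i * J (ds ! i)) = (\<Sum>i<n. u' i * J (ds ! i))"
      and L: "(\<Sum>i<n. u' i * J (ds ! i)) \<in> L" and k: "k < n" for u u' k
  proof -
    obtain \<delta> where \<delta>: "\<delta> \<in> Der_log_stalk X A D p" "(\<Sum>i<n. u' i * J (ds ! i)) = J \<delta>" using L unfolding L_def by blast
    have \<delta>E: "\<delta> \<in> carrier E" using \<delta>(1) Der_fields Der_log_iff[OF h I] by blast
    obtain a where a: "a \<in> {..<n} \<rightarrow>\<^sub>E carrier Op" "\<forall>i<n. u i = M (a i)" using lift_coefficients[OF u] by blast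
    obtain a' where a': "a' \<in> {..<n} \<rightarrow>\<^sub>E carrier Op" "\<forall>i<n. u' i = M (a' i)" using lift_coefficients[OF u'] by blast
    have "J (\<Oplus>\<^bsub>E\<^esub>i\<in>{..<n}. mult_op Op (a i) \<otimes>\<^sub>E ds ! i) = J \<delta>"
      unfolding sumJ(2)[OF a(1)] \<delta>(2)[symmetric] eq[symmetric] by (rule sum.cong) (use a(2) in auto)
    then have 1: "\<delta> = (\<Oplus>\<^bsub>E\<^esub>i\<in>{..<n}. mult_op Op (a i) \<otimes>\<^sub>E ds ! i)"
      using J.eq_iff[OF sumJ(1)[OF a(1)] \<delta>E] by simp
    have "J (\<Oplus>\<^bsub>E\<^esub>i\<in>{..<n}. mult_op Op (a' i) \<otimes>\<^sub>E ds ! i) = J \<delta>"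
      unfolding sumJ(2)[OF a'(1)] \<delta>(2)[symmetric] by (rule sum.cong) (use a'(2) in auto)
    then have 2: "\<delta> = (\<Oplus>\<^bsub>E\<^esub>i\<in>{..<n}. mult_op Op (a' i) \<otimes>\<^sub>E ds ! i)"
      using J.eq_iff[OF sumJ(1)[OF a'(1)] \<delta>E] by simp
    have "a = a'" using ex1[OF \<delta>(1)] a(1) a'(1) 1 2 by blast
    then show ?thesis using a(2) a'(2) k by simp
  qed
  have L_zero: "0 \<in> L" unfolding L_iff using d.fields_zero d.B_zero by (intro conjI bexI[of _ 0]) auto
  have L_plus: "x + y \<in> L" if xy: "x \<in> L" "y \<in> L" for x y
  proof -
    obtain b c where "b \<in> Bp" "c \<in> Bp" "x * M h - M h * x = b * M h" "y * M h - M h * y = c * M h"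
      using xy unfolding L_iff by blast
    then have "(x + y) * M h - M h * (x + y) = (b + c) * M h"
      using arg_cong2[of "x * M h - M h * x" "b * M h" "y * M h - M h * y" "c * M h" "(+)"]
      by (simp add: algebra_simps)
    then show ?thesis unfolding L_iff using xy[unfolded L_iff] d.fields_plus d.B_plus \<open>b \<in> Bp\<close> \<open>c \<in> Bp\<close> by blast
  qed
  have L_scale: "b * x \<in> L" if b: "b \<in> Bp" and x: "x \<in> L" for b x
  proof -
    obtain c where c: "c \<in> Bp" "x * M h - M h * x = c * M h" using x unfolding L_iff by blast
    have "b * x * M h - M h * (b * x) = b * (x * M h - M h * x)"
      using d.B_commute[OF b hB] by (simp add: right_diff_distrib mult.assoc[symmetric])
    then have "b * x * M h - M h * (b * x) = b * c * M h" by (simp add: c(2) mult.assoc)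
    then show ?thesis unfolding L_iff using x[unfolded L_iff] d.fields_scale d.B_times b c(1) by blast
  qed
  have L_bracket: "x * y - y * x \<in> L" if x: "x \<in> L" and y: "y \<in> L" for x y
  proof -
    obtain b where b: "b \<in> Bp" "x * M h - M h * x = b * M h" using x unfolding L_iff by blast
    obtain c where c: "c \<in> Bp" "y * M h - M h * y = c * M h" using y unfolding L_iff by blast
    have xf: "x \<in> d.fields" and yf: "y \<in> d.fields" using x y unfolding L_iff by auto
    let ?z = "(x * c - c * x) - (y * b - b * y)"
    have "(x * y - y * x) * M h - M h * (x * y - y * x) =
        (x * (y * M h - M h * y) - (y * M h - M h * y) * x) - (y * (x * M h - M h * x) - (x * M h - M h * x) * y)"
      by (simp add: algebra_simps)
    also have "\<dots> = (x * (c * M h) - c * M h * x) - (y * (b * M h) - b * M h * y)" by (simp only: b(2) c(2))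
    also have "\<dots> = ?z * M h + (c * (x * M h - M h * x) - b * (y * M h - M h * y))" by (simp add: algebra_simps)
    also have "c * (x * M h - M h * x) = b * (y * M h - M h * y)"
      using d.B_commute[OF b(1) c(1)] by (simp add: b(2) c(2) mult.assoc[symmetric])
    finally have "(x * y - y * x) * M h - M h * (x * y - y * x) = ?z * M h" by simp
    moreover have "?z \<in> Bp" by (intro d.B_minus d.fields_B xf yf b(1) c(1))
    ultimately show ?thesis unfolding L_iff using d.fields_bracket[OF xf yf] by blast
  qed
  have gL: "J (ds ! i) \<in> L" if "i < n" for i using dsL[OF that] unfolding L_def by blast
  have L_sum: "(\<Sum>i<m. u i * J (ds ! i)) \<in> L" if u: "\<forall>i<n. u i \<in> Bp" and m: "m \<le> n" for u m
    using m by (induction m) (auto intro!: L_zero L_plus L_scale gL simp: u)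
  define co where "co v = (SOME c. (\<forall>i<n. c i \<in> Bp) \<and> (\<Sum>i<n. c i * J (ds ! i)) = v)" for v
  have co: "(\<forall>i<n. co v i \<in> Bp) \<and> (\<Sum>i<n. co v i * J (ds ! i)) = v" if "v \<in> L" for v
    unfolding co_def by (rule someI_ex[OF expand[OF that]])
  have "lie_basis ep opsp Bp L n (\<lambda>i. J (ds ! i)) co"
  proof
    fix u k assume u: "\<And>i. i < n \<Longrightarrow> u i \<in> Bp" and k: "k < n"
    have u': "\<forall>i<n. u i \<in> Bp" using u by blast
    have sL: "(\<Sum>i<n. u i * J (ds ! i)) \<in> L" by (rule L_sum[OF u' order_refl])
    show "co (\<Sum>i<n. u i * J (ds ! i)) k = u k"
      by (rule unique[OF _ u' _ sL k]) (use co[OF sL] in auto)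
  next
    show "L \<subseteq> opsp" using L_iff d.fields_diffop unfolding opsp_def by blast
    show "x * b - b * x \<in> Bp" if "x \<in> L" "b \<in> Bp" for x b using that L_iff d.fields_B by blast
  qed (use opsp_closed opsp_e Bp_ops d.B_e d.B_plus d.B_minus d.B_times d.B_commute L_zero L_plus L_scale L_bracket gL co in auto)
  then show ?thesis unfolding n_def L_def by blast
qed

text \<open>
  \<open>\<Theta>\<close> consists of the operators \<open>\<theta>\<close> of all logarithmic vector fields, and these are combinations of the
  \<open>\<theta>\<^sub>i\<close>, so both generate the same left ideal.
\<close>
lemma quotient_torsion_free_at:
  fixes f :: "'a \<Rightarrow> complex"
  defines "h \<equiv> germ f"
  assumes h: "h \<in> carrier Op" and I: "ideal_stalk X A D p = PIdl\<^bsub>Op\<^esub> h"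
    and log: "log_lie_basis ep opsp Bp (J ` Der_log_stalk X A D p) n g co (M h)"
  shows "quotient_torsion_free Dsp (left_ideal_gen Dsp (Theta_stalk X A f p)) (s_var X A p) \<longleftrightarrow>
    specialization.torsion_free n (polys opsp) (\<lambda>i. log_lie_basis.theta Bp (M h) (g i)) (\<lambda>x. fps_X * x)"
proof -
  interpret f: log_lie_basis ep opsp Bp "J ` Der_log_stalk X A D p" n g co "M h" by (rule log)
  have th: "K (theta X A p \<delta> \<alpha>) = f.theta (J \<delta>)"
    if "\<delta> \<in> Der_stalk X A p" "\<alpha> \<in> carrier Op" "\<delta> h = \<alpha> \<otimes>\<^sub>p h" for \<delta> \<alpha>
  proof -
    have "f.al (J \<delta>) = M \<alpha>" by (rule f.al_eqI) (use that h in \<open>simp_all add: M_Bp Der_M M_mult\<close>)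
    then show ?thesis by (simp add: theta_Dsp(2)[OF that(1,2)] f.theta_def)
  qed
  have S: "Theta_stalk X A f p \<subseteq> carrier Dsp" unfolding Theta_stalk_def using theta_Dsp(1) by blast
  have KS: "K ` Theta_stalk X A f p = f.theta ` J ` Der_log_stalk X A D p"
  proof
    show "K ` Theta_stalk X A f p \<subseteq> f.theta ` J ` Der_log_stalk X A D p"
    proof clarify
      fix x assume "x \<in> Theta_stalk X A f p"
      then obtain \<delta> \<alpha> where \<delta>: "x = theta X A p \<delta> \<alpha>" "\<delta> \<in> Der_stalk X A p" "\<alpha> \<in> carrier Op" "\<delta> h = \<alpha> \<otimes>\<^sub>p h"
        unfolding Theta_stalk_def h_def by blast
      then have "\<delta> \<in> Der_log_stalk X A D p" unfolding Der_log_iff[OF h I] by blast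
      then show "K x \<in> f.theta ` J ` Der_log_stalk X A D p" unfolding \<delta>(1) th[OF \<delta>(2-4)] by blast
    qed
    show "f.theta ` J ` Der_log_stalk X A D p \<subseteq> K ` Theta_stalk X A f p"
    proof clarify
      fix \<delta> assume "\<delta> \<in> Der_log_stalk X A D p"
      then obtain \<alpha> where \<alpha>: "\<delta> \<in> Der_stalk X A p" "\<alpha> \<in> carrier Op" "\<delta> h = \<alpha> \<otimes>\<^sub>p h" unfolding Der_log_iff[OF h I] by blast
      then have "theta X A p \<delta> \<alpha> \<in> Theta_stalk X A f p" unfolding Theta_stalk_def h_def by blast
      then show "f.theta (J \<delta>) \<in> K ` Theta_stalk X A f p" unfolding th[OF \<alpha>, symmetric] by blast
    qed
  qed
  have LI: "f.spec.left_ideal = {(\<Sum>i<n. q i * f.theta (g i)) | q. \<forall>i<n. q i \<in> K ` carrier Dsp}"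
    unfolding f.spec.left_ideal_def K_carrier ..
  have jS: "K ` Theta_stalk X A f p \<subseteq> f.spec.left_ideal"
    unfolding KS f.spec.left_ideal_def
  proof
    fix x assume x: "x \<in> f.theta ` J ` Der_log_stalk X A D p"
    have "\<forall>i<n. fps_const (co (x $ 0) i) \<in> polys opsp" using f.spec.S.co_B[OF x] f.spec.S.B_C by blast
    then show "x \<in> {(\<Sum>i<n. q i * f.theta (g i)) | q. \<forall>i<n. q i \<in> polys opsp}"
      using f.spec.S.co_expand[OF x] by (intro CollectI exI[of _ "\<lambda>i. fps_const (co (x $ 0) i)"]) simp
  qed
  have gS: "f.theta (g i) \<in> K ` Theta_stalk X A f p" if "i < n" for i unfolding KS using f.g_L[OF that] by blast
  note gen = K.left_ideal_gen_eq[OF S jS gS LI]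
  have "quotient_torsion_free Dsp (left_ideal_gen Dsp (Theta_stalk X A f p)) (s_var X A p) \<longleftrightarrow>
      (\<forall>Y\<in>K ` carrier Dsp. K (s_var X A p) * Y \<in> f.spec.left_ideal \<longrightarrow> Y \<in> f.spec.left_ideal)"
    by (rule K.quotient_torsion_free_iff[OF gen(2,1) s_var(1)])
  also have "\<dots> \<longleftrightarrow> f.spec.torsion_free"
    unfolding f.spec.torsion_free_def K_carrier by (intro ball_cong refl) (simp add: K_s_var)
  finally show ?thesis .
qed

lemma spencer_exact_at_iff:
  assumes "lie_basis ep opsp Bp (J ` Der_log_stalk X A D p) n g co"
    and h: "h \<in> carrier Op" and I: "ideal_stalk X A D p = PIdl\<^bsub>Op\<^esub> h"
  shows "spencer_exact Dp (mult_op Op ` carrier Op) (Der_log_stalk X A D p) (Suc r) \<longleftrightarrow>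
    lie_basis.exact_at opsp n g co (Suc r)"
proof -
  have Bp: "J ` mult_op Op ` carrier Op = Bp" unfolding Bp_def image_image M_def ..
  have "presented_lie_basis Dp J ep (mult_op Op ` carrier Op) (Der_log_stalk X A D p) n g co"
  proof (rule presented_lie_basis.intro[OF DS.ring_embedding_axioms])
    show "lie_basis ep (J ` carrier Dp) (J ` mult_op Op ` carrier Op) (J ` Der_log_stalk X A D p) n g co"
      unfolding J_Dp Bp by fact
    show "presented_lie_basis_axioms Dp (mult_op Op ` carrier Op) (Der_log_stalk X A D p)"
    proof
      show "mult_op Op ` carrier Op \<subseteq> carrier Dp"
        using M_Bp opsp_Bp by (auto intro!: Dp_mem mult_op_E simp: M_def[symmetric])
      show "Der_log_stalk X A D p \<subseteq> carrier Dp" using Der_Dp unfolding Der_log_stalk_def by blast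
    qed
  qed
  from presented_lie_basis.spencer_exact_iff[OF this, of r] show ?thesis unfolding J_Dp .
qed

end

section \<open>The equivalence\<close>

context manifold_at
begin

lemma log_quotient_at:
  assumes h: "h \<in> carrier Op" and \<delta>: "\<delta> \<in> Der_stalk X A p" "\<alpha> \<in> carrier Op" "\<delta> h = \<alpha> \<otimes>\<^sub>p h"
    and regular: "\<And>a. a \<in> carrier Op \<Longrightarrow> a \<otimes>\<^sub>p h = \<zero>\<^sub>p \<Longrightarrow> a = \<zero>\<^sub>p"
  shows "log_quotient Op \<delta> h = \<alpha>"
  unfolding log_quotient_def
proof (rule the_equality)
  show "\<alpha> \<in> carrier Op \<and> \<delta> h = \<alpha> \<otimes>\<^sub>p h" using \<delta> by blast
  fix \<beta> assume \<beta>: "\<beta> \<in> carrier Op \<and> \<delta> h = \<beta> \<otimes>\<^sub>p h"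
  have "M ((\<beta> \<ominus>\<^bsub>Op\<^esub> \<alpha>) \<otimes>\<^sub>p h) = M (\<delta> h) - M (\<delta> h)"
    using \<beta> \<delta> h by (simp add: M_mult M_minus left_diff_distrib) (simp add: M_mult[symmetric])
  then have "(\<beta> \<ominus>\<^bsub>Op\<^esub> \<alpha>) \<otimes>\<^sub>p h = \<zero>\<^sub>p"
    by (intro M_inj) (use \<beta> \<delta> h in \<open>simp_all add: M_zero\<close>)
  then have "\<beta> \<ominus>\<^bsub>Op\<^esub> \<alpha> = \<zero>\<^sub>p" by (rule regular[rotated]) (use \<beta> \<delta> in auto)
  then have "M \<beta> - M \<alpha> = 0" using \<beta> \<delta>(2) by (simp add: M_minus[symmetric] M_zero)
  then show "\<beta> = \<alpha>" by (intro M_inj) (use \<beta> \<delta> in auto)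
qed

lemma regular_lie_basis_GK:
  assumes h: "h \<in> carrier Op" and I: "ideal_stalk X A D p = PIdl\<^bsub>Op\<^esub> h"
    and regular: "\<And>a. a \<in> carrier Op \<Longrightarrow> a \<otimes>\<^sub>p h = \<zero>\<^sub>p \<Longrightarrow> a = \<zero>\<^sub>p"
    and ds: "set ds \<subseteq> Der_log_stalk X A D p"
    and basis: "lie_basis ep opsp Bp (J ` Der_log_stalk X A D p) (length ds) (\<lambda>i. J (ds ! i)) co"
    and GK: "regular_sequence (Gr Dsp (total_order X A p))
          (map (\<lambda>\<delta>. gr_symbol Dsp (total_order X A p) (theta X A p \<delta> (log_quotient Op \<delta> h))) ds)"
  shows "regular_lie_basis (fps_const ep) (polys opsp) (fps_const ` Bp)
      (log_lie_basis.theta Bp (M h) ` J ` Der_log_stalk X A D p) (length ds)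
      (\<lambda>i. log_lie_basis.theta Bp (M h) (J (ds ! i))) (\<lambda>x i. fps_const (co (x $ 0) i)) d.Gs"
proof -
  have log: "log_lie_basis ep d.ops Bp (J ` Der_log_stalk X A D p) (length ds) (\<lambda>i. J (ds ! i)) co (M h)"
    using log_lie_basis_at[OF h I regular basis] unfolding opsp_def .
  interpret f: log_lie_basis ep d.ops Bp "J ` Der_log_stalk X A D p" "length ds" "\<lambda>i. J (ds ! i)" co "M h" by (rule log)
  have L: "J ` Der_log_stalk X A D p \<subseteq> d.fields" using J_Der_log[OF h I] by blast
  have e: "ep \<noteq> 0"
  proof
    assume "ep = 0"
    then have "M \<one>\<^sub>p = M \<zero>\<^sub>p" by (simp only: M_one M_zero)
    then have "\<one>\<^sub>p = \<zero>\<^sub>p" by (rule M_inj[rotated 2]) auto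
    then show False using one_neq_zero_Op by simp
  qed
  \<comment> \<open>The operators \<open>\<theta>\<^sub>i\<close> formed with the equation \<open>h\<close>.\<close>
  define ths where "ths = map (\<lambda>\<delta>. theta X A p \<delta> (log_quotient Op \<delta> h)) ds"
  have th: "ths ! i \<in> carrier Dsp" "K (ths ! i) = f.theta (J (ds ! i))" if i: "i < length ds" for i
  proof -
    have "ds ! i \<in> Der_log_stalk X A D p" using ds i by auto
    then obtain \<alpha> where \<alpha>: "ds ! i \<in> Der_stalk X A p" "\<alpha> \<in> carrier Op" "(ds ! i) h = \<alpha> \<otimes>\<^sub>p h"
      unfolding Der_log_iff[OF h I] by blast
    have lq: "log_quotient Op (ds ! i) h = \<alpha>" by (rule log_quotient_at[OF h \<alpha> regular])
    have "f.al (J (ds ! i)) = M \<alpha>" by (rule f.al_eqI) (use \<alpha> h in \<open>simp_all add: M_Bp Der_M M_mult\<close>)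
    then show "ths ! i \<in> carrier Dsp" "K (ths ! i) = f.theta (J (ds ! i))"
      using theta_Dsp[OF \<alpha>(1,2)] i by (simp_all add: ths_def lq f.theta_def)
  qed
  have len: "length ths = length ds" by (simp add: ths_def)
  have GK': "regular_sequence (Gr Dsp (total_order X A p)) (map (gr_symbol Dsp (total_order X A p)) ths)"
    using GK by (simp add: ths_def o_def)
  have lead: "ths ! i \<in> carrier Dsp \<and> K (ths ! i) \<in> d.Gs 2 \<and> K (ths ! i) \<notin> d.Gs 1" if "i < length ths" for i
    using d.log_lie_basis_leading[OF log L _ e, of i] th[of i] that by (simp add: len)
  show ?thesis
    unfolding opsp_def
  proof (rule d.regular_lie_basis_theta[OF log L])
    fix m y k q
    assume m: "m < length ds" and y: "y \<in> d.Gs (Suc k)" and q: "\<And>j. j < m \<Longrightarrow> q j \<in> d.Gs (Suc k)"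
      and rel: "y * f.theta (J (ds ! m)) + (\<Sum>j<m. q j * f.theta (J (ds ! j))) \<in> d.Gs (Suc k)"
    have s: "(\<Sum>j<m. r j * K (ths ! j)) = (\<Sum>j<m. r j * f.theta (J (ds ! j)))" for r
      by (rule sum.cong) (use m th in auto)
    have "\<exists>p' t. (\<forall>j<m. p' j \<in> d.Gs k) \<and> t \<in> d.Gs k \<and> y = t + (\<Sum>j<m. p' j * K (ths ! j))"
      by (rule K.regular_sequence_elements[OF GK' lead]) (use m y q rel th in \<open>auto simp: len s\<close>)
    then show "\<exists>q' t. (\<forall>j<m. q' j \<in> d.Gs k) \<and> t \<in> d.Gs k \<and> y = t + (\<Sum>j<m. q' j * f.theta (J (ds ! j)))"
      unfolding s .
  qed
qed

text \<open>
  Exactness in degree \<open>1\<close> gives torsion-freeness for any equation. For the converse, (GK) provides the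
  exactness of the complex over \<open>D[s]\<close> for \<open>h\<close> only, whence the transfer from \<open>f\<close> to \<open>h\<close>.
\<close>
theorem equivalence_on_divisor:
  fixes f :: "'a \<Rightarrow> complex"
  assumes f: "hol f" and I: "ideal_stalk X A D p = PIdl\<^bsub>Op\<^esub> (germ f)"
    and regular: "\<And>a. a \<in> carrier Op \<Longrightarrow> a \<otimes>\<^sub>p germ f = \<zero>\<^sub>p \<Longrightarrow> a = \<zero>\<^sub>p"
    and h: "h \<in> carrier Op" and Ih: "ideal_stalk X A D p = PIdl\<^bsub>Op\<^esub> h"
    and basis: "O_basis Op (Der_log_stalk X A D p) ds"
    and GK: "regular_sequence (Gr Dsp (total_order X A p))
          (map (\<lambda>\<delta>. gr_symbol Dsp (total_order X A p) (theta X A p \<delta> (log_quotient Op \<delta> h))) ds)"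
  defines "exact \<equiv> spencer_exact Dp (mult_op Op ` carrier Op) (Der_log_stalk X A D p)"
    and "torsion_free \<equiv> quotient_torsion_free Dsp (left_ideal_gen Dsp (Theta_stalk X A f p)) (s_var X A p)"
  shows "exact 1 \<longleftrightarrow> torsion_free" and "exact (Suc (Suc r))"
proof -
  let ?L = "J ` Der_log_stalk X A D p" and ?n = "length ds" and ?g = "\<lambda>i. J (ds ! i)"
  have fO: "germ f \<in> carrier Op" using f by simp
  obtain co where lb: "lie_basis ep opsp Bp ?L ?n ?g co" using lie_basis_Der_log[OF h Ih basis] by blast
  obtain u where u: "u \<in> carrier Op" "h = u \<otimes>\<^sub>p germ f"
    using O.cgenideal_self[OF h] unfolding Ih[symmetric] I PIdl_iff by blast
  obtain v where v: "v \<in> carrier Op" "germ f = v \<otimes>\<^sub>p h"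
    using O.cgenideal_self[OF fO] unfolding I[symmetric] Ih PIdl_iff by blast
  \<comment> \<open>\<open>f = v u f\<close>, and \<open>f\<close> is a nonzerodivisor.\<close>
  have uv: "M u * M v = ep"
  proof -
    have "germ f = v \<otimes>\<^sub>p (u \<otimes>\<^sub>p germ f)" unfolding u(2)[symmetric] by (rule v(2))
    then have "M (germ f) = M (v \<otimes>\<^sub>p (u \<otimes>\<^sub>p germ f))" by (rule arg_cong)
    then have "M v * M u * M (germ f) = M (germ f)" using u(1) v(1) fO by (simp add: M_mult mult.assoc)
    then have "M ((\<one>\<^sub>p \<ominus>\<^bsub>Op\<^esub> v \<otimes>\<^sub>p u) \<otimes>\<^sub>p germ f) = M \<zero>\<^sub>p"
      using u(1) v(1) fO opsp_e(1)[OF opsp_Bp[OF M_Bp[OF fO]]] by (simp add: M_mult M_minus M_one M_zero left_diff_distrib)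
    then have "(\<one>\<^sub>p \<ominus>\<^bsub>Op\<^esub> v \<otimes>\<^sub>p u) \<otimes>\<^sub>p germ f = \<zero>\<^sub>p"
      by (rule M_inj[rotated 2]) (use u(1) v(1) fO in auto)
    then have "\<one>\<^sub>p \<ominus>\<^bsub>Op\<^esub> v \<otimes>\<^sub>p u = \<zero>\<^sub>p" by (rule regular[rotated]) (use u(1) v(1) in auto)
    then have "ep - M v * M u = 0" using u(1) v(1) by (simp add: M_mult[symmetric] M_one[symmetric] M_minus[symmetric] M_zero)
    then show ?thesis using d.B_commute[OF M_Bp[OF u(1)] M_Bp[OF v(1)]] by simp
  qed
  have regular_h: "a = \<zero>\<^sub>p" if a: "a \<in> carrier Op" "a \<otimes>\<^sub>p h = \<zero>\<^sub>p" for a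
  proof -
    have "a \<otimes>\<^sub>p u \<otimes>\<^sub>p germ f = \<zero>\<^sub>p" using a u fO by (simp add: O.m_assoc)
    then have "a \<otimes>\<^sub>p u = \<zero>\<^sub>p" by (rule regular[rotated]) (use a u in auto)
    then have "M a * M u * M v = 0" using a(1) u(1) M_zero by (simp add: M_mult[symmetric])
    then have "M a * ep = 0" by (simp add: mult.assoc uv)
    then have "M a = M \<zero>\<^sub>p" using opsp_e(2)[OF opsp_Bp[OF M_Bp[OF a(1)]]] M_zero by simp
    then show ?thesis by (rule M_inj[rotated 2]) (use a in auto)
  qed
  have logf: "log_lie_basis ep opsp Bp ?L ?n ?g co (M (germ f))" by (rule log_lie_basis_at[OF fO I regular lb])
  have logh: "log_lie_basis ep opsp Bp ?L ?n ?g co (M h)" by (rule log_lie_basis_at[OF h Ih regular_h lb])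
  have ds: "set ds \<subseteq> Der_log_stalk X A D p" using basis unfolding O_basis_def by blast
  interpret f: log_lie_basis ep opsp Bp ?L ?n ?g co "M (germ f)" by (rule logf)
  interpret h: log_lie_basis ep opsp Bp ?L ?n ?g co "M h" by (rule logh)
  have S: "h.spec.S.exact_at (Suc k)" for k
    by (rule regular_lie_basis.exact[OF regular_lie_basis_GK[OF h Ih regular_h ds lb GK]])
  have ex: "exact (Suc k) \<longleftrightarrow> f.exact_at (Suc k)" for k
    unfolding exact_def by (rule spencer_exact_at_iff[OF lb h Ih])
  have tf: "torsion_free \<longleftrightarrow> f.spec.torsion_free"
    unfolding torsion_free_def by (rule quotient_torsion_free_at[OF fO I logf])
  interpret change: change_of_equation ep Bp "Xp cp" yp index "M u" "M v"
    by unfold_locales (rule M_Bp u(1) v(1) uv)+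
  have L: "?L \<subseteq> d.fields" using J_Der_log[OF h Ih] by blast
  have Mh: "M h = M u * M (germ f)" unfolding u(2) by (rule M_mult[OF u(1) fO])
  have "h.spec.torsion_free" if "f.spec.torsion_free"
    using change.torsion_free_change_of_equation[OF logf[unfolded opsp_def] logh[unfolded opsp_def Mh] L] that
    unfolding opsp_def Mh by blast
  then have "f.exact_at 1" if "f.spec.torsion_free"
    using h.spec.torsion_free_imp_exact S[of 0] that by simp
  then show "exact 1 \<longleftrightarrow> torsion_free"
    using f.spec.exact_imp_torsion_free ex[of 0] tf by auto
  show "exact (Suc (Suc r))"
    unfolding ex by (rule h.spec.exact_higher[OF S S])
qed

text \<open>
  Here \<open>f\<close> is a unit, so that every vector field is logarithmic. Torsion-freeness is then a consequence
  of exactness.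
\<close>
theorem exact_off_divisor:
  fixes f :: "'a \<Rightarrow> complex"
  assumes f: "hol f" and I: "ideal_stalk X A D p = PIdl\<^bsub>Op\<^esub> (germ f)"
    and regular: "\<And>a. a \<in> carrier Op \<Longrightarrow> a \<otimes>\<^sub>p germ f = \<zero>\<^sub>p \<Longrightarrow> a = \<zero>\<^sub>p"
    and unit: "ideal_stalk X A D p = carrier Op"
  shows "spencer_exact Dp (mult_op Op ` carrier Op) (Der_log_stalk X A D p) (Suc r)"
    and "quotient_torsion_free Dsp (left_ideal_gen Dsp (Theta_stalk X A f p)) (s_var X A p)"
proof -
  have fO: "germ f \<in> carrier Op" using f by simp
  have "J ` Der_log_stalk X A D p = d.fields"
  proof
    show "J ` Der_log_stalk X A D p \<subseteq> d.fields" using J_Der_log[OF fO I] by blast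
    show "d.fields \<subseteq> J ` Der_log_stalk X A D p"
    proof
      fix v assume v: "v \<in> d.fields"
      have "v * M (germ f) - M (germ f) * v \<in> Bp" by (rule d.fields_B[OF v M_Bp[OF fO]])
      then obtain a where a: "a \<in> carrier Op" "v * M (germ f) - M (germ f) * v = M a" by (rule BpE)
      have "a \<in> PIdl\<^bsub>Op\<^esub> (germ f)" using a(1) unit I by (simp only:)
      then obtain x where x: "x \<in> carrier Op" "a = x \<otimes>\<^sub>p germ f" unfolding PIdl_iff by blast
      have "v * M (germ f) - M (germ f) * v = M x * M (germ f)" unfolding a(2) x(2) by (rule M_mult[OF x(1) fO])
      then show "v \<in> J ` Der_log_stalk X A D p" unfolding J_Der_log[OF fO I] using v M_Bp[OF x(1)] by blast
    qed
  qed
  then have reg: "regular_lie_basis ep opsp Bp (J ` Der_log_stalk X A D p) CARD('n) (\<lambda>i. Xp cp (index i))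
      (\<lambda>v i. v * yp (index i) - yp (index i) * v) d.G"
    using d.regular_lie_basis_fields unfolding opsp_def by simp
  note lb = regular_lie_basis.axioms(1)[OF reg]
  have exact: "lie_basis.exact_at opsp CARD('n) (\<lambda>i. Xp cp (index i)) (\<lambda>v i. v * yp (index i) - yp (index i) * v) (Suc k)" for k
    by (rule regular_lie_basis.exact[OF reg])
  show "spencer_exact Dp (mult_op Op ` carrier Op) (Der_log_stalk X A D p) (Suc r)"
    unfolding spencer_exact_at_iff[OF lb fO I] by (rule exact)
  note log = log_lie_basis_at[OF fO I regular lb]
  interpret f: log_lie_basis ep opsp Bp "J ` Der_log_stalk X A D p" "CARD('n)" "\<lambda>i. Xp cp (index i)"
      "\<lambda>v i. v * yp (index i) - yp (index i) * v" "M (germ f)" by (rule log)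
  show "quotient_torsion_free Dsp (left_ideal_gen Dsp (Theta_stalk X A f p)) (s_var X A p)"
  proof (rule iffD2[OF quotient_torsion_free_at[OF fO I log]])
    show "f.spec.torsion_free" by (rule f.spec.exact_imp_torsion_free) (use exact[of 0] in simp)
  qed
qed

end

theorem mainTheorem3:
  fixes X :: "'a topology"
    and A :: "('a, 'n::finite) chart set"
    and f :: "'a \<Rightarrow> complex"
    and D :: "'a set"
  assumes "complex_manifold X A"
    and "global_reduced_equation X A f D"
    and "free_divisor X A D"
    and "property_GK X A D"
  shows "(log_spencer_exact X A D 1 \<longleftrightarrow> no_s_torsion X A f) \<and>
         (no_s_torsion X A f \<longleftrightarrow> pre_spencer X A D)"
proof -
  define exact where "exact p = spencer_exact (D_stalk X A p)
      (mult_op (O_stalk X A p) ` carrier (O_stalk X A p)) (Der_log_stalk X A D p)" for p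
  define torsion_free where "torsion_free p \<longleftrightarrow> quotient_torsion_free (Ds_stalk X A p)
      (left_ideal_gen (Ds_stalk X A p) (Theta_stalk X A f p)) (s_var X A p)" for p
  have local: "(exact p 1 \<longleftrightarrow> torsion_free p) \<and> (\<forall>r. exact p (Suc (Suc r)))" if p: "p \<in> topspace X" for p
  proof -
    interpret manifold_at X A p by unfold_locales (rule assms(1) p)+
    have hol_f: "holomorphic_fun X A f (topspace X)" and D: "D = {x \<in> topspace X. f x = 0}"
      and I: "ideal_stalk X A D p = PIdl\<^bsub>Op\<^esub> (germ f)"
      and ne: "\<And>x. x \<in> topspace X \<Longrightarrow> germ_at X x f \<noteq> \<zero>\<^bsub>O_stalk X A x\<^esub>"
      using assms(2) p unfolding global_reduced_equation_def by blast+
    have f: "hol f" by (rule hol_at[OF hol_f p])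
    note regular = germ_regular[OF ne]
    show ?thesis
    proof (cases "p \<in> D")
      case True
      then obtain h ds where h: "h \<in> carrier Op" "ideal_stalk X A D p = PIdl\<^bsub>Op\<^esub> h"
          "O_basis Op (Der_log_stalk X A D p) ds"
          "regular_sequence (Gr Dsp (total_order X A p))
            (map (\<lambda>\<delta>. gr_symbol Dsp (total_order X A p) (theta X A p \<delta> (log_quotient Op \<delta> h))) ds)"
        using assms(4) unfolding property_GK_def by blast
      show ?thesis
        unfolding exact_def torsion_free_def using equivalence_on_divisor[OF f I regular h] by blast
    next
      case False
      then have "f p \<noteq> 0" using D p by blast
      then have "eventually (\<lambda>x. f x \<noteq> 0) (nhdsin X p)" by (rule hol_nonzero[OF f])
      then have ev: "eventually (\<lambda>x. x \<in> D \<longrightarrow> g x = 0) (nhdsin X p)" for g :: "'a \<Rightarrow> complex"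
        by eventually_elim (simp add: D)
      \<comment> \<open>Near \<open>p\<close> the divisor is empty, so every germ vanishes on it.\<close>
      have "ideal_stalk X A D p = carrier Op"
      proof
        show "carrier Op \<subseteq> ideal_stalk X A D p"
        proof
          fix a assume a: "a \<in> carrier Op"
          then obtain g where g: "hol g" "a = germ g" by (rule carrier_OpE)
          have "g \<in> a" by (simp add: g(2) germ_at_def)
          then show "a \<in> ideal_stalk X A D p" using a ev unfolding ideal_stalk_def by blast
        qed
      qed (auto simp: ideal_stalk_def)
      note off = exact_off_divisor[OF f I regular this]
      have "exact p (Suc r)" for r unfolding exact_def by (rule off(1))
      moreover have "torsion_free p" unfolding torsion_free_def by (rule off(2))
      ultimately show ?thesis by simp
    qed
  qed
  have higher: "exact p r" if p: "p \<in> topspace X" and r: "r \<ge> 2" for p r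
  proof -
    have "r = Suc (Suc (r - 2))" using r by simp
    then show ?thesis using local[OF p] by metis
  qed
  have a: "log_spencer_exact X A D r \<longleftrightarrow> (\<forall>p\<in>topspace X. exact p r)" for r
    by (simp add: log_spencer_exact_def exact_def)
  have b: "no_s_torsion X A f \<longleftrightarrow> (\<forall>p\<in>topspace X. torsion_free p)"
    by (simp add: no_s_torsion_def torsion_free_def)
  have ab: "log_spencer_exact X A D 1 \<longleftrightarrow> no_s_torsion X A f"
    unfolding a b using local by blast
  have "pre_spencer X A D \<longleftrightarrow> log_spencer_exact X A D 1"
  proof
    assume 1: "log_spencer_exact X A D 1"
    show "pre_spencer X A D"
      unfolding pre_spencer_def
    proof (intro allI impI)
      fix r :: nat assume "1 \<le> r"
      then consider "r = 1" | "r \<ge> 2" by linarith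
      then show "log_spencer_exact X A D r" using 1 higher by cases (simp_all add: a)
    qed
  qed (simp add: pre_spencer_def)
  then show ?thesis using ab by blast
qed

end
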